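(* For every element $[x]\in l_{2q+1}(\Lambda)$ there is a positive integer $k$ such that $[x]+e([H_\epsilon(\Lambda^k)])$ is elementary.
   Context: $q\ge1$, $\epsilon=(-1)^q$, $\Lambda$ is a unital ring with involution $x\mapsto\bar x$, weakly finite (ranks of finitely generated free modules are well defined). Fix a subgroup $Z\subset\widetilde K_1(\Lambda)=\mathrm{coker}(K_1(\mathbb Z)\to K_1(\Lambda))$ invariant under $[f]\mapsto[f^*]$. A based module is a stably finitely generated free left $\Lambda$-module $M$ with an equivalence class of $s$-bases (bases of some $M\oplus\Lambda^m$; two are equivalent if after adding standard basis vectors the transformation matrix represents an element of $Z$). An isomorphism of based modules is simple if its torsion lies in $Z$. For a based module $M$ let $T_\epsilon$ act on $\mathrm{Hom}(M,M^* )$ by $(T_\epsilon\phi)(x)(y)=\epsilon\overline{\phi(y)(x)}$ and $Q_\epsilon(M)=\mathrm{coker}(1-T_\epsilon)$. An $\epsilon$-quadratic form is $(M,\psi)$ with $\psi\in Q_\epsilon(M)$; it is simple if $\psi+\epsilon\psi^*\colon M\to M^*$ is a simple isomorphism. Isometries are simple isomorphisms preserving $\psi$. $H_\epsilon(L)=(L\oplus L^*,\begin{pmatrix}0&1\\0&0\end{pmatrix})$. A Lagrangian is a based direct summand $L$ with $L=L^\perp$ (unbased, with respect to $\psi+\epsilon\psi^*$) and $\psi|_L=0\in Q_\epsilon(L)$; it is simple, for a simple form, if $0\to L\to M\to L^*\to0$ is a based exact sequence. A quasi-formation $(M,\psi;L,V)$ is a simple form with a simple Lagrangian $L$ and a based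 half-rank direct summand $V$. Isomorphisms are isometries carrying $L$ to $L'$, $V$ to $V'$ by simple isomorphisms. Trivial formations are $(H_\epsilon(P);P,P^* )$; stable isomorphism is isomorphism after adding trivial formations. $l_{2q+1}(\Lambda)$ is the abelian monoid (direct sum) of stable isomorphism classes of quasi-formations modulo $(M,\psi;K,L)\oplus(M,\psi;L,V)\sim(M,\psi;K,V)$ for simple Lagrangians $K,L$. An element is elementary if it is represented by a boundary $\delta(K,\rho)=(H_\epsilon(K);K,\begin{pmatrix}1\\\rho\end{pmatrix}K)$, $K$ based, $\rho\in\mathrm{Hom}(K,K^* )$ arbitrary. For an $\epsilon$-quadratic form $v=(V,\theta)$, $e([v]):=[\delta(V,\rho)]\in l_{2q+1}(\Lambda)$ where $\rho\in\mathrm{Hom}(V,V^* )$ is any representative of $\theta$; it depends only on the class $[v]$ of $v$ modulo isometry after adding zero forms. *)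

theory Defs
  imports "Jordan_Normal_Form.Matrix" "HOL-Algebra.Generated_Groups"
begin

section \<open>Rings with involution and left modules\<close>

class involutive_ring = ring_1 +
  fixes invol :: "'a \<Rightarrow> 'a"
  assumes invol_add: "invol (a + b) = invol a + invol b"
    and invol_mult: "invol (a * b) = invol b * invol a"
    and invol_invol: "invol (invol a) = a"

text \<open>The locale of modules in HOL-Algebra is restricted to commutative rings; only its record
  type is used here. The fields of the record that make up a ring multiplication are ignored.\<close>

definition left_module :: "('a::ring_1, 'm, 'z) module_scheme \<Rightarrow> bool" where
  "left_module M \<longleftrightarrow> abelian_group M \<and>
     (\<forall>a. \<forall>x\<in>carrier M. a \<odot>\<^bsub>M\<^esub> x \<in> carrier M) \<and>
     (\<forall>a b. \<forall>x\<in>carrier M. (a + b) \<odot>\<^bsub>M\<^esub> x = a \<odot>\<^bsub>M\<^esub> x \<oplus>\<^bsub>M\<^esub> b \<odot>\<^bsub>M\<^esub> x) \<and>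
     (\<forall>a. \<forall>x\<in>carrier M. \<forall>y\<in>carrier M. a \<odot>\<^bsub>M\<^esub> (x \<oplus>\<^bsub>M\<^esub> y) = a \<odot>\<^bsub>M\<^esub> x \<oplus>\<^bsub>M\<^esub> a \<odot>\<^bsub>M\<^esub> y) \<and>
     (\<forall>a b. \<forall>x\<in>carrier M. (a * b) \<odot>\<^bsub>M\<^esub> x = a \<odot>\<^bsub>M\<^esub> (b \<odot>\<^bsub>M\<^esub> x)) \<and>
     (\<forall>x\<in>carrier M. 1 \<odot>\<^bsub>M\<^esub> x = x)"

definition linear_maps ::
    "('a, 'm, 'y) module_scheme \<Rightarrow> ('a, 'n, 'z) module_scheme \<Rightarrow> ('m \<Rightarrow> 'n) set" where
  "linear_maps M N = {f \<in> carrier M \<rightarrow> carrier N.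
     (\<forall>x\<in>carrier M. \<forall>y\<in>carrier M. f (x \<oplus>\<^bsub>M\<^esub> y) = f x \<oplus>\<^bsub>N\<^esub> f y) \<and>
     (\<forall>a. \<forall>x\<in>carrier M. f (a \<odot>\<^bsub>M\<^esub> x) = a \<odot>\<^bsub>N\<^esub> f x)}"

definition module_isos ::
    "('a, 'm, 'y) module_scheme \<Rightarrow> ('a, 'n, 'z) module_scheme \<Rightarrow> ('m \<Rightarrow> 'n) set" where
  "module_isos M N = {f \<in> linear_maps M N. bij_betw f (carrier M) (carrier N)}"

abbreviation free_module :: "nat \<Rightarrow> ('a::ring_1, 'a vec) module" where
  "free_module n \<equiv> module_vec TYPE('a) n"

definition weakly_finite :: "'a::ring_1 itself \<Rightarrow> bool" where
  "weakly_finite _ \<longleftrightarrow>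
     (\<forall>m n. module_isos (free_module m :: ('a, 'a vec) module) (free_module n) \<noteq> {} \<longrightarrow> m = n)"

definition module_sum ::
    "('a, 'm, 'y) module_scheme \<Rightarrow> ('a, 'n, 'z) module_scheme \<Rightarrow> ('a, 'm \<times> 'n) module" where
  "module_sum M N = \<lparr>carrier = carrier M \<times> carrier N, mult = undefined, one = undefined,
     zero = (\<zero>\<^bsub>M\<^esub>, \<zero>\<^bsub>N\<^esub>),
     add = (\<lambda>(x, y) (x', y'). (x \<oplus>\<^bsub>M\<^esub> x', y \<oplus>\<^bsub>N\<^esub> y')),
     smult = (\<lambda>a (x, y). (a \<odot>\<^bsub>M\<^esub> x, a \<odot>\<^bsub>N\<^esub> y))\<rparr>"

text \<open>Functionals are extensional, so that equality in the dual is equality on the module. The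
  involution turns the right module of functionals into a left module.\<close>

definition dual :: "('a::involutive_ring, 'm, 'z) module_scheme \<Rightarrow> ('a, 'm \<Rightarrow> 'a) module" where
  "dual M = \<lparr>carrier = {f \<in> extensional (carrier M).
       (\<forall>x\<in>carrier M. \<forall>y\<in>carrier M. f (x \<oplus>\<^bsub>M\<^esub> y) = f x + f y) \<and>
       (\<forall>a. \<forall>x\<in>carrier M. f (a \<odot>\<^bsub>M\<^esub> x) = a * f x)},
     mult = undefined, one = undefined,
     zero = (\<lambda>x\<in>carrier M. 0),
     add = (\<lambda>f g. \<lambda>x\<in>carrier M. f x + g x),
     smult = (\<lambda>a f. \<lambda>x\<in>carrier M. f x * invol a)\<rparr>"

definition submodule_of :: "'m set \<Rightarrow> ('a, 'm, 'z) module_scheme \<Rightarrow> bool" where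
  "submodule_of C M \<longleftrightarrow> C \<subseteq> carrier M \<and> \<zero>\<^bsub>M\<^esub> \<in> C \<and>
     (\<forall>x\<in>C. \<forall>y\<in>C. x \<oplus>\<^bsub>M\<^esub> y \<in> C) \<and> (\<forall>a. \<forall>x\<in>C. a \<odot>\<^bsub>M\<^esub> x \<in> C)"


section \<open>The reduced group $\widetilde K_1$\<close>

type_synonym 'a infinite_matrix = "nat \<Rightarrow> nat \<Rightarrow> 'a"

definition stabilise :: "'a::ring_1 mat \<Rightarrow> 'a infinite_matrix" where
  "stabilise A = (\<lambda>i j. if i < dim_row A \<and> j < dim_col A then A $$ (i, j)
                        else if i = j then 1 else 0)"

text \<open>The rows of the matrices in the carrier have finite support, hence the sum is finite.\<close>

definition GL :: "'a::ring_1 infinite_matrix monoid" where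
  "GL = \<lparr>carrier = {stabilise A | A. invertible_mat A},
         mult = (\<lambda>A B i k. \<Sum>j | A i j \<noteq> 0. A i j * B j k),
         one = (\<lambda>i j. if i = j then 1 else 0)\<rparr>"

definition K1 :: "'a::ring_1 infinite_matrix set monoid" where
  "K1 = GL Mod derived GL (carrier GL)"

definition K1_class :: "'a::ring_1 infinite_matrix \<Rightarrow> 'a infinite_matrix set" where
  "K1_class A = derived GL (carrier GL) #>\<^bsub>GL\<^esub> A"

definition K1_image_of_int :: "'a::ring_1 infinite_matrix set set" where
  "K1_image_of_int = {K1_class (\<lambda>i j. of_int (A i j)) | A. A \<in> carrier (GL :: int infinite_matrix monoid)}"

definition reduced_K1 :: "'a::ring_1 infinite_matrix set set monoid" where
  "reduced_K1 = K1 Mod K1_image_of_int"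

definition reduced_K1_class :: "'a::ring_1 infinite_matrix \<Rightarrow> 'a infinite_matrix set set" where
  "reduced_K1_class A = K1_image_of_int #>\<^bsub>K1\<^esub> K1_class A"

text \<open>With respect to dual bases, the dual of an automorphism of a free module is given by the
  conjugate transpose.\<close>

definition invol_invariant :: "'a::involutive_ring infinite_matrix set set set \<Rightarrow> bool" where
  "invol_invariant Z \<longleftrightarrow> (\<forall>A\<in>carrier GL. reduced_K1_class A \<in> Z \<longrightarrow>
     reduced_K1_class (\<lambda>i j. invol (A j i)) \<in> Z)"

type_synonym 'a torsion_set = "'a infinite_matrix set set set"


section \<open>Based modules\<close>

text \<open>An \<open>s\<close>-basis \<open>(m, bs)\<close> of \<open>M\<close> is an ordered basis \<open>bs\<close> of \<open>M \<oplus> \<Lambda>\<^sup>m\<close>.\<close>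

type_synonym ('a, 'm) s_basis = "nat \<times> ('m \<times> 'a vec) list"

definition is_basis :: "('a::ring_1, 'm, 'z) module_scheme \<Rightarrow> 'm list \<Rightarrow> bool" where
  "is_basis M bs \<longleftrightarrow> set bs \<subseteq> carrier M \<and>
     (\<forall>x\<in>carrier M. \<exists>!v. v \<in> carrier_vec (length bs) \<and>
        x = (\<Oplus>\<^bsub>M\<^esub>i\<in>{..<length bs}. (v $ i) \<odot>\<^bsub>M\<^esub> (bs ! i)))"

definition s_bases :: "('a::ring_1, 'm, 'z) module_scheme \<Rightarrow> ('a, 'm) s_basis set" where
  "s_bases M = {(m, bs). is_basis (module_sum M (free_module m)) bs}"

text \<open>Stabilisation of \<open>(m, bs)\<close> to a basis of \<open>M \<oplus> \<Lambda>\<^sup>p\<close>, for \<open>p \<ge> m\<close>.\<close>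

fun extend_s_basis ::
    "('a::ring_1, 'm, 'z) module_scheme \<Rightarrow> nat \<Rightarrow> ('a, 'm) s_basis \<Rightarrow> ('m \<times> 'a vec) list" where
  "extend_s_basis M p (m, bs) =
     map (\<lambda>(x, v). (x, v @\<^sub>v 0\<^sub>v (p - m))) bs @ map (\<lambda>i. (\<zero>\<^bsub>M\<^esub>, unit_vec p i)) [m..<p]"

definition transition_matrix ::
    "('a::ring_1, 'm, 'z) module_scheme \<Rightarrow> 'm list \<Rightarrow> 'm list \<Rightarrow> 'a mat \<Rightarrow> bool" where
  "transition_matrix M bs cs A \<longleftrightarrow> length bs = length cs \<and>
     A \<in> carrier_mat (length bs) (length cs) \<and>
     (\<forall>i<length bs. bs ! i = (\<Oplus>\<^bsub>M\<^esub>j\<in>{..<length cs}. (A $$ (i, j)) \<odot>\<^bsub>M\<^esub> (cs ! j)))"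

definition torsion_in ::
    "'a torsion_set \<Rightarrow> ('a::ring_1, 'm, 'z) module_scheme \<Rightarrow> ('a, 'm) s_basis \<Rightarrow> ('a, 'm) s_basis \<Rightarrow> bool"
  where
  "torsion_in Z M b c \<longleftrightarrow> (\<exists>p\<ge>max (fst b) (fst c). \<exists>A.
     transition_matrix (module_sum M (free_module p)) (extend_s_basis M p b) (extend_s_basis M p c) A \<and>
     reduced_K1_class (stabilise A) \<in> Z)"

definition s_basis_rel ::
    "'a torsion_set \<Rightarrow> ('a::ring_1, 'm, 'z) module_scheme \<Rightarrow> (('a, 'm) s_basis \<times> ('a, 'm) s_basis) set"
  where
  "s_basis_rel Z M = {(b, c). b \<in> s_bases M \<and> c \<in> s_bases M \<and> torsion_in Z M b c}"

record ('a, 'm) based_module = "('a, 'm) module" +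
  bases :: "('a, 'm) s_basis set"

text \<open>Membership in the quotient includes that there is an \<open>s\<close>-basis, i.e. that \<open>M\<close> is stably
  finitely generated free.\<close>

definition based_module :: "'a torsion_set \<Rightarrow> ('a::ring_1, 'm) based_module \<Rightarrow> bool" where
  "based_module Z M \<longleftrightarrow> left_module M \<and> bases M \<in> s_bases M // s_basis_rel Z M"

definition with_bases ::
    "'a torsion_set \<Rightarrow> ('a::ring_1, 'm) module \<Rightarrow> ('a, 'm) s_basis set \<Rightarrow> ('a, 'm) based_module" where
  "with_bases Z M B = module.extend M (based_module.fields (s_basis_rel Z M `` B))"

definition module_rank :: "('a, 'm) based_module \<Rightarrow> int" where
  "module_rank M = (THE r. \<exists>(m, bs)\<in>bases M. r = int (length bs) - int m)"

text \<open>The matrix of \<open>f \<oplus> id\<close> with respect to \<open>b\<close> and \<open>c\<close> is the transition matrix from the image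
  of \<open>b\<close> to \<open>c\<close>.\<close>

definition map_s_basis :: "('m \<Rightarrow> 'n) \<Rightarrow> ('a, 'm) s_basis \<Rightarrow> ('a, 'n) s_basis" where
  "map_s_basis f = map_prod id (map (map_prod f id))"

definition simple_iso ::
    "'a torsion_set \<Rightarrow> ('a::ring_1, 'm) based_module \<Rightarrow> ('a, 'n) based_module \<Rightarrow> ('m \<Rightarrow> 'n) \<Rightarrow> bool" where
  "simple_iso Z M N f \<longleftrightarrow> f \<in> module_isos M N \<and>
     (\<exists>b\<in>bases M. \<exists>c\<in>bases N. torsion_in Z N (map_s_basis f b) c)"

definition free_based :: "'a torsion_set \<Rightarrow> nat \<Rightarrow> ('a::ring_1, 'a vec) based_module" where
  "free_based Z k = with_bases Z (free_module k) {(0, map (\<lambda>i. (unit_vec k i, 0\<^sub>v 0)) [0..<k])}"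

fun concat_s_bases ::
    "('a::ring_1, 'm, 'y) module_scheme \<Rightarrow> ('a, 'n, 'z) module_scheme \<Rightarrow>
     ('a, 'm) s_basis \<Rightarrow> ('a, 'n) s_basis \<Rightarrow> ('a, 'm \<times> 'n) s_basis" where
  "concat_s_bases M N (m, bs) (n, cs) =
     (m + n, map (\<lambda>(x, v). ((x, \<zero>\<^bsub>N\<^esub>), v @\<^sub>v 0\<^sub>v n)) bs @ map (\<lambda>(y, w). ((\<zero>\<^bsub>M\<^esub>, y), 0\<^sub>v m @\<^sub>v w)) cs)"

definition based_sum ::
    "'a torsion_set \<Rightarrow> ('a::ring_1, 'm) based_module \<Rightarrow> ('a, 'n) based_module \<Rightarrow> ('a, 'm \<times> 'n) based_module" where
  "based_sum Z M N = with_bases Z (module_sum M N)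
     {concat_s_bases M N b c | b c. b \<in> bases M \<and> c \<in> bases N}"

text \<open>\<open>(f, w)\<close> in \<open>M\<^sup>* \<oplus> \<Lambda>\<^sup>m\<close> is regarded as the functional that maps \<open>(x, v)\<close> to
  \<open>f x + \<Sum>k. v k * invol (w k)\<close>, so that the unit vectors of \<open>\<Lambda>\<^sup>m\<close> become the standard dual basis.\<close>

fun dual_s_bases ::
    "('a::involutive_ring, 'm, 'z) module_scheme \<Rightarrow> ('a, 'm) s_basis \<Rightarrow> ('a, 'm \<Rightarrow> 'a) s_basis set" where
  "dual_s_bases M (m, bs) = {(m', ds). m' = m \<and> length ds = length bs \<and>
     set ds \<subseteq> carrier (module_sum (dual M) (free_module m)) \<and>
     (\<forall>i<length bs. \<forall>j<length bs.
        (case ds ! i of (f, w) \<Rightarrow> case bs ! j of (x, v) \<Rightarrow> f x + (\<Sum>k<m. v $ k * invol (w $ k)))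
          = (if i = j then 1 else 0))}"

definition based_dual ::
    "'a torsion_set \<Rightarrow> ('a::involutive_ring, 'm) based_module \<Rightarrow> ('a, 'm \<Rightarrow> 'a) based_module" where
  "based_dual Z M = with_bases Z (dual M) (\<Union>b\<in>bases M. dual_s_bases M b)"

text \<open>The image of a based module under an injective linear map into \<open>M\<close>, as a based submodule of \<open>M\<close>.\<close>

definition based_image ::
    "('m \<Rightarrow> 'n) \<Rightarrow> ('a, 'm) based_module \<Rightarrow> ('a, 'n) based_module \<Rightarrow> ('a, 'n) based_module" where
  "based_image f L M = M\<lparr>carrier := f ` carrier L, bases := map_s_basis f ` bases L\<rparr>"

definition based_summand ::
    "'a torsion_set \<Rightarrow> ('a::ring_1, 'm) based_module \<Rightarrow> ('a, 'm) based_module \<Rightarrow> bool" where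
  "based_summand Z L M \<longleftrightarrow> based_module Z L \<and> carrier L \<subseteq> carrier M \<and> \<zero>\<^bsub>L\<^esub> = \<zero>\<^bsub>M\<^esub> \<and>
     (\<forall>x\<in>carrier L. \<forall>y\<in>carrier L. x \<oplus>\<^bsub>L\<^esub> y = x \<oplus>\<^bsub>M\<^esub> y) \<and>
     (\<forall>a. \<forall>x\<in>carrier L. a \<odot>\<^bsub>L\<^esub> x = a \<odot>\<^bsub>M\<^esub> x) \<and>
     (\<exists>C. submodule_of C M \<and> carrier L \<inter> C = {\<zero>\<^bsub>M\<^esub>} \<and>
        (\<forall>x\<in>carrier M. \<exists>l\<in>carrier L. \<exists>c\<in>C. x = l \<oplus>\<^bsub>M\<^esub> c))"

text \<open>A short exact sequence is based if the isomorphism \<open>A \<oplus> C \<rightarrow> B\<close> given by a splitting is simple.\<close>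

definition based_exact ::
    "'a torsion_set \<Rightarrow> ('a::ring_1, 'm) based_module \<Rightarrow> ('a, 'n) based_module \<Rightarrow> ('a, 'o) based_module \<Rightarrow>
     ('m \<Rightarrow> 'n) \<Rightarrow> ('n \<Rightarrow> 'o) \<Rightarrow> bool" where
  "based_exact Z A B C i p \<longleftrightarrow> i \<in> linear_maps A B \<and> p \<in> linear_maps B C \<and>
     inj_on i (carrier A) \<and> i ` carrier A = {x \<in> carrier B. p x = \<zero>\<^bsub>C\<^esub>} \<and> p ` carrier B = carrier C \<and>
     (\<exists>s\<in>linear_maps C B. (\<forall>z\<in>carrier C. p (s z) = z) \<and>
        simple_iso Z (based_sum Z A C) B (\<lambda>(x, z). i x \<oplus>\<^bsub>B\<^esub> s z))"


section \<open>Quadratic forms\<close>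

type_synonym ('a, 'm) bilinear = "'m \<Rightarrow> 'm \<Rightarrow> 'a"

definition Hom_dual :: "('a::involutive_ring, 'm, 'z) module_scheme \<Rightarrow> ('a, 'm) bilinear monoid" where
  "Hom_dual M = \<lparr>carrier = linear_maps M (dual M) \<inter> extensional (carrier M),
     mult = (\<lambda>\<phi> \<chi>. \<lambda>x\<in>carrier M. \<phi> x \<oplus>\<^bsub>dual M\<^esub> \<chi> x),
     one = (\<lambda>x\<in>carrier M. \<zero>\<^bsub>dual M\<^esub>)\<rparr>"

definition T_involution ::
    "'a \<Rightarrow> ('a::involutive_ring, 'm, 'z) module_scheme \<Rightarrow> ('a, 'm) bilinear \<Rightarrow> ('a, 'm) bilinear" where
  "T_involution \<epsilon> M \<phi> = (\<lambda>x\<in>carrier M. \<lambda>y\<in>carrier M. \<epsilon> * invol (\<phi> y x))"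

definition even_forms ::
    "'a \<Rightarrow> ('a::involutive_ring, 'm, 'z) module_scheme \<Rightarrow> ('a, 'm) bilinear set" where
  "even_forms \<epsilon> M = (\<lambda>\<phi>. \<lambda>x\<in>carrier M. \<lambda>y\<in>carrier M. \<phi> x y - T_involution \<epsilon> M \<phi> x y) ` carrier (Hom_dual M)"

text \<open>The group operation of \<open>Hom_dual M\<close>, and hence of this cokernel, is addition of forms.\<close>

definition Q_group ::
    "'a \<Rightarrow> ('a::involutive_ring, 'm, 'z) module_scheme \<Rightarrow> ('a, 'm) bilinear set monoid" where
  "Q_group \<epsilon> M = Hom_dual M Mod even_forms \<epsilon> M"

definition Q_class ::
    "'a \<Rightarrow> ('a::involutive_ring, 'm, 'z) module_scheme \<Rightarrow> ('a, 'm) bilinear \<Rightarrow> ('a, 'm) bilinear set" where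
  "Q_class \<epsilon> M \<phi> = even_forms \<epsilon> M #>\<^bsub>Hom_dual M\<^esub> \<phi>"

text \<open>Here and below \<^const>\<open>the_elem\<close> evaluates an expression that takes the same value on all
  representatives of a class.\<close>

definition symmetrisation ::
    "'a \<Rightarrow> ('a::involutive_ring, 'm, 'z) module_scheme \<Rightarrow> ('a, 'm) bilinear set \<Rightarrow> ('a, 'm) bilinear" where
  "symmetrisation \<epsilon> M \<psi> =
     the_elem ((\<lambda>\<phi>. \<lambda>x\<in>carrier M. \<lambda>y\<in>carrier M. \<phi> x y + T_involution \<epsilon> M \<phi> x y) ` \<psi>)"

definition Q_pullback ::
    "'a \<Rightarrow> ('a::involutive_ring, 'm, 'z) module_scheme \<Rightarrow> ('m \<Rightarrow> 'n) \<Rightarrow>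
     ('a, 'n) bilinear set \<Rightarrow> ('a, 'm) bilinear set" where
  "Q_pullback \<epsilon> L f \<psi> =
     the_elem ((\<lambda>\<phi>. Q_class \<epsilon> L (\<lambda>x\<in>carrier L. \<lambda>y\<in>carrier L. \<phi> (f x) (f y))) ` \<psi>)"

type_synonym ('a, 'm) quad_form = "('a, 'm) based_module \<times> ('a, 'm) bilinear set"

fun quad_form :: "'a \<Rightarrow> 'a torsion_set \<Rightarrow> ('a::involutive_ring, 'm) quad_form \<Rightarrow> bool" where
  "quad_form \<epsilon> Z (M, \<psi>) \<longleftrightarrow> based_module Z M \<and> \<psi> \<in> carrier (Q_group \<epsilon> M)"

fun simple_form :: "'a \<Rightarrow> 'a torsion_set \<Rightarrow> ('a::involutive_ring, 'm) quad_form \<Rightarrow> bool" where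
  "simple_form \<epsilon> Z (M, \<psi>) \<longleftrightarrow> quad_form \<epsilon> Z (M, \<psi>) \<and>
     simple_iso Z M (based_dual Z M) (symmetrisation \<epsilon> M \<psi>)"

fun isometry ::
    "'a \<Rightarrow> 'a torsion_set \<Rightarrow> ('a::involutive_ring, 'm) quad_form \<Rightarrow> ('a, 'n) quad_form \<Rightarrow> ('m \<Rightarrow> 'n) \<Rightarrow> bool" where
  "isometry \<epsilon> Z (M, \<psi>) (M', \<psi>') f \<longleftrightarrow> simple_iso Z M M' f \<and> Q_pullback \<epsilon> M f \<psi>' = \<psi>"

fun form_sum ::
    "'a \<Rightarrow> 'a torsion_set \<Rightarrow> ('a::involutive_ring, 'm) quad_form \<Rightarrow> ('a, 'n) quad_form \<Rightarrow> ('a, 'm \<times> 'n) quad_form" where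
  "form_sum \<epsilon> Z (M, \<psi>) (N, \<chi>) = (based_sum Z M N,
     the_elem {Q_class \<epsilon> (module_sum M N)
       (\<lambda>(x, y)\<in>carrier M \<times> carrier N. \<lambda>(x', y')\<in>carrier M \<times> carrier N. \<phi> x x' + \<phi>' y y') | \<phi> \<phi>'.
       \<phi> \<in> \<psi> \<and> \<phi>' \<in> \<chi>})"

definition zero_form :: "'a \<Rightarrow> ('a::involutive_ring, 'm) based_module \<Rightarrow> ('a, 'm) quad_form" where
  "zero_form \<epsilon> P = (P, \<one>\<^bsub>Q_group \<epsilon> P\<^esub>)"

text \<open>The entry \<open>1\<close> of the matrix of \<open>H\<^sub>\<epsilon>(L)\<close> maps \<open>f \<in> L\<^sup>*\<close> to \<open>f\<close>, a functional on the summand \<open>L\<close>.\<close>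

definition hyperbolic ::
    "'a \<Rightarrow> 'a torsion_set \<Rightarrow> ('a::involutive_ring, 'm) based_module \<Rightarrow> ('a, 'm \<times> ('m \<Rightarrow> 'a)) quad_form" where
  "hyperbolic \<epsilon> Z L = (let H = based_sum Z L (based_dual Z L) in
     (H, Q_class \<epsilon> H (\<lambda>(x, f)\<in>carrier H. \<lambda>(y, g)\<in>carrier H. f y)))"

fun lagrangian ::
    "'a \<Rightarrow> 'a torsion_set \<Rightarrow> ('a::involutive_ring, 'm) quad_form \<Rightarrow> ('a, 'm) based_module \<Rightarrow> bool" where
  "lagrangian \<epsilon> Z (M, \<psi>) L \<longleftrightarrow> based_summand Z L M \<and>
     carrier L = {x \<in> carrier M. \<forall>y\<in>carrier L. symmetrisation \<epsilon> M \<psi> x y = 0} \<and>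
     Q_pullback \<epsilon> L id \<psi> = \<one>\<^bsub>Q_group \<epsilon> L\<^esub>"

fun simple_lagrangian ::
    "'a \<Rightarrow> 'a torsion_set \<Rightarrow> ('a::involutive_ring, 'm) quad_form \<Rightarrow> ('a, 'm) based_module \<Rightarrow> bool" where
  "simple_lagrangian \<epsilon> Z (M, \<psi>) L \<longleftrightarrow> simple_form \<epsilon> Z (M, \<psi>) \<and> lagrangian \<epsilon> Z (M, \<psi>) L \<and>
     based_exact Z L M (based_dual Z L) id (\<lambda>x. restrict (symmetrisation \<epsilon> M \<psi> x) (carrier L))"


section \<open>Quasi-formations\<close>

type_synonym ('a, 'm) quasi_formation =
  "('a, 'm) quad_form \<times> ('a, 'm) based_module \<times> ('a, 'm) based_module"

fun quasi_formation :: "'a \<Rightarrow> 'a torsion_set \<Rightarrow> ('a::involutive_ring, 'm) quasi_formation \<Rightarrow> bool" where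
  "quasi_formation \<epsilon> Z ((M, \<psi>), L, V) \<longleftrightarrow> simple_form \<epsilon> Z (M, \<psi>) \<and>
     simple_lagrangian \<epsilon> Z (M, \<psi>) L \<and> based_summand Z V M \<and> 2 * module_rank V = module_rank M"

fun qf_isomorphic ::
    "'a \<Rightarrow> 'a torsion_set \<Rightarrow> ('a::involutive_ring, 'm) quasi_formation \<Rightarrow> ('a, 'n) quasi_formation \<Rightarrow> bool" where
  "qf_isomorphic \<epsilon> Z (F, L, V) (F', L', V') \<longleftrightarrow>
     (\<exists>f. isometry \<epsilon> Z F F' f \<and> simple_iso Z L L' f \<and> simple_iso Z V V' f)"

fun qf_sum ::
    "'a \<Rightarrow> 'a torsion_set \<Rightarrow> ('a::involutive_ring, 'm) quasi_formation \<Rightarrow> ('a, 'n) quasi_formation \<Rightarrow>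
     ('a, 'm \<times> 'n) quasi_formation" where
  "qf_sum \<epsilon> Z (F, L, V) (F', L', V') = (form_sum \<epsilon> Z F F', based_sum Z L L', based_sum Z V V')"

definition trivial_formation ::
    "'a \<Rightarrow> 'a torsion_set \<Rightarrow> ('a::involutive_ring, 'm) based_module \<Rightarrow> ('a, 'm \<times> ('m \<Rightarrow> 'a)) quasi_formation" where
  "trivial_formation \<epsilon> Z P = (hyperbolic \<epsilon> Z P,
     based_image (\<lambda>x. (x, \<zero>\<^bsub>dual P\<^esub>)) P (fst (hyperbolic \<epsilon> Z P)),
     based_image (\<lambda>f. (\<zero>\<^bsub>P\<^esub>, f)) (based_dual Z P) (fst (hyperbolic \<epsilon> Z P)))"

definition boundary ::
    "'a \<Rightarrow> 'a torsion_set \<Rightarrow> ('a::involutive_ring, 'm) based_module \<Rightarrow> ('a, 'm) bilinear \<Rightarrow>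
     ('a, 'm \<times> ('m \<Rightarrow> 'a)) quasi_formation" where
  "boundary \<epsilon> Z K \<rho> = (hyperbolic \<epsilon> Z K,
     based_image (\<lambda>x. (x, \<zero>\<^bsub>dual K\<^esub>)) K (fst (hyperbolic \<epsilon> Z K)),
     based_image (\<lambda>x. (x, \<rho> x)) K (fst (hyperbolic \<epsilon> Z K)))"

text \<open>Every stably finitely generated free module is isomorphic to a submodule of some
  \<open>\<Lambda>\<^sup>n\<close>, so modules whose elements have type \<^typ>\<open>'a vec\<close> represent all isomorphism classes.
  Predicates comparing two objects allow different element types.\<close>

definition stably_isomorphic ::
    "'a \<Rightarrow> 'a torsion_set \<Rightarrow> ('a::involutive_ring, 'm) quasi_formation \<Rightarrow> ('a, 'n) quasi_formation \<Rightarrow> bool" where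
  "stably_isomorphic \<epsilon> Z x y \<longleftrightarrow>
     (\<exists>(P :: ('a, 'a vec) based_module) (Q :: ('a, 'a vec) based_module).
        based_module Z P \<and> based_module Z Q \<and>
        qf_isomorphic \<epsilon> Z (qf_sum \<epsilon> Z x (trivial_formation \<epsilon> Z P)) (qf_sum \<epsilon> Z y (trivial_formation \<epsilon> Z Q)))"


section \<open>The monoid $l_{2q+1}(\Lambda)$\<close>

text \<open>The congruence on stable isomorphism classes generated by the Lagrangian relation, as a relation
  on quasi-formations.\<close>

inductive l_equiv ::
    "'a \<Rightarrow> 'a torsion_set \<Rightarrow> ('a::involutive_ring, 'a vec) quasi_formation \<Rightarrow> ('a, 'a vec) quasi_formation \<Rightarrow> bool"
  for \<epsilon> :: 'a and Z :: "'a torsion_set" where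
  stable: "\<lbrakk>quasi_formation \<epsilon> Z x; quasi_formation \<epsilon> Z y; stably_isomorphic \<epsilon> Z x y\<rbrakk>
    \<Longrightarrow> l_equiv \<epsilon> Z x y"
| lagrangian_rel: "\<lbrakk>simple_lagrangian \<epsilon> Z F K; simple_lagrangian \<epsilon> Z F L;
     quasi_formation \<epsilon> Z (F, K, V);
     quasi_formation \<epsilon> Z x;
     stably_isomorphic \<epsilon> Z x (qf_sum \<epsilon> Z (F, K, L) (F, L, V))\<rbrakk>
    \<Longrightarrow> l_equiv \<epsilon> Z x (F, K, V)"
| sum: "\<lbrakk>l_equiv \<epsilon> Z x y; quasi_formation \<epsilon> Z (w :: ('a, 'a vec) quasi_formation);
     quasi_formation \<epsilon> Z x'; quasi_formation \<epsilon> Z y';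
     stably_isomorphic \<epsilon> Z x' (qf_sum \<epsilon> Z x w); stably_isomorphic \<epsilon> Z y' (qf_sum \<epsilon> Z y w)\<rbrakk>
    \<Longrightarrow> l_equiv \<epsilon> Z x' y'"
| sym: "l_equiv \<epsilon> Z x y \<Longrightarrow> l_equiv \<epsilon> Z y x"
| trans: "\<lbrakk>l_equiv \<epsilon> Z x y; l_equiv \<epsilon> Z y z\<rbrakk> \<Longrightarrow> l_equiv \<epsilon> Z x z"

definition l_class ::
    "'a \<Rightarrow> 'a torsion_set \<Rightarrow> ('a::involutive_ring, 'm) quasi_formation \<Rightarrow> ('a, 'a vec) quasi_formation set" where
  "l_class \<epsilon> Z y = {z. \<exists>x. quasi_formation \<epsilon> Z x \<and> qf_isomorphic \<epsilon> Z y x \<and> l_equiv \<epsilon> Z x z}"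

definition l_monoid ::
    "'a \<Rightarrow> 'a torsion_set \<Rightarrow> ('a::involutive_ring, 'a vec) quasi_formation set monoid" where
  "l_monoid \<epsilon> Z = \<lparr>
     carrier = {x. quasi_formation \<epsilon> Z x} // {(x, y). l_equiv \<epsilon> Z x y},
     mult = (\<lambda>X Y. \<Union>x\<in>X. \<Union>y\<in>Y. l_class \<epsilon> Z (qf_sum \<epsilon> Z x y)),
     one = l_class \<epsilon> Z (trivial_formation \<epsilon> Z (free_based Z 0))\<rparr>"

definition elementary ::
    "'a \<Rightarrow> 'a torsion_set \<Rightarrow> ('a::involutive_ring, 'a vec) quasi_formation set \<Rightarrow> bool" where
  "elementary \<epsilon> Z X \<longleftrightarrow> (\<exists>(K :: ('a, 'a vec) based_module) \<rho>.
     based_module Z K \<and> \<rho> \<in> carrier (Hom_dual K) \<and> X = l_class \<epsilon> Z (boundary \<epsilon> Z K \<rho>))"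

definition form_class ::
    "'a \<Rightarrow> 'a torsion_set \<Rightarrow> ('a::involutive_ring, 'm) quad_form \<Rightarrow> ('a, 'a vec) quad_form set" where
  "form_class \<epsilon> Z v = {w. quad_form \<epsilon> Z w \<and>
     (\<exists>(P :: ('a, 'a vec) based_module) (Q :: ('a, 'a vec) based_module) f.
        based_module Z P \<and> based_module Z Q \<and>
        isometry \<epsilon> Z (form_sum \<epsilon> Z v (zero_form \<epsilon> P)) (form_sum \<epsilon> Z w (zero_form \<epsilon> Q)) f)}"

definition e_map ::
    "'a \<Rightarrow> 'a torsion_set \<Rightarrow> ('a::involutive_ring, 'a vec) quad_form set \<Rightarrow> ('a, 'a vec) quasi_formation set" where
  "e_map \<epsilon> Z C = the_elem {l_class \<epsilon> Z (boundary \<epsilon> Z V \<rho>) | V \<theta> \<rho>. (V, \<theta>) \<in> C \<and> \<rho> \<in> \<theta>}"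

end

theory Submission
 imports Defs
begin

text \<open>
  For a hyperbolic form \<open>M = H(A)\<close> let \<open>\<pi>\<close> be the projection to the second summand. The map
  \<open>(a, b) \<mapsto> (a - b, b + \<pi> (a - b))\<close> is an isometry of \<open>M \<oplus> -M\<close> onto the hyperbolic form on the module
  \<open>M\<close> and takes \<open>M \<oplus> 0\<close> to the graph of \<open>\<pi>\<close>, whence the Lagrangian relation gives
  \<open>e(M) = c + [M \<oplus> -M; A \<oplus> A, M \<oplus> 0]\<close> for some \<open>c\<close>. If \<open>\<gamma>\<close> is an isometry of \<open>M\<close>, then
  \<open>\<gamma> \<oplus> 1\<close> preserves \<open>M \<oplus> 0\<close>, so the last class absorbs \<open>[M; A, \<gamma> A]\<close>, and hence so does \<open>e(M)\<close>.

  After stabilisation, an element is represented by \<open>(M; A, v A)\<close> such that \<open>v A\<close> has a complement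
  \<open>w A\<close> with \<open>(v, w)\<close> a simple isomorphism. The isometry above followed by the contragredient of
  \<open>(v, w)\<^sup>-\<^sup>1\<close> and a shear takes \<open>v A \<oplus> 0\<close> to the graph of the form induced on \<open>A\<close> by \<open>v\<close>. Thus, up to the class
  of an isometry of \<open>M \<oplus> -M\<close>, the given element and the boundary of this form agree after adding
  \<open>e(M)\<close>, and adding \<open>e(M \<oplus> -M)\<close> as well removes that class.
\<close>

section \<open>The group $\widetilde K_1$\<close>

text \<open>The monoid has no cancellation, and classes can be composed only through a Lagrangian,
  while V is an arbitrary half-rank summand. An unwanted class can therefore only be absorbed, and V
  has to be compared with a graph. In M it need not be one. In M \<oplus> -M the diagonal is a
  Lagrangian that meets M \<oplus> 0, hence also V \<oplus> 0, trivially; relative to it M \<oplus>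
  0 is the graph of a map that represents the form of M, and restricting that form to V gives the
  boundary that is sought. The contragredient needs a free complement of V, while V only has a
  stably free one; this costs a further trivial summand. So a Lagrangian of rank n becomes A of rank
  2n, and k = 6n is the rank of A, for e(M), plus that of A \<oplus> A, for e(M \<oplus> -M). The
  other burden is torsion. Bases are turned into isomorphisms from free modules onto stabilised
  modules. As M is only stably free, the torsion of a map that acts on the stabilising summand has
  to be found without a basis of M; the factorisation of h \<oplus> h^-1 into shears does
  this.\<close>

definition gl_mat :: "nat => 'a::ring_1 mat set" where
 "gl_mat n = {A \<in> carrier_mat n n. \<exists>B\<in>carrier_mat n n. A * B = 1\<^sub>m n \<and> B * A = 1\<^sub>m n}"

definition pad_mat :: "nat => 'a::ring_1 mat => 'a mat" where
 "pad_mat d A = four_block_mat A (0\<^sub>m (dim_row A) d) (0\<^sub>m d (dim_col A)) (1\<^sub>m d)"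

text \<open>\<open>invertible_mat\<close> leaves the size of the inverse open; comparing the
  dimensions of the two products with those of the identity matrices determines it.\<close>

lemma invertible_iff_gl: "invertible_mat A \<longleftrightarrow> (\<exists>n. A \<in> gl_mat n)"
proof
 assume "invertible_mat A"
 then obtain B where sq: "dim_row A = dim_col A" and B: "A * B = 1\<^sub>m (dim_row A)" "B * A = 1\<^sub>m (dim_row B)"
  by (auto simp: invertible_mat_def inverts_mat_def)
 let ?n = "dim_row A"
 have c: "A \<in> carrier_mat ?n ?n" "B \<in> carrier_mat ?n ?n"
  using arg_cong[OF B(1), of dim_col] arg_cong[OF B(2), of dim_col] sq unfolding carrier_mat_def by simp_all
 moreover from c(2) have "B * A = 1\<^sub>m ?n" using B(2) by (metis carrier_matD(1))
 ultimately have "A \<in> gl_mat ?n" unfolding gl_mat_def using B(1) by blast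
 then show "\<exists>n. A \<in> gl_mat n" ..
next
 assume "\<exists>n. A \<in> gl_mat n"
 then obtain n B where "A \<in> carrier_mat n n" "B \<in> carrier_mat n n" "A * B = 1\<^sub>m n" "B * A = 1\<^sub>m n"
  by (auto simp: gl_mat_def)
 then show "invertible_mat A" unfolding invertible_mat_def inverts_mat_def
  by (metis carrier_matD square_mat.elims(3))
qed

lemma pad_mat_carrier: "A \<in> carrier_mat n n ==> pad_mat d A \<in> carrier_mat (n + d) (n + d)"
 unfolding pad_mat_def by (intro four_block_carrier_mat) auto

lemma stabilise_pad: "A \<in> carrier_mat n n ==> stabilise (pad_mat d A) = stabilise A"
 by (intro ext) (auto simp: stabilise_def pad_mat_def)

lemma pad_mult:
 assumes "A \<in> carrier_mat n n" "B \<in> carrier_mat n n"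
 shows "pad_mat d A * pad_mat d B = pad_mat d (A * B)"
proof -
 have "pad_mat d A * pad_mat d B = four_block_mat (A * B + 0\<^sub>m n d * 0\<^sub>m d n)
   (A * 0\<^sub>m n d + 0\<^sub>m n d * 1\<^sub>m d) (0\<^sub>m d n * B + 1\<^sub>m d * 0\<^sub>m d n) (0\<^sub>m d n * 0\<^sub>m n d + 1\<^sub>m d * 1\<^sub>m d)"
  unfolding pad_mat_def using assms by (subst mult_four_block_mat[of _ n n _ d _ d]) auto
 then show ?thesis using assms by (simp add: pad_mat_def)
qed

lemma pad_gl:
 assumes "A \<in> gl_mat n"
 shows "pad_mat d A \<in> gl_mat (n + d)"
proof -
 obtain B where "A \<in> carrier_mat n n" "B \<in> carrier_mat n n" "A * B = 1\<^sub>m n" "B * A = 1\<^sub>m n"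
  using assms by (auto simp: gl_mat_def)
 moreover have "pad_mat d (1\<^sub>m n) = (1\<^sub>m (n + d) :: 'a mat)" by (simp add: pad_mat_def)
 ultimately show ?thesis unfolding gl_mat_def
  by (auto simp: pad_mult[of _ n] intro!: pad_mat_carrier bexI[of _ "pad_mat d B"])
qed

lemma gl_mult: "A \<in> gl_mat n ==> B \<in> gl_mat n ==> A * B \<in> gl_mat n"
proof -
 assume "A \<in> gl_mat n" "B \<in> gl_mat n"
 then obtain A' B' where c: "A \<in> carrier_mat n n" "B \<in> carrier_mat n n" "A' \<in> carrier_mat n n" "B' \<in> carrier_mat n n"
  and e: "A * A' = 1\<^sub>m n" "A' * A = 1\<^sub>m n" "B * B' = 1\<^sub>m n" "B' * B = 1\<^sub>m n" by (auto simp: gl_mat_def)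
 have "A * B * (B' * A') = A * ((B * B') * A')" using c by (simp add: assoc_mult_mat[of _ n n _ n _ n])
 moreover have "B' * A' * (A * B) = B' * ((A' * A) * B)" using c by (simp add: assoc_mult_mat[of _ n n _ n _ n])
 ultimately have "A * B * (B' * A') = 1\<^sub>m n" "B' * A' * (A * B) = 1\<^sub>m n" using c e by (simp_all del: assoc_mult_mat)
 then show "A * B \<in> gl_mat n" using c unfolding gl_mat_def
  by (auto simp del: assoc_mult_mat intro!: bexI[of _ "B' * A'"])
qed

text \<open>The product in \<open>GL\<close> sums over the support of a row of the left factor. Rows
  inside the block are supported in the block, rows outside it are unit rows, so the two kinds are
  computed separately.\<close>

lemma stabilise_mult:
 assumes A: "A \<in> carrier_mat n n" and B: "B \<in> carrier_mat n n"
 shows "stabilise A \<otimes>\<^bsub>GL\<^esub> stabilise B = stabilise (A * B)"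
proof (intro ext)
 fix i k
 let ?S = "{j. stabilise A i j \<noteq> 0}"
 show "(stabilise A \<otimes>\<^bsub>GL\<^esub> stabilise B) i k = stabilise (A * B) i k"
 proof (cases "i < n")
  case True
  have "(\<Sum>j\<in>?S. stabilise A i j * stabilise B j k) = (\<Sum>j\<in>{..<n}. stabilise A i j * stabilise B j k)"
   by (rule sum.mono_neutral_left) (use A True in \<open>auto simp: stabilise_def split: if_splits\<close>)
  also have "\<dots> = stabilise (A * B) i k"
  proof (cases "k < n")
   case True
   then show ?thesis using A B \<open>i < n\<close>
    by (auto simp: stabilise_def scalar_prod_def atLeast0LessThan intro!: sum.cong)
  next
   case False
   then show ?thesis using A B \<open>i < n\<close> by (auto simp: stabilise_def intro!: sum.neutral)
  qed
  finally show ?thesis by (simp add: GL_def)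
 next
  case False
  then have "?S \<subseteq> {i}" using A by (auto simp: stabilise_def split: if_splits)
  then have "(\<Sum>j\<in>?S. stabilise A i j * stabilise B j k) = (\<Sum>j\<in>{i}. stabilise A i j * stabilise B j k)"
   by (intro sum.mono_neutral_left) auto
  then show ?thesis using A B False by (simp add: GL_def stabilise_def)
 qed
qed

lemma carrier_GL: "carrier GL = (\<Union>n. stabilise ` gl_mat n)"
 by (auto simp: GL_def invertible_iff_gl)

lemma gl_in_GL: "A \<in> gl_mat n ==> stabilise A \<in> carrier GL"
 by (auto simp: carrier_GL)

text \<open>Lets finitely many elements of \<open>GL\<close> be written as matrices of one common
  size, which reduces the group laws to those of finite matrices.\<close>

lemma GL_common_size:
 assumes "X \<in> carrier GL"
 shows "\<exists>n0. \<forall>n\<ge>n0. \<exists>A\<in>gl_mat n. X = stabilise A"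
proof -
 obtain m A where A: "A \<in> gl_mat m" "X = stabilise A" using assms by (auto simp: carrier_GL)
 have "\<exists>A\<in>gl_mat n. X = stabilise A" if "n \<ge> m" for n
 proof -
  have "A \<in> carrier_mat m m" using A by (simp add: gl_mat_def)
  then show ?thesis using A pad_gl[OF A(1), of "n - m"] that
   by (intro bexI[of _ "pad_mat (n - m) A"]) (auto simp: stabilise_pad)
 qed
 then show ?thesis by blast
qed

lemma group_GL: "group (GL :: 'a::ring_1 infinite_matrix monoid)"
proof (rule groupI)
 have one: "\<one>\<^bsub>GL\<^esub> = stabilise (1\<^sub>m n :: 'a mat)" for n by (intro ext) (auto simp: GL_def stabilise_def)
 have one_gl: "(1\<^sub>m n :: 'a mat) \<in> gl_mat n" for n by (auto simp: gl_mat_def)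
 show "\<one>\<^bsub>GL\<^esub> \<in> carrier (GL :: 'a infinite_matrix monoid)" 
  unfolding one[of 0] by (rule gl_in_GL[OF one_gl])
 fix x y z :: "'a infinite_matrix"
 assume x: "x \<in> carrier GL" and y: "y \<in> carrier GL"
 obtain a b where "\<forall>n\<ge>a. \<exists>A\<in>gl_mat n. x = stabilise A" "\<forall>n\<ge>b. \<exists>A\<in>gl_mat n. y = stabilise A"
  using x y GL_common_size by metis
 then have xy: "\<exists>A B. A \<in> gl_mat n \<and> B \<in> gl_mat n \<and> x = stabilise A \<and> y = stabilise B" if "n \<ge> a + b" for n
  using that by (meson add_leD1 add_leD2)
 then obtain A B where AB: "A \<in> gl_mat (a + b)" "B \<in> gl_mat (a + b)" "x = stabilise A" "y = stabilise B" by blast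
 then show "x \<otimes>\<^bsub>GL\<^esub> y \<in> carrier GL"
  using gl_in_GL[OF gl_mult[OF AB(1,2)]] by (simp add: stabilise_mult[of _ "a + b"] gl_mat_def)
 show "\<one>\<^bsub>GL\<^esub> \<otimes>\<^bsub>GL\<^esub> x = x"
  unfolding one[of "a + b"] using AB by (auto simp: stabilise_mult[of _ "a + b"] gl_mat_def)
 obtain A' where "A \<in> carrier_mat (a + b) (a + b)" "A' \<in> carrier_mat (a + b) (a + b)" "A * A' = 1\<^sub>m (a + b)" "A' * A = 1\<^sub>m (a + b)"
  using AB by (auto simp: gl_mat_def)
 then have "stabilise A' \<in> carrier GL" "stabilise A' \<otimes>\<^bsub>GL\<^esub> x = \<one>\<^bsub>GL\<^esub>"
  unfolding one[of "a + b"] using AB by (auto simp: stabilise_mult[of _ "a + b"] gl_mat_def intro!: gl_in_GL[of _ "a + b"])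
 then show "\<exists>y\<in>carrier GL. y \<otimes>\<^bsub>GL\<^esub> x = \<one>\<^bsub>GL\<^esub>" by blast
 assume z: "z \<in> carrier GL"
 then obtain c where c: "\<forall>n\<ge>c. \<exists>A\<in>gl_mat n. z = stabilise A" using GL_common_size by metis
 have "\<exists>A B C. A \<in> gl_mat (a + b + c) \<and> B \<in> gl_mat (a + b + c) \<and> C \<in> gl_mat (a + b + c) \<and>
   x = stabilise A \<and> y = stabilise B \<and> z = stabilise C"
  using xy[of "a + b + c"] c by (metis le_add1 le_add2)
 then obtain A B C where ABC: "A \<in> carrier_mat (a + b + c) (a + b + c)" "B \<in> carrier_mat (a + b + c) (a + b + c)"
  "C \<in> carrier_mat (a + b + c) (a + b + c)" "x = stabilise A" "y = stabilise B" "z = stabilise C"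
  by (auto simp: gl_mat_def)
 then show "x \<otimes>\<^bsub>GL\<^esub> y \<otimes>\<^bsub>GL\<^esub> z = x \<otimes>\<^bsub>GL\<^esub> (y \<otimes>\<^bsub>GL\<^esub> z)"
  by (simp add: stabilise_mult[of _ "a + b + c"])
qed

section \<open>K_1 and the classes of integral matrices\<close>

lemma derived_GL_normal: "derived GL (carrier GL) \<lhd> (GL :: 'a::ring_1 infinite_matrix monoid)"
proof -
 interpret group "GL :: 'a infinite_matrix monoid" by (rule group_GL)
 show ?thesis by (intro derived_is_normal normal_self)
qed

lemma comm_group_K1: "comm_group (K1 :: 'a::ring_1 infinite_matrix set monoid)"
 unfolding K1_def by (rule group.derived_quot_is_comm_group[OF group_GL])

lemma K1_class_hom: "(K1_class :: 'a::ring_1 infinite_matrix => _) \<in> hom GL K1"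
 using normal.r_coset_hom_Mod[OF derived_GL_normal] unfolding K1_def K1_class_def[abs_def] .

lemma of_int_stabilise:
 "(\<lambda>i j. of_int (stabilise A i j)) = (stabilise (map_mat of_int A) :: 'a::ring_1 infinite_matrix)"
 by (intro ext) (auto simp: stabilise_def)

lemma of_int_mat_mult:
 "A \<in> carrier_mat n n ==> B \<in> carrier_mat n n ==>
   (map_mat of_int A * map_mat of_int B :: 'a::ring_1 mat) = map_mat of_int (A * B)"
 by (intro eq_matI) (auto simp: scalar_prod_def)

lemma of_int_gl:
 assumes "A \<in> gl_mat n"
 shows "(map_mat of_int A :: 'a::ring_1 mat) \<in> gl_mat n"
proof -
 obtain B where "A \<in> carrier_mat n n" "B \<in> carrier_mat n n" "A * B = 1\<^sub>m n" "B * A = 1\<^sub>m n"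
  using assms by (auto simp: gl_mat_def)
 moreover have "(map_mat of_int (1\<^sub>m n) :: 'a mat) = 1\<^sub>m n" by (intro eq_matI) auto
 ultimately show ?thesis unfolding gl_mat_def
  by (auto simp: of_int_mat_mult[of _ n] intro!: bexI[of _ "map_mat of_int B"])
qed

text \<open>Needed to see that the classes of integral matrices form a subgroup of
  \<open>K1\<close>: they are the image of a homomorphism.\<close>

lemma of_int_GL_hom:
 "(\<lambda>A i j. of_int (A i j)) \<in> hom GL (GL :: 'a::ring_1 infinite_matrix monoid)"
proof (rule homI)
 fix X Y :: "int infinite_matrix"
 assume X: "X \<in> carrier GL" and Y: "Y \<in> carrier GL"
 then show "(\<lambda>i j. of_int (X i j) :: 'a) \<in> carrier GL"
  using of_int_gl unfolding carrier_GL by (fastforce simp: of_int_stabilise)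
 obtain a b where "\<forall>n\<ge>a. \<exists>A\<in>gl_mat n. X = stabilise A" "\<forall>n\<ge>b. \<exists>A\<in>gl_mat n. Y = stabilise A"
  using X Y GL_common_size by metis
 then have "\<exists>A B. A \<in> gl_mat (a + b) \<and> B \<in> gl_mat (a + b) \<and> X = stabilise A \<and> Y = stabilise B"
  by (meson le_add1 le_add2)
 then obtain A B where AB: "A \<in> carrier_mat (a + b) (a + b)" "B \<in> carrier_mat (a + b) (a + b)" "X = stabilise A" "Y = stabilise B"
  by (auto simp: gl_mat_def)
 then show "(\<lambda>i j. of_int ((X \<otimes>\<^bsub>GL\<^esub> Y) i j) :: 'a) = (\<lambda>i j. of_int (X i j)) \<otimes>\<^bsub>GL\<^esub> (\<lambda>i j. of_int (Y i j))"
  by (simp add: of_int_stabilise stabilise_mult[of _ "a + b"] of_int_mat_mult[of _ "a + b"])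
qed

lemma K1_image_subgroup: "subgroup K1_image_of_int (K1 :: 'a::ring_1 infinite_matrix set monoid)"
proof -
 have "K1_class \<circ> (\<lambda>A i j. of_int (A i j)) \<in> hom GL (K1 :: 'a infinite_matrix set monoid)"
  by (rule hom_compose[OF of_int_GL_hom K1_class_hom])
 then interpret group_hom GL "K1 :: 'a infinite_matrix set monoid" "K1_class \<circ> (\<lambda>A i j. of_int (A i j))"
  by (intro group_hom.intro group_hom_axioms.intro group_GL comm_group.axioms(2)[OF comm_group_K1])
 have "K1_image_of_int = (K1_class \<circ> (\<lambda>A i j. of_int (A i j) :: 'a)) ` carrier GL"
  by (auto simp: K1_image_of_int_def)
 then show ?thesis using img_is_subgroup by simp
qed

lemma K1_image_normal: "K1_image_of_int \<lhd> (K1 :: 'a::ring_1 infinite_matrix set monoid)"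
 by (rule comm_group.subgroup_imp_normal[OF comm_group_K1 K1_image_subgroup])

lemma comm_group_reduced_K1: "comm_group (reduced_K1 :: 'a::ring_1 infinite_matrix set set monoid)"
 unfolding reduced_K1_def by (rule comm_group.abelian_FactGroup[OF comm_group_K1 K1_image_subgroup])

lemma reduced_K1_class_hom:
 "(reduced_K1_class :: 'a::ring_1 infinite_matrix => _) \<in> hom GL reduced_K1"
proof -
 have "(\<lambda>X. K1_image_of_int #>\<^bsub>K1\<^esub> X) \<circ> K1_class \<in> hom GL (reduced_K1 :: 'a infinite_matrix set set monoid)"
  unfolding reduced_K1_def by (rule hom_compose[OF K1_class_hom normal.r_coset_hom_Mod[OF K1_image_normal]])
 then show ?thesis by (simp add: o_def reduced_K1_class_def[abs_def])
qed

text \<open>This is why changes of sign and permutations of coordinates are simple for every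
  Z.\<close>

lemma reduced_K1_class_of_int:
 assumes "A \<in> gl_mat n"
 shows "reduced_K1_class (stabilise (map_mat of_int A :: 'a::ring_1 mat)) = \<one>\<^bsub>reduced_K1\<^esub>"
proof -
 have "K1_class (stabilise (map_mat of_int A :: 'a mat)) \<in> K1_image_of_int"
  using gl_in_GL[OF assms] unfolding K1_image_of_int_def of_int_stabilise[symmetric] by blast
 moreover have "\<one>\<^bsub>reduced_K1\<^esub> = (K1_image_of_int :: 'a infinite_matrix set set)"
  by (simp add: reduced_K1_def FactGroup_def)
 ultimately show ?thesis unfolding reduced_K1_class_def
  by (simp add: subgroup.rcos_const[OF K1_image_subgroup] comm_group.axioms(2)[OF comm_group_K1])
qed

section \<open>Linear maps\<close>

abbreviation (input) mem_carrier (infix "IN" 50) where "x IN M \<equiv> x \<in> carrier M"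

abbreviation (input) mem_carrier_vec (infix "INV" 50) where "x INV n \<equiv> x \<in> carrier_vec n"

lemmas free_module_simps [simp] = module_vec_simps

lemma lmodD:
 assumes "left_module M"
 shows "abelian_group M" "\<And>x y. x IN M ==> y IN M ==> x \<oplus>\<^bsub>M\<^esub> y IN M"
  "(zero M) IN M"
  "\<And>a x. x IN M ==> a \<odot>\<^bsub>M\<^esub> x IN M"
  "\<And>a b x. x IN M ==> (a + b) \<odot>\<^bsub>M\<^esub> x = a \<odot>\<^bsub>M\<^esub> x \<oplus>\<^bsub>M\<^esub> b \<odot>\<^bsub>M\<^esub> x"
  "\<And>a x y. x IN M ==> y IN M ==> a \<odot>\<^bsub>M\<^esub> (x \<oplus>\<^bsub>M\<^esub> y) = a \<odot>\<^bsub>M\<^esub> x \<oplus>\<^bsub>M\<^esub> a \<odot>\<^bsub>M\<^esub> y"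
  "\<And>a b x. x IN M ==> (a * b) \<odot>\<^bsub>M\<^esub> x = a \<odot>\<^bsub>M\<^esub> (b \<odot>\<^bsub>M\<^esub> x)"
  "\<And>x. x IN M ==> 1 \<odot>\<^bsub>M\<^esub> x = x"
  "\<And>x. x IN M ==> (zero M) \<oplus>\<^bsub>M\<^esub> x = x" "\<And>x. x IN M ==> x \<oplus>\<^bsub>M\<^esub> (zero M) = x"
proof -
 interpret abelian_group M using assms by (simp add: left_module_def)
 show "abelian_group M" by (rule abelian_group_axioms)
qed (use assms in \<open>auto simp: left_module_def abelian_group_def abelian_monoid.a_closed
   abelian_monoid.l_zero abelian_monoid.r_zero abelian_monoid.zero_closed\<close>)

lemma left_module_cancel:
 assumes "left_module M" "x IN M" "y IN M" "z IN M"
 shows "x \<oplus>\<^bsub>M\<^esub> y = x \<oplus>\<^bsub>M\<^esub> z \<longleftrightarrow> y = z"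
proof -
 interpret abelian_group M using assms(1) by (rule lmodD)
 show ?thesis using assms by simp
qed

lemma lmod_minus:
 assumes "left_module M" "x IN M"
 shows "(- 1) \<odot>\<^bsub>M\<^esub> x \<oplus>\<^bsub>M\<^esub> x = zero M" "x \<oplus>\<^bsub>M\<^esub> (- 1) \<odot>\<^bsub>M\<^esub> x = zero M" "0 \<odot>\<^bsub>M\<^esub> x = zero M" "a \<odot>\<^bsub>M\<^esub> (zero M) = zero M"
proof -
 note M = lmodD[OF assms(1)]
 have "0 \<odot>\<^bsub>M\<^esub> x \<oplus>\<^bsub>M\<^esub> 0 \<odot>\<^bsub>M\<^esub> x = 0 \<odot>\<^bsub>M\<^esub> x \<oplus>\<^bsub>M\<^esub> (zero M)"
  using M(5)[of x 0 0] M assms by simp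
 then show z: "0 \<odot>\<^bsub>M\<^esub> x = zero M" using left_module_cancel[OF assms(1)] M assms by metis
 have "a \<odot>\<^bsub>M\<^esub> (zero M) \<oplus>\<^bsub>M\<^esub> a \<odot>\<^bsub>M\<^esub> (zero M) = a \<odot>\<^bsub>M\<^esub> (zero M) \<oplus>\<^bsub>M\<^esub> (zero M)"
  using M(6)[of "zero M" "zero M" a] M by simp
 then show "a \<odot>\<^bsub>M\<^esub> (zero M) = zero M" using left_module_cancel[OF assms(1)] M assms by metis
 show "(- 1) \<odot>\<^bsub>M\<^esub> x \<oplus>\<^bsub>M\<^esub> x = zero M" using M(5)[of x "- 1" 1] M(8) z assms by simp
 show "x \<oplus>\<^bsub>M\<^esub> (- 1) \<odot>\<^bsub>M\<^esub> x = zero M" using M(5)[of x 1 "- 1"] M(8) z assms by simp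
qed

lemma left_module_comm:
 assumes "left_module M" "x IN M" "y IN M"
 shows "x \<oplus>\<^bsub>M\<^esub> y = y \<oplus>\<^bsub>M\<^esub> x"
 using assms by (meson abelian_group_def abelian_monoid.a_comm lmodD(1))

lemma left_module_assoc:
 assumes "left_module M" "x IN M" "y IN M" "z IN M"
 shows "x \<oplus>\<^bsub>M\<^esub> y \<oplus>\<^bsub>M\<^esub> z = x \<oplus>\<^bsub>M\<^esub> (y \<oplus>\<^bsub>M\<^esub> z)"
 using assms by (meson abelian_group_def abelian_monoid.a_assoc lmodD(1))

text \<open>Additive inverses need not be supplied: distributivity and the assumption on the scalar
  0 make \<open>(- 1) \<odot> x\<close> an inverse of x.\<close>

lemma left_moduleI:
 assumes "\<And>x y. x IN M ==> y IN M ==> x \<oplus>\<^bsub>M\<^esub> y IN M"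
  "(zero M) IN M"
  "\<And>x y z. x IN M ==> y IN M ==> z IN M ==> x \<oplus>\<^bsub>M\<^esub> y \<oplus>\<^bsub>M\<^esub> z = x \<oplus>\<^bsub>M\<^esub> (y \<oplus>\<^bsub>M\<^esub> z)"
  "\<And>x y. x IN M ==> y IN M ==> x \<oplus>\<^bsub>M\<^esub> y = y \<oplus>\<^bsub>M\<^esub> x"
  "\<And>x. x IN M ==> (zero M) \<oplus>\<^bsub>M\<^esub> x = x"
  "\<And>x. x IN M ==> 0 \<odot>\<^bsub>M\<^esub> x = zero M"
  "\<And>a x. x IN M ==> a \<odot>\<^bsub>M\<^esub> x IN M"
  "\<And>a b x. x IN M ==> (a + b) \<odot>\<^bsub>M\<^esub> x = a \<odot>\<^bsub>M\<^esub> x \<oplus>\<^bsub>M\<^esub> b \<odot>\<^bsub>M\<^esub> x"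
  "\<And>a x y. x IN M ==> y IN M ==> a \<odot>\<^bsub>M\<^esub> (x \<oplus>\<^bsub>M\<^esub> y) = a \<odot>\<^bsub>M\<^esub> x \<oplus>\<^bsub>M\<^esub> a \<odot>\<^bsub>M\<^esub> y"
  "\<And>a b x. x IN M ==> (a * b) \<odot>\<^bsub>M\<^esub> x = a \<odot>\<^bsub>M\<^esub> (b \<odot>\<^bsub>M\<^esub> x)"
  "\<And>x. x IN M ==> 1 \<odot>\<^bsub>M\<^esub> x = x"
 shows "left_module (M :: ('a::ring_1, 'm, 'z) module_scheme)"
proof -
 have "abelian_group M"
 proof (rule abelian_groupI)
  fix x assume x: "x IN M"
  then have "(- 1) \<odot>\<^bsub>M\<^esub> x \<oplus>\<^bsub>M\<^esub> x = zero M" using assms(8)[of x "-1" 1] assms(6,11) by simp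
  then show "\<exists>y\<in>carrier M. y \<oplus>\<^bsub>M\<^esub> x = zero M" using assms(7) x by blast
 qed (use assms in auto)
 then show ?thesis using assms(7-11) by (simp add: left_module_def)
qed

lemma left_module_free [simp]: "left_module (free_module n :: ('a::ring_1, 'a vec) module)"
 by (rule left_moduleI) (auto simp: algebra_simps smult_add_distrib_vec add_smult_distrib_vec smult_smult_assoc intro!: eq_vecI)

lemma module_sum_simps [simp]:
 "carrier (module_sum M N) = carrier M \<times> carrier N" "(zero (module_sum M N)) = (zero M, zero N)"
 "(x, y) \<oplus>\<^bsub>module_sum M N\<^esub> (x', y') = (x \<oplus>\<^bsub>M\<^esub> x', y \<oplus>\<^bsub>N\<^esub> y')"
 "a \<odot>\<^bsub>module_sum M N\<^esub> (x, y) = (a \<odot>\<^bsub>M\<^esub> x, a \<odot>\<^bsub>N\<^esub> y)"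
 by (simp_all add: module_sum_def)

lemma left_module_sum [simp]:
 assumes "left_module M" "left_module N"
 shows "left_module (module_sum M N)"
proof (rule left_moduleI)
 note simps = lmodD(2-)[OF assms(1)] lmodD(2-)[OF assms(2)] lmod_minus(3)[OF assms(1)] lmod_minus(3)[OF assms(2)]
 fix x y z a b
 assume x: "x IN (module_sum M N)"
 then show "(zero (module_sum M N)) \<oplus>\<^bsub>module_sum M N\<^esub> x = x" "0 \<odot>\<^bsub>module_sum M N\<^esub> x = zero (module_sum M N)"
  "a \<odot>\<^bsub>module_sum M N\<^esub> x IN (module_sum M N)" "1 \<odot>\<^bsub>module_sum M N\<^esub> x = x"
  "(a + b) \<odot>\<^bsub>module_sum M N\<^esub> x = a \<odot>\<^bsub>module_sum M N\<^esub> x \<oplus>\<^bsub>module_sum M N\<^esub> b \<odot>\<^bsub>module_sum M N\<^esub> x"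
  "(a * b) \<odot>\<^bsub>module_sum M N\<^esub> x = a \<odot>\<^bsub>module_sum M N\<^esub> (b \<odot>\<^bsub>module_sum M N\<^esub> x)"
  by (auto simp: simps)
 assume y: "y IN (module_sum M N)"
 show "x \<oplus>\<^bsub>module_sum M N\<^esub> y IN (module_sum M N)"
  "a \<odot>\<^bsub>module_sum M N\<^esub> (x \<oplus>\<^bsub>module_sum M N\<^esub> y) = a \<odot>\<^bsub>module_sum M N\<^esub> x \<oplus>\<^bsub>module_sum M N\<^esub> a \<odot>\<^bsub>module_sum M N\<^esub> y"
  using x y by (auto simp: simps)
 show "x \<oplus>\<^bsub>module_sum M N\<^esub> y = y \<oplus>\<^bsub>module_sum M N\<^esub> x"
  using x y by (auto simp: left_module_comm[OF assms(1)] left_module_comm[OF assms(2)])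
 assume "z IN (module_sum M N)"
 then show "x \<oplus>\<^bsub>module_sum M N\<^esub> y \<oplus>\<^bsub>module_sum M N\<^esub> z = x \<oplus>\<^bsub>module_sum M N\<^esub> (y \<oplus>\<^bsub>module_sum M N\<^esub> z)"
  using x y by (auto simp: left_module_assoc[OF assms(1)] left_module_assoc[OF assms(2)])
qed (auto simp: lmodD assms)

section \<open>Linear maps and isomorphisms\<close>

lemma linI:
 assumes "\<And>x. x IN M ==> f x IN N"
  "\<And>x y. x IN M ==> y IN M ==> f (x \<oplus>\<^bsub>M\<^esub> y) = f x \<oplus>\<^bsub>N\<^esub> f y"
  "\<And>a x. x IN M ==> f (a \<odot>\<^bsub>M\<^esub> x) = a \<odot>\<^bsub>N\<^esub> f x"
 shows "f \<in> linear_maps M N"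
 using assms by (auto simp: linear_maps_def)

lemma linD:
 assumes "f \<in> linear_maps M N"
 shows "\<And>x. x IN M ==> f x IN N"
  "\<And>x y. x IN M ==> y IN M ==> f (x \<oplus>\<^bsub>M\<^esub> y) = f x \<oplus>\<^bsub>N\<^esub> f y"
  "\<And>a x. x IN M ==> f (a \<odot>\<^bsub>M\<^esub> x) = a \<odot>\<^bsub>N\<^esub> f x"
 using assms by (auto simp: linear_maps_def)

lemma linear_maps_zero:
 assumes "f \<in> linear_maps M N" "left_module M" "left_module N"
 shows "f (zero M) = zero N"
 using linD[OF assms(1)] lmod_minus(3)[OF assms(2)] lmod_minus(3)[OF assms(3)] lmodD(3)[OF assms(2)]
 by metis

lemma lin_comp:
 "f \<in> linear_maps M N ==> g \<in> linear_maps N P ==> g \<circ> f \<in> linear_maps M P"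
 by (intro linI) (auto simp: linD)

lemma module_isosI:
 assumes "f \<in> linear_maps M N" "\<And>y. y IN N ==> g y IN M"
  "\<And>x. x IN M ==> g (f x) = x" "\<And>y. y IN N ==> f (g y) = y"
 shows "f \<in> module_isos M N"
 unfolding module_isos_def using assms linD(1)[OF assms(1)]
 by (auto intro!: bij_betw_byWitness[where f' = g])

lemma module_isosD:
 assumes "f \<in> module_isos M N"
 shows "f \<in> linear_maps M N" "bij_betw f (carrier M) (carrier N)" "\<And>x. x IN M ==> f x IN N"
 using assms by (auto simp: module_isos_def linear_maps_def)

abbreviation inv_map :: "('a, 'm, 'y) module_scheme => ('m => 'n) => 'n => 'm" where
 "inv_map M \<equiv> inv_into (carrier M)"

lemma inv_map:
 assumes "f \<in> module_isos M N"
 shows "\<And>x. x IN M ==> inv_map M f (f x) = x" "\<And>y. y IN N ==> f (inv_map M f y) = y"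
  "\<And>y. y IN N ==> inv_map M f y IN M"
 using module_isosD(2)[OF assms] by (auto simp: bij_betw_def inv_into_into f_inv_into_f)

lemma inv_map_eq:
 assumes "f \<in> module_isos M N" "x IN M" "f x = y"
 shows "inv_map M f y = x"
 using assms inv_map by metis

lemma module_isos_inv:
 assumes f: "f \<in> module_isos M N" and M: "left_module M"
 shows "inv_map M f \<in> module_isos N M"
proof (rule module_isosI[where g = f])
 note i = inv_map[OF f] and l = linD[OF module_isosD(1)[OF f]] and m = lmodD[OF M]
 show "inv_map M f \<in> linear_maps N M"
 proof (rule linI)
  fix x y assume "x IN N" "y IN N"
  then show "inv_map M f (x \<oplus>\<^bsub>N\<^esub> y) = inv_map M f x \<oplus>\<^bsub>M\<^esub> inv_map M f y"
   by (intro inv_map_eq[OF f]) (auto simp: i l m)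
 next
  fix a x assume "x IN N"
  then show "inv_map M f (a \<odot>\<^bsub>N\<^esub> x) = a \<odot>\<^bsub>M\<^esub> inv_map M f x"
   by (intro inv_map_eq[OF f]) (auto simp: i l m)
 qed (auto simp: i)
qed (auto simp: inv_map[OF f] module_isosD[OF f])

lemma module_isos_comp:
 "f \<in> module_isos M N ==> g \<in> module_isos N P ==> g \<circ> f \<in> module_isos M P"
 unfolding module_isos_def using lin_comp bij_betw_trans by blast

lemma module_isos_id: "id \<in> module_isos M M"
 by (auto simp: module_isos_def linear_maps_def)

lemma module_isos_cong:
 assumes "f \<in> module_isos M N" "\<And>x. x IN M ==> f x = g x" "left_module M"
 shows "g \<in> module_isos M N"
proof (rule module_isosI[where g = "inv_map M f"])
 note l = linD[OF module_isosD(1)[OF assms(1)]] and m = lmodD[OF assms(3)]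
 show "g \<in> linear_maps M N"
  by (rule linI) (use l m assms(2) in \<open>metis+\<close>)
qed (use inv_map[OF assms(1)] assms(2) in \<open>metis+\<close>)

lemma linear_maps_map_prod:
 assumes "f \<in> linear_maps M M'" "g \<in> linear_maps N N'"
 shows "map_prod f g \<in> linear_maps (module_sum M N) (module_sum M' N')"
 by (rule linI) (use linD[OF assms(1)] linD[OF assms(2)] in auto)

lemma module_isos_map_prod:
 assumes "f \<in> module_isos M M'" "g \<in> module_isos N N'"
 shows "map_prod f g \<in> module_isos (module_sum M N) (module_sum M' N')"
 using assms linear_maps_map_prod by (auto simp: module_isos_def bij_betw_map_prod)

section \<open>Torsion of automorphisms of free modules\<close>

text \<open>Induction on the number k of leading coordinates that are kept, the others being
  replaced by 0. Scalar values suffice: it is applied to single coordinates of a map and to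
  pairings.\<close>

lemma additive_vec_sum:
 fixes F :: "'a::ring_1 vec => 'a"
 assumes add: "\<And>x y. x INV n ==> y INV n ==> F (x + y) = F x + F y"
  and smult: "\<And>a x. x INV n ==> F (a \<cdot>\<^sub>v x) = a * F x"
  and v: "v INV n"
 shows "F v = (\<Sum>i<n. v $ i * F (unit_vec n i))"
proof -
 have "F (vec n (\<lambda>i. if i < k then v $ i else 0)) = (\<Sum>i<k. v $ i * F (unit_vec n i))" if "k \<le> n" for k
  using that
 proof (induction k)
  case 0
  have "F (0 \<cdot>\<^sub>v 0\<^sub>v n) = 0 * F (0\<^sub>v n)" by (rule smult) simp
  moreover have "vec n (\<lambda>i. if i < 0 then v $ i else 0) = (0::'a) \<cdot>\<^sub>v 0\<^sub>v n" by (intro eq_vecI) auto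
  ultimately show ?case by simp
 next
  case (Suc k)
  have "vec n (\<lambda>i. if i < Suc k then v $ i else 0) =
    vec n (\<lambda>i. if i < k then v $ i else 0) + v $ k \<cdot>\<^sub>v unit_vec n k"
   using Suc.prems by (intro eq_vecI) (auto simp: less_Suc_eq unit_vec_def)
  then have "F (vec n (\<lambda>i. if i < Suc k then v $ i else 0)) =
    F (vec n (\<lambda>i. if i < k then v $ i else 0)) + v $ k * F (unit_vec n k)"
   by (simp add: add smult)
  then show ?case using Suc by simp
 qed
 moreover have "vec n (\<lambda>i. if i < n then v $ i else 0) = v" using v by (intro eq_vecI) auto
 ultimately show ?thesis by force
qed

abbreviation lin :: "nat => nat => ('a::ring_1 vec => 'a vec) set" where
 "lin n m \<equiv> linear_maps (free_module n) (free_module m)"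

abbreviation aut :: "nat => ('a::ring_1 vec => 'a vec) set" where
 "aut n \<equiv> module_isos (free_module n) (free_module n)"

lemma lin_index:
 assumes "h \<in> lin n m" "v INV n" "j < m"
 shows "h v $ j = (\<Sum>i<n. v $ i * h (unit_vec n i) $ j)"
proof (rule additive_vec_sum[where F = "\<lambda>v. h v $ j"])
 note h = linD[OF assms(1), simplified]
 show "h (x + y) $ j = h x $ j + h y $ j" if "x INV n" "y INV n" for x y
  using h(1)[OF that(1)] h(1)[OF that(2)] h(2)[OF that] assms(3) by simp
 show "h (a \<cdot>\<^sub>v x) $ j = a * h x $ j" if "x INV n" for a x
  using h(1)[OF that] h(3)[OF that] assms(3) by simp
qed (rule assms)

text \<open>Scalars act from the left, so vectors are rows: row i is the image of the i-th unit
  vector, and composition of maps reverses the order of the matrix product.\<close>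

definition mat_of_lin :: "nat => nat => ('a::ring_1 vec => 'a vec) => 'a mat" where
 "mat_of_lin n m h = mat n m (\<lambda>(i, j). h (unit_vec n i) $ j)"

lemma mat_of_lin_carrier [simp]: "mat_of_lin n m h \<in> carrier_mat n m"
 by (simp add: mat_of_lin_def)

lemma mat_of_lin_comp:
 assumes "h \<in> lin n m" "k \<in> lin m l"
 shows "mat_of_lin n l (k \<circ> h) = mat_of_lin n m h * mat_of_lin m l k"
proof (intro eq_matI)
 fix i j assume ij: "i < dim_row (mat_of_lin n m h * mat_of_lin m l k)" "j < dim_col (mat_of_lin n m h * mat_of_lin m l k)"
 then have "h (unit_vec n i) INV m" using linD(1)[OF assms(1)] by (simp add: mat_of_lin_def)
 then show "mat_of_lin n l (k \<circ> h) $$ (i, j) = (mat_of_lin n m h * mat_of_lin m l k) $$ (i, j)"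
  using ij lin_index[OF assms(2), of "h (unit_vec n i)" j]
  by (simp add: mat_of_lin_def scalar_prod_def atLeast0LessThan)
qed (auto simp: mat_of_lin_def)

lemma mat_of_lin_id: "(\<And>x. x INV n ==> h x = x) ==> mat_of_lin n n h = 1\<^sub>m n"
 by (intro eq_matI) (auto simp: mat_of_lin_def unit_vec_def)

lemma mat_of_lin_cong: "(\<And>x. x INV n ==> h x = k x) ==> mat_of_lin n m h = mat_of_lin n m k"
 by (intro eq_matI) (auto simp: mat_of_lin_def)

lemma mat_of_lin_gl:
 assumes "h \<in> aut n"
 shows "mat_of_lin n n h \<in> gl_mat n"
proof -
 let ?k = "inv_map (free_module n :: ('a, 'a vec) module) h"
 have h: "h \<in> lin n n" and k: "?k \<in> lin n n"
  using assms module_isos_inv[OF assms] by (auto dest: module_isosD(1))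
 have "mat_of_lin n n (?k \<circ> h) = 1\<^sub>m n" "mat_of_lin n n (h \<circ> ?k) = 1\<^sub>m n"
  using inv_map[OF assms] by (auto intro!: mat_of_lin_id)
 then show ?thesis unfolding gl_mat_def mat_of_lin_comp[OF h k] mat_of_lin_comp[OF k h] by auto
qed

definition torsion :: "nat => ('a::ring_1 vec => 'a vec) => 'a infinite_matrix set set" where
 "torsion n h = reduced_K1_class (stabilise (mat_of_lin n n h))"

interpretation RK: comm_group "reduced_K1 :: 'a::ring_1 infinite_matrix set set monoid"
 by (rule comm_group_reduced_K1)

lemma torsion_closed [simp]: "h \<in> aut n ==> torsion n h IN reduced_K1"
 unfolding torsion_def by (intro hom_in_carrier[OF reduced_K1_class_hom] gl_in_GL[OF mat_of_lin_gl])

lemma torsion_comp: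
 assumes "h \<in> aut n" "k \<in> aut n"
 shows "torsion n (k \<circ> h) = torsion n h \<otimes>\<^bsub>reduced_K1\<^esub> torsion n k"
proof -
 have "stabilise (mat_of_lin n n (k \<circ> h)) = stabilise (mat_of_lin n n h) \<otimes>\<^bsub>GL\<^esub> stabilise (mat_of_lin n n k)"
  using module_isosD(1)[OF assms(1)] module_isosD(1)[OF assms(2)]
  by (simp add: stabilise_mult[of _ n] mat_of_lin_comp[of _ n n])
 then show ?thesis unfolding torsion_def
  using hom_mult[OF reduced_K1_class_hom] assms mat_of_lin_gl gl_in_GL by metis
qed

lemma torsion_cong: "(\<And>x. x INV n ==> h x = k x) ==> torsion n h = torsion n k"
 unfolding torsion_def by (metis mat_of_lin_cong)

text \<open>The map \<open>h'\<close> over the integers supplies invertibility over the integers;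
  integral entries of an automorphism over the ring would not be enough.\<close>

lemma torsion_of_int:
 assumes "h' \<in> aut n" "\<And>i j. i < n ==> j < n ==> h (unit_vec n i) $ j = of_int (h' (unit_vec n i) $ j)"
 shows "torsion n (h :: 'a::ring_1 vec => 'a vec) = \<one>\<^bsub>reduced_K1\<^esub>"
proof -
 have "mat_of_lin n n h = map_mat of_int (mat_of_lin n n h')"
  using assms(2) by (intro eq_matI) (auto simp: mat_of_lin_def)
 then show ?thesis unfolding torsion_def using reduced_K1_class_of_int[OF mat_of_lin_gl[OF assms(1)]] by simp
qed

lemma torsion_id: "(\<And>x. x INV n ==> h x = x) ==> torsion n h = \<one>\<^bsub>reduced_K1\<^esub>"
 by (rule torsion_of_int[of id]) (auto simp: module_isos_id unit_vec_def)

section \<open>Block decompositions of vectors\<close>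

lemma append_vec_cases:
 assumes "v INV (n + m)"
 obtains a b where "v = a @\<^sub>v b" "a INV n" "b INV m"
 using assms by (metis vec_first_last_append vec_first_carrier vec_last_carrier)

lemma append_vec_ex:
 "v INV (n + m) ==> \<exists>a b. v = a @\<^sub>v b \<and> a INV n \<and> b INV m"
 by (metis append_vec_cases)

lemma vec_first_last_of_append [simp]:
 "a INV n ==> vec_first (a @\<^sub>v b) n = a" "b INV m ==> vec_last (a @\<^sub>v b) m = b"
 by (auto simp: vec_first_def vec_last_def)

lemma append_vec_ops:
 assumes "a INV n" "b INV m" "a' INV n" "b' INV m"
 shows "(a @\<^sub>v b) + (a' @\<^sub>v b') = (a + a') @\<^sub>v (b + b')" "c \<cdot>\<^sub>v (a @\<^sub>v b) = (c \<cdot>\<^sub>v a) @\<^sub>v (c \<cdot>\<^sub>v b)"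
  "a @\<^sub>v b = a' @\<^sub>v b' \<longleftrightarrow> a = a' \<and> b = b'"
 using assms append_vec_eq[of a n a' b b'] by (auto intro!: eq_vecI)

definition on_append :: "nat => nat => ('a vec => 'a vec => 'b) => 'a vec => 'b" where
 "on_append n m f v = f (vec_first v n) (vec_last v m)"

lemma on_append [simp]: "a INV n ==> b INV m ==> on_append n m f (a @\<^sub>v b) = f a b"
 by (simp add: on_append_def)

lemma on_append_linear:
 assumes "\<And>a b. a INV n ==> b INV m ==> f a b IN N"
  "\<And>a b a' b'. a INV n ==> b INV m ==> a' INV n ==> b' INV m ==>
    f (a + a') (b + b') = f a b \<oplus>\<^bsub>N\<^esub> f a' b'"
  "\<And>c a b. a INV n ==> b INV m ==> f (c \<cdot>\<^sub>v a) (c \<cdot>\<^sub>v b) = c \<odot>\<^bsub>N\<^esub> f a b"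
 shows "on_append n m f \<in> linear_maps (free_module (n + m) :: ('a::ring_1, 'a vec) module) N"
proof (rule linI)
 fix x y :: "'a vec"
 assume "x \<in> carrier (free_module (n + m))" "y \<in> carrier (free_module (n + m))"
 then obtain a b a' b' where "x = a @\<^sub>v b" "a INV n" "b INV m"
  "y = a' @\<^sub>v b'" "a' INV n" "b' INV m"
  unfolding free_module_simps by (metis append_vec_cases)
 then show "on_append n m f (x \<oplus>\<^bsub>free_module (n + m)\<^esub> y) = on_append n m f x \<oplus>\<^bsub>N\<^esub> on_append n m f y"
  by (simp add: append_vec_ops[of _ n _ m] assms)
next
 fix c and x :: "'a vec"
 assume "x \<in> carrier (free_module (n + m))"
 then obtain a b where "x = a @\<^sub>v b" "a INV n" "b INV m"
  unfolding free_module_simps by (metis append_vec_cases)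
 then show "on_append n m f (c \<odot>\<^bsub>free_module (n + m)\<^esub> x) = c \<odot>\<^bsub>N\<^esub> on_append n m f x"
  by (simp add: append_vec_ops[of _ n _ m _ _] assms)
qed (auto dest!: append_vec_ex simp: assms)

lemma unit_vec_append:
 "i < n + m ==> unit_vec (n + m) i = (if i < n then unit_vec n i @\<^sub>v 0\<^sub>v m else 0\<^sub>v n @\<^sub>v unit_vec m (i - n))"
 by (intro eq_vecI) (auto simp: unit_vec_def)

definition block_sum :: "nat => nat => ('a vec => 'a vec) => ('a vec => 'a vec) => 'a vec => 'a vec" where
 "block_sum n m h k = on_append n m (\<lambda>a b. h a @\<^sub>v k b)"

lemma block_sum_append [simp]:
 "a INV n ==> b INV m ==> block_sum n m h k (a @\<^sub>v b) = h a @\<^sub>v k b"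
 by (simp add: block_sum_def)

lemma block_sum_lin:
 assumes "h \<in> lin n n'" "k \<in> lin m m'"
 shows "block_sum n m h k \<in> lin (n + m) (n' + m')"
 unfolding block_sum_def by (rule on_append_linear)
  (use linD[OF assms(1)] linD[OF assms(2)] in \<open>auto simp: append_vec_ops[of _ n' _ m']\<close>)

lemma block_sum_aut:
 assumes "h \<in> aut n" "k \<in> aut m"
 shows "block_sum n m h k \<in> aut (n + m)"
proof -
 let ?g = "block_sum n m (inv_map (free_module n :: ('a, 'a vec) module) h) (inv_map (free_module m :: ('a, 'a vec) module) k)"
 show ?thesis
 proof (rule module_isosI[where g = ?g])
 show "block_sum n m h k \<in> lin (n + m) (n + m)"
  by (intro block_sum_lin module_isosD assms)
 show "?g y \<in> carrier (free_module (n + m))" if "y \<in> carrier (free_module (n + m))" for y :: "'a vec"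
  using that inv_map[OF assms(1)] inv_map[OF assms(2)] by (auto dest!: append_vec_ex)
 show "?g (block_sum n m h k y) = y" "block_sum n m h k (?g y) = y" if "y \<in> carrier (free_module (n + m))" for y :: "'a vec"
  using that inv_map[OF assms(1)] inv_map[OF assms(2)] module_isosD(3)[OF assms(1)] module_isosD(3)[OF assms(2)]
  by (auto dest!: append_vec_ex)
 qed
qed

text \<open>The matrix is padded by an identity block, which \<open>stabilise\<close> does not
  see.\<close>

lemma torsion_pad:
 assumes "h \<in> aut n"
 shows "torsion (n + d) (block_sum n d h id) = torsion n h"
proof -
 have "mat_of_lin (n + d) (n + d) (block_sum n d h id) = pad_mat d (mat_of_lin n n h)"
  (is "?A = ?B")
 proof (intro eq_matI)
  fix i j assume ij: "i < dim_row ?B" "j < dim_col ?B"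
  have z: "h (0\<^sub>v n) = 0\<^sub>v n"
   using linear_maps_zero[OF module_isosD(1)[OF assms]] by simp
  show "?A $$ (i, j) = ?B $$ (i, j)"
  proof (cases "i < n")
   case True
   then have "h (unit_vec n i) INV n" using module_isosD(3)[OF assms] by simp
   then show ?thesis using ij True by (auto simp: mat_of_lin_def pad_mat_def unit_vec_append)
  next
   case False
   then show ?thesis using ij z by (auto simp: mat_of_lin_def pad_mat_def unit_vec_append)
  qed
 qed (auto simp: mat_of_lin_def pad_mat_def)
 then show ?thesis by (simp add: torsion_def stabilise_pad[of _ n])
qed

definition swap_blocks :: "nat => nat => 'a vec => 'a vec" where
 "swap_blocks n m = on_append n m (\<lambda>a b. b @\<^sub>v a)"

lemma swap_blocks_append [simp]:
 "a INV n ==> b INV m ==> swap_blocks n m (a @\<^sub>v b) = b @\<^sub>v a"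
 by (simp add: swap_blocks_def)

lemma swap_blocks_lin: "swap_blocks n m \<in> lin (n + m) (m + n)"
 unfolding swap_blocks_def by (rule on_append_linear) (auto simp: append_vec_ops[of _ m _ n])

lemma swap_blocks_swap: "v INV (n + m) ==> swap_blocks m n (swap_blocks n m v) = v"
 by (auto dest!: append_vec_ex)

lemma swap_blocks_aut: "swap_blocks n m \<in> aut (n + m)"
proof (rule module_isosI[where g = "swap_blocks m n"])
 show "swap_blocks n m \<in> lin (n + m) (n + m)" using swap_blocks_lin[of n m] by (simp add: add.commute)
 fix y :: "'a vec" assume y: "y \<in> carrier (free_module (n + m))"
 then show "swap_blocks m n (swap_blocks n m y) = y" by (simp add: swap_blocks_swap)
 from y have "y INV (m + n)" by (simp add: add.commute)
 then show "swap_blocks n m (swap_blocks m n y) = y" "swap_blocks m n y \<in> carrier (free_module (n + m))"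
  using linD(1)[OF swap_blocks_lin[of m n]] by (simp_all add: swap_blocks_swap)
qed

lemma torsion_swap_blocks: "torsion (n + m) (swap_blocks n m) = \<one>\<^bsub>reduced_K1\<^esub>"
 by (rule torsion_of_int[OF swap_blocks_aut]) (auto simp: unit_vec_append)

lemma neg_aut: "uminus \<in> aut n"
 by (rule module_isosI[where g = uminus]; (rule linI)?) auto

lemma torsion_neg: "torsion n uminus = \<one>\<^bsub>reduced_K1\<^esub>"
 by (rule torsion_of_int[OF neg_aut]) (auto simp: unit_vec_def)

text \<open>The reduced group is commutative, so the torsion of the conjugating map cancels.\<close>

lemma torsion_conj:
 assumes "f \<in> aut n" "h \<in> aut n" "h' \<in> aut n" "\<And>x. x INV n ==> f (h x) = h' (f x)"
 shows "torsion n h = torsion n h'"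
proof -
 have "torsion n (f \<circ> h) = torsion n (h' \<circ> f)" by (rule torsion_cong) (simp add: assms(4))
 then have "torsion n h \<otimes>\<^bsub>reduced_K1\<^esub> torsion n f = torsion n f \<otimes>\<^bsub>reduced_K1\<^esub> torsion n h'"
  unfolding torsion_comp[OF assms(2,1)] torsion_comp[OF assms(1,3)] .
 then show ?thesis using torsion_closed[OF assms(1)] torsion_closed[OF assms(2)] torsion_closed[OF assms(3)]
  by (metis RK.m_comm RK.right_cancel)
qed

text \<open>The sum is the composite of \<open>h\<close> plus identity and identity plus
  \<open>k\<close>. Exchanging the blocks conjugates the latter to \<open>k\<close> plus identity,
  so both factors are paddings.\<close>

lemma torsion_block_sum:
 assumes "h \<in> aut n" "k \<in> aut m"
 shows "torsion (n + m) (block_sum n m h k) = torsion n h \<otimes>\<^bsub>reduced_K1\<^esub> torsion m k"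
proof -
 have hk: "block_sum n m h id \<in> aut (n + m)" "block_sum n m id k \<in> aut (n + m)" "block_sum m n k id \<in> aut (n + m)"
  using block_sum_aut[OF assms(1) module_isos_id, of m] block_sum_aut[OF module_isos_id assms(2), of n]
   block_sum_aut[OF assms(2) module_isos_id, of n] by (simp_all add: add.commute)
 have "torsion (n + m) (block_sum n m id k) = torsion (n + m) (block_sum m n k id)"
  by (rule torsion_conj[OF swap_blocks_aut hk(2,3)])
   (use module_isosD(3)[OF assms(2)] in \<open>auto dest!: append_vec_ex\<close>)
 also have "\<dots> = torsion m k" using torsion_pad[OF assms(2), of n] by (simp add: add.commute)
 finally have "torsion (n + m) (block_sum n m id k \<circ> block_sum n m h id) = torsion n h \<otimes>\<^bsub>reduced_K1\<^esub> torsion m k"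
  unfolding torsion_comp[OF hk(1,2)] torsion_pad[OF assms(1)] by simp
 moreover have "torsion (n + m) (block_sum n m h k) = torsion (n + m) (block_sum n m id k \<circ> block_sum n m h id)"
  by (rule torsion_cong) (use module_isosD(3)[OF assms(1)] in \<open>auto dest!: append_vec_ex\<close>)
 ultimately show ?thesis by simp
qed

section \<open>Shears and the factorisation of h \<oplus> h^-1\<close>

definition upper_shear :: "nat => nat => ('a::plus vec => 'a vec) => 'a vec => 'a vec" where
 "upper_shear n m X = on_append n m (\<lambda>a b. (a + X b) @\<^sub>v b)"

definition lower_shear :: "nat => nat => ('a::plus vec => 'a vec) => 'a vec => 'a vec" where
 "lower_shear n m Y = on_append n m (\<lambda>a b. a @\<^sub>v (b + Y a))"

lemma shear_append [simp]:
 assumes "a INV n" "b INV m"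
 shows "upper_shear n m X (a @\<^sub>v b) = (a + X b) @\<^sub>v b" "lower_shear n m Y (a @\<^sub>v b) = a @\<^sub>v (b + Y a)"
 using assms by (simp_all add: upper_shear_def lower_shear_def)

lemma upper_shear_aut:
 assumes "X \<in> lin m n"
 shows "upper_shear n m X \<in> aut (n + m)"
proof (rule module_isosI[where g = "upper_shear n m (\<lambda>b. - X b)"])
 note X = linD[OF assms, simplified]
 have ac: "a + X b + (a' + X b') = a + a' + (X b + X b')" if "a INV n" "a' INV n" "b INV m" "b' INV m"
  for a a' b b'
  using that X(1)[of b] X(1)[of b'] by (intro eq_vecI) (auto simp: algebra_simps carrier_vecD)
 show "upper_shear n m X \<in> lin (n + m) (n + m)"
  unfolding upper_shear_def by (rule on_append_linear)
   (use X in \<open>auto simp: append_vec_ops[of _ n _ m] ac smult_add_distrib_vec[of _ n]\<close>)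
 show "upper_shear n m (\<lambda>b. - X b) (upper_shear n m X v) = v" "upper_shear n m X (upper_shear n m (\<lambda>b. - X b) v) = v"
  if "v \<in> carrier (free_module (n + m))" for v
 proof -
  obtain a b where ab: "v = a @\<^sub>v b" "a INV n" "b INV m" using \<open>v \<in> _\<close> unfolding free_module_simps by (metis append_vec_cases)
  have "a + X b + - X b = a" "a + - X b + X b = a" using ab X(1)[of b] by (auto intro!: eq_vecI)
  then show "upper_shear n m (\<lambda>b. - X b) (upper_shear n m X v) = v" "upper_shear n m X (upper_shear n m (\<lambda>b. - X b) v) = v"
   using ab X(1)[of b] by simp_all
 qed
qed (use linD[OF assms] in \<open>auto dest!: append_vec_ex\<close>)

lemma torsion_upper_shear:
 assumes "X \<in> lin m n"
 shows "torsion (n + m) (upper_shear n m X) = \<one>\<^bsub>reduced_K1\<^esub>"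
proof -
 text \<open>The shear is the commutator of two shears on $\Lambda^{n+m+m}$.\<close>
 note X = linD[OF assms, simplified]
 \<comment> \<open>\<open>?a\<close> adds X of the third block to the first, and \<open>?b\<close>
   adds the second block to the third. Performing \<open>?b\<close> before \<open>?a\<close> rather
   than after it adds X of the second block to the first in addition, and this is
   \<open>?h\<close>.\<close>
 let ?a = "upper_shear n (m + m) (\<lambda>v. X (vec_last v m))"
 let ?b = "block_sum n (m + m) id (swap_blocks m m \<circ> (upper_shear m m id \<circ> swap_blocks m m))"
 let ?h = "block_sum (n + m) m (upper_shear n m X) id"
 have last: "(\<lambda>v. X (vec_last v m)) = X \<circ> on_append m m (\<lambda>a b. b)" by (auto simp: on_append_def)
 have a: "?a \<in> aut (n + m + m)" unfolding add.assoc last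
  by (intro upper_shear_aut lin_comp[OF _ assms] on_append_linear) auto
 have b: "?b \<in> aut (n + m + m)" unfolding add.assoc
  by (rule block_sum_aut[OF module_isos_id module_isos_comp[OF module_isos_comp[OF swap_blocks_aut
     upper_shear_aut[OF module_isosD(1)[OF module_isos_id]]] swap_blocks_aut]])
 have h: "?h \<in> aut (n + m + m)"
  by (intro block_sum_aut module_isos_id upper_shear_aut assms)
 have "(?a \<circ> ?b) v = (?h \<circ> (?b \<circ> ?a)) v" if v: "v INV (n + m + m)" for v
 proof -
  obtain x y z where xyz: "v = (x @\<^sub>v y) @\<^sub>v z" "x INV n" "y INV m" "z INV m"
   using v by (metis append_vec_cases)
  have as: "(x @\<^sub>v y) @\<^sub>v z = x @\<^sub>v (y @\<^sub>v z)" for x y z :: "'a vec" by (intro eq_vecI) auto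
  have cl: "y @\<^sub>v z INV (m + m)" "y @\<^sub>v (z + y) INV (m + m)" "(z + y) @\<^sub>v y INV (m + m)"
   "z @\<^sub>v y INV (m + m)" "X z INV n" "X y INV n" "z + y INV m"
   "(x + X z) @\<^sub>v y INV (n + m)" using xyz X by auto
  have l: "?a v = (x + X z) @\<^sub>v (y @\<^sub>v z)" "?b v = x @\<^sub>v (y @\<^sub>v (z + y))"
   unfolding xyz as using xyz cl by simp_all
  have "?b (?a v) = ((x + X z) @\<^sub>v y) @\<^sub>v (z + y)" unfolding l as using xyz cl by simp
  then have "?h (?b (?a v)) = ((x + X z + X y) @\<^sub>v y) @\<^sub>v (z + y)" using xyz cl by simp
  moreover have "?a (?b v) = (x + X (z + y)) @\<^sub>v (y @\<^sub>v (z + y))" unfolding l using xyz cl by simp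
  moreover have "x + X (z + y) = x + X z + X y" using X(2)[of z y] xyz cl by simp
  ultimately show ?thesis by (simp add: as)
 qed
 then have "torsion (n + m + m) (?a \<circ> ?b) = torsion (n + m + m) (?h \<circ> (?b \<circ> ?a))" by (rule torsion_cong)
 then have "torsion (n + m + m) ?b \<otimes>\<^bsub>reduced_K1\<^esub> torsion (n + m + m) ?a =
   (torsion (n + m + m) ?a \<otimes>\<^bsub>reduced_K1\<^esub> torsion (n + m + m) ?b) \<otimes>\<^bsub>reduced_K1\<^esub> torsion (n + m + m) ?h"
  unfolding torsion_comp[OF b a] torsion_comp[OF module_isos_comp[OF a b] h] torsion_comp[OF a b] .
 then have "torsion (n + m + m) ?h = \<one>\<^bsub>reduced_K1\<^esub>"
  using torsion_closed[OF a] torsion_closed[OF b] torsion_closed[OF h]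
  by (metis RK.m_comm RK.l_cancel_one RK.m_closed)
 then show ?thesis using torsion_pad[OF upper_shear_aut[OF assms]] by simp
qed

text \<open>Conjugate to an upper shear by the exchange of the two blocks.\<close>

lemma lower_shear_aut_torsion:
 assumes "Y \<in> lin n m"
 shows "lower_shear n m Y \<in> aut (n + m)" "torsion (n + m) (lower_shear n m Y) = \<one>\<^bsub>reduced_K1\<^esub>"
proof -
 note Y = linD[OF assms, simplified]
 let ?u = "upper_shear m n Y"
 have u: "?u \<in> aut (n + m)" using upper_shear_aut[OF assms] by (simp add: add.commute)
 have s: "swap_blocks m n \<in> aut (n + m)" using swap_blocks_aut[of m n] by (simp add: add.commute)
 have eq: "lower_shear n m Y v = (swap_blocks m n \<circ> (?u \<circ> swap_blocks n m)) v" if "v INV (n + m)" for v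
  using that Y by (auto dest!: append_vec_ex)
 have "swap_blocks m n \<circ> (?u \<circ> swap_blocks n m) \<in> aut (n + m)"
  by (rule module_isos_comp[OF module_isos_comp[OF swap_blocks_aut u] s])
 then show l: "lower_shear n m Y \<in> aut (n + m)"
  by (rule module_isos_cong) (use eq in auto)
 have "torsion (n + m) (lower_shear n m Y) = torsion (n + m) ?u"
  by (rule torsion_conj[OF swap_blocks_aut l u]) (use Y in \<open>auto dest!: append_vec_ex\<close>)
 then show "torsion (n + m) (lower_shear n m Y) = \<one>\<^bsub>reduced_K1\<^esub>"
  using torsion_upper_shear[OF assms] by (simp add: add.commute)
qed

definition torsion_free :: "nat => ('a::ring_1 vec => 'a vec) => bool" where
 "torsion_free n h \<longleftrightarrow> h \<in> aut n \<and> torsion n h = \<one>\<^bsub>reduced_K1\<^esub>"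

lemma torsion_free_comp: "torsion_free n h ==> torsion_free n k ==> torsion_free n (k \<circ> h)"
 by (auto simp: torsion_free_def torsion_comp intro: module_isos_comp)

lemma torsion_free_shear:
 "X \<in> lin m n ==> torsion_free (n + m) (upper_shear n m X)"
 "Y \<in> lin n m ==> torsion_free (n + m) (lower_shear n m Y)"
 by (simp_all add: torsion_free_def upper_shear_aut torsion_upper_shear lower_shear_aut_torsion)

lemma torsion_inv:
 assumes "h \<in> aut n"
 shows "torsion n (inv_map (free_module n) h) = inv\<^bsub>reduced_K1\<^esub> (torsion n h)"
proof -
 have h': "inv_map (free_module n) h \<in> aut n" by (rule module_isos_inv[OF assms]) simp
 have "torsion n (h \<circ> inv_map (free_module n) h) = \<one>\<^bsub>reduced_K1\<^esub>"
  by (rule torsion_id) (use inv_map[OF assms] in auto)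
 then show ?thesis unfolding torsion_comp[OF h' assms] using h' assms by (metis RK.inv_equality torsion_closed)
qed

lemma vec_lin_simps:
 assumes "h \<in> lin n m"
 shows "x INV n ==> h x INV m"
  "x INV n ==> y INV n ==> h (x + y) = h x + h y"
  "x INV n ==> y INV n ==> h (x - y) = h x - h y"
  "x INV n ==> h (- x) = - h x"
  "x INV n ==> h (c \<cdot>\<^sub>v x) = c \<cdot>\<^sub>v h x"
  "h (0\<^sub>v n) = 0\<^sub>v m"
proof -
 note h = linD[OF assms, simplified]
 show *: "x INV n ==> h x INV m"
  "x INV n ==> y INV n ==> h (x + y) = h x + h y"
  "x INV n ==> h (c \<cdot>\<^sub>v x) = c \<cdot>\<^sub>v h x" for x y c
  using h by auto
 show neg: "x INV n ==> h (- x) = - h x" for x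
 proof -
  assume x: "x INV n"
  have "(- 1) \<cdot>\<^sub>v v = - v" for v :: "'a vec" by (intro eq_vecI) auto
  then show ?thesis using h(3)[OF x, of "-1"] by simp
 qed
 show "x INV n ==> y INV n ==> h (x - y) = h x - h y"
  using *(2)[of x "- y"] neg[of y] *(1)[of x] *(1)[of y]
  by (metis minus_add_uminus_vec uminus_carrier_vec)
 show "h (0\<^sub>v n) = 0\<^sub>v m" using linear_maps_zero[OF assms] by simp
qed

text \<open>By the factorisation of $h \oplus h^{-1}$ into elementary matrices, an automorphism of a free module that
 is $h$ on a free direct summand and the identity on a complement has the torsion of $h$; the complement need not be free.\<close>

lemma torsion_summand:
 assumes i: "i \<in> lin p n" and r: "r \<in> lin n p" and ri: "\<And>w. w INV p ==> r (i w) = w"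
  and h: "h \<in> aut p" and k: "k \<in> aut n"
  and keq: "\<And>a. a INV n ==> k a = a + i (h (r a) - r a)"
 shows "torsion n k = torsion p h"
proof -
 define h' where "h' = inv_map (free_module p) h"
 have h': "h' \<in> aut p" unfolding h'_def by (rule module_isos_inv[OF h]) simp
 note hl = module_isosD(1)[OF h] and hl' = module_isosD(1)[OF h']
 have hh': "h (h' w) = w" "h' (h w) = w" if "w INV p" for w
  using inv_map[OF h] that by (simp_all add: h'_def)
 note ls = vec_lin_simps[OF i] vec_lin_simps[OF r] vec_lin_simps[OF hl] vec_lin_simps[OF hl']
 have negid: "uminus \<in> lin p p" using module_isosD(1)[OF neg_aut] .
 have id: "id \<in> lin p p" using module_isosD(1)[OF module_isos_id] .
 have negh': "uminus \<circ> h' \<in> lin p p" by (rule lin_comp[OF hl' negid])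
 let ?U = "\<lambda>X. upper_shear n p (i \<circ> X)" and ?L = "\<lambda>Y. lower_shear n p (Y \<circ> r)"
 \<comment> \<open>On the summand the three shears applied first give (a, w) -> (- w, a), and the
   other three give (x, y) -> (h y, - h' x). Together they give (a, w) -> (h a, h' w), while the
   kernel of r is left alone.\<close>
 let ?c = "?U h \<circ> (?L (uminus \<circ> h') \<circ> (?U h \<circ> (?U uminus \<circ> (?L id \<circ> ?U uminus))))"
 have tf: "torsion_free (n + p) ?c"
  by (intro torsion_free_comp torsion_free_shear lin_comp[OF _ i] lin_comp[OF r] hl negid id negh')
 have eq: "?c v = block_sum n p k h' v" if v: "v INV (n + p)" for v
 proof -
  obtain a w where aw: "v = a @\<^sub>v w" "a INV n" "w INV p" using v by (metis append_vec_cases)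
  note car = aw(2,3) ls(1)[OF aw(3)] ls(7)[OF aw(2)] 
  have c': "h (r a) INV p" "i (r a) INV n" "i (h (r a)) INV n" "i w INV n" "r a INV p"
   "h' w INV p"
   using car ls by auto
  note d = car[THEN carrier_vecD] c'[THEN carrier_vecD]
  have s1: "?U uminus v = (a - i w) @\<^sub>v w"
   using aw car c' by (simp add: ls minus_add_uminus_vec[of _ n])
  have e2: "w + r (a - i w) = r a" using car c' ri[of w] by (auto simp: ls d intro!: eq_vecI)
  have s2: "?L id (?U uminus v) = (a - i w) @\<^sub>v r a"
   unfolding s1 using car c' e2 by simp
  have s3: "?U uminus (?L id (?U uminus v)) = (a - i w - i (r a)) @\<^sub>v r a"
   unfolding s2 using car c' by (simp add: ls minus_add_uminus_vec[of _ n])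
  let ?d = "a - i w - i (r a) + i (h (r a))"
  have s4: "?U h (?U uminus (?L id (?U uminus v))) = ?d @\<^sub>v r a"
   unfolding s3 using car c' by simp
  have rd: "r ?d = h (r a) - w" using car c' ri[of w] ri[of "r a"] ri[of "h (r a)"] by (auto simp: ls d intro!: eq_vecI)
  have e5: "r a + - h' (r ?d) = h' w" unfolding rd using car c' hh'(2)[of "r a"] by (auto simp: ls d intro!: eq_vecI)
  have s5: "?L (uminus \<circ> h') (?U h (?U uminus (?L id (?U uminus v)))) = ?d @\<^sub>v h' w"
   unfolding s4 using car c' e5 by simp
  have "?d + i (h (h' w)) = k a" using car c' by (auto simp: hh' ls d keq intro!: eq_vecI)
  then show ?thesis unfolding o_def using s5 car c' aw by (simp add: o_def)
 qed
 have "torsion (n + p) (block_sum n p k h') = \<one>\<^bsub>reduced_K1\<^esub>"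
  using tf torsion_cong[of "n + p" ?c "block_sum n p k h'", OF eq] unfolding torsion_free_def by simp
 then have "torsion n k \<otimes>\<^bsub>reduced_K1\<^esub> inv\<^bsub>reduced_K1\<^esub> torsion p h = \<one>\<^bsub>reduced_K1\<^esub>"
  using torsion_block_sum[OF k h'] torsion_inv[OF h] by (simp add: h'_def)
 then show ?thesis using torsion_closed[OF k] torsion_closed[OF h]
  by (metis RK.inv_closed RK.inv_equality RK.inv_inv)
qed

section \<open>The standard pairing and adjoints\<close>

lemma invol_simps [simp]:
 "invol (0 :: 'a::involutive_ring) = 0" "invol (- a :: 'a) = - invol a" "invol (1 :: 'a) = 1"
 "invol (a - b :: 'a) = invol a - invol b" "invol (invol (a :: 'a)) = a"
proof -
 show z: "invol (0 :: 'a) = 0" using invol_add[of 0 "0::'a"] by simp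
 show n: "invol (- a :: 'a) = - invol a" for a
  using invol_add[of a "- a"] z by (simp add: eq_neg_iff_add_eq_0 add.commute)
 show "invol (a - b :: 'a) = invol a - invol b" using invol_add[of a "- b"] n[of b] by simp
 show "invol (invol (a :: 'a)) = a" by (rule invol_invol)
 \<comment> \<open>The left side is \<open>invol (invol 1) = 1\<close> and the right side is
   \<open>1 * invol 1\<close>.\<close>
 have "invol (1 * invol 1) = invol (invol 1) * invol (1 :: 'a)" by (rule invol_mult)
 then show "invol (1 :: 'a) = 1" by (simp add: invol_invol)
qed

lemma invol_sum: "invol (sum f A :: 'a::involutive_ring) = (\<Sum>x\<in>A. invol (f x))"
 by (induction A rule: infinite_finite_induct) (auto simp: invol_add)

text \<open>Linear in the first and conjugate-linear in the second argument. It identifies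
  \<Lambda>^n with its own dual in such a way that the unit vectors become the dual basis.\<close>

definition vpair :: "nat => 'a::involutive_ring vec => 'a vec => 'a" where
 "vpair n a b = (\<Sum>k<n. a $ k * invol (b $ k))"

lemma vpair_add:
 assumes "a INV n" "b INV n" "c INV n"
 shows "vpair n (a + b) c = vpair n a c + vpair n b c"
  "vpair n c (a + b) = vpair n c a + vpair n c b"
  "vpair n (s \<cdot>\<^sub>v a) c = s * vpair n a c"
  "vpair n c (s \<cdot>\<^sub>v a) = vpair n c a * invol s"
  "vpair n c (- a) = - vpair n c a"
 using assms by (auto simp: vpair_def invol_add invol_mult algebra_simps sum.distrib sum_distrib_left sum_distrib_right sum_negf)

lemma vpair_unit:
 assumes "a INV n" "i < n"
 shows "vpair n a (unit_vec n i) = a $ i" "vpair n (unit_vec n i) a = invol (a $ i)"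
proof -
 have "vpair n a (unit_vec n i) = (\<Sum>k<n. if k = i then a $ i else 0)"
  unfolding vpair_def by (rule sum.cong) (use assms in \<open>auto simp: unit_vec_def\<close>)
 then show "vpair n a (unit_vec n i) = a $ i" using assms by simp
 have "vpair n (unit_vec n i) a = (\<Sum>k<n. if k = i then invol (a $ i) else 0)"
  unfolding vpair_def by (rule sum.cong) (use assms in \<open>auto simp: unit_vec_def\<close>)
 then show "vpair n (unit_vec n i) a = invol (a $ i)" using assms by simp
qed

lemma vpair_append:
 assumes "a INV n" "b INV m" "a' INV n" "b' INV m"
 shows "vpair (n + m) (a @\<^sub>v b) (a' @\<^sub>v b') = vpair n a a' + vpair m b b'"
proof -
 have "vpair (n + m) (a @\<^sub>v b) (a' @\<^sub>v b') = (\<Sum>k<n. (a @\<^sub>v b) $ k * invol ((a' @\<^sub>v b') $ k))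
   + (\<Sum>k<m. (a @\<^sub>v b) $ (n + k) * invol ((a' @\<^sub>v b') $ (n + k)))"
  unfolding vpair_def by (simp add: sum.nat_group lessThan_atLeast0 sum.atLeastLessThan_concat[symmetric, of 0 n "n + m"]
    sum.atLeastLessThan_shift_0[of _ n "n + m"])
 then show ?thesis unfolding vpair_def using assms by simp
qed

lemma vpair_ext:
 assumes "b INV n" "b' INV n" "\<And>a. a INV n ==> vpair n a b = vpair n a b'"
 shows "b = b'"
proof (rule eq_vecI)
 fix i assume "i < dim_vec b'"
 then have "invol (b $ i) = invol (b' $ i)" using assms(3)[of "unit_vec n i"] assms by (simp add: vpair_unit)
 then show "b $ i = b' $ i" by (metis invol_invol)
qed (use assms in auto)

text \<open>With respect to the unit vectors, the adjoint has the conjugate transpose as its matrix.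
  This is where the invariance of Z under the involution enters.\<close>

lemma torsion_adjoint:
 assumes Z: "invol_invariant Z" and h: "h \<in> aut n" and h': "h' \<in> lin n n"
  and adj: "\<And>a b. a INV n ==> b INV n ==> vpair n (h a) b = vpair n a (h' b)"
  and t: "torsion n h \<in> Z"
 shows "torsion n h' \<in> Z"
proof -
 have "mat_of_lin n n h' $$ (j, i) = invol (mat_of_lin n n h $$ (i, j))" if "i < n" "j < n" for i j
  using that adj[of "unit_vec n i" "unit_vec n j"] linD(1)[OF h'] module_isosD(3)[OF h]
  by (simp add: mat_of_lin_def vpair_unit)
 then have "stabilise (mat_of_lin n n h') = (\<lambda>i j. invol (stabilise (mat_of_lin n n h) j i))"
  by (intro ext) (auto simp: stabilise_def mat_of_lin_def)
 then show ?thesis using Z t gl_in_GL[OF mat_of_lin_gl[OF h]] unfolding invol_invariant_def torsion_def by metis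
qed

section \<open>Bases and simple isomorphisms\<close>

lemma finsum_vec_lin:
 assumes N: "left_module (N :: ('a::ring_1, 'n, 'z) module_scheme)" and g: "g \<in> linear_maps (free_module n) N" and v: "v INV n"
 shows "g v = (\<Oplus>\<^bsub>N\<^esub>i\<in>{..<n}. (v $ i) \<odot>\<^bsub>N\<^esub> g (unit_vec n i))"
proof -
 interpret abelian_group N using N by (rule lmodD)
 note N' = lmodD[OF N] and g' = linD[OF g, simplified]
 have "g (vec n (\<lambda>i. if i < k then v $ i else 0)) = (\<Oplus>\<^bsub>N\<^esub>i\<in>{..<k}. (v $ i) \<odot>\<^bsub>N\<^esub> g (unit_vec n i))" if "k \<le> n" for k
  using that
 proof (induction k)
  case 0
  have "vec n (\<lambda>i. if i < 0 then v $ i else 0) = 0\<^sub>v n" by (intro eq_vecI) auto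
  then show ?case using linear_maps_zero[OF g _ N] by simp
 next
  case (Suc k)
  have "vec n (\<lambda>i. if i < Suc k then v $ i else 0) =
    vec n (\<lambda>i. if i < k then v $ i else 0) + v $ k \<cdot>\<^sub>v unit_vec n k"
   using Suc.prems by (intro eq_vecI) (auto simp: less_Suc_eq unit_vec_def)
  then have "g (vec n (\<lambda>i. if i < Suc k then v $ i else 0)) =
    g (vec n (\<lambda>i. if i < k then v $ i else 0)) \<oplus>\<^bsub>N\<^esub> v $ k \<odot>\<^bsub>N\<^esub> g (unit_vec n k)"
   by (simp add: g')
  then show ?case using Suc N' g' by (simp add: lessThan_Suc a_comm finsum_insert Pi_def)
 qed
 moreover have "vec n (\<lambda>i. if i < n then v $ i else 0) = v" using v by (intro eq_vecI) auto
 ultimately show ?thesis by force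
qed

text \<open>Existence and uniqueness of coordinates say that the linear combination map from
  \<Lambda>^n is bijective. Bases are handled as isomorphisms from here on, so that composites and
  inverses replace computations with lists.\<close>

lemma is_basis_iff:
 assumes N: "left_module (N :: ('a::ring_1, 'n, 'z) module_scheme)"
 shows "is_basis N bs \<longleftrightarrow> (\<exists>g\<in>module_isos (free_module (length bs)) N. bs = map (\<lambda>i. g (unit_vec (length bs) i)) [0..<length bs])"
  (is "_ \<longleftrightarrow> ?R")
proof
 let ?n = "length bs"
 assume b: "is_basis N bs"
 interpret abelian_group N using N by (rule lmodD)
 note N' = lmodD[OF N]
 define g where "g v = (\<Oplus>\<^bsub>N\<^esub>i\<in>{..<?n}. (v $ i) \<odot>\<^bsub>N\<^esub> (bs ! i))" for v
 have bs: "bs ! i IN N" if "i < ?n" for i using b that by (auto simp: is_basis_def)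
 have sm: "(\<Oplus>\<^bsub>N\<^esub>i\<in>{..<k}. (c * v $ i) \<odot>\<^bsub>N\<^esub> (bs ! i)) = c \<odot>\<^bsub>N\<^esub> (\<Oplus>\<^bsub>N\<^esub>i\<in>{..<k}. (v $ i) \<odot>\<^bsub>N\<^esub> (bs ! i))" if "k \<le> ?n" for k c v
  using that
 proof (induction k)
  case 0
  then show ?case using lmod_minus(4)[OF N N'(3)] by simp
 next
  case (Suc k)
  have "(\<Oplus>\<^bsub>N\<^esub>i\<in>{..<k}. (v $ i) \<odot>\<^bsub>N\<^esub> (bs ! i)) IN N"
   by (rule finsum_closed) (use Suc.prems bs N' in auto)
  then show ?case using Suc N' bs by (simp add: lessThan_Suc finsum_insert Pi_def)
 qed
 have lin: "g \<in> linear_maps (free_module ?n) N"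
 proof (rule linI)
  fix x y :: "'a vec" assume "x IN (free_module ?n)" "y IN (free_module ?n)"
  then have "g (x + y) = (\<Oplus>\<^bsub>N\<^esub>i\<in>{..<?n}. (x $ i) \<odot>\<^bsub>N\<^esub> (bs ! i) \<oplus>\<^bsub>N\<^esub> (y $ i) \<odot>\<^bsub>N\<^esub> (bs ! i))"
   unfolding g_def by (intro finsum_cong') (use bs N' in auto)
  also have "\<dots> = g x \<oplus>\<^bsub>N\<^esub> g y" unfolding g_def by (intro finsum_addf) (use bs N' in auto)
  finally show "g (x \<oplus>\<^bsub>free_module ?n\<^esub> y) = g x \<oplus>\<^bsub>N\<^esub> g y" by simp
 next
  fix c and x :: "'a vec" assume x: "x IN (free_module ?n)"
  then have "g (c \<cdot>\<^sub>v x) = (\<Oplus>\<^bsub>N\<^esub>i\<in>{..<?n}. (c * x $ i) \<odot>\<^bsub>N\<^esub> (bs ! i))"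
   unfolding g_def by (intro finsum_cong') (use bs N' in auto)
  then show "g (c \<odot>\<^bsub>free_module ?n\<^esub> x) = c \<odot>\<^bsub>N\<^esub> g x" using sm[of ?n c x] by (simp add: g_def)
 qed (use bs N' in \<open>auto simp: g_def intro!: finsum_closed\<close>)
 have ex: "\<exists>!v. v INV ?n \<and> x = g v" if "x IN N" for x
  using b that unfolding is_basis_def g_def by blast
 have "bij_betw g (carrier_vec ?n) (carrier N)"
  unfolding bij_betw_def inj_on_def using ex linD(1)[OF lin] by (auto simp: image_iff) (metis+)
 then have iso: "g \<in> module_isos (free_module ?n) N" using lin by (simp add: module_isos_def)
 have "g (unit_vec ?n i) = bs ! i" if "i < ?n" for i
 proof -
  have "g (unit_vec ?n i) = (\<Oplus>\<^bsub>N\<^esub>j\<in>{..<?n}. if j = i then bs ! j else (zero N))"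
   unfolding g_def by (intro finsum_cong') (use that bs N' lmod_minus(3)[OF N] in auto)
  also have "\<dots> = (\<Oplus>\<^bsub>N\<^esub>j\<in>{..<?n}. if i = j then bs ! j else (zero N))"
   by (intro finsum_cong') (use bs in auto)
  also have "\<dots> = bs ! i" by (rule finsum_singleton) (use that bs in auto)
  finally show ?thesis .
 qed
 then have "bs = map (\<lambda>i. g (unit_vec ?n i)) [0..<?n]" by (intro nth_equalityI) auto
 then show ?R using iso by blast
next
 let ?n = "length bs"
 assume ?R
 then obtain g where g: "g \<in> module_isos (free_module ?n) N" and bs: "bs = map (\<lambda>i. g (unit_vec ?n i)) [0..<?n]" by blast
 have nth: "bs ! i = g (unit_vec ?n i)" if "i < ?n" for i using bs that by (metis (no_types, lifting) add.left_neutral diff_zero length_upt nth_map nth_upt)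
 interpret abelian_group N using N by (rule lmodD)
 have "(\<Oplus>\<^bsub>N\<^esub>i\<in>{..<?n}. (v $ i) \<odot>\<^bsub>N\<^esub> (bs ! i)) = g v" if "v INV ?n" for v
  unfolding finsum_vec_lin[OF N module_isosD(1)[OF g] that]
  by (intro finsum_cong') (use nth module_isosD(3)[OF g] lmodD[OF N] in auto)
 moreover have "\<exists>!v. v INV ?n \<and> x = g v" if "x IN N" for x
  using inv_map[OF g] that by (metis free_module_simps(3))
 ultimately have "\<exists>!v. v INV ?n \<and> x = (\<Oplus>\<^bsub>N\<^esub>i\<in>{..<?n}. (v $ i) \<odot>\<^bsub>N\<^esub> (bs ! i))" if "x IN N" for x
  using that by (simp cong: conj_cong)
 moreover have "set bs \<subseteq> carrier N"
  using nth module_isosD(3)[OF g] by (auto simp: in_set_conv_nth)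
 ultimately show "is_basis N bs" unfolding is_basis_def by blast
qed

text \<open>An \<open>s\<close>-basis of \<open>M\<close> is the same as an isomorphism $g \colon \Lambda^n \to M \oplus \Lambda^p$, called a frame.\<close>

abbreviation stabilised :: "('a::ring_1, 'm, 'z) module_scheme => nat => ('a, 'm \<times> 'a vec) module" where
 "stabilised M p \<equiv> module_sum M (free_module p)"

definition is_frame :: "('a::ring_1, 'm, 'z) module_scheme => nat => nat => ('a vec => 'm \<times> 'a vec) => bool" where
 "is_frame M p n g \<longleftrightarrow> g \<in> module_isos (free_module n) (stabilised M p)"

definition basis_of_frame :: "nat => ('a::ring_1 vec => 'b) => 'b list" where
 "basis_of_frame n g = map (\<lambda>i. g (unit_vec n i)) [0..<n]"

definition frame_basis :: "nat => nat => ('a::ring_1 vec => 'm \<times> 'a vec) => ('a, 'm) s_basis" where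
 "frame_basis p n g = (p, basis_of_frame n g)"

lemma length_basis_of_frame [simp]: "length (basis_of_frame n g) = n"
 by (simp add: basis_of_frame_def)

lemma nth_basis_of_frame [simp]: "i < n ==> basis_of_frame n g ! i = g (unit_vec n i)"
 by (simp add: basis_of_frame_def)

lemma basis_of_frame_cong: "(\<And>x. x INV n ==> g x = g' x) ==> basis_of_frame n g = basis_of_frame n g'"
 by (auto simp: basis_of_frame_def)

lemma is_frame_cong: "is_frame M p n g ==> (\<And>x. x INV n ==> g x = g' x) ==> is_frame M p n g'"
 unfolding is_frame_def by (erule module_isos_cong) auto

lemma s_bases_iff:
 assumes "left_module (M :: ('a::ring_1, 'm, 'z) module_scheme)"
 shows "b \<in> s_bases M \<longleftrightarrow> (\<exists>p n g. is_frame M p n g \<and> b = frame_basis p n g)"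
proof -
 have "is_basis (stabilised M p) bs \<longleftrightarrow> (\<exists>n g. is_frame M p n g \<and> bs = basis_of_frame n g)" for p bs
  unfolding is_frame_def basis_of_frame_def is_basis_iff[OF left_module_sum[OF assms left_module_free]] by auto
 then show ?thesis by (cases b) (auto simp: s_bases_def frame_basis_def)
qed

lemma is_frameD:
 assumes "is_frame M p n g"
 shows "\<And>a. a INV n ==> fst (g a) IN M" "\<And>a. a INV n ==> snd (g a) INV p"
  "\<And>a b. a INV n ==> b INV n ==> fst (g (a + b)) = fst (g a) \<oplus>\<^bsub>M\<^esub> fst (g b)"
  "\<And>a b. a INV n ==> b INV n ==> snd (g (a + b)) = snd (g a) + snd (g b)"
  "\<And>a c. a INV n ==> fst (g (c \<cdot>\<^sub>v a)) = c \<odot>\<^bsub>M\<^esub> fst (g a)"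
  "\<And>a c. a INV n ==> snd (g (c \<cdot>\<^sub>v a)) = c \<cdot>\<^sub>v snd (g a)"
proof -
 note l = linD[OF module_isosD(1)[OF assms[unfolded is_frame_def]], simplified]
 show cl: "fst (g a) IN M" "snd (g a) INV p" if "a INV n" for a
  using l(1)[OF that] by (auto simp: mem_Times_iff)
 show "fst (g (a + b)) = fst (g a) \<oplus>\<^bsub>M\<^esub> fst (g b)" "snd (g (a + b)) = snd (g a) + snd (g b)"
  if "a INV n" "b INV n" for a b
  using l(2)[OF that] by (cases "g a"; cases "g b"; simp)+
 show "fst (g (c \<cdot>\<^sub>v a)) = c \<odot>\<^bsub>M\<^esub> fst (g a)" "snd (g (c \<cdot>\<^sub>v a)) = c \<cdot>\<^sub>v snd (g a)"
  if "a INV n" for a c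
  using l(3)[OF that] by (cases "g a"; simp)+
qed

abbreviation frame_inv :: "nat => ('a::ring_1 vec => 'm \<times> 'a vec) => 'm \<times> 'a vec => 'a vec" where
 "frame_inv n g \<equiv> inv_into (carrier_vec n) g"

lemma module_isos_inv_free:
 "g \<in> module_isos (free_module n) N ==> inv_into (carrier_vec n) g \<in> module_isos N (free_module n)"
 using module_isos_inv[of g "free_module n" N] by simp

lemma frame_inv:
 assumes "is_frame M p n g"
 shows "\<And>a. a INV n ==> frame_inv n g (g a) = a"
  "\<And>x v. x IN M ==> v INV p ==> g (frame_inv n g (x, v)) = (x, v)"
  "\<And>x v. x IN M ==> v INV p ==> frame_inv n g (x, v) INV n"
 using inv_map[OF assms[unfolded is_frame_def]] by auto

lemma frame_inv_lin:
 assumes "is_frame M p n g" "left_module M"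
 shows "frame_inv n g \<in> linear_maps (stabilised M p) (free_module n)"
 using module_isosD(1)[OF module_isos_inv_free[OF assms(1)[unfolded is_frame_def]]] by simp

lemma frame_inv_eq:
 assumes "is_frame M p n g" "a INV n" "g a = y"
 shows "frame_inv n g y = a"
 using assms frame_inv(1) by metis

section \<open>Transition matrices as changes of frames\<close>

definition frame_change :: "nat => ('a::ring_1 vec => 'm \<times> 'a vec) => ('a vec => 'm \<times> 'a vec) => 'a vec => 'a vec" where
 "frame_change n g g' = frame_inv n g' \<circ> g"

lemma frame_change_aut:
 assumes "is_frame M p n g" "is_frame M p n g'"
 shows "frame_change n g g' \<in> aut n"
 unfolding frame_change_def
 using assms by (auto simp: is_frame_def intro!: module_isos_comp[of g _ "stabilised M p"] module_isos_inv_free)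

lemma frame_change_eq:
 assumes "is_frame M p n g'" "b INV n" "g' b = g a"
 shows "frame_change n g g' a = b"
 unfolding frame_change_def o_def by (rule frame_inv_eq[OF assms])

lemma frame_change_apply:
 assumes "is_frame M p n g" "is_frame M p n g'" "a INV n"
 shows "g' (frame_change n g g' a) = g a"
 using frame_inv(2)[OF assms(2) is_frameD(1,2)[OF assms(1) assms(3)]] by (simp add: frame_change_def)

text \<open>Row i of a transition matrix holds the coordinates with respect to \<open>g'\<close> of
  the i-th vector of \<open>g\<close>. These are also the coordinates of the i-th unit vector under
  the change of frames.\<close>

lemma transition_matrix_iff:
 assumes M: "left_module (M :: ('a::ring_1, 'm, 'z) module_scheme)" and g: "is_frame M p n g" and g': "is_frame M p n' g'"
 shows "transition_matrix (stabilised M p) (basis_of_frame n g) (basis_of_frame n' g') A \<longleftrightarrow>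
  n = n' \<and> A = mat_of_lin n n (frame_change n g g')"
proof (cases "n = n'")
 case False
 then show ?thesis by (simp add: transition_matrix_def)
next
 case True
 let ?N = "stabilised M p"
 have N: "left_module ?N" using M by simp
 interpret abelian_group ?N using N by (rule lmodD)
 note g' = g'[folded True]
 have sum: "(\<Oplus>\<^bsub>?N\<^esub>j\<in>{..<n}. (v $ j) \<odot>\<^bsub>?N\<^esub> g' (unit_vec n j)) = g' v" if "v INV n" for v
  using finsum_vec_lin[OF N module_isosD(1)[OF g'[unfolded is_frame_def]] that] by simp
 have row: "(\<Oplus>\<^bsub>?N\<^esub>j\<in>{..<n}. (A $$ (i, j)) \<odot>\<^bsub>?N\<^esub> basis_of_frame n g' ! j) = g' (row A i)" if "A \<in> carrier_mat n n" "i < n" for i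
 proof -
  have "(\<Oplus>\<^bsub>?N\<^esub>j\<in>{..<n}. (A $$ (i, j)) \<odot>\<^bsub>?N\<^esub> basis_of_frame n g' ! j) = (\<Oplus>\<^bsub>?N\<^esub>j\<in>{..<n}. (row A i $ j) \<odot>\<^bsub>?N\<^esub> g' (unit_vec n j))"
  proof (rule finsum_cong')
   have "g' (unit_vec n j) IN ?N" for j
    using module_isosD(3)[OF g'[unfolded is_frame_def], of "unit_vec n j"] by simp
   then show "(\<lambda>j. row A i $ j \<odot>\<^bsub>?N\<^esub> g' (unit_vec n j)) \<in> {..<n} \<rightarrow> carrier ?N"
    by (intro Pi_I lmodD(4)[OF N])
   show "A $$ (i, j) \<odot>\<^bsub>?N\<^esub> basis_of_frame n g' ! j = row A i $ j \<odot>\<^bsub>?N\<^esub> g' (unit_vec n j)" if "j \<in> {..<n}" for j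
    using that \<open>A \<in> carrier_mat n n\<close> \<open>i < n\<close> by simp
  qed simp
  then show ?thesis using sum[of "row A i"] that by simp
 qed
 have "transition_matrix ?N (basis_of_frame n g) (basis_of_frame n' g') A \<longleftrightarrow>
   A \<in> carrier_mat n n \<and> (\<forall>i<n. g (unit_vec n i) = g' (row A i))"
  using row unfolding True[symmetric] transition_matrix_def by (auto simp del: free_module_simps)
 also have "\<dots> \<longleftrightarrow> A \<in> carrier_mat n n \<and> (\<forall>i<n. frame_change n g g' (unit_vec n i) = row A i)"
 proof -
  have "g (unit_vec n i) = g' (row A i) \<longleftrightarrow> frame_change n g g' (unit_vec n i) = row A i"
   if "A \<in> carrier_mat n n" "i < n" for i
   using frame_change_eq[OF g', of "row A i" g "unit_vec n i"] frame_change_apply[OF g g', of "unit_vec n i"] that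
   by auto
  then show ?thesis by blast
 qed
 also have "\<dots> \<longleftrightarrow> A = mat_of_lin n n (frame_change n g g')"
 proof -
  have "frame_change n g g' (unit_vec n i) INV n" for i
   using module_isosD(3)[OF frame_change_aut[OF g g']] by simp
  then show ?thesis by (auto simp: mat_of_lin_def vec_eq_iff mat_eq_iff carrier_vecD)
 qed
 finally show ?thesis using True by simp
qed

definition extend_frame :: "nat => nat => ('a vec => 'm \<times> 'a vec) => 'a vec => 'm \<times> 'a vec" where
 "extend_frame n d g = on_append n d (\<lambda>a b. (fst (g a), snd (g a) @\<^sub>v b))"

lemma extend_frame_append [simp]:
 "a INV n ==> b INV d ==> extend_frame n d g (a @\<^sub>v b) = (fst (g a), snd (g a) @\<^sub>v b)"
 by (simp add: extend_frame_def)

lemma is_frame_extend: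
 assumes g: "is_frame M p n g"
 shows "is_frame M (p + d) (n + d) (extend_frame n d g)"
 unfolding is_frame_def
proof (rule module_isosI[where g = "\<lambda>(x, v). frame_inv n g (x, vec_first v p) @\<^sub>v vec_last v d"])
 note D = is_frameD[OF g] frame_inv[OF g]
 show "extend_frame n d g \<in> linear_maps (free_module (n + d)) (stabilised M (p + d))"
  unfolding extend_frame_def by (rule on_append_linear) (auto simp: D append_vec_ops[of _ p _ d])
 show "(\<lambda>(x, v). frame_inv n g (x, vec_first v p) @\<^sub>v vec_last v d) y \<in> carrier (free_module (n + d))"
  "extend_frame n d g ((\<lambda>(x, v). frame_inv n g (x, vec_first v p) @\<^sub>v vec_last v d) y) = y"
  if "y \<in> carrier (stabilised M (p + d))" for y
  using that by (auto simp: D)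
 show "(\<lambda>(x, v). frame_inv n g (x, vec_first v p) @\<^sub>v vec_last v d) (extend_frame n d g y) = y"
  if "y \<in> carrier (free_module (n + d))" for y
  using that by (auto simp: D dest!: append_vec_ex)
qed

lemma extend_s_basis_of_frame:
 assumes g: "is_frame M p n g" and M: "left_module M"
 shows "extend_s_basis M (p + d) (frame_basis p n g) = basis_of_frame (n + d) (extend_frame n d g)"
proof (rule nth_equalityI)
 have len: "length (extend_s_basis M (p + d) (frame_basis p n g)) = n + d" by (simp add: frame_basis_def)
 then show "length (extend_s_basis M (p + d) (frame_basis p n g)) = length (basis_of_frame (n + d) (extend_frame n d g))" by simp
 fix i assume "i < length (extend_s_basis M (p + d) (frame_basis p n g))"
 then have i: "i < n + d" using len by simp
 have "g (0\<^sub>v n) = (zero M, 0\<^sub>v p)"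
  using linear_maps_zero[OF module_isosD(1)[OF g[unfolded is_frame_def]]] M by simp
 then show "extend_s_basis M (p + d) (frame_basis p n g) ! i = basis_of_frame (n + d) (extend_frame n d g) ! i"
  using i by (auto simp: frame_basis_def nth_append unit_vec_append split: prod.split)
qed

lemma extend_frame_extend:
 assumes "v INV (n + d + e)"
 shows "extend_frame (n + d) e (extend_frame n d g) v = extend_frame n (d + e) g v"
proof -
 obtain a b c where v: "v = (a @\<^sub>v b) @\<^sub>v c" "a INV n" "b INV d" "c INV e"
  using assms by (metis append_vec_cases)
 have as: "(x @\<^sub>v y) @\<^sub>v z = x @\<^sub>v (y @\<^sub>v z)" for x y z :: "'a vec" by (intro eq_vecI) auto
 have "extend_frame (n + d) e (extend_frame n d g) v = (fst (g a), (snd (g a) @\<^sub>v b) @\<^sub>v c)"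
  unfolding v using v(2-) by simp
 moreover have "extend_frame n (d + e) g v = (fst (g a), snd (g a) @\<^sub>v (b @\<^sub>v c))"
  unfolding v as using v(2-) by simp
 ultimately show ?thesis by (simp add: as)
qed

lemma extend_frame_0: "v INV n ==> extend_frame n 0 g v = g (v :: 'a::ring_1 vec)"
proof -
 assume "v INV n"
 moreover have "w @\<^sub>v 0\<^sub>v 0 = w" for w :: "'a vec" by (intro eq_vecI) auto
 ultimately show ?thesis using extend_frame_append[of v n "0\<^sub>v 0" 0 g] by simp
qed

text \<open>Both extended frames agree on the added coordinates, so the change between them is the
  old one padded by an identity.\<close>

lemma torsion_frame_change_extend:
 assumes "is_frame M p n g" "is_frame M p n g'"
 shows "torsion (n + e) (frame_change (n + e) (extend_frame n e g) (extend_frame n e g')) = torsion n (frame_change n g g')"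
proof -
 have "frame_change (n + e) (extend_frame n e g) (extend_frame n e g') v = block_sum n e (frame_change n g g') id v"
  if v: "v INV (n + e)" for v
 proof -
  obtain a b where ab: "v = a @\<^sub>v b" "a INV n" "b INV e" using v by (metis append_vec_cases)
  have "frame_change n g g' a INV n" using module_isosD(3)[OF frame_change_aut[OF assms]] ab by simp
  then show ?thesis using ab frame_change_apply[OF assms ab(2)]
   by (intro frame_change_eq[OF is_frame_extend[OF assms(2)]]) auto
 qed
 then have "torsion (n + e) (frame_change (n + e) (extend_frame n e g) (extend_frame n e g'))
   = torsion (n + e) (block_sum n e (frame_change n g g') id)" by (rule torsion_cong)
 then show ?thesis using torsion_pad[OF frame_change_aut[OF assms]] by simp
qed

lemma torsion_frame_change_cong:
 assumes "\<And>a. a INV n ==> g a = h a" "\<And>a. a INV n ==> g' a = h' a"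
 shows "torsion n (frame_change n g g') = torsion n (frame_change n h h')"
proof (rule torsion_cong)
 fix x :: "'a vec" assume "x INV n"
 then show "frame_change n g g' x = frame_change n h h' x"
  using assms by (auto simp: frame_change_def inv_into_def intro!: arg_cong[of _ _ Eps])
qed

lemma torsion_in_iff_ex:
 assumes M: "left_module (M :: ('a::ring_1, 'm, 'z) module_scheme)" and g: "is_frame M p n g" and g': "is_frame M p' n' g'"
 shows "torsion_in Z M (frame_basis p n g) (frame_basis p' n' g') \<longleftrightarrow>
  (\<exists>d d'. p + d = p' + d' \<and> n + d = n' + d' \<and> torsion (n + d) (frame_change (n + d) (extend_frame n d g) (extend_frame n' d' g')) \<in> Z)"
proof -
 have *: "(\<exists>A. transition_matrix (stabilised M q) (extend_s_basis M q (frame_basis p n g))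
     (extend_s_basis M q (frame_basis p' n' g')) A \<and> reduced_K1_class (stabilise A) \<in> Z) \<longleftrightarrow>
   n + d = n' + d' \<and> torsion (n + d) (frame_change (n + d) (extend_frame n d g) (extend_frame n' d' g')) \<in> Z"
  if "q = p + d" "q = p' + d'" for q d d'
  using extend_s_basis_of_frame[OF g M, of d, folded that] extend_s_basis_of_frame[OF g' M, of d', folded that]
   transition_matrix_iff[OF M is_frame_extend[OF g, of d, folded that(1)] is_frame_extend[OF g', of d', folded that(2)]]
  by (auto simp: torsion_def)
 show ?thesis
  unfolding torsion_in_def
 proof safe
  fix q A
  assume q: "max (fst (frame_basis p n g)) (fst (frame_basis p' n' g')) \<le> q"
   and A: "transition_matrix (stabilised M q) (extend_s_basis M q (frame_basis p n g))
     (extend_s_basis M q (frame_basis p' n' g')) A" "reduced_K1_class (stabilise A) \<in> Z"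
  have "q = p + (q - p)" "q = p' + (q - p')" using q by (auto simp: frame_basis_def)
  then show "\<exists>d d'. p + d = p' + d' \<and> n + d = n' + d' \<and>
    torsion (n + d) (frame_change (n + d) (extend_frame n d g) (extend_frame n' d' g')) \<in> Z"
   using *[of q "q - p" "q - p'"] A by metis
 next
  fix d d'
  assume d: "p + d = p' + d'" "n + d = n' + d'" "torsion (n + d) (frame_change (n + d) (extend_frame n d g) (extend_frame n' d' g')) \<in> Z"
  have "max (fst (frame_basis p n g)) (fst (frame_basis p' n' g')) \<le> p + d"
   using d(1) by (auto simp: frame_basis_def)
  then show "\<exists>pa\<ge>max (fst (frame_basis p n g)) (fst (frame_basis p' n' g')).
    \<exists>A. transition_matrix (stabilised M pa) (extend_s_basis M pa (frame_basis p n g))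
     (extend_s_basis M pa (frame_basis p' n' g')) A \<and> reduced_K1_class (stabilise A) \<in> Z"
   using *[OF refl d(1)] d(2,3) by blast
 qed
qed

text \<open>Enlarging both frames by the same amount changes neither the torsion nor the difference
  of their lengths. So the existential quantifier over stabilisations may be tested at any one
  common size.\<close>

lemma torsion_in_iff:
 assumes M: "left_module (M :: ('a::ring_1, 'm, 'z) module_scheme)" and g: "is_frame M p n g" and g': "is_frame M p' n' g'"
  and d: "p + d = p' + d'"
 shows "torsion_in Z M (frame_basis p n g) (frame_basis p' n' g') \<longleftrightarrow>
  n + d = n' + d' \<and> torsion (n + d) (frame_change (n + d) (extend_frame n d g) (extend_frame n' d' g')) \<in> Z"
proof -
 define T where "T d d' = torsion (n + d) (frame_change (n + d) (extend_frame n d g) (extend_frame n' d' g'))" for d d'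
 have step: "T (d + e) (d' + e) = T d d'" if "p + d = p' + d'" "n + d = n' + d'" for d d' e
 proof -
  have g2: "is_frame M (p + d) (n + d) (extend_frame n' d' g')" using is_frame_extend[OF g', of d'] that by simp
  have "T (d + e) (d' + e) = torsion (n + d + e) (frame_change (n + d + e) (extend_frame (n + d) e (extend_frame n d g)) (extend_frame (n + d) e (extend_frame n' d' g')))"
   unfolding T_def add.assoc[symmetric]
   by (rule torsion_frame_change_cong) (metis extend_frame_extend that(2) add.assoc)+
  also have "\<dots> = T d d'" unfolding T_def by (rule torsion_frame_change_extend[OF is_frame_extend[OF g] g2])
  finally show ?thesis .
 qed
 have le: "T d1 d1' = T d2 d2'" if "p + d1 = p' + d1'" "p + d2 = p' + d2'" "n + d1 = n' + d1'" "d1 \<le> d2" for d1 d1' d2 d2'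
 proof -
  have "d2 = d1 + (d2 - d1)" "d2' = d1' + (d2 - d1)" using that by auto
  then show ?thesis using step[OF that(1,3), of "d2 - d1"] by simp
 qed
 have eq: "T d1 d1' = T d2 d2'" if "p + d1 = p' + d1'" "p + d2 = p' + d2'" "n + d1 = n' + d1'" "n + d2 = n' + d2'" for d1 d1' d2 d2'
 proof (cases "d1 \<le> d2")
  case True
  then show ?thesis by (rule le[OF that(1,2,3)])
 next
  case False
  then show ?thesis using le[OF that(2,1,4)] by simp
 qed
 have "(\<exists>d d'. p + d = p' + d' \<and> n + d = n' + d' \<and> T d d' \<in> Z) \<longleftrightarrow> n + d = n' + d' \<and> T d d' \<in> Z"
 proof (intro iffI)
  assume "\<exists>d d'. p + d = p' + d' \<and> n + d = n' + d' \<and> T d d' \<in> Z"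
  then obtain e e' where e: "p + e = p' + e'" "n + e = n' + e'" "T e e' \<in> Z" by blast
  moreover have "n + d = n' + d'" using e(1,2) d by linarith
  ultimately show "n + d = n' + d' \<and> T d d' \<in> Z" using eq[OF e(1) d e(2)] by simp
 qed (use d in blast)
 then show ?thesis unfolding torsion_in_iff_ex[OF M g g'] T_def .
qed

text \<open>Records of based modules have further fields, and \<open>with_bases\<close> builds new
  records. Bases, duals and forms depend only on the four fields compared here, so they are
  transferred along this relation.\<close>

definition same_module :: "('a, 'm, 'y) module_scheme => ('a, 'm, 'z) module_scheme => bool" where
 "same_module M M' \<longleftrightarrow> carrier M = carrier M' \<and> zero M = zero M' \<and> add M = add M' \<and> smult M = smult M'"

lemma same_module_left_module_aux:
 fixes M :: "('a::ring_1, 'm, 'y) module_scheme" and N :: "('a, 'm, 'z) module_scheme"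
 assumes N: "left_module M" and s: "same_module M N"
 shows "left_module N"
proof -
 have eq: "carrier N = carrier M" "zero N = zero M" "add N = add M" "smult N = smult M"
  using s by (simp_all add: same_module_def)
 show ?thesis
 proof (rule left_moduleI, unfold eq)
  fix x y z assume x: "x IN M" and y: "y IN M"
  show "x \<oplus>\<^bsub>M\<^esub> y = y \<oplus>\<^bsub>M\<^esub> x" using left_module_comm[OF N x y] .
  assume z: "z IN M"
  show "x \<oplus>\<^bsub>M\<^esub> y \<oplus>\<^bsub>M\<^esub> z = x \<oplus>\<^bsub>M\<^esub> (y \<oplus>\<^bsub>M\<^esub> z)" using left_module_assoc[OF N x y z] .
 qed (simp_all add: lmodD[OF N] lmod_minus(3)[OF N])
qed

lemma same_module_left_module:
 fixes M :: "('a::ring_1, 'm, 'y) module_scheme" and M' :: "('a, 'm, 'z) module_scheme"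
 shows "same_module M M' ==> left_module M \<longleftrightarrow> left_module M'"
proof -
 assume "same_module M M'"
 moreover from this have "same_module M' M" by (simp add: same_module_def)
 ultimately show "left_module M \<longleftrightarrow> left_module M'" using same_module_left_module_aux[of M M'] same_module_left_module_aux[of M' M] by blast
qed

lemma same_module_sum: "same_module M M' ==> module_sum M N = module_sum M' N"
 unfolding module_sum_def same_module_def by simp

lemma same_module_s_basis_rel:
 fixes M :: "('a::ring_1, 'm, 'y) module_scheme"
 assumes "same_module M M'"
 shows "s_bases M = s_bases M'" "torsion_in Z M = torsion_in Z M'" "s_basis_rel Z M = s_basis_rel Z M'"
proof -
 show s: "s_bases M = s_bases M'" unfolding s_bases_def same_module_sum[OF assms] ..
 have "extend_s_basis M p b = extend_s_basis M' p b" for p and b :: "('a, 'm) s_basis"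
  using assms by (cases b) (simp add: same_module_def)
 then show t: "torsion_in Z M = torsion_in Z M'" by (intro ext) (simp add: torsion_in_def same_module_sum[OF assms])
 show "s_basis_rel Z M = s_basis_rel Z M'" by (simp add: s_basis_rel_def s t)
qed

lemma with_bases_simps [simp]:
 "carrier (with_bases Z M B) = carrier M" "zero (with_bases Z M B) = zero M"
 "add (with_bases Z M B) = add M" "smult (with_bases Z M B) = smult M"
 "bases (with_bases Z M B) = s_basis_rel Z M `` B"
 by (simp_all add: with_bases_def module.defs based_module.defs)

lemma same_module_with_bases: "same_module (with_bases Z M B) M"
 by (simp add: same_module_def)

definition frame :: "('a::ring_1, 'm) based_module => nat => nat => ('a vec => 'm \<times> 'a vec) => bool" where
 "frame M p n g \<longleftrightarrow> is_frame M p n g \<and> frame_basis p n g \<in> bases M"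

text \<open>An instance of \<open>torsion_summand\<close>: the free summand is the stabilising
  \<Lambda>^p, embedded in \<Lambda>^n by the inverse of \<open>g\<close>, and the complement is M,
  which is only stably free.\<close>

lemma torsion_frame_stab:
 fixes M :: "('a::ring_1, 'm, 'z) module_scheme"
 assumes M: "left_module M" and g: "is_frame M p n g" and s: "s \<in> aut p"
 shows "frame_inv n g \<circ> (map_prod id s \<circ> g) \<in> aut n" "torsion n (frame_inv n g \<circ> (map_prod id s \<circ> g)) = torsion p s"
proof -
 let ?k = "frame_inv n g \<circ> (map_prod id s \<circ> g)"
 note g' = g[unfolded is_frame_def]
 show k: "?k \<in> aut n"
  using module_isos_comp[OF module_isos_comp[OF g' module_isos_map_prod[OF module_isos_id s]] module_isos_inv_free[OF g']] by simp
 note inv = linD[OF frame_inv_lin[OF g M]] and sl = vec_lin_simps[OF module_isosD(1)[OF s]] and D = is_frameD[OF g]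
 note M' = lmodD[OF M]
 have i: "(\<lambda>w. frame_inv n g (zero M, w)) \<in> lin p n"
 proof (rule linI)
  show "frame_inv n g (zero M, x \<oplus>\<^bsub>free_module p\<^esub> y) = frame_inv n g (zero M, x) \<oplus>\<^bsub>free_module n\<^esub> frame_inv n g (zero M, y)"
   if "x IN (free_module p)" "y IN (free_module p)" for x y
   using inv(2)[of "(zero M, x)" "(zero M, y)"] that M' by simp
  show "frame_inv n g (zero M, c \<odot>\<^bsub>free_module p\<^esub> x) = c \<odot>\<^bsub>free_module n\<^esub> frame_inv n g (zero M, x)"
   if "x IN (free_module p)" for c x
   using inv(3)[of "(zero M, x)" c] that M' lmod_minus(4)[OF M M'(3)] by simp
 qed (use inv(1) M' in auto)
 have r: "snd \<circ> g \<in> lin n p" by (rule linI) (auto simp: D)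
 show "torsion n ?k = torsion p s"
 proof (rule torsion_summand[OF i r _ s k])
  show "(snd \<circ> g) (frame_inv n g (zero M, w)) = w" if "w INV p" for w
   using frame_inv(2)[OF g] that M' by simp
  fix a :: "'a vec" assume a: "a INV n"
  have "g a \<oplus>\<^bsub>stabilised M p\<^esub> (zero M, s (snd (g a)) - snd (g a)) = (fst (g a), s (snd (g a)))"
   using D(1,2)[OF a] sl(1)[of "snd (g a)"] M' by (cases "g a") (auto intro!: eq_vecI)
  then have "frame_inv n g (fst (g a), s (snd (g a))) = frame_inv n g (g a) + frame_inv n g (zero M, s (snd (g a)) - snd (g a))"
   using inv(2)[of "g a" "(zero M, s (snd (g a)) - snd (g a))"] D(1,2)[OF a] sl(1)[of "snd (g a)"] M' by (simp add: mem_Times_iff)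
  then show "?k a = a + frame_inv n g (zero M, s ((snd \<circ> g) a) - (snd \<circ> g) a)"
   using frame_inv(1)[OF g a] by (cases "g a") simp
 qed
qed

section \<open>Simple automorphisms, changes of frames and isomorphisms\<close>

locale torsion_subgroup =
 fixes Z :: "'a::involutive_ring torsion_set"
 assumes Z_subgroup: "subgroup Z reduced_K1" and Z_invol: "invol_invariant Z"
begin

abbreviation based where "based \<equiv> based_module Z"

abbreviation siso where "siso \<equiv> simple_iso Z"

abbreviation bsum where "bsum \<equiv> based_sum Z"

abbreviation bdual where "bdual \<equiv> based_dual Z"

abbreviation bfree where "bfree \<equiv> free_based Z"

lemma Z_closed:
 "\<one>\<^bsub>reduced_K1\<^esub> \<in> Z" "a \<in> Z ==> b \<in> Z ==> a \<otimes>\<^bsub>reduced_K1\<^esub> b \<in> Z" "a \<in> Z ==> inv\<^bsub>reduced_K1\<^esub> a \<in> Z"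
 using Z_subgroup by (auto simp: subgroup.one_closed subgroup.m_closed subgroup.m_inv_closed)

definition simple_aut :: "nat => ('a vec => 'a vec) => bool" where
 "simple_aut n h \<longleftrightarrow> h \<in> aut n \<and> torsion n h \<in> Z"

lemma simple_aut_comp: "simple_aut n h ==> simple_aut n k ==> simple_aut n (k \<circ> h)"
 by (auto simp: simple_aut_def torsion_comp Z_closed intro: module_isos_comp)

lemma simple_aut_inv: "simple_aut n h ==> simple_aut n (inv_into (carrier_vec n) h)"
 using torsion_inv[of h n] by (simp add: simple_aut_def Z_closed module_isos_inv_free)

lemma simple_aut_id: "simple_aut n id"
 by (simp add: simple_aut_def module_isos_id torsion_id Z_closed)

lemma simple_aut_cong: "simple_aut n h ==> (\<And>x. x INV n ==> h x = k x) ==> simple_aut n k"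
 unfolding simple_aut_def using module_isos_cong[of h "free_module n" "free_module n" k] torsion_cong[of n h k] by simp

lemma simple_aut_block_sum: "simple_aut n h ==> simple_aut m k ==> simple_aut (n + m) (block_sum n m h k)"
 by (simp add: simple_aut_def block_sum_aut torsion_block_sum Z_closed)

lemma simple_aut_torsion_free: "torsion_free n h ==> simple_aut n h"
 by (simp add: simple_aut_def torsion_free_def Z_closed)

lemma frame_change_inv:
 assumes "is_frame M p n g" "is_frame M p n g'" "a INV n"
 shows "inv_into (carrier_vec n) (frame_change n g g') a = frame_change n g' g a"
 by (rule inv_map_eq[OF frame_change_aut[OF assms(1,2)], simplified])
  (use module_isosD(3)[OF frame_change_aut[OF assms(2,1)]] assms frame_change_apply[OF assms(2,1,3)]
   frame_change_eq[OF assms(2,3), of g "frame_change n g' g a"] in auto)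

lemma simple_frame_change_refl: "is_frame M p n g ==> simple_aut n (frame_change n g g)"
 by (rule simple_aut_cong[OF simple_aut_id]) (simp add: frame_change_def frame_inv)

lemma simple_frame_change_eq:
 assumes "is_frame M p n g" "\<And>a. a INV n ==> g a = g' a"
 shows "simple_aut n (frame_change n g g')"
 by (rule simple_aut_cong[OF simple_aut_id])
  (simp add: frame_change_eq[OF is_frame_cong[OF assms]] assms(2))

lemma simple_frame_change_sym:
 assumes "is_frame M p n g" "is_frame M p n g'" "simple_aut n (frame_change n g g')"
 shows "simple_aut n (frame_change n g' g)"
 by (rule simple_aut_cong[OF simple_aut_inv[OF assms(3)]]) (rule frame_change_inv[OF assms(1,2)])

lemma simple_frame_change_trans:
 assumes "is_frame M p n g" "is_frame M p n g'" "is_frame M p n g''"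
  "simple_aut n (frame_change n g g')" "simple_aut n (frame_change n g' g'')"
 shows "simple_aut n (frame_change n g g'')"
proof (rule simple_aut_cong[OF simple_aut_comp[OF assms(4,5)]])
 fix x :: "'a vec" assume x: "x INV n"
 have "frame_change n g g' x INV n" using module_isosD(3)[OF frame_change_aut[OF assms(1,2)]] x by simp
 then show "(frame_change n g' g'' \<circ> frame_change n g g') x = frame_change n g g'' x"
  using frame_change_apply[OF assms(1,2) x] frame_change_apply[OF assms(2,3)] module_isosD(3)[OF frame_change_aut[OF assms(2,3)]]
  by (intro frame_change_eq[OF assms(3), symmetric]) auto
qed

lemma torsion_in_simple_iff:
 assumes "left_module M" "is_frame M p n g" "is_frame M p' n' g'" "p + d = p' + d'"
 shows "torsion_in Z M (frame_basis p n g) (frame_basis p' n' g') \<longleftrightarrow>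
  n + d = n' + d' \<and> simple_aut (n + d) (frame_change (n + d) (extend_frame n d g) (extend_frame n' d' g'))"
 unfolding torsion_in_iff[OF assms] simple_aut_def
 using frame_change_aut[OF is_frame_extend[OF assms(2), of d], of "extend_frame n' d' g'"] is_frame_extend[OF assms(3), of d'] assms(4)
 by auto

lemma torsion_in_same_size:
 assumes "left_module M" "is_frame M p n g" "is_frame M p n' g'"
 shows "torsion_in Z M (frame_basis p n g) (frame_basis p n' g') \<longleftrightarrow> n = n' \<and> simple_aut n (frame_change n g g')"
 using torsion_in_simple_iff[OF assms, of 0 0] torsion_frame_change_cong[of n "extend_frame n 0 g" g "extend_frame n 0 g'" g']
  extend_frame_0[of _ n g] extend_frame_0[of _ n g']
  frame_change_aut[OF assms(2)] frame_change_aut[OF is_frame_extend[OF assms(2), of 0]] assms(3) is_frame_extend[OF assms(3), of 0]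
 by (auto simp: simple_aut_def)

lemma equiv_s_basis_rel:
 assumes M: "left_module (M :: ('a, 'm, 'z) module_scheme)"
 shows "equiv (s_bases M) (s_basis_rel Z M)"
proof (rule equivI)
 show "s_basis_rel Z M \<subseteq> s_bases M \<times> s_bases M" by (auto simp: s_basis_rel_def)
 show "refl_on (s_bases M) (s_basis_rel Z M)"
 proof (rule refl_onI)
  fix b assume b: "b \<in> s_bases M"
  then obtain p n g where "is_frame M p n g" "b = frame_basis p n g" using s_bases_iff[OF M] by blast
  then show "(b, b) \<in> s_basis_rel Z M" using torsion_in_same_size[OF M] simple_frame_change_refl b by (auto simp: s_basis_rel_def)
 qed
 show "sym (s_basis_rel Z M)"
 proof (rule symI)
  fix b c assume bc: "(b, c) \<in> s_basis_rel Z M"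
  then obtain p n g p' n' g' where g: "is_frame M p n g" "b = frame_basis p n g" "is_frame M p' n' g'" "c = frame_basis p' n' g'"
   using s_bases_iff[OF M] by (auto simp: s_basis_rel_def)
  have e: "n + p' = n' + p" "simple_aut (n + p') (frame_change (n + p') (extend_frame n p' g) (extend_frame n' p g'))"
   using torsion_in_simple_iff[OF M g(1,3), of p' p] bc g by (auto simp: s_basis_rel_def)
  then have "simple_aut (n + p') (frame_change (n + p') (extend_frame n' p g') (extend_frame n p' g))"
   using simple_frame_change_sym is_frame_extend[OF g(1), of p'] is_frame_extend[OF g(3), of p] by (metis add.commute)
  then show "(c, b) \<in> s_basis_rel Z M"
   using torsion_in_simple_iff[OF M g(3,1), of p p'] bc g e by (auto simp: s_basis_rel_def)
 qed
 show "trans (s_basis_rel Z M)"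
 proof (rule transI)
  fix b c e assume bc: "(b, c) \<in> s_basis_rel Z M" and ce: "(c, e) \<in> s_basis_rel Z M"
  obtain p n g where g: "is_frame M p n g" "b = frame_basis p n g" using bc s_bases_iff[OF M] by (auto simp: s_basis_rel_def)
  obtain p' n' g' where g': "is_frame M p' n' g'" "c = frame_basis p' n' g'" using bc s_bases_iff[OF M] by (auto simp: s_basis_rel_def)
  obtain q m h where h: "is_frame M q m h" "e = frame_basis q m h" using ce s_bases_iff[OF M] by (auto simp: s_basis_rel_def)
  \<comment> \<open>Each of the three bases is stabilised by the sizes of the other two, which
    brings all of them to the size p + p' + q.\<close>
  let ?d = "p' + q" and ?d' = "p + q" and ?e = "p + p'"
  have 1: "n + ?d = n' + ?d'" "simple_aut (n + ?d) (frame_change (n + ?d) (extend_frame n ?d g) (extend_frame n' ?d' g'))"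
   using torsion_in_simple_iff[OF M g(1) g'(1), of ?d ?d'] bc g g' by (auto simp: s_basis_rel_def)
  have 2: "n' + ?d' = m + ?e" "simple_aut (n' + ?d') (frame_change (n' + ?d') (extend_frame n' ?d' g') (extend_frame m ?e h))"
   using torsion_in_simple_iff[OF M g'(1) h(1), of ?d' ?e] ce h g' by (auto simp: s_basis_rel_def)
  have s: "p' + ?d' = p + ?d" "q + ?e = p + ?d" "n' + ?d' = n + ?d" "m + ?e = n + ?d" using 1 2 by auto
  have "simple_aut (n + ?d) (frame_change (n + ?d) (extend_frame n ?d g) (extend_frame m ?e h))"
   by (rule simple_frame_change_trans[OF is_frame_extend[OF g(1)] is_frame_extend[OF g'(1), of ?d', unfolded s] is_frame_extend[OF h(1), of ?e, unfolded s] 1(2) 2(2)[unfolded s]])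
  then show "(b, e) \<in> s_basis_rel Z M"
   using torsion_in_simple_iff[OF M g(1) h(1), of ?d ?e] bc ce g h s by (auto simp: s_basis_rel_def)
 qed
qed

lemma basedD:
 assumes "based M"
 shows "left_module M" "b \<in> bases M ==> bases M = s_basis_rel Z M `` {b}" "bases M \<subseteq> s_bases M" "bases M \<noteq> {}"
proof -
 show M: "left_module M" using assms by (simp add: based_module_def)
 then have e: "equiv (s_bases M) (s_basis_rel Z M)" by (rule equiv_s_basis_rel)
 have B: "bases M \<in> s_bases M // s_basis_rel Z M" using assms by (simp add: based_module_def)
 show "b \<in> bases M ==> bases M = s_basis_rel Z M `` {b}"
  using B e by (metis (no_types, lifting) equiv_class_eq quotientE Image_singleton_iff)
 show "bases M \<subseteq> s_bases M" "bases M \<noteq> {}"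
  using B e by (auto simp: in_quotient_imp_subset in_quotient_imp_non_empty)
qed

lemma bases_rel_iff:
 assumes "based M" "b \<in> bases M" "c \<in> s_bases M"
 shows "c \<in> bases M \<longleftrightarrow> torsion_in Z M b c"
 using basedD(2)[OF assms(1,2)] basedD(3)[OF assms(1)] assms by (auto simp: s_basis_rel_def)

lemma based_moduleI:
 assumes "left_module M" "is_frame M p n g" "bases M = s_basis_rel Z M `` {frame_basis p n g}"
 shows "based M" "frame M p n g"
proof -
 have s: "frame_basis p n g \<in> s_bases M" using s_bases_iff[OF assms(1)] assms(2) by blast
 then show "based M" using assms by (auto simp: based_module_def quotientI)
 show "frame M p n g" unfolding frame_def assms(3) using equiv_class_self[OF equiv_s_basis_rel[OF assms(1)] s] assms(2) by blast
qed

text \<open>Frames exist for all large p, so several modules can be given frames with the same p.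
  The lower bound on n later allows to force n > 0 by the choice of p.\<close>

lemma frame_exists:
 assumes M: "based M"
 shows "\<exists>p0. \<forall>p\<ge>p0. \<exists>n g. frame M p n g \<and> n \<ge> p - p0"
proof -
 note D = basedD[OF M]
 obtain b where b: "b \<in> bases M" using D(4) by blast
 then obtain p n g where g: "is_frame M p n g" "b = frame_basis p n g" using s_bases_iff[OF D(1)] D(3) by blast
 have "frame M (p + d) (n + d) (extend_frame n d g)" for d
 proof -
  note e = is_frame_extend[OF g(1), of d]
  have "simple_aut (n + d) (frame_change (n + d) (extend_frame n d g) (extend_frame (n + d) 0 (extend_frame n d g)))"
   by (rule simple_frame_change_eq[OF e]) (simp add: extend_frame_0)
  then have "torsion_in Z M b (frame_basis (p + d) (n + d) (extend_frame n d g))"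
   unfolding g(2) using torsion_in_simple_iff[OF D(1) g(1) e, of d 0] by simp
  moreover have "frame_basis (p + d) (n + d) (extend_frame n d g) \<in> s_bases M" using s_bases_iff[OF D(1)] e by blast
  ultimately show ?thesis using bases_rel_iff[OF M b] e by (simp add: frame_def)
 qed
 then have "\<forall>q\<ge>p. \<exists>m h. frame M q m h \<and> m \<ge> q - p"
  by (metis le_add_diff_inverse le_add2)
 then show ?thesis by blast
qed

text \<open>\<open>with_bases\<close> collects everything equivalent to some member of B. If all
  members are equivalent to one frame, this is a single class, as a based module requires.\<close>

lemma with_bases_frame:
 assumes M: "left_module M" and g: "is_frame M p n g" and B: "frame_basis p n g \<in> B"
  and eq: "\<And>b. b \<in> B ==> b \<in> s_bases M \<and> torsion_in Z M (frame_basis p n g) b"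
 shows "based (with_bases Z M B)" "frame (with_bases Z M B) p n g"
proof -
 let ?b = "frame_basis p n g" and ?W = "with_bases Z M B"
 note same = same_module_with_bases[of Z M B]
 have s: "?b \<in> s_bases M" using s_bases_iff[OF M] g by blast
 have "s_basis_rel Z M `` {b} = s_basis_rel Z M `` {?b}" if "b \<in> B" for b
  using eq[OF that] s equiv_class_eq[OF equiv_s_basis_rel[OF M], of ?b b] by (auto simp: s_basis_rel_def)
 then have "s_basis_rel Z M `` B = s_basis_rel Z M `` {?b}" using B by blast
 then have "bases ?W = s_basis_rel Z ?W `` {?b}" by (simp add: same_module_s_basis_rel(3)[OF same])
 moreover have "left_module ?W" using M same_module_left_module[OF same] by simp
 moreover have "is_frame ?W p n g" using g by (simp add: is_frame_def same_module_sum[OF same])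
 ultimately show "based ?W" "frame ?W p n g" by (auto intro: based_moduleI)
qed

lemma map_s_basis_of_frame: "map_s_basis f (frame_basis p n g) = frame_basis p n (map_prod f id \<circ> g)"
 by (auto simp: map_s_basis_def frame_basis_def basis_of_frame_def)

lemma is_frame_map:
 assumes "f \<in> module_isos M N" "is_frame M p n g"
 shows "is_frame N p n (map_prod f id \<circ> g)"
 using assms unfolding is_frame_def by (intro module_isos_comp[OF _ module_isos_map_prod[OF _ module_isos_id]])

text \<open>The isomorphism carries both frames along and leaves the change between them as it
  is.\<close>

lemma torsion_in_map:
 assumes M: "left_module M" and N: "left_module N" and f: "f \<in> module_isos M N" and b: "b \<in> s_bases M" and c: "c \<in> s_bases M"
 shows "torsion_in Z N (map_s_basis f b) (map_s_basis f c) \<longleftrightarrow> torsion_in Z M b c"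
proof -
 obtain p n g where g: "is_frame M p n g" "b = frame_basis p n g" using b s_bases_iff[OF M] by blast
 obtain p' n' g' where g': "is_frame M p' n' g'" "c = frame_basis p' n' g'" using c s_bases_iff[OF M] by blast
 let ?f = "map_prod f id"
 have "torsion (n + p') (frame_change (n + p') (extend_frame n p' (?f \<circ> g)) (extend_frame n' p (?f \<circ> g')))
   = torsion (n + p') (frame_change (n + p') (extend_frame n p' g) (extend_frame n' p g'))" if s: "n + p' = n' + p"
 proof (rule torsion_cong)
  fix a :: "'a vec" assume a: "a INV (n + p')"
  have e: "extend_frame k d (?f \<circ> h) v = ?f (extend_frame k d h v)" if "v INV (k + d)" for k d h v
   using that by (auto dest!: append_vec_ex)
  have fr: "is_frame M (p + p') (n + p') (extend_frame n p' g)" "is_frame M (p + p') (n + p') (extend_frame n' p g')"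
   using is_frame_extend[OF g(1), of p'] is_frame_extend[OF g'(1), of p] s by (simp_all add: add.commute)
  have "is_frame N (p + p') (n + p') (extend_frame n' p (?f \<circ> g'))"
   using is_frame_extend[OF is_frame_map[OF f g'(1)], of p] s by (simp add: add.commute)
  then show "frame_change (n + p') (extend_frame n p' (?f \<circ> g)) (extend_frame n' p (?f \<circ> g')) a
   = frame_change (n + p') (extend_frame n p' g) (extend_frame n' p g') a"
  proof (rule frame_change_eq)
   let ?b = "frame_change (n + p') (extend_frame n p' g) (extend_frame n' p g') a"
   show b: "?b INV (n + p')" using module_isosD(3)[OF frame_change_aut[OF fr]] a by simp
   have "extend_frame n' p (?f \<circ> g') ?b = ?f (extend_frame n' p g' ?b)" by (rule e) (use b s in simp)
   also have "\<dots> = extend_frame n p' (?f \<circ> g) a" unfolding frame_change_apply[OF fr a] by (rule e[OF a, symmetric])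
   finally show "extend_frame n' p (?f \<circ> g') ?b = extend_frame n p' (?f \<circ> g) a" .
  qed
 qed
 then show ?thesis
  unfolding g g' map_s_basis_of_frame torsion_in_iff[OF M g(1) g'(1) add.commute[of p p']]
   torsion_in_iff[OF N is_frame_map[OF f g(1)] is_frame_map[OF f g'(1)] add.commute[of p p']] by auto
qed

text \<open>Simplicity asks for some pair of bases. As the bases of a based module form one
  equivalence class, it can be tested on any given pair of frames with the same p.\<close>

lemma simple_iso_iff:
 assumes M: "based M" and N: "based N" and g: "frame M p n g" and h: "frame N p m h"
 shows "siso M N f \<longleftrightarrow> f \<in> module_isos M N \<and> n = m \<and> simple_aut n (frame_change n (map_prod f id \<circ> g) h)"
proof (cases "f \<in> module_isos M N")
 case False
 then show ?thesis by (simp add: simple_iso_def)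
next
 case f: True
 note DM = basedD[OF M] and DN = basedD[OF N]
 note eq = equiv_s_basis_rel[OF DN(1)]
 have im: "map_s_basis f b \<in> s_bases N" if b: "b \<in> s_bases M" for b
 proof -
  obtain p n g where "is_frame M p n g" "b = frame_basis p n g" using b s_bases_iff[OF DM(1)] by blast
  then show ?thesis using is_frame_map[OF f] map_s_basis_of_frame s_bases_iff[OF DN(1)] by metis
 qed
 let ?b = "frame_basis p n g" and ?c = "frame_basis p m h"
 have bc: "?b \<in> bases M" "?c \<in> bases N" using g h by (auto simp: frame_def)
 have "torsion_in Z N (map_s_basis f ?b) ?c" if b: "b \<in> bases M" and c: "c \<in> bases N" and t: "torsion_in Z N (map_s_basis f b) c" for b c
 proof -
  have "torsion_in Z N (map_s_basis f ?b) (map_s_basis f b)"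
   using torsion_in_map[OF DM(1) DN(1) f, of ?b b] bases_rel_iff[OF M bc(1), of b] b bc DM(3) by auto
  moreover have s: "map_s_basis f ?b \<in> s_bases N" "map_s_basis f b \<in> s_bases N" using im bc(1) b DM(3) by blast+
  ultimately have 1: "(map_s_basis f ?b, map_s_basis f b) \<in> s_basis_rel Z N" by (simp add: s_basis_rel_def)
  have 2: "(map_s_basis f b, c) \<in> s_basis_rel Z N" using s(2) c DN(3) t unfolding s_basis_rel_def by blast
  have 3: "(c, ?c) \<in> s_basis_rel Z N" using bases_rel_iff[OF N c, of ?c] c bc DN(3) by (auto simp: s_basis_rel_def)
  show ?thesis using 1 2 3 eq by (metis (no_types, lifting) equivE transE s_basis_rel_def mem_Collect_eq case_prodD)
 qed
 then have "siso M N f \<longleftrightarrow> torsion_in Z N (map_s_basis f ?b) ?c"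
  using f bc unfolding simple_iso_def by blast
 then show ?thesis
  unfolding map_s_basis_of_frame using torsion_in_same_size[OF DN(1) is_frame_map[OF f], of p n g m h] g h f by (auto simp: frame_def)
qed

text \<open>Natural frames of sums often agree only after reordering the coordinates of \<Lambda>^n
  and those of the stabilising \<Lambda>^p. The first reordering composes with the frame;
  \<open>torsion_frame_stab\<close> moves the second one into \<Lambda>^n.\<close>

lemma simple_frame_change_stab:
 assumes M: "left_module M" and g: "is_frame M p n g" and h: "is_frame M p n h" and s: "simple_aut p s" and t: "simple_aut n t"
  and eq: "\<And>a. a INV n ==> g a = map_prod id s (h (t a))"
 shows "simple_aut n (frame_change n g h)"
proof (rule simple_aut_cong)
 show "simple_aut n ((frame_inv n h \<circ> (map_prod id s \<circ> h)) \<circ> t)"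
  using torsion_frame_stab[OF M h] s t by (intro simple_aut_comp) (auto simp: simple_aut_def)
qed (simp add: frame_change_def eq)

end

section \<open>Frames of direct sums\<close>

definition sum_frame :: "nat => nat => ('a vec => 'm \<times> 'a vec) => ('a vec => 'n \<times> 'a vec) => 'a vec => ('m \<times> 'n) \<times> 'a vec" where
 "sum_frame n m g h = on_append n m (\<lambda>a b. ((fst (g a), fst (h b)), snd (g a) @\<^sub>v snd (h b)))"

lemma sum_frame_append [simp]:
 "a INV n ==> b INV m ==>
   sum_frame n m g h (a @\<^sub>v b) = ((fst (g a), fst (h b)), snd (g a) @\<^sub>v snd (h b))"
 by (simp add: sum_frame_def)

lemma is_frame_sum:
 fixes M :: "('a::ring_1, 'm, 'y) module_scheme" and N :: "('a, 'n, 'z) module_scheme"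
 assumes g: "is_frame M p n g" and h: "is_frame N q m h"
 shows "is_frame (module_sum M N) (p + q) (n + m) (sum_frame n m g h)"
 unfolding is_frame_def
proof (rule module_isosI[where g = "\<lambda>((x, y), v). frame_inv n g (x, vec_first v p) @\<^sub>v frame_inv m h (y, vec_last v q)"])
 note D = is_frameD[OF g] frame_inv[OF g] is_frameD[OF h] frame_inv[OF h]
 let ?i = "\<lambda>((x, y), v). frame_inv n g (x, vec_first v p) @\<^sub>v frame_inv m h (y, vec_last v q)"
 show "sum_frame n m g h \<in> linear_maps (free_module (n + m)) (stabilised (module_sum M N) (p + q))"
  unfolding sum_frame_def by (rule on_append_linear) (auto simp: D append_vec_ops[of _ p _ q])
 show "?i y \<in> carrier (free_module (n + m))" "sum_frame n m g h (?i y) = y"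
  if "y \<in> carrier (stabilised (module_sum M N) (p + q))" for y
  using that by (auto simp: D)
 show "?i (sum_frame n m g h y) = y" if "y \<in> carrier (free_module (n + m))" for y
  using that by (auto simp: D dest!: append_vec_ex)
qed

lemma concat_s_bases_of_frames:
 fixes M :: "('a::ring_1, 'm, 'y) module_scheme" and N :: "('a, 'n, 'z) module_scheme"
 assumes g: "is_frame M p n g" and h: "is_frame N q m h" and M: "left_module M" and N: "left_module N"
 shows "concat_s_bases M N (frame_basis p n g) (frame_basis q m h) = frame_basis (p + q) (n + m) (sum_frame n m g h)"
proof -
 have "g (0\<^sub>v n) = (zero M, 0\<^sub>v p)" "h (0\<^sub>v m) = (zero N, 0\<^sub>v q)"
  using linear_maps_zero[OF module_isosD(1)[OF g[unfolded is_frame_def]]] linear_maps_zero[OF module_isosD(1)[OF h[unfolded is_frame_def]]] M N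
  by simp_all
 then show ?thesis
  by (auto simp: frame_basis_def nth_append unit_vec_append split: prod.split intro!: nth_equalityI)
qed

definition interchange_blocks :: "nat => nat => nat => nat => 'a vec => 'a vec" where
 "interchange_blocks n m d e = block_sum n (m + d + e) id (block_sum (m + d) e (swap_blocks m d) id)"

lemma append_vec_assoc: "(x @\<^sub>v y) @\<^sub>v z = x @\<^sub>v (y @\<^sub>v z)"
 by (intro eq_vecI) auto

lemma interchange_blocks_append [simp]:
 assumes "a INV n" "b INV m" "c INV d" "w INV e"
 shows "interchange_blocks n m d e ((a @\<^sub>v b) @\<^sub>v (c @\<^sub>v w)) = (a @\<^sub>v c) @\<^sub>v (b @\<^sub>v w)"
proof -
 have "(a @\<^sub>v b) @\<^sub>v (c @\<^sub>v w) = a @\<^sub>v ((b @\<^sub>v c) @\<^sub>v w)" by (simp add: append_vec_assoc)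
 then have "interchange_blocks n m d e ((a @\<^sub>v b) @\<^sub>v (c @\<^sub>v w)) = a @\<^sub>v ((c @\<^sub>v b) @\<^sub>v w)"
  using assms by (simp add: interchange_blocks_def)
 then show ?thesis by (simp add: append_vec_assoc)
qed

lemma append_vec_ex4:
 assumes "v \<in> carrier_vec (n + m + (d + e))"
 obtains a b c w where "v = (a @\<^sub>v b) @\<^sub>v (c @\<^sub>v w)" "a INV n" "b INV m" "c INV d" "w INV e"
proof -
 obtain x y where "v = x @\<^sub>v y" "x INV (n + m)" "y INV (d + e)" using assms by (metis append_vec_cases)
 moreover obtain a b where "x = a @\<^sub>v b" "a INV n" "b INV m" using calculation(2) by (metis append_vec_cases)
 moreover obtain c w where "y = c @\<^sub>v w" "c INV d" "w INV e" using calculation(3) by (metis append_vec_cases)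
 ultimately show ?thesis using that by blast
qed

section \<open>Frames of dual modules\<close>

lemma dual_simps:
 "carrier (dual M) = {f \<in> extensional (carrier M). (\<forall>x\<in>carrier M. \<forall>y\<in>carrier M. f (x \<oplus>\<^bsub>M\<^esub> y) = f x + f y) \<and> (\<forall>a. \<forall>x\<in>carrier M. f (a \<odot>\<^bsub>M\<^esub> x) = a * f x)}"
 "(zero (dual M)) = (\<lambda>x\<in>carrier M. 0)" "f \<oplus>\<^bsub>dual M\<^esub> g = (\<lambda>x\<in>carrier M. f x + g x)"
 "a \<odot>\<^bsub>dual M\<^esub> f = (\<lambda>x\<in>carrier M. f x * invol a)"
 by (simp_all add: dual_def)

lemma dual_apply [simp]:
 "x IN M ==> (zero (dual M)) x = 0" "x IN M ==> (f \<oplus>\<^bsub>dual M\<^esub> g) x = f x + g x"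
 "x IN M ==> (a \<odot>\<^bsub>dual M\<^esub> f) x = f x * invol a"
 by (simp_all add: dual_simps)

lemma dualI:
 assumes "f \<in> extensional (carrier M)" "\<And>x y. x IN M ==> y IN M ==> f (x \<oplus>\<^bsub>M\<^esub> y) = f x + f y"
  "\<And>a x. x IN M ==> f (a \<odot>\<^bsub>M\<^esub> x) = a * f x"
 shows "f IN (dual M)"
 using assms by (simp add: dual_simps)

lemma dualD:
 assumes "f IN (dual M)"
 shows "f \<in> extensional (carrier M)" "\<And>x y. x IN M ==> y IN M ==> f (x \<oplus>\<^bsub>M\<^esub> y) = f x + f y"
  "\<And>a x. x IN M ==> f (a \<odot>\<^bsub>M\<^esub> x) = a * f x"
 using assms by (simp_all add: dual_simps)

lemma dual_zero: "f IN (dual M) ==> left_module M ==> f (zero M) = 0"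
 using dualD(3)[of f M "zero M" 0] lmod_minus(3)[of M "zero M"] lmodD(3)[of M] by simp

lemma dual_ext:
 "f IN (dual M) ==> g IN (dual M) ==> (\<And>x. x IN M ==> f x = g x) ==> f = g"
 using dualD(1) extensionalityI by blast

lemma left_module_dual [simp]:
 assumes "left_module M"
 shows "left_module (dual M)"
proof (rule left_moduleI)
 note M = lmodD[OF assms]
 fix x y z assume x: "x IN (dual M)" and y: "y IN (dual M)"
 show xy: "x \<oplus>\<^bsub>dual M\<^esub> y IN (dual M)"
  by (rule dualI) (use dualD[OF x] dualD[OF y] M in \<open>auto simp: algebra_simps dual_simps(3)\<close>)
 show "x \<oplus>\<^bsub>dual M\<^esub> y = y \<oplus>\<^bsub>dual M\<^esub> x" by (auto simp: dual_simps add.commute)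
 assume z: "z IN (dual M)"
 show "x \<oplus>\<^bsub>dual M\<^esub> y \<oplus>\<^bsub>dual M\<^esub> z = x \<oplus>\<^bsub>dual M\<^esub> (y \<oplus>\<^bsub>dual M\<^esub> z)" by (auto simp: dual_simps add.assoc)
next
 note M = lmodD[OF assms]
 fix a b x y assume x: "x IN (dual M)"
 show "a \<odot>\<^bsub>dual M\<^esub> x IN (dual M)"
  by (rule dualI) (use dualD[OF x] M in \<open>auto simp: algebra_simps dual_simps(4)\<close>)
 show "(a + b) \<odot>\<^bsub>dual M\<^esub> x = a \<odot>\<^bsub>dual M\<^esub> x \<oplus>\<^bsub>dual M\<^esub> b \<odot>\<^bsub>dual M\<^esub> x"
  by (auto simp: dual_simps algebra_simps invol_add)
 show "(a * b) \<odot>\<^bsub>dual M\<^esub> x = a \<odot>\<^bsub>dual M\<^esub> (b \<odot>\<^bsub>dual M\<^esub> x)"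
  by (auto simp: dual_simps invol_mult mult.assoc)
 show "(zero (dual M)) \<oplus>\<^bsub>dual M\<^esub> x = x" "1 \<odot>\<^bsub>dual M\<^esub> x = x"
  using dualD(1)[OF x] by (auto simp: dual_simps extensional_def)
 show "0 \<odot>\<^bsub>dual M\<^esub> x = zero (dual M)" by (auto simp: dual_simps)
 show "a \<odot>\<^bsub>dual M\<^esub> (x \<oplus>\<^bsub>dual M\<^esub> y) = a \<odot>\<^bsub>dual M\<^esub> x \<oplus>\<^bsub>dual M\<^esub> a \<odot>\<^bsub>dual M\<^esub> y"
  by (auto simp: dual_simps algebra_simps)
next
 show "(zero (dual M)) IN (dual M)" using lmodD[OF assms] by (auto simp: dual_simps)
qed

definition stab_pairing :: "nat => ('m => 'a::involutive_ring) \<times> 'a vec => 'm \<times> 'a vec => 'a" where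
 "stab_pairing p X y = fst X (fst y) + vpair p (snd y) (snd X)"

lemma vpair_zero [simp]: "vpair n (0\<^sub>v n) b = 0" "vpair n b (0\<^sub>v n) = 0"
 by (simp_all add: vpair_def)

text \<open>Testing on (x, 0) determines the functional, testing on (0, v) determines the vector.
  Equalities between frames of duals are proved in this way.\<close>

lemma stab_pairing_ext:
 fixes M :: "('a::involutive_ring, 'm, 'z) module_scheme"
 assumes M: "left_module M" and X: "X \<in> carrier (stabilised (dual M) p)" and Y: "Y \<in> carrier (stabilised (dual M) p)"
  and eq: "\<And>x v. x IN M ==> v INV p ==> stab_pairing p X (x, v) = stab_pairing p Y (x, v)"
 shows "X = Y"
proof (rule prod_eqI)
 have XY: "fst X IN (dual M)" "snd X INV p" "fst Y IN (dual M)" "snd Y INV p"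
  using X Y by (auto simp: mem_Times_iff)
 show "fst X = fst Y"
 proof (rule dual_ext[OF XY(1,3)])
  fix x assume "x IN M"
  then show "fst X x = fst Y x" using eq[of x "0\<^sub>v p"] by (simp add: stab_pairing_def)
 qed
 show "snd X = snd Y"
 proof (rule vpair_ext[OF XY(2,4)])
  fix v :: "'a vec" assume "v INV p"
  then show "vpair p v (snd X) = vpair p v (snd Y)"
   using eq[OF lmodD(3)[OF M], of v] dual_zero[OF XY(1) M] dual_zero[OF XY(3) M] by (simp add: stab_pairing_def)
 qed
qed

lemma stab_pairing_frame:
 fixes M :: "('a::involutive_ring, 'm, 'z) module_scheme"
 assumes M: "left_module M" and g: "is_frame M p n g" and X: "X \<in> carrier (stabilised (dual M) p)" and a: "a INV n"
 shows "stab_pairing p X (g a) = (\<Sum>i<n. a $ i * stab_pairing p X (g (unit_vec n i)))"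
proof (rule additive_vec_sum[OF _ _ a])
 note D = is_frameD[OF g]
 have XY: "fst X IN (dual M)" "snd X INV p" using X by (auto simp: mem_Times_iff)
 show "stab_pairing p X (g (x + y)) = stab_pairing p X (g x) + stab_pairing p X (g y)"
  if "x INV n" "y INV n" for x y
  using that XY dualD[OF XY(1)] by (simp add: stab_pairing_def D vpair_add[of _ p])
 show "stab_pairing p X (g (c \<cdot>\<^sub>v x)) = c * stab_pairing p X (g x)" if "x INV n" for c x
  using that XY dualD[OF XY(1)] by (simp add: stab_pairing_def D vpair_add(3)[of _ p _ _ c] distrib_left)
qed

text \<open>The inverse adjoint of \<open>g\<close>: b goes to the functional y ->
  \<open>vpair n (frame_inv n g y) b\<close> on the stabilised module, split into its restriction to
  M and its values on the unit vectors of \<Lambda>^p. The values are conjugated because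
  \<open>stab_pairing\<close> conjugates the vector part.\<close>

definition dual_frame :: "('a::involutive_ring, 'm, 'z) module_scheme => nat => nat => ('a vec => 'm \<times> 'a vec) => 'a vec => ('m => 'a) \<times> 'a vec" where
 "dual_frame M p n g b = (\<lambda>x\<in>carrier M. vpair n (frame_inv n g (x, 0\<^sub>v p)) b,
   vec p (\<lambda>k. invol (vpair n (frame_inv n g (zero M, unit_vec p k)) b)))"

lemma dual_frame:
 fixes M :: "('a::involutive_ring, 'm, 'z) module_scheme"
 assumes M: "left_module M" and g: "is_frame M p n g" and b: "b INV n"
 shows "dual_frame M p n g b \<in> carrier (stabilised (dual M) p)"
  "x IN M ==> v INV p ==> stab_pairing p (dual_frame M p n g b) (x, v) = vpair n (frame_inv n g (x, v)) b"
  "a INV n ==> stab_pairing p (dual_frame M p n g b) (g a) = vpair n a b"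
proof -
 note inv = linD[OF frame_inv_lin[OF g M]] and i = frame_inv[OF g] and M' = lmodD[OF M]
 have add: "frame_inv n g (x \<oplus>\<^bsub>M\<^esub> y, v + w) = frame_inv n g (x, v) + frame_inv n g (y, w)"
  if "x IN M" "y IN M" "v INV p" "w INV p" for x y v w
  using inv(2)[of "(x, v)" "(y, w)"] that by simp
 have smult: "frame_inv n g (c \<odot>\<^bsub>M\<^esub> x, c \<cdot>\<^sub>v v) = c \<cdot>\<^sub>v frame_inv n g (x, v)"
  if "x IN M" "v INV p" for x v c
  using inv(3)[of "(x, v)" c] that by simp
 have smult0: "frame_inv n g (c \<odot>\<^bsub>M\<^esub> x, 0\<^sub>v p) = c \<cdot>\<^sub>v frame_inv n g (x, 0\<^sub>v p)" if "x IN M" for c x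
 proof -
  have "c \<cdot>\<^sub>v 0\<^sub>v p = (0\<^sub>v p :: 'a vec)" by (intro eq_vecI) auto
  then show ?thesis using smult[OF that, of "0\<^sub>v p" c] by simp
 qed
 have add0: "frame_inv n g (x \<oplus>\<^bsub>M\<^esub> y, 0\<^sub>v p) = frame_inv n g (x, 0\<^sub>v p) + frame_inv n g (y, 0\<^sub>v p)"
  if "x IN M" "y IN M" for x y
  using add[OF that, of "0\<^sub>v p" "0\<^sub>v p"] by simp
 show "dual_frame M p n g b \<in> carrier (stabilised (dual M) p)"
  using M' b i add0 smult0 by (auto simp: dual_frame_def vpair_add[of _ n] intro!: dualI)
 show pair: "stab_pairing p (dual_frame M p n g b) (x, v) = vpair n (frame_inv n g (x, v)) b"
  if xv: "x IN M" "v INV p" for x v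
 proof -
  have "vpair n (frame_inv n g (zero M, v)) b = (\<Sum>k<p. v $ k * vpair n (frame_inv n g (zero M, unit_vec p k)) b)"
  proof (rule additive_vec_sum[OF _ _ xv(2)])
   show "vpair n (frame_inv n g (zero M, x + y)) b = vpair n (frame_inv n g (zero M, x)) b + vpair n (frame_inv n g (zero M, y)) b"
    if "x INV p" "y INV p" for x y
    using add[of "zero M" "zero M" x y] that M' i b by (simp add: vpair_add[of _ n])
   show "vpair n (frame_inv n g (zero M, c \<cdot>\<^sub>v x)) b = c * vpair n (frame_inv n g (zero M, x)) b"
    if "x INV p" for c x
    using smult[of "zero M" x c] that M' i b lmod_minus(4)[OF M M'(3)] by (simp add: vpair_add[of _ n])
  qed
  then have "stab_pairing p (dual_frame M p n g b) (x, v) = vpair n (frame_inv n g (x, 0\<^sub>v p)) b + vpair n (frame_inv n g (zero M, v)) b"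
   using xv(1) by (simp add: stab_pairing_def dual_frame_def vpair_def[of p])
  also have "\<dots> = vpair n (frame_inv n g (x, v)) b"
   using add[of x "zero M" "0\<^sub>v p" v] xv M' i b by (simp add: vpair_add[of _ n])
  finally show ?thesis .
 qed
 show "stab_pairing p (dual_frame M p n g b) (g a) = vpair n a b" if "a INV n"
  using pair[OF is_frameD(1,2)[OF g that]] i(1)[OF that] by simp
qed

text \<open>The inverse map reads off the conjugated values on the basis given by \<open>g\<close>;
  a stabilised functional is determined by these.\<close>

lemma is_frame_dual:
 fixes M :: "('a::involutive_ring, 'm, 'z) module_scheme"
 assumes M: "left_module M" and g: "is_frame M p n g"
 shows "is_frame (dual M) p n (dual_frame M p n g)"
 unfolding is_frame_def
proof (rule module_isosI[where g = "\<lambda>X. vec n (\<lambda>i. invol (stab_pairing p X (g (unit_vec n i))))"])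
 note i = frame_inv[OF g] and M' = lmodD[OF M] and D = dual_frame[OF M g]
 show "dual_frame M p n g \<in> linear_maps (free_module n) (stabilised (dual M) p)"
 proof (rule linI)
  fix a b :: "'a vec" assume ab: "a IN (free_module n)" "b IN (free_module n)"
  then have *: "vpair n (frame_inv n g (x, v)) (a + b) = vpair n (frame_inv n g (x, v)) a + vpair n (frame_inv n g (x, v)) b"
   if "x IN M" "v INV p" for x v using that i by (intro vpair_add(2)) auto
  show "dual_frame M p n g (a \<oplus>\<^bsub>free_module n\<^esub> b) = dual_frame M p n g a \<oplus>\<^bsub>stabilised (dual M) p\<^esub> dual_frame M p n g b"
   by (auto simp: dual_frame_def dual_simps(3) * M' invol_add intro!: eq_vecI)
 next
  fix c and a :: "'a vec" assume a: "a IN (free_module n)"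
  then have *: "vpair n (frame_inv n g (x, v)) (c \<cdot>\<^sub>v a) = vpair n (frame_inv n g (x, v)) a * invol c"
   if "x IN M" "v INV p" for x v using that i by (intro vpair_add(4)[of _ n]) auto
  show "dual_frame M p n g (c \<odot>\<^bsub>free_module n\<^esub> a) = c \<odot>\<^bsub>stabilised (dual M) p\<^esub> dual_frame M p n g a"
   by (auto simp: dual_frame_def dual_simps(4) * M' invol_mult intro!: eq_vecI)
 qed (use D in simp)
 fix X assume X: "X \<in> carrier (stabilised (dual M) p)"
 let ?b = "vec n (\<lambda>i. invol (stab_pairing p X (g (unit_vec n i))))"
 show "?b IN (free_module n)" by simp
 show "dual_frame M p n g ?b = X"
 proof (rule stab_pairing_ext[OF M _ X])
  show "dual_frame M p n g ?b \<in> carrier (stabilised (dual M) p)" by (rule D) simp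
  fix x and v :: "'a vec" assume xv: "x IN M" "v INV p"
  have "stab_pairing p (dual_frame M p n g ?b) (x, v) = vpair n (frame_inv n g (x, v)) ?b"
   by (rule D(2)[OF _ xv]) simp
  also have "\<dots> = stab_pairing p X (g (frame_inv n g (x, v)))"
   unfolding stab_pairing_frame[OF M g X i(3)[OF xv]] vpair_def by simp
  finally show "stab_pairing p (dual_frame M p n g ?b) (x, v) = stab_pairing p X (x, v)" using i(2)[OF xv] by simp
 qed
next
 fix b :: "'a vec" assume b: "b IN (free_module n)"
 then show "vec n (\<lambda>i. invol (stab_pairing p (dual_frame M p n g b) (g (unit_vec n i)))) = b"
  using dual_frame(3)[OF M g, of b] by (auto simp: vpair_unit intro!: eq_vecI)
qed

text \<open>The values on the basis \<open>g\<close> determine a stabilised functional, so the dual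
  basis is unique, and the dual frame attains the required values by
  \<open>vpair_unit\<close>.\<close>

lemma dual_s_bases_of_frame:
 fixes M :: "('a::involutive_ring, 'm, 'z) module_scheme"
 assumes M: "left_module M" and g: "is_frame M p n g"
 shows "dual_s_bases M (frame_basis p n g) = {frame_basis p n (dual_frame M p n g)}"
proof -
 note D = dual_frame[OF M g]
 have pair: "stab_pairing p (dual_frame M p n g (unit_vec n i)) (g (unit_vec n j)) = (if i = j then 1 else 0)" if "i < n" "j < n" for i j
  using D(3)[of "unit_vec n i" "unit_vec n j"] that by (simp add: vpair_unit)
 have uniq: "X = dual_frame M p n g (unit_vec n i)"
  if X: "X \<in> carrier (stabilised (dual M) p)" and i: "i < n"
   and eq: "\<And>j. j < n ==> stab_pairing p X (g (unit_vec n j)) = (if i = j then 1 else 0)" for X i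
 proof (rule stab_pairing_ext[OF M X])
  show Y: "dual_frame M p n g (unit_vec n i) \<in> carrier (stabilised (dual M) p)" by (rule D) simp
  fix x and v :: "'a vec" assume xv: "x IN M" "v INV p"
  have "stab_pairing p X (g (frame_inv n g (x, v))) = stab_pairing p (dual_frame M p n g (unit_vec n i)) (g (frame_inv n g (x, v)))"
   unfolding stab_pairing_frame[OF M g X frame_inv(3)[OF g xv]] stab_pairing_frame[OF M g Y frame_inv(3)[OF g xv]]
   by (rule sum.cong) (use eq pair[OF i] in auto)
  then show "stab_pairing p X (x, v) = stab_pairing p (dual_frame M p n g (unit_vec n i)) (x, v)"
   using frame_inv(2)[OF g xv] by simp
 qed
 have sp: "(case X of (f, w) => case y of (x, v) => f x + (\<Sum>k<p. v $ k * invol (w $ k))) = stab_pairing p X y" for X :: "('m => 'a) \<times> 'a vec" and y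
  by (simp add: stab_pairing_def vpair_def split: prod.split)
 show ?thesis
 proof (rule Set.set_eqI)
  fix z :: "('a, 'm => 'a) s_basis"
  obtain m ds where z: "z = (m, ds)" by (cases z)
  have "z \<in> dual_s_bases M (frame_basis p n g) \<longleftrightarrow> m = p \<and> length ds = n \<and> set ds \<subseteq> carrier (stabilised (dual M) p) \<and>
    (\<forall>i<n. \<forall>j<n. stab_pairing p (ds ! i) (g (unit_vec n j)) = (if i = j then 1 else 0))"
   by (auto simp: z frame_basis_def sp)
  also have "\<dots> \<longleftrightarrow> m = p \<and> ds = basis_of_frame n (dual_frame M p n g)"
  proof (intro iffI; elim conjE; intro conjI)
   assume l: "length ds = n" and s: "set ds \<subseteq> carrier (stabilised (dual M) p)"
    and *: "\<forall>i<n. \<forall>j<n. stab_pairing p (ds ! i) (g (unit_vec n j)) = (if i = j then 1 else 0)"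
   show "ds = basis_of_frame n (dual_frame M p n g)"
   proof (rule nth_equalityI)
    fix i assume "i < length ds"
    then have i: "i < n" using l by simp
    have "ds ! i \<in> carrier (stabilised (dual M) p)" using s nth_mem[of i ds] i l by blast
    then show "ds ! i = basis_of_frame n (dual_frame M p n g) ! i" using uniq[OF _ i] * i by simp
   qed (use l in simp)
  next
   assume ds: "ds = basis_of_frame n (dual_frame M p n g)"
   show "length ds = n" "\<forall>i<n. \<forall>j<n. stab_pairing p (ds ! i) (g (unit_vec n j)) = (if i = j then 1 else 0)"
    using ds pair by simp_all
   show "set ds \<subseteq> carrier (stabilised (dual M) p)" using D(1)[OF unit_vec_carrier] ds unfolding basis_of_frame_def by (auto simp del: module_sum_simps)
  qed
  finally show "z \<in> dual_s_bases M (frame_basis p n g) \<longleftrightarrow> z \<in> {frame_basis p n (dual_frame M p n g)}"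
   by (simp add: z frame_basis_def)
 qed
qed

lemma extend_dual_frame:
 fixes M :: "('a::involutive_ring, 'm, 'z) module_scheme"
 assumes M: "left_module M" and g: "is_frame M p n g" and b: "b INV (n + d)"
 shows "extend_frame n d (dual_frame M p n g) b = dual_frame M (p + d) (n + d) (extend_frame n d g) b"
proof (rule stab_pairing_ext[OF M])
 note e = is_frame_extend[OF g, of d]
 show "extend_frame n d (dual_frame M p n g) b \<in> carrier (stabilised (dual M) (p + d))"
  using module_isosD(3)[OF is_frame_extend[OF is_frame_dual[OF M g], unfolded is_frame_def]] b by simp
 show "dual_frame M (p + d) (n + d) (extend_frame n d g) b \<in> carrier (stabilised (dual M) (p + d))"
  by (rule dual_frame[OF M e b])
 obtain b1 b2 where b12: "b = b1 @\<^sub>v b2" "b1 INV n" "b2 INV d" using b by (metis append_vec_cases)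
 fix x and v :: "'a vec" assume x: "x IN M" and "v INV (p + d)"
 then obtain v1 v2 where v: "v = v1 @\<^sub>v v2" "v1 INV p" "v2 INV d" by (metis append_vec_cases)
 note D = dual_frame[OF M g b12(2)]
 have inv: "frame_inv (n + d) (extend_frame n d g) (x, v) = frame_inv n g (x, v1) @\<^sub>v v2"
  by (rule frame_inv_eq[OF e]) (use frame_inv[OF g] x v in auto)
 have "stab_pairing (p + d) (extend_frame n d (dual_frame M p n g) b) (x, v) = stab_pairing p (dual_frame M p n g b1) (x, v1) + vpair d v2 b2"
  using D(1) b12 v by (auto simp: stab_pairing_def vpair_append[of _ p _ d] mem_Times_iff)
 also have "\<dots> = vpair (n + d) (frame_inv n g (x, v1) @\<^sub>v v2) (b1 @\<^sub>v b2)"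
  unfolding D(2)[OF x v(2)] using frame_inv(3)[OF g x v(2)] b12 v by (simp add: vpair_append)
 also have "\<dots> = stab_pairing (p + d) (dual_frame M (p + d) (n + d) (extend_frame n d g) b) (x, v)"
  using dual_frame(2)[OF M e b x, of v] v inv b12 by simp
 finally show "stab_pairing (p + d) (extend_frame n d (dual_frame M p n g) b) (x, v)
  = stab_pairing (p + d) (dual_frame M (p + d) (n + d) (extend_frame n d g) b) (x, v)" .
qed

section \<open>Sums, duals, free modules and images as based modules\<close>

context torsion_subgroup
begin

lemma simple_interchange_blocks: "simple_aut (n + m + (d + e)) (interchange_blocks n m d e)"
proof -
 have sw: "simple_aut (m + d) (swap_blocks m d)"
  by (simp add: simple_aut_def swap_blocks_aut torsion_swap_blocks Z_closed)
 have "simple_aut (n + (m + d + e)) (interchange_blocks n m d e)"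
  unfolding interchange_blocks_def by (intro simple_aut_block_sum simple_aut_id sw)
 then show ?thesis by (simp add: add.assoc)
qed

lemma simple_sum_frame:
 assumes g: "is_frame M p n g" "is_frame M p n g'" and h: "is_frame N q m h" "is_frame N q m h'"
  and s: "simple_aut n (frame_change n g g')" "simple_aut m (frame_change m h h')"
 shows "simple_aut (n + m) (frame_change (n + m) (sum_frame n m g h) (sum_frame n m g' h'))"
proof (rule simple_aut_cong[OF simple_aut_block_sum[OF s]])
 fix x :: "'a vec" assume "x INV (n + m)"
 then obtain a b where ab: "x = a @\<^sub>v b" "a INV n" "b INV m" by (metis append_vec_cases)
 have "frame_change n g g' a INV n" "frame_change m h h' b INV m"
  using module_isosD(3)[OF frame_change_aut[OF g]] module_isosD(3)[OF frame_change_aut[OF h]] ab by auto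
 then show "block_sum n m (frame_change n g g') (frame_change m h h') x = frame_change (n + m) (sum_frame n m g h) (sum_frame n m g' h') x"
  using ab frame_change_apply[OF g ab(2)] frame_change_apply[OF h ab(3)]
  by (intro frame_change_eq[OF is_frame_sum[OF g(2) h(2)], symmetric]) auto
qed

text \<open>The two frames place the added coordinates differently, in the source as well as in the
  stabilising summand. Each of the two reorderings exchanges a pair of adjacent blocks.\<close>

lemma simple_extend_sum_frame:
 assumes M: "left_module M" and N: "left_module N" and g: "is_frame M p n g" and h: "is_frame N q m h"
 shows "simple_aut (n + m + (d + e)) (frame_change (n + m + (d + e)) (extend_frame (n + m) (d + e) (sum_frame n m g h))
  (sum_frame (n + d) (m + e) (extend_frame n d g) (extend_frame m e h)))"
proof (rule simple_frame_change_stab[OF left_module_sum[OF M N] is_frame_extend[OF is_frame_sum[OF g h]]])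
 have "p + d + (q + e) = p + q + (d + e)" "n + d + (m + e) = n + m + (d + e)" by simp_all
 then show "is_frame (module_sum M N) (p + q + (d + e)) (n + m + (d + e)) (sum_frame (n + d) (m + e) (extend_frame n d g) (extend_frame m e h))"
  using is_frame_sum[OF is_frame_extend[OF g, of d] is_frame_extend[OF h, of e]] by (simp only:)
 show "simple_aut (p + q + (d + e)) (interchange_blocks p d q e)"
  using simple_interchange_blocks[of p d q e] by (simp add: ac_simps)
 show "simple_aut (n + m + (d + e)) (interchange_blocks n m d e)" by (rule simple_interchange_blocks)
 fix v :: "'a vec" assume "v \<in> carrier_vec (n + m + (d + e))"
 then obtain a b c w where v: "v = (a @\<^sub>v b) @\<^sub>v (c @\<^sub>v w)" "a INV n" "b INV m" "c INV d" "w INV e"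
  by (rule append_vec_ex4)
 then show "extend_frame (n + m) (d + e) (sum_frame n m g h) v = map_prod id (interchange_blocks p d q e)
   (sum_frame (n + d) (m + e) (extend_frame n d g) (extend_frame m e h) (interchange_blocks n m d e v))"
  using is_frameD(2)[OF g v(2)] is_frameD(2)[OF h v(3)] by simp
qed

text \<open>All concatenations of bases of M and N are equivalent: go from the extended sum to the
  sum of the extended frames, change the frames of both summands there, and go back.\<close>

lemma based_sum:
 fixes M :: "('a, 'm) based_module" and N :: "('a, 'n) based_module"
 assumes M: "based M" and N: "based N" and g: "frame M p n g" and h: "frame N q m h"
 shows "based (bsum M N)" "frame (bsum M N) (p + q) (n + m) (sum_frame n m g h)"
proof -
 note DM = basedD[OF M] and DN = basedD[OF N]
 have gi: "is_frame M p n g" and hi: "is_frame N q m h" using g h by (simp_all add: frame_def)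
 let ?B = "{concat_s_bases M N b c | b c. b \<in> bases M \<and> c \<in> bases N}"
 note lm = left_module_sum[OF DM(1) DN(1)]
 note fr = is_frame_sum[OF gi hi]
 have in_B: "frame_basis (p + q) (n + m) (sum_frame n m g h) \<in> ?B"
  using concat_s_bases_of_frames[OF gi hi DM(1) DN(1)] g h unfolding frame_def by (metis (mono_tags, lifting) mem_Collect_eq)
 have eq: "x \<in> s_bases (module_sum M N) \<and> torsion_in Z (module_sum M N) (frame_basis (p + q) (n + m) (sum_frame n m g h)) x"
  if "x \<in> ?B" for x
 proof -
  obtain b c where bc: "x = concat_s_bases M N b c" "b \<in> bases M" "c \<in> bases N" using \<open>x \<in> ?B\<close> by blast
  obtain p' n' g' where g': "is_frame M p' n' g'" "b = frame_basis p' n' g'" using bc(2) DM(3) s_bases_iff[OF DM(1)] by blast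
  obtain q' m' h' where h': "is_frame N q' m' h'" "c = frame_basis q' m' h'" using bc(3) DN(3) s_bases_iff[OF DN(1)] by blast
  have x: "x = frame_basis (p' + q') (n' + m') (sum_frame n' m' g' h')"
   unfolding bc g' h' by (rule concat_s_bases_of_frames[OF g'(1) h'(1) DM(1) DN(1)])
  note fr' = is_frame_sum[OF g'(1) h'(1)]
  have tb: "torsion_in Z M (frame_basis p n g) b" "torsion_in Z N (frame_basis q m h) c"
   using bases_rel_iff[OF M, of "frame_basis p n g" b] bases_rel_iff[OF N, of "frame_basis q m h" c] g h bc DM(3) DN(3) unfolding frame_def by blast+
  have tg: "n + p' = n' + p" "simple_aut (n + p') (frame_change (n + p') (extend_frame n p' g) (extend_frame n' p g'))"
   using tb(1) torsion_in_simple_iff[OF DM(1) gi g'(1), of p' p] g' by auto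
  have th: "m + q' = m' + q" "simple_aut (m + q') (frame_change (m + q') (extend_frame m q' h) (extend_frame m' q h'))"
   using tb(2) torsion_in_simple_iff[OF DN(1) hi h'(1), of q' q] h' by auto
  let ?n = "n + m + (p' + q')" and ?p = "p + q + (p' + q')"
  have sz: "n + p' + (m + q') = ?n" "n' + m' + (p + q) = ?n" "p' + q' + (p + q) = ?p" "p + p' + (q + q') = ?p"
   "n' + p + (m' + q) = ?n" using tg th by auto
  have F1: "is_frame (module_sum M N) ?p ?n (extend_frame (n + m) (p' + q') (sum_frame n m g h))"
   by (rule is_frame_extend[OF fr])
  have F2: "is_frame (module_sum M N) ?p ?n (sum_frame (n + p') (m + q') (extend_frame n p' g) (extend_frame m q' h))"
   using is_frame_sum[OF is_frame_extend[OF gi, of p'] is_frame_extend[OF hi, of q']] sz by simp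
  have F3: "is_frame (module_sum M N) ?p ?n (sum_frame (n + p') (m + q') (extend_frame n' p g') (extend_frame m' q h'))"
  proof -
   have "p' + p + (q' + q) = ?p" by simp
   then show ?thesis using is_frame_sum[OF is_frame_extend[OF g'(1), of p] is_frame_extend[OF h'(1), of q]]
    by (simp only: tg(1)[symmetric] th(1)[symmetric] sz(1))
  qed
  have F4: "is_frame (module_sum M N) ?p ?n (extend_frame (n' + m') (p + q) (sum_frame n' m' g' h'))"
   using is_frame_extend[OF fr', of "p + q"] sz by simp
  have 1: "simple_aut ?n (frame_change ?n (extend_frame (n + m) (p' + q') (sum_frame n m g h)) (sum_frame (n + p') (m + q') (extend_frame n p' g) (extend_frame m q' h)))"
   by (rule simple_extend_sum_frame[OF DM(1) DN(1) gi hi])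
  have 2: "simple_aut ?n (frame_change ?n (sum_frame (n + p') (m + q') (extend_frame n p' g) (extend_frame m q' h))
    (sum_frame (n + p') (m + q') (extend_frame n' p g') (extend_frame m' q h')))"
  proof -
   have "is_frame M (p + p') (n + p') (extend_frame n' p g')" "is_frame N (q + q') (m + q') (extend_frame m' q h')"
    using is_frame_extend[OF g'(1), of p] is_frame_extend[OF h'(1), of q] tg(1) th(1) by (simp_all add: ac_simps)
   then show ?thesis
    using simple_sum_frame[OF is_frame_extend[OF gi, of p'] _ is_frame_extend[OF hi, of q'] _ tg(2) th(2)] sz by simp
  qed
  have 3: "simple_aut ?n (frame_change ?n (sum_frame (n + p') (m + q') (extend_frame n' p g') (extend_frame m' q h'))
    (extend_frame (n' + m') (p + q) (sum_frame n' m' g' h')))"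
   using simple_extend_sum_frame[OF DM(1) DN(1) g'(1) h'(1), of p q] sz tg(1) th(1)
   by (intro simple_frame_change_sym[OF F4 F3]) simp
  have "simple_aut ?n (frame_change ?n (extend_frame (n + m) (p' + q') (sum_frame n m g h)) (extend_frame (n' + m') (p + q) (sum_frame n' m' g' h')))"
   by (rule simple_frame_change_trans[OF F1 F2 F4 1 simple_frame_change_trans[OF F2 F3 F4 2 3]])
  then have "torsion_in Z (module_sum M N) (frame_basis (p + q) (n + m) (sum_frame n m g h)) x"
   unfolding x using torsion_in_simple_iff[OF lm fr fr', of "p' + q'" "p + q"] sz by simp
  moreover have "x \<in> s_bases (module_sum M N)" using s_bases_iff[OF lm] fr' x by blast
  ultimately show ?thesis by blast
 qed
 show "based (bsum M N)" "frame (bsum M N) (p + q) (n + m) (sum_frame n m g h)"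
  unfolding based_sum_def using with_bases_frame[OF lm fr in_B eq] by auto
qed

text \<open>The change between the dual frames is adjoint to the inverse of the change from
  \<open>g\<close> to \<open>g'\<close>, so \<open>torsion_adjoint\<close> applies.\<close>

lemma simple_dual_frame:
 fixes M :: "('a, 'm, 'z) module_scheme"
 assumes M: "left_module M" and g: "is_frame M p n g" "is_frame M p n g'" and s: "simple_aut n (frame_change n g g')"
 shows "simple_aut n (frame_change n (dual_frame M p n g) (dual_frame M p n g'))"
proof -
 let ?k = "frame_change n (dual_frame M p n g) (dual_frame M p n g')" and ?h = "frame_change n g' g"
 have k: "?k \<in> aut n" by (rule frame_change_aut[OF is_frame_dual[OF M g(1)] is_frame_dual[OF M g(2)]])
 have h: "simple_aut n ?h" by (rule simple_frame_change_sym[OF g s])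
 have "vpair n (?h a) b = vpair n a (?k b)" if ab: "a INV n" "b INV n" for a b
 proof -
  have c: "?h a INV n" "?k b INV n"
   using module_isosD(3)[OF k] module_isosD(3)[OF frame_change_aut[OF g(2,1)]] ab by auto
  have "vpair n a (?k b) = stab_pairing p (dual_frame M p n g' (?k b)) (g' a)"
   using dual_frame(3)[OF M g(2) c(2) ab(1)] by simp
  also have "\<dots> = stab_pairing p (dual_frame M p n g b) (g (?h a))"
   using frame_change_apply[OF is_frame_dual[OF M g(1)] is_frame_dual[OF M g(2)] ab(2)] frame_change_apply[OF g(2,1) ab(1)] by simp
  also have "\<dots> = vpair n (?h a) b" by (rule dual_frame(3)[OF M g(1) ab(2) c(1)])
  finally show ?thesis by simp
 qed
 then show ?thesis using torsion_adjoint[OF Z_invol, of ?h n ?k] h k module_isosD(1)[OF k] by (auto simp: simple_aut_def)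
qed

lemma based_dual:
 fixes M :: "('a, 'm) based_module"
 assumes M: "based M" and g: "frame M p n g"
 shows "based (bdual M)" "frame (bdual M) p n (dual_frame M p n g)"
proof -
 note DM = basedD[OF M]
 have gi: "is_frame M p n g" using g by (simp add: frame_def)
 let ?B = "\<Union>b\<in>bases M. dual_s_bases M b"
 note lm = left_module_dual[OF DM(1)] and fr = is_frame_dual[OF DM(1) gi]
 have in_B: "frame_basis p n (dual_frame M p n g) \<in> ?B"
  using dual_s_bases_of_frame[OF DM(1) gi] g unfolding frame_def by blast
 have eq: "x \<in> s_bases (dual M) \<and> torsion_in Z (dual M) (frame_basis p n (dual_frame M p n g)) x" if x: "x \<in> ?B" for x
 proof -
  obtain b where b: "b \<in> bases M" "x \<in> dual_s_bases M b" using x by blast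
  obtain p' n' g' where g': "is_frame M p' n' g'" "b = frame_basis p' n' g'" using b(1) DM(3) s_bases_iff[OF DM(1)] by blast
  have x: "x = frame_basis p' n' (dual_frame M p' n' g')" using b(2) unfolding g' dual_s_bases_of_frame[OF DM(1) g'(1)] by simp
  have "torsion_in Z M (frame_basis p n g) b" using bases_rel_iff[OF M, of "frame_basis p n g" b] g b DM(3) unfolding frame_def by blast
  then have tg: "n + p' = n' + p" "simple_aut (n + p') (frame_change (n + p') (extend_frame n p' g) (extend_frame n' p g'))"
   using torsion_in_simple_iff[OF DM(1) gi g'(1), of p' p] g' by auto
  have F: "is_frame M (p + p') (n + p') (extend_frame n p' g)" "is_frame M (p + p') (n + p') (extend_frame n' p g')"
   using is_frame_extend[OF gi, of p'] is_frame_extend[OF g'(1), of p] tg(1) by (simp_all add: add.commute)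
  have "torsion (n + p') (frame_change (n + p') (extend_frame n p' (dual_frame M p n g)) (extend_frame n' p (dual_frame M p' n' g')))
    = torsion (n + p') (frame_change (n + p') (dual_frame M (p + p') (n + p') (extend_frame n p' g)) (dual_frame M (p + p') (n + p') (extend_frame n' p g')))"
  proof (rule torsion_frame_change_cong)
   fix a :: "'a vec" assume "a INV (n + p')"
   then show "extend_frame n p' (dual_frame M p n g) a = dual_frame M (p + p') (n + p') (extend_frame n p' g) a"
    "extend_frame n' p (dual_frame M p' n' g') a = dual_frame M (p + p') (n + p') (extend_frame n' p g') a"
    using extend_dual_frame[OF DM(1) gi, of a p'] extend_dual_frame[OF DM(1) g'(1), of a p] tg(1) by (simp_all add: add.commute)
  qed
  then have "torsion (n + p') (frame_change (n + p') (extend_frame n p' (dual_frame M p n g)) (extend_frame n' p (dual_frame M p' n' g'))) \<in> Z"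
   using simple_dual_frame[OF DM(1) F tg(2)] by (simp add: simple_aut_def)
  then have "torsion_in Z (dual M) (frame_basis p n (dual_frame M p n g)) x"
   unfolding x torsion_in_iff[OF lm fr is_frame_dual[OF DM(1) g'(1)] add.commute[of p p']] using tg(1) by simp
  then show ?thesis using s_bases_iff[OF lm] is_frame_dual[OF DM(1) g'(1)] x by blast
 qed
 show "based (bdual M)" "frame (bdual M) p n (dual_frame M p n g)"
  unfolding based_dual_def using with_bases_frame[OF lm fr in_B eq] by auto
qed

lemma frame_extend:
 assumes M: "based M" and g: "frame M p n g"
 shows "frame M (p + d) (n + d) (extend_frame n d g)"
proof -
 note D = basedD[OF M]
 have gi: "is_frame M p n g" and b: "frame_basis p n g \<in> bases M" using g by (simp_all add: frame_def)
 note e = is_frame_extend[OF gi, of d]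
 have "simple_aut (n + d) (frame_change (n + d) (extend_frame n d g) (extend_frame (n + d) 0 (extend_frame n d g)))"
  by (rule simple_frame_change_eq[OF e]) (simp add: extend_frame_0)
 then have "torsion_in Z M (frame_basis p n g) (frame_basis (p + d) (n + d) (extend_frame n d g))"
  using torsion_in_simple_iff[OF D(1) gi e, of d 0] by simp
 moreover have "frame_basis (p + d) (n + d) (extend_frame n d g) \<in> s_bases M" using s_bases_iff[OF D(1)] e by blast
 ultimately show ?thesis using bases_rel_iff[OF M b] e by (simp add: frame_def)
qed

lemma frame_cong: "frame M p n g ==> (\<And>a. a INV n ==> g a = g' a) ==> frame M p n g'"
 unfolding frame_def frame_basis_def using is_frame_cong[of M p n g g'] basis_of_frame_cong[of n g g'] by simp

lemma based_free:
 "based (bfree k)" "frame (bfree k) p (k + p) (on_append k p Pair)"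
proof -
 let ?g = "\<lambda>v :: 'a vec. (v, 0\<^sub>v 0 :: 'a vec)"
 have fr: "is_frame (free_module k) 0 k ?g"
  unfolding is_frame_def by (rule module_isosI[where g = fst]; (rule linI)?) (auto intro!: eq_vecI)
 have b: "(0, map (\<lambda>i. (unit_vec k i, 0\<^sub>v 0)) [0..<k]) = frame_basis 0 k ?g"
  by (simp add: frame_basis_def basis_of_frame_def)
 have "torsion_in Z (free_module k) (frame_basis 0 k ?g) (frame_basis 0 k ?g)"
  using torsion_in_same_size[OF left_module_free fr fr] simple_frame_change_refl[OF fr] by simp
 moreover have "frame_basis 0 k ?g \<in> s_bases (free_module k)" using s_bases_iff[OF left_module_free] fr by blast
 ultimately have *: "based (bfree k)" "frame (bfree k) 0 k ?g"
  unfolding free_based_def b using with_bases_frame[OF left_module_free fr, of "{frame_basis 0 k ?g}"] by auto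
 then show "based (bfree k)" by simp
 have "frame (bfree k) p (k + p) (extend_frame k p ?g)" using frame_extend[OF *, of p] by simp
 then show "frame (bfree k) p (k + p) (on_append k p Pair)"
  by (rule frame_cong) (auto dest!: append_vec_ex intro!: eq_vecI)
qed

text \<open>The images of the bases fill a whole equivalence class, because a basis equivalent to an
  image can be pulled back by the inverse map.\<close>

lemma based_transport:
 assumes L: "based L" and N: "left_module N" and f: "f \<in> module_isos L N" and B: "bases N = map_s_basis f ` bases L"
 shows "based N" "siso L N f" "frame L p n g ==> frame N p n (map_prod f id \<circ> g)"
proof -
 note D = basedD[OF L]
 obtain b where b: "b \<in> bases L" using D(4) by blast
 then obtain p n g where g: "is_frame L p n g" "b = frame_basis p n g" using s_bases_iff[OF D(1)] D(3) by blast
 note fr = is_frame_map[OF f g(1)]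
 have mb: "map_s_basis f b = frame_basis p n (map_prod f id \<circ> g)" unfolding g(2) by (rule map_s_basis_of_frame)
 have fin: "map_s_basis f c \<in> s_bases N" if c: "c \<in> s_bases L" for c
 proof -
  obtain p n g where "is_frame L p n g" "c = frame_basis p n g" using c s_bases_iff[OF D(1)] by blast
  then show ?thesis using is_frame_map[OF f] map_s_basis_of_frame[of f] s_bases_iff[OF N] by metis
 qed
 have "bases N = s_basis_rel Z N `` {map_s_basis f b}"
 proof (rule Set.set_eqI, rule iffI)
  fix c assume "c \<in> bases N"
  then obtain c' where c': "c' \<in> bases L" "c = map_s_basis f c'" using B by blast
  have cb: "c' \<in> s_bases L" "b \<in> s_bases L" using c' b D(3) by blast+
  then have "torsion_in Z L b c'" using bases_rel_iff[OF L b] c' by blast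
  then show "c \<in> s_basis_rel Z N `` {map_s_basis f b}"
   using torsion_in_map[OF D(1) N f cb(2,1)] fin cb c' by (auto simp: s_basis_rel_def)
 next
  fix c assume c: "c \<in> s_basis_rel Z N `` {map_s_basis f b}"
  then have cN: "c \<in> s_bases N" and t: "torsion_in Z N (map_s_basis f b) c" by (auto simp: s_basis_rel_def)
  obtain q m h where h: "is_frame N q m h" "c = frame_basis q m h" using cN s_bases_iff[OF N] by blast
  note fi = module_isos_inv[OF f D(1)]
  let ?h = "map_prod (inv_map L f) id \<circ> h"
  have fr': "is_frame L q m ?h" by (rule is_frame_map[OF fi h(1)])
  have "map_s_basis f (frame_basis q m ?h) = frame_basis q m (map_prod f id \<circ> ?h)" by (rule map_s_basis_of_frame)
  also have "\<dots> = c" unfolding h(2) frame_basis_def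
  proof (intro arg_cong[of _ _ "Pair q"] basis_of_frame_cong)
   fix x :: "'a vec" assume "x INV m"
   then show "(map_prod f id \<circ> ?h) x = h x" using is_frameD(1)[OF h(1)] inv_map(2)[OF f] by (cases "h x") (auto dest: meta_spec[of _ x])
  qed
  finally have c': "map_s_basis f (frame_basis q m ?h) = c" .
  have cs: "frame_basis q m ?h \<in> s_bases L" using fr' s_bases_iff[OF D(1)] by blast
  have "b \<in> s_bases L" using b D(3) by blast
  then have "torsion_in Z L b (frame_basis q m ?h)" using torsion_in_map[OF D(1) N f _ cs] t c' by simp
  then have "frame_basis q m ?h \<in> bases L" using bases_rel_iff[OF L b cs] by simp
  then show "c \<in> bases N" using B c' by blast
 qed
 then have *: "based N" using based_moduleI[OF N fr] mb by simp
 then show "based N" .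
 show fr2: "frame N p n (map_prod f id \<circ> g)" if "frame L p n g" for p n g
  using that is_frame_map[OF f] map_s_basis_of_frame[of f p n g] B by (auto simp: frame_def) (metis imageI)
 have "frame L p n g" using g b by (simp add: frame_def)
 then show "siso L N f"
  using simple_iso_iff[OF L * _ fr2] f simple_frame_change_refl[OF is_frame_map[OF f g(1)]] by blast
qed

lemma based_image:
 fixes L :: "('a, 'm) based_module" and M :: "('a, 'n) based_module"
 assumes L: "based L" and M: "left_module M" and f: "f \<in> linear_maps L M" and inj: "inj_on f (carrier L)"
 shows "based (based_image f L M)" "siso L (based_image f L M) f"
proof -
 let ?N = "based_image f L M"
 have simps: "carrier ?N = f ` carrier L" "zero ?N = zero M" "add ?N = add M" "smult ?N = smult M" "bases ?N = map_s_basis f ` bases L"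
  by (simp_all add: based_image_def)
 note L' = lmodD[OF basedD(1)[OF L]] and M' = lmodD[OF M] and l = linD[OF f]
 have z: "(zero M) = f (zero L)" using linear_maps_zero[OF f basedD(1)[OF L] M] by simp
 have N: "left_module ?N"
 proof (rule left_moduleI, unfold simps)
  fix x y w a b assume x: "x \<in> f ` carrier L"
  then have xM: "x IN M" using l by blast
  show "a \<odot>\<^bsub>M\<^esub> x \<in> f ` carrier L" using x l(3) L' by (auto simp flip: l(3))
  show "(zero M) \<oplus>\<^bsub>M\<^esub> x = x" "0 \<odot>\<^bsub>M\<^esub> x = zero M" "1 \<odot>\<^bsub>M\<^esub> x = x" "(a + b) \<odot>\<^bsub>M\<^esub> x = a \<odot>\<^bsub>M\<^esub> x \<oplus>\<^bsub>M\<^esub> b \<odot>\<^bsub>M\<^esub> x"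
   "(a * b) \<odot>\<^bsub>M\<^esub> x = a \<odot>\<^bsub>M\<^esub> (b \<odot>\<^bsub>M\<^esub> x)"
   using xM M' lmod_minus(3)[OF M] by simp_all
  assume y: "y \<in> f ` carrier L"
  then have yM: "y IN M" using l by blast
  show "x \<oplus>\<^bsub>M\<^esub> y \<in> f ` carrier L" using x y l(2) L' by (auto simp flip: l(2))
  show "x \<oplus>\<^bsub>M\<^esub> y = y \<oplus>\<^bsub>M\<^esub> x" by (rule left_module_comm[OF M xM yM])
  show "a \<odot>\<^bsub>M\<^esub> (x \<oplus>\<^bsub>M\<^esub> y) = a \<odot>\<^bsub>M\<^esub> x \<oplus>\<^bsub>M\<^esub> a \<odot>\<^bsub>M\<^esub> y" using xM yM M' by simp
  assume w: "w \<in> f ` carrier L"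
  then have "w IN M" using l by blast
  then show "x \<oplus>\<^bsub>M\<^esub> y \<oplus>\<^bsub>M\<^esub> w = x \<oplus>\<^bsub>M\<^esub> (y \<oplus>\<^bsub>M\<^esub> w)" by (rule left_module_assoc[OF M xM yM])
 next
  show "(zero M) \<in> f ` carrier L" unfolding z using L' by simp
 qed
 have iso: "f \<in> module_isos L ?N"
  unfolding module_isos_def using f inj by (auto simp: linear_maps_def simps bij_betw_def)
 show "based ?N" "siso L ?N f" using based_transport[OF L N iso] simps by auto
qed

end

section \<open>Structural maps between sums and duals\<close>

lemma based_sum_simps [simp]:
 "carrier (based_sum Z M N) = carrier M \<times> carrier N" "(zero (based_sum Z M N)) = (zero M, zero N)"
 "(x, y) \<oplus>\<^bsub>based_sum Z M N\<^esub> (x', y') = (x \<oplus>\<^bsub>M\<^esub> x', y \<oplus>\<^bsub>N\<^esub> y')"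
 "a \<odot>\<^bsub>based_sum Z M N\<^esub> (x, y) = (a \<odot>\<^bsub>M\<^esub> x, a \<odot>\<^bsub>N\<^esub> y)"
 by (simp_all add: based_sum_def)

lemma based_dual_simps [simp]:
 "carrier (based_dual Z M) = carrier (dual M)" "zero (based_dual Z M) = zero (dual M)"
 "add (based_dual Z M) = add (dual M)" "smult (based_dual Z M) = smult (dual M)"
 by (simp_all add: based_dual_def)

lemma free_based_simps [simp]:
 "carrier (free_based Z k) = carrier_vec k" "zero (free_based Z k) = 0\<^sub>v k"
 "add (free_based Z k) = (+)" "smult (free_based Z k) = (\<cdot>\<^sub>v)"
 by (simp_all add: free_based_def)

lemma based_image_simps [simp]:
 "carrier (based_image f L M) = f ` carrier L" "zero (based_image f L M) = zero M"
 "add (based_image f L M) = add M" "smult (based_image f L M) = smult M"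
 by (simp_all add: based_image_def)

lemma dual_based_sum: "dual (based_sum Z M N) = dual (module_sum M N)"
 by (simp add: dual_def based_sum_def)

lemma linear_maps_based [simp]:
 "linear_maps (based_sum Z M N) P = linear_maps (module_sum M N) P" "linear_maps P (based_sum Z M N) = linear_maps P (module_sum M N)"
 "linear_maps (based_dual Z M) P = linear_maps (dual M) P" "linear_maps P (based_dual Z M) = linear_maps P (dual M)"
 "linear_maps (free_based Z k) P = linear_maps (free_module k) P" "linear_maps P (free_based Z k) = linear_maps P (free_module k)"
 by (auto simp: linear_maps_def based_sum_def)

lemma module_isos_based [simp]:
 "module_isos (based_sum Z M N) P = module_isos (module_sum M N) P" "module_isos P (based_sum Z M N) = module_isos P (module_sum M N)"
 "module_isos (based_dual Z M) P = module_isos (dual M) P" "module_isos P (based_dual Z M) = module_isos P (dual M)"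
 "module_isos (free_based Z k) P = module_isos (free_module k) P" "module_isos P (free_based Z k) = module_isos P (free_module k)"
 by (auto simp: module_isos_def)

lemma module_isos_swap: "prod.swap \<in> module_isos (module_sum M N) (module_sum N M)"
 by (rule module_isosI[where g = prod.swap]; (rule linI)?) auto

definition interchange :: "('m \<times> 'n) \<times> ('p \<times> 'q) => ('m \<times> 'p) \<times> ('n \<times> 'q)" where
 "interchange = (\<lambda>((x, y), (z, w)). ((x, z), (y, w)))"

lemma interchange_apply [simp]: "interchange ((x, y), (z, w)) = ((x, z), (y, w))"
 by (simp add: interchange_def)

definition reassoc :: "('m \<times> 'n) \<times> 'p => 'm \<times> ('n \<times> 'p)" where
 "reassoc = (\<lambda>((x, y), z). (x, (y, z)))"

lemma reassoc_apply [simp]: "reassoc ((x, y), z) = (x, (y, z))"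
 by (simp add: reassoc_def)

lemma module_isos_shear:
 assumes M: "left_module M" and N: "left_module N" and h: "h \<in> linear_maps N M"
 shows "(\<lambda>(x, y). (x \<oplus>\<^bsub>M\<^esub> h y, y)) \<in> module_isos (module_sum M N) (module_sum M N)"
proof (rule module_isosI[where g = "\<lambda>(x, y). (x \<oplus>\<^bsub>M\<^esub> (- 1) \<odot>\<^bsub>M\<^esub> h y, y)"])
 note M' = lmodD[OF M] and h' = linD[OF h] and mm = lmod_minus[OF M]
 have ac: "x \<oplus>\<^bsub>M\<^esub> y \<oplus>\<^bsub>M\<^esub> (z \<oplus>\<^bsub>M\<^esub> w) = x \<oplus>\<^bsub>M\<^esub> z \<oplus>\<^bsub>M\<^esub> (y \<oplus>\<^bsub>M\<^esub> w)"
  if "x IN M" "y IN M" "z IN M" "w IN M" for x y z w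
  using that M'(2) left_module_assoc[OF M] left_module_comm[OF M] by (metis (no_types, lifting))
 show "(\<lambda>(x, y). (x \<oplus>\<^bsub>M\<^esub> h y, y)) \<in> linear_maps (module_sum M N) (module_sum M N)"
  by (rule linI) (use M' h' ac in auto)
 have "x \<oplus>\<^bsub>M\<^esub> h y \<oplus>\<^bsub>M\<^esub> (- 1) \<odot>\<^bsub>M\<^esub> h y = x" "x \<oplus>\<^bsub>M\<^esub> (- 1) \<odot>\<^bsub>M\<^esub> h y \<oplus>\<^bsub>M\<^esub> h y = x"
  if "x IN M" "y IN N" for x y
  using left_module_assoc[OF M that(1) h'(1)[OF that(2)] M'(4)[OF h'(1)[OF that(2)], of "- 1"]]
   left_module_assoc[OF M that(1) M'(4)[OF h'(1)[OF that(2)], of "- 1"] h'(1)[OF that(2)]]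
   mm(1,2)[OF h'(1)[OF that(2)]] M'(10)[OF that(1)] by simp_all
 then show "(\<lambda>(x, y). (x \<oplus>\<^bsub>M\<^esub> (- 1) \<odot>\<^bsub>M\<^esub> h y, y)) ((\<lambda>(x, y). (x \<oplus>\<^bsub>M\<^esub> h y, y)) p) = p"
  "(\<lambda>(x, y). (x \<oplus>\<^bsub>M\<^esub> h y, y)) ((\<lambda>(x, y). (x \<oplus>\<^bsub>M\<^esub> (- 1) \<odot>\<^bsub>M\<^esub> h y, y)) p) = p"
  if "p IN (module_sum M N)" for p
  using that by auto
 show "(\<lambda>(x, y). (x \<oplus>\<^bsub>M\<^esub> (- 1) \<odot>\<^bsub>M\<^esub> h y, y)) p IN (module_sum M N)"
  if "p IN (module_sum M N)" for p
  using that M'(2,4) h'(1) by auto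
qed

lemma module_isos_minus:
 assumes M: "left_module M" and e: "e = 1 \<or> e = - 1"
 shows "(\<lambda>x. e \<odot>\<^bsub>M\<^esub> x) \<in> module_isos M M"
proof (rule module_isosI[where g = "\<lambda>x. e \<odot>\<^bsub>M\<^esub> x"])
 note M' = lmodD[OF M]
 have ee: "e * e = 1" "e * a = a * e" for a using e by auto
 show "(\<lambda>x. e \<odot>\<^bsub>M\<^esub> x) \<in> linear_maps M M"
 proof (rule linI)
  show "e \<odot>\<^bsub>M\<^esub> (a \<odot>\<^bsub>M\<^esub> x) = a \<odot>\<^bsub>M\<^esub> (e \<odot>\<^bsub>M\<^esub> x)" if "x IN M" for a x
   using M'(7)[OF that, of e a] M'(7)[OF that, of a e] ee(2)[of a] by simp
 qed (simp_all add: M')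
 fix x assume x: "x IN M"
 then show "e \<odot>\<^bsub>M\<^esub> x IN M" by (simp add: M')
 show "e \<odot>\<^bsub>M\<^esub> (e \<odot>\<^bsub>M\<^esub> x) = x" "e \<odot>\<^bsub>M\<^esub> (e \<odot>\<^bsub>M\<^esub> x) = x" using M'(7)[OF x, of e e] M'(8)[OF x] ee(1) by simp_all
qed

definition dual_sum_iso :: "('a::involutive_ring, 'm, 'y) module_scheme => ('a, 'n, 'z) module_scheme =>
  ('m => 'a) \<times> ('n => 'a) => 'm \<times> 'n => 'a" where
 "dual_sum_iso M N = (\<lambda>(f, g). \<lambda>(x, y)\<in>carrier M \<times> carrier N. f x + g y)"

lemma dual_sum_iso_apply [simp]:
 "x IN M ==> y IN N ==> dual_sum_iso M N (f, g) (x, y) = f x + g y"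
 by (simp add: dual_sum_iso_def)

lemma dual_sum_iso_iso:
 fixes M :: "('a::involutive_ring, 'm, 'y) module_scheme" and N :: "('a, 'n, 'z) module_scheme"
 assumes M: "left_module M" and N: "left_module N"
 shows "dual_sum_iso M N \<in> module_isos (module_sum (dual M) (dual N)) (dual (module_sum M N))"
proof (rule module_isosI[where g = "\<lambda>F. (\<lambda>x\<in>carrier M. F (x, zero N), \<lambda>y\<in>carrier N. F (zero M, y))"])
 note M' = lmodD[OF M] and N' = lmodD[OF N] and lm = left_module_sum[OF M N]
 have cl: "dual_sum_iso M N p \<in> carrier (dual (module_sum M N))" if p: "p \<in> carrier (module_sum (dual M) (dual N))" for p
 proof -
  obtain f g where "p = (f, g)" "f IN (dual M)" "g IN (dual N)" using p by auto
  then show ?thesis by (intro dualI) (auto simp: dualD M' N' algebra_simps dual_sum_iso_def)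
 qed
 show "dual_sum_iso M N \<in> linear_maps (module_sum (dual M) (dual N)) (dual (module_sum M N))"
 proof (rule linI)
  show "dual_sum_iso M N (p \<oplus>\<^bsub>module_sum (dual M) (dual N)\<^esub> q) = dual_sum_iso M N p \<oplus>\<^bsub>dual (module_sum M N)\<^esub> dual_sum_iso M N q" for p q
   by (cases p; cases q) (auto simp: dual_sum_iso_def dual_simps(3) algebra_simps)
  show "dual_sum_iso M N (a \<odot>\<^bsub>module_sum (dual M) (dual N)\<^esub> p) = a \<odot>\<^bsub>dual (module_sum M N)\<^esub> dual_sum_iso M N p" for a p
   by (cases p) (auto simp: dual_sum_iso_def dual_simps(4) algebra_simps)
 qed (rule cl)
 fix F assume F: "F \<in> carrier (dual (module_sum M N))"
 note F' = dualD[OF F]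
 let ?p = "(\<lambda>x\<in>carrier M. F (x, zero N), \<lambda>y\<in>carrier N. F (zero M, y))"
 have "F (x \<oplus>\<^bsub>M\<^esub> x', zero N) = F (x, zero N) + F (x', zero N)" if "x IN M" "x' IN M" for x x'
  using F'(2)[of "(x, zero N)" "(x', zero N)"] that N' by simp
 moreover have "F (zero M, y \<oplus>\<^bsub>N\<^esub> y') = F (zero M, y) + F (zero M, y')" if "y IN N" "y' IN N" for y y'
  using F'(2)[of "(zero M, y)" "(zero M, y')"] that M' by simp
 moreover have "F (a \<odot>\<^bsub>M\<^esub> x, zero N) = a * F (x, zero N)" if "x IN M" for a x
  using F'(3)[of "(x, zero N)" a] that N' lmod_minus(4)[OF N N'(3)] by simp
 moreover have "F (zero M, a \<odot>\<^bsub>N\<^esub> y) = a * F (zero M, y)" if "y IN N" for a y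
  using F'(3)[of "(zero M, y)" a] that M' lmod_minus(4)[OF M M'(3)] by simp
 ultimately show p: "?p \<in> carrier (module_sum (dual M) (dual N))"
  by (auto intro!: dualI simp: M' N')
 show "dual_sum_iso M N ?p = F"
 proof (rule dual_ext[OF cl[OF p] F])
  fix z assume z: "z IN (module_sum M N)"
  then obtain x y where xy: "z = (x, y)" "x IN M" "y IN N" by auto
  then show "dual_sum_iso M N ?p z = F z"
   using F'(2)[of "(x, zero N)" "(zero M, y)"] M' N' by simp
 qed
next
 fix p assume p: "p \<in> carrier (module_sum (dual M) (dual N))"
 then obtain f g where fg: "p = (f, g)" "f IN (dual M)" "g IN (dual N)" by auto
 then show "(\<lambda>x\<in>carrier M. dual_sum_iso M N p (x, zero N), \<lambda>y\<in>carrier N. dual_sum_iso M N p (zero M, y)) = p"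
  using dual_zero[OF fg(2) M] dual_zero[OF fg(3) N] dualD(1)[OF fg(2)] dualD(1)[OF fg(3)] lmodD(3)[OF M] lmodD(3)[OF N]
  by (auto intro!: extensionalityI[of _ "carrier M"] extensionalityI[of _ "carrier N"])
qed

definition dual_map :: "('a::involutive_ring, 'm, 'z) module_scheme => ('m => 'n) => ('n => 'a) => 'm => 'a" where
 "dual_map M f F = (\<lambda>x\<in>carrier M. F (f x))"

lemma dual_map_apply [simp]: "x IN M ==> dual_map M f F x = F (f x)"
 by (simp add: dual_map_def)

lemma dual_map_linear:
 fixes M :: "('a::involutive_ring, 'm, 'y) module_scheme" and N :: "('a, 'n, 'z) module_scheme"
 assumes f: "f \<in> linear_maps M N" and M: "left_module M"
 shows "dual_map M f \<in> linear_maps (dual N) (dual M)"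
proof (rule linI)
 note f' = linD[OF f] and M' = lmodD[OF M]
 show "dual_map M f F IN (dual M)" if "F IN (dual N)" for F
  by (rule dualI) (use dualD[OF that] f' M' in \<open>auto simp: dual_map_def\<close>)
 show "dual_map M f (F \<oplus>\<^bsub>dual N\<^esub> G) = dual_map M f F \<oplus>\<^bsub>dual M\<^esub> dual_map M f G" for F G
  using f' by (auto simp: dual_map_def dual_simps(3))
 show "dual_map M f (a \<odot>\<^bsub>dual N\<^esub> F) = a \<odot>\<^bsub>dual M\<^esub> dual_map M f F" for a F
  using f' by (auto simp: dual_map_def dual_simps(4))
qed

lemma dual_map_iso:
 fixes M :: "('a::involutive_ring, 'm, 'y) module_scheme" and N :: "('a, 'n, 'z) module_scheme"
 assumes f: "f \<in> module_isos M N" and M: "left_module M" and N: "left_module N"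
 shows "dual_map M f \<in> module_isos (dual N) (dual M)"
proof (rule module_isosI[where g = "dual_map N (inv_map M f)"])
 note fi = module_isos_inv[OF f M] and i = inv_map[OF f]
 note l = dual_map_linear[OF module_isosD(1)[OF f] M] and l' = dual_map_linear[OF module_isosD(1)[OF fi] N]
 show "dual_map M f \<in> linear_maps (dual N) (dual M)" by (rule l)
 show "dual_map N (inv_map M f) F IN (dual N)" if "F IN (dual M)" for F
  using linD(1)[OF l'] that by blast
 show "dual_map N (inv_map M f) (dual_map M f F) = F" if F: "F IN (dual N)" for F
  by (rule dual_ext[OF linD(1)[OF l' linD(1)[OF l F]] F]) (use i in auto)
 show "dual_map M f (dual_map N (inv_map M f) F) = F" if F: "F IN (dual M)" for F
  by (rule dual_ext[OF linD(1)[OF l linD(1)[OF l' F]] F]) (use i module_isosD(3)[OF f] in auto)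
qed

text \<open>Biduality M -> M**. The conjugation is forced by the left structure of the dual, where a
  acts on the values by right multiplication with \<open>invol a\<close>.\<close>

definition evaluation :: "('a::involutive_ring, 'm, 'z) module_scheme => 'm => ('m => 'a) => 'a" where
 "evaluation M x = (\<lambda>F\<in>carrier (dual M). invol (F x))"

lemma evaluation_linear:
 fixes M :: "('a::involutive_ring, 'm, 'z) module_scheme"
 assumes M: "left_module M"
 shows "evaluation M \<in> linear_maps M (dual (dual M))"
proof (rule linI)
 note D = lmodD[OF left_module_dual[OF M]]
 show "evaluation M x \<in> carrier (dual (dual M))" if "x IN M" for x
  by (rule dualI) (use that D in \<open>auto simp: evaluation_def invol_add invol_mult\<close>)
 show "evaluation M (x \<oplus>\<^bsub>M\<^esub> y) = evaluation M x \<oplus>\<^bsub>dual (dual M)\<^esub> evaluation M y" if "x IN M" "y IN M" for x y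
  using that dualD(2) by (fastforce simp: evaluation_def dual_simps(3)[of "dual M"] invol_add)
 show "evaluation M (a \<odot>\<^bsub>M\<^esub> x) = a \<odot>\<^bsub>dual (dual M)\<^esub> evaluation M x" if "x IN M" for a x
  using that dualD(3) by (fastforce simp: evaluation_def dual_simps(4)[of "dual M"] invol_mult)
qed

definition vec_dual :: "nat => 'a::involutive_ring vec => 'a vec => 'a" where
 "vec_dual n b = (\<lambda>a\<in>carrier_vec n. vpair n a b)"

lemma vpair_sym: "invol (vpair n a b) = vpair n b a"
 by (simp add: vpair_def invol_sum invol_mult)

section \<open>The calculus of simple isomorphisms\<close>

context torsion_subgroup
begin

lemma common_frames:
 assumes "based M" "based N"
 obtains p n g m h where "frame M p n g" "frame N p m h"
proof -
 obtain p0 where p0: "\<forall>p\<ge>p0. \<exists>n g. frame M p n g \<and> n \<ge> p - p0" using frame_exists[OF assms(1)] by blast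
 obtain q0 where q0: "\<forall>p\<ge>q0. \<exists>n g. frame N p n g \<and> n \<ge> p - q0" using frame_exists[OF assms(2)] by blast
 obtain n g where "frame M (p0 + q0) n g" using p0[rule_format, of "p0 + q0"] by auto
 moreover obtain m h where "frame N (p0 + q0) m h" using q0[rule_format, of "p0 + q0"] by auto
 ultimately show ?thesis using that by blast
qed

lemma some_frame:
 assumes "based M"
 obtains p n g where "frame M p n g"
 using common_frames[OF assms assms] by blast

lemma based_sum_closed [simp]: "based M ==> based N ==> based (bsum M N)"
proof -
 assume M: "based M" and N: "based N"
 obtain p n g where g: "frame M p n g" by (rule some_frame[OF M])
 obtain q m h where h: "frame N q m h" by (rule some_frame[OF N])
 show ?thesis by (rule based_sum(1)[OF M N g h])
qed

lemma based_dual_closed [simp]: "based M ==> based (bdual M)"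
proof -
 assume M: "based M"
 obtain p n g where "frame M p n g" by (rule some_frame[OF M])
 then show ?thesis by (rule based_dual(1)[OF M])
qed

lemma based_free_closed [simp]: "based (bfree k)"
 by (rule based_free)

lemma sisoD:
 assumes "siso M N f"
 shows "f \<in> module_isos M N" "f \<in> linear_maps M N" "\<And>x. x IN M ==> f x IN N"
  "\<And>x y. x IN M ==> y IN M ==> f (x \<oplus>\<^bsub>M\<^esub> y) = f x \<oplus>\<^bsub>N\<^esub> f y"
  "\<And>a x. x IN M ==> f (a \<odot>\<^bsub>M\<^esub> x) = a \<odot>\<^bsub>N\<^esub> f x"
  "\<And>x. x IN M ==> inv_map M f (f x) = x" "\<And>y. y IN N ==> f (inv_map M f y) = y"
  "\<And>y. y IN N ==> inv_map M f y IN M"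
  "inj_on f (carrier M)" "f ` carrier M = carrier N"
proof -
 show f: "f \<in> module_isos M N" using assms by (simp add: simple_iso_def)
 show "f \<in> linear_maps M N" by (rule module_isosD(1)[OF f])
 show "inj_on f (carrier M)" "f ` carrier M = carrier N" using module_isosD(2)[OF f] by (auto simp: bij_betw_def)
qed (use linD[OF module_isosD(1)] inv_map assms in \<open>auto simp: simple_iso_def\<close>)

text \<open>The criterion by which the structural isomorphisms are checked: \<open>f\<close> has to
  match the two frames only up to a simple automorphism \<open>t\<close> of the source and another
  one, \<open>s\<close>, of the stabilising summand.\<close>

lemma simple_isoI_frames:
 assumes M: "based M" and N: "based N" and g: "frame M p n g" and h: "frame N p n h"
  and f: "f \<in> module_isos M N" and s: "simple_aut p s" and t: "simple_aut n t"
  and eq: "\<And>a. a INV n ==> map_prod f id (g a) = map_prod id s (h (t a))"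
 shows "siso M N f"
proof -
 have "is_frame N p n (map_prod f id \<circ> g)" using is_frame_map[OF f] g by (simp add: frame_def)
 then have "simple_aut n (frame_change n (map_prod f id \<circ> g) h)"
  using simple_frame_change_stab[OF basedD(1)[OF N] _ _ s t] h eq by (simp add: frame_def)
 then show ?thesis using simple_iso_iff[OF M N g h] f by simp
qed

lemma siso_id [intro]: "based M ==> siso M M id"
proof -
 assume M: "based M"
 then obtain p n g where "frame M p n g" by (rule some_frame)
 then show ?thesis
  using simple_isoI_frames[OF M M _ _ module_isos_id simple_aut_id simple_aut_id, of p n g g] by simp
qed

lemma siso_comp:
 assumes M: "based M" and N: "based N" and P: "based P"
  and f: "siso M N f" and k: "siso N P k"
 shows "siso M P (k \<circ> f)"
proof -
 obtain p0 where p0: "\<forall>p\<ge>p0. \<exists>n g. frame M p n g \<and> n \<ge> p - p0" using frame_exists[OF M] by blast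
 obtain q0 where q0: "\<forall>p\<ge>q0. \<exists>n g. frame N p n g \<and> n \<ge> p - q0" using frame_exists[OF N] by blast
 obtain r0 where r0: "\<forall>p\<ge>r0. \<exists>n g. frame P p n g \<and> n \<ge> p - r0" using frame_exists[OF P] by blast
 obtain n g where g: "frame M (p0 + q0 + r0) n g" using p0[rule_format, of "p0 + q0 + r0"] by auto
 obtain m h where h: "frame N (p0 + q0 + r0) m h" using q0[rule_format, of "p0 + q0 + r0"] by auto
 obtain l j where j: "frame P (p0 + q0 + r0) l j" using r0[rule_format, of "p0 + q0 + r0"] by auto
 let ?p = "p0 + q0 + r0"
 have fi: "f \<in> module_isos M N" and ki: "k \<in> module_isos N P" using f k by (simp_all add: sisoD)
 have 1: "n = m" "simple_aut n (frame_change n (map_prod f id \<circ> g) h)" using simple_iso_iff[OF M N g h] f by auto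
 have 2: "m = l" "simple_aut m (frame_change m (map_prod k id \<circ> h) j)" using simple_iso_iff[OF N P h j] k by auto
 have F: "is_frame N ?p n (map_prod f id \<circ> g)" "is_frame N ?p n h" "is_frame P ?p n j" "is_frame P ?p n (map_prod k id \<circ> h)"
  "is_frame P ?p n (map_prod (k \<circ> f) id \<circ> g)"
  using is_frame_map[OF fi] is_frame_map[OF ki] is_frame_map[OF module_isos_comp[OF fi ki]] g h j 1 2 by (simp_all add: frame_def)
 have "frame_change n (map_prod (k \<circ> f) id \<circ> g) (map_prod k id \<circ> h) a = frame_change n (map_prod f id \<circ> g) h a" if a: "a INV n" for a
 proof (rule frame_change_eq[OF F(4)])
  show "frame_change n (map_prod f id \<circ> g) h a INV n"
   using module_isosD(3)[OF frame_change_aut[OF F(1,2)]] a by simp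
  show "(map_prod k id \<circ> h) (frame_change n (map_prod f id \<circ> g) h a) = (map_prod (k \<circ> f) id \<circ> g) a"
   using frame_change_apply[OF F(1,2) a] by (simp add: map_prod.compositionality map_prod_def split: prod.split)
 qed
 then have "simple_aut n (frame_change n (map_prod (k \<circ> f) id \<circ> g) (map_prod k id \<circ> h))"
  by (intro simple_aut_cong[OF 1(2)]) simp
 then have "simple_aut n (frame_change n (map_prod (k \<circ> f) id \<circ> g) j)"
  using simple_frame_change_trans[OF F(5,4,3)] 2(2) 1(1) by simp
 then show ?thesis using simple_iso_iff[OF M P g j] module_isos_comp[OF fi ki] 1 2 by simp
qed

lemma simple_iso_cong:
 assumes "siso M N f" "based M" "based N" "\<And>x. x IN M ==> f x = f' x"
 shows "siso M N f'"
proof -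
 obtain p n g m h where g: "frame M p n g" and h: "frame N p m h" by (rule common_frames[OF assms(2,3)])
 have f': "f' \<in> module_isos M N"
  by (rule module_isos_cong[OF sisoD(1)[OF assms(1)]]) (use assms basedD(1) in auto)
 have 1: "n = m" "simple_aut n (frame_change n (map_prod f id \<circ> g) h)" using simple_iso_iff[OF assms(2,3) g h] assms(1) by auto
 have "is_frameD_g": "fst (g a) IN M" if "a INV n" for a using is_frameD(1) g that by (auto simp: frame_def)
 have "simple_aut n (frame_change n (map_prod f' id \<circ> g) h)"
  by (rule simple_aut_cong[OF 1(2)]) (use is_frameD_g assms(4) in \<open>auto simp: frame_change_def map_prod_def split: prod.split dest: fstI\<close>)
 then show ?thesis using simple_iso_iff[OF assms(2,3) g h] f' 1 by simp
qed

lemma siso_inv: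
 assumes M: "based M" and N: "based N" and f: "siso M N f"
 shows "siso N M (inv_map M f)"
proof -
 obtain p n g m h where g: "frame M p n g" and h: "frame N p m h" by (rule common_frames[OF M N])
 have fi: "f \<in> module_isos M N" by (rule sisoD[OF f])
 note ii = module_isos_inv[OF fi basedD(1)[OF M]]
 have 1: "n = m" "simple_aut n (frame_change n (map_prod f id \<circ> g) h)" using simple_iso_iff[OF M N g h] f by auto
 have F: "is_frame N p n (map_prod f id \<circ> g)" "is_frame N p n h" "is_frame M p n g" "is_frame M p n (map_prod (inv_map M f) id \<circ> h)"
  using is_frame_map[OF fi] is_frame_map[OF ii] g h 1 by (simp_all add: frame_def)
 have "frame_change n (map_prod (inv_map M f) id \<circ> h) g a = frame_change n h (map_prod f id \<circ> g) a" if a: "a INV n" for a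
 proof (rule frame_change_eq[OF F(3)])
  let ?b = "frame_change n h (map_prod f id \<circ> g) a"
  show b: "?b INV n" using module_isosD(3)[OF frame_change_aut[OF F(2,1)]] a by simp
  have "map_prod f id (g ?b) = h a" using frame_change_apply[OF F(2,1) a] by simp
  then show "g ?b = (map_prod (inv_map M f) id \<circ> h) a"
   using is_frameD(1)[OF F(3) b] sisoD(6)[OF f] by (cases "g ?b"; cases "h a") auto
 qed
 then have "simple_aut n (frame_change n (map_prod (inv_map M f) id \<circ> h) g)"
  by (intro simple_aut_cong[OF simple_frame_change_sym[OF F(1,2) 1(2)]]) simp
 then show ?thesis using simple_iso_iff[OF N M h g] ii 1 by simp
qed

lemma simple_iso_map_prod:
 assumes M: "based M" and N: "based N" and M': "based M'" and N': "based N'"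
  and f: "siso M M' f" and k: "siso N N' k"
 shows "siso (bsum M N) (bsum M' N') (map_prod f k)"
proof -
 obtain p n g m h where g: "frame M p n g" and h: "frame M' p m h" by (rule common_frames[OF M M'])
 obtain p' n' g' m' h' where g': "frame N p' n' g'" and h': "frame N' p' m' h'" by (rule common_frames[OF N N'])
 have fi: "f \<in> module_isos M M'" and ki: "k \<in> module_isos N N'" using f k by (simp_all add: sisoD)
 have 1: "n = m" "simple_aut n (frame_change n (map_prod f id \<circ> g) h)" using simple_iso_iff[OF M M' g h] f by auto
 have 2: "n' = m'" "simple_aut n' (frame_change n' (map_prod k id \<circ> g') h')" using simple_iso_iff[OF N N' g' h'] k by auto
 have F: "is_frame M' p n (map_prod f id \<circ> g)" "is_frame M' p n h" "is_frame N' p' n' (map_prod k id \<circ> g')" "is_frame N' p' n' h'"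
  using is_frame_map[OF fi] is_frame_map[OF ki] g h g' h' 1 2 by (simp_all add: frame_def)
 have s: "simple_aut (n + n') (frame_change (n + n') (sum_frame n n' (map_prod f id \<circ> g) (map_prod k id \<circ> g')) (sum_frame n n' h h'))"
  by (rule simple_sum_frame[OF F 1(2) 2(2)])
 have "simple_aut (n + n') (frame_change (n + n') (map_prod (map_prod f k) id \<circ> sum_frame n n' g g') (sum_frame n n' h h'))"
  by (rule simple_aut_cong[OF s]) (auto simp: frame_change_def dest!: append_vec_ex)
 then show ?thesis
  using simple_iso_iff[OF based_sum(1)[OF M N g g'] based_sum(1)[OF M' N' h h'] based_sum(2)[OF M N g g'] based_sum(2)[OF M' N' h h']]
   module_isos_map_prod[OF fi ki] 1 2 by simp
qed

text \<open>The dual map takes the dual of the transported frame back to the dual of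
  \<open>g\<close>. What remains is a change between dual frames on N, which is simple by
  \<open>simple_dual_frame\<close>.\<close>

lemma simple_iso_dual:
 fixes M :: "('a, 'm) based_module" and N :: "('a, 'n) based_module"
 assumes M: "based M" and N: "based N" and f: "siso M N f"
 shows "siso (bdual N) (bdual M) (dual_map M f)"
proof -
 obtain p n g m h where g: "frame M p n g" and h: "frame N p m h" by (rule common_frames[OF M N])
 have fi: "f \<in> module_isos M N" by (rule sisoD[OF f])
 note M' = basedD(1)[OF M] and N' = basedD(1)[OF N]
 have 1: "n = m" "simple_aut n (frame_change n (map_prod f id \<circ> g) h)" using simple_iso_iff[OF M N g h] f by auto
 have F: "is_frame N p n (map_prod f id \<circ> g)" "is_frame N p n h" "is_frame M p n g"
  using is_frame_map[OF fi] g h 1 by (simp_all add: frame_def)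
 note D = is_frame_dual[OF M' F(3)] is_frame_dual[OF N' F(1)] is_frame_dual[OF N' F(2)]
 note di = dual_map_iso[OF fi M' N']
 note G = is_frame_map[OF di D(2)]
 have eq: "(map_prod (dual_map M f) id \<circ> dual_frame N p n (map_prod f id \<circ> g)) b = dual_frame M p n g b" if b: "b INV n" for b
 proof (rule stab_pairing_ext[OF M'])
  show "(map_prod (dual_map M f) id \<circ> dual_frame N p n (map_prod f id \<circ> g)) b \<in> carrier (stabilised (dual M) p)"
   using is_frameD(1,2)[OF G b] by (simp add: mem_Times_iff)
  show "dual_frame M p n g b \<in> carrier (stabilised (dual M) p)" by (rule dual_frame[OF M' F(3) b])
  fix x and v :: "'a vec" assume xv: "x IN M" "v INV p"
  have "stab_pairing p ((map_prod (dual_map M f) id \<circ> dual_frame N p n (map_prod f id \<circ> g)) b) (x, v)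
    = stab_pairing p (dual_frame N p n (map_prod f id \<circ> g) b) (f x, v)"
   using xv by (simp add: stab_pairing_def)
  also have "\<dots> = vpair n (frame_inv n (map_prod f id \<circ> g) (f x, v)) b"
   by (rule dual_frame(2)[OF N' F(1) b _ xv(2)]) (use sisoD[OF f] xv in simp)
  also have "frame_inv n (map_prod f id \<circ> g) (f x, v) = frame_inv n g (x, v)"
   by (rule frame_inv_eq[OF F(1)]) (use frame_inv[OF F(3)] xv in auto)
  also have "vpair n (frame_inv n g (x, v)) b = stab_pairing p (dual_frame M p n g b) (x, v)"
   by (rule dual_frame(2)[OF M' F(3) b xv, symmetric])
  finally show "stab_pairing p ((map_prod (dual_map M f) id \<circ> dual_frame N p n (map_prod f id \<circ> g)) b) (x, v) = stab_pairing p (dual_frame M p n g b) (x, v)" .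
 qed
 have "simple_aut n (frame_change n (dual_frame N p n h) (dual_frame N p n (map_prod f id \<circ> g)))"
  by (rule simple_dual_frame[OF N' F(2,1) simple_frame_change_sym[OF F(1,2) 1(2)]])
 then have "simple_aut n (frame_change n (map_prod (dual_map M f) id \<circ> dual_frame N p n h) (dual_frame M p n g))"
 proof (rule simple_aut_cong)
  fix b :: "'a vec" assume b: "b INV n"
  let ?c = "frame_change n (dual_frame N p n h) (dual_frame N p n (map_prod f id \<circ> g)) b"
  have c: "?c INV n" using module_isosD(3)[OF frame_change_aut[OF D(3,2)]] b by simp
  show "?c = frame_change n (map_prod (dual_map M f) id \<circ> dual_frame N p n h) (dual_frame M p n g) b"
   by (rule frame_change_eq[OF D(1) c, symmetric]) (simp add: eq[OF c, symmetric] frame_change_apply[OF D(3,2) b])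
 qed
 then show ?thesis
  using simple_iso_iff[OF based_dual(1)[OF N h] based_dual(1)[OF M g] based_dual(2)[OF N h] based_dual(2)[OF M g]] di 1 by simp
qed

lemma simple_swap_blocks: "simple_aut (m + d) (swap_blocks m d)"
 by (simp add: simple_aut_def swap_blocks_aut torsion_swap_blocks Z_closed)

lemma simple_neg: "simple_aut n uminus"
 by (simp add: simple_aut_def neg_aut torsion_neg Z_closed)

lemma simple_iso_swap:
 assumes M: "based M" and N: "based N"
 shows "siso (bsum M N) (bsum N M) prod.swap"
proof -
 obtain p n g where g: "frame M p n g" by (rule some_frame[OF M])
 obtain q m h where h: "frame N q m h" by (rule some_frame[OF N])
 have gi: "is_frame M p n g" and hi: "is_frame N q m h" using g h by (simp_all add: frame_def)
 have h2: "frame (bsum N M) (p + q) (n + m) (sum_frame m n h g)"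
  using based_sum(2)[OF N M h g] by (simp add: add.commute)
 show ?thesis
 proof (rule simple_isoI_frames[OF based_sum(1)[OF M N g h] based_sum(1)[OF N M h g] based_sum(2)[OF M N g h] h2])
  show "prod.swap \<in> module_isos (bsum M N) (bsum N M)" by (simp add: module_isos_swap)
  show "simple_aut (p + q) (swap_blocks q p)" using simple_swap_blocks[of q p] by (simp add: add.commute)
  show "simple_aut (n + m) (swap_blocks n m)" by (rule simple_swap_blocks)
  fix a :: "'a vec" assume "a INV (n + m)"
  then show "map_prod prod.swap id (sum_frame n m g h a) = map_prod id (swap_blocks q p) (sum_frame m n h g (swap_blocks n m a))"
   using is_frameD(2)[OF gi] is_frameD(2)[OF hi] by (auto dest!: append_vec_ex)
 qed
qed

lemma simple_iso_interchange:
 assumes M: "based M" and N: "based N" and P: "based P" and Q: "based Q"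
 shows "siso (bsum (bsum M N) (bsum P Q)) (bsum (bsum M P) (bsum N Q)) interchange"
proof -
 obtain p n g where g: "frame M p n g" by (rule some_frame[OF M])
 obtain q m h where h: "frame N q m h" by (rule some_frame[OF N])
 obtain p' n' g' where g': "frame P p' n' g'" by (rule some_frame[OF P])
 obtain q' m' h' where h': "frame Q q' m' h'" by (rule some_frame[OF Q])
 have i: "is_frame M p n g" "is_frame N q m h" "is_frame P p' n' g'" "is_frame Q q' m' h'" using g h g' h' by (simp_all add: frame_def)
 note s1 = based_sum[OF M N g h] and s2 = based_sum[OF P Q g' h'] and s3 = based_sum[OF M P g g'] and s4 = based_sum[OF N Q h h']
 note A = based_sum[OF s1(1) s2(1) s1(2) s2(2)] and B = based_sum[OF s3(1) s4(1) s3(2) s4(2)]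
 have "p + p' + (q + q') = p + q + (p' + q')" "n + n' + (m + m') = n + m + (n' + m')" by simp_all
 note B2 = B(2)[unfolded this]
 show ?thesis
 proof (rule simple_isoI_frames[OF A(1) B(1) A(2) B2])
  show "interchange \<in> module_isos (bsum (bsum M N) (bsum P Q)) (bsum (bsum M P) (bsum N Q))"
   by (rule module_isosI[where g = interchange]; (rule linI)?) auto
  show "simple_aut (p + q + (p' + q')) (interchange_blocks p p' q q')"
   using simple_interchange_blocks[of p p' q q'] by (simp add: ac_simps)
  show "simple_aut (n + m + (n' + m')) (interchange_blocks n m n' m')" by (rule simple_interchange_blocks)
  fix v :: "'a vec" assume "v \<in> carrier_vec (n + m + (n' + m'))"
  then obtain a b c w where v: "v = (a @\<^sub>v b) @\<^sub>v (c @\<^sub>v w)" "a INV n" "b INV m" "c INV n'" "w INV m'"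
   by (rule append_vec_ex4)
  then show "map_prod interchange id (sum_frame (n + m) (n' + m') (sum_frame n m g h) (sum_frame n' m' g' h') v) =
    map_prod id (interchange_blocks p p' q q') (sum_frame (n + n') (m + m') (sum_frame n n' g g') (sum_frame m m' h h') (interchange_blocks n m n' m' v))"
   using is_frameD(2)[OF i(1)] is_frameD(2)[OF i(2)] is_frameD(2)[OF i(3)] is_frameD(2)[OF i(4)] by simp
 qed
qed

lemma simple_iso_reassoc:
 assumes M: "based M" and N: "based N" and P: "based P"
 shows "siso (bsum (bsum M N) P) (bsum M (bsum N P)) reassoc"
proof -
 obtain p n g where g: "frame M p n g" by (rule some_frame[OF M])
 obtain q m h where h: "frame N q m h" by (rule some_frame[OF N])
 obtain r l k where k: "frame P r l k" by (rule some_frame[OF P])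
 note s1 = based_sum[OF M N g h] and s2 = based_sum[OF N P h k]
 note A = based_sum[OF s1(1) P s1(2) k] and B = based_sum[OF M s2(1) g s2(2), folded add.assoc]
 show ?thesis
 proof (rule simple_isoI_frames[OF A(1) B(1) A(2) B(2)])
  show "reassoc \<in> module_isos (bsum (bsum M N) P) (bsum M (bsum N P))"
   by (rule module_isosI[where g = "\<lambda>(x, (y, z)). ((x, y), z)"]; (rule linI)?) auto
  fix v :: "'a vec" assume "v INV (n + m + l)"
  then obtain a b c where v: "v = (a @\<^sub>v b) @\<^sub>v c" "a INV n" "b INV m" "c INV l"
   by (metis append_vec_cases)
  have "map_prod reassoc id (sum_frame (n + m) l (sum_frame n m g h) k v) = ((fst (g a), (fst (h b), fst (k c))), (snd (g a) @\<^sub>v snd (h b)) @\<^sub>v snd (k c))"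
   unfolding v using v(2-) by simp
  moreover have "sum_frame n (m + l) g (sum_frame m l h k) v = ((fst (g a), (fst (h b), fst (k c))), snd (g a) @\<^sub>v (snd (h b) @\<^sub>v snd (k c)))"
   unfolding v append_vec_assoc using v(2-) by simp
  ultimately show "map_prod reassoc id (sum_frame (n + m) l (sum_frame n m g h) k v) = map_prod id id (sum_frame n (m + l) g (sum_frame m l h k) (id v))"
   by (simp add: append_vec_assoc)
 qed (rule simple_aut_id)+
qed

text \<open>Through the frames this becomes the shear of \<Lambda>^(n+m) by \<open>?X\<close>, where
  f is followed by the inverse of \<open>g\<close> with stabilising part 0. Shears have trivial
  torsion.\<close>

lemma simple_iso_shear:
 assumes M: "based M" and N: "based N" and f: "f \<in> linear_maps N M"
 shows "siso (bsum M N) (bsum M N) (\<lambda>(x, y). (x \<oplus>\<^bsub>M\<^esub> f y, y))"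
proof -
 obtain p n g where g: "frame M p n g" by (rule some_frame[OF M])
 obtain q m h where h: "frame N q m h" by (rule some_frame[OF N])
 have gi: "is_frame M p n g" and hi: "is_frame N q m h" using g h by (simp_all add: frame_def)
 note S = based_sum[OF M N g h]
 note M' = basedD(1)[OF M] and lf = linD[OF f]
 note inv = linD[OF frame_inv_lin[OF gi M']]
 let ?X = "\<lambda>b. frame_inv n g (f (fst (h b)), 0\<^sub>v p)"
 have X: "?X \<in> lin m n"
 proof (rule linI)
  show "?X (a \<oplus>\<^bsub>free_module m\<^esub> b) = ?X a \<oplus>\<^bsub>free_module n\<^esub> ?X b" if "a IN (free_module m)" "b IN (free_module m)" for a b
   using inv(2)[of "(f (fst (h a)), 0\<^sub>v p)" "(f (fst (h b)), 0\<^sub>v p)"] that is_frameD[OF hi] lf by simp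
  show "?X (c \<odot>\<^bsub>free_module m\<^esub> b) = c \<odot>\<^bsub>free_module n\<^esub> ?X b" if "b IN (free_module m)" for c b
  proof -
   have "c \<cdot>\<^sub>v 0\<^sub>v p = (0\<^sub>v p :: 'a vec)" by (intro eq_vecI) auto
   then show ?thesis using inv(3)[of "(f (fst (h b)), 0\<^sub>v p)" c] that is_frameD[OF hi] lf by simp
  qed
 qed (use inv(1) is_frameD[OF hi] lf in auto)
 show ?thesis
 proof (rule simple_isoI_frames[OF S(1) S(1) S(2) S(2) _ simple_aut_id])
  show "(\<lambda>(x, y). (x \<oplus>\<^bsub>M\<^esub> f y, y)) \<in> module_isos (bsum M N) (bsum M N)"
   using module_isos_shear[OF M' basedD(1)[OF N] f] by simp
  show "simple_aut (n + m) (upper_shear n m ?X)"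
   by (rule simple_aut_torsion_free[OF torsion_free_shear(1)[OF X]])
  fix v :: "'a vec" assume "v INV (n + m)"
  then obtain a b where v: "v = a @\<^sub>v b" "a INV n" "b INV m" by (metis append_vec_cases)
  have c: "?X b INV n" using linD(1)[OF X] v by simp
  have "g (?X b) = (f (fst (h b)), 0\<^sub>v p)" by (rule frame_inv(2)[OF gi]) (use is_frameD[OF hi] lf v in auto)
  then show "map_prod (\<lambda>(x, y). (x \<oplus>\<^bsub>M\<^esub> f y, y)) id (sum_frame n m g h v) = map_prod id id (sum_frame n m g h (upper_shear n m ?X v))"
   using v c is_frameD[OF gi] by simp
 qed
qed

lemma simple_iso_shear':
 assumes M: "based M" and N: "based N" and f: "f \<in> linear_maps M N"
 shows "siso (bsum M N) (bsum M N) (\<lambda>(x, y). (x, y \<oplus>\<^bsub>N\<^esub> f x))"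
proof -
 note b = based_sum_closed[OF M N] based_sum_closed[OF N M]
 have "siso (bsum M N) (bsum M N) (prod.swap \<circ> ((\<lambda>(x, y). (x \<oplus>\<^bsub>N\<^esub> f y, y)) \<circ> prod.swap))"
  by (rule siso_comp[OF b(1,2,1) siso_comp[OF b(1,2,2) simple_iso_swap[OF M N] simple_iso_shear[OF N M f]] simple_iso_swap[OF N M]])
 then show ?thesis by (rule simple_iso_cong) (use b in auto)
qed

lemma simple_iso_sign:
 assumes M: "based M" and e: "e = 1 \<or> e = - 1"
 shows "siso M M (\<lambda>x. e \<odot>\<^bsub>M\<^esub> x)"
proof (cases "e = 1")
 case True
 then show ?thesis using simple_iso_cong[OF siso_id[OF M] M M] lmodD[OF basedD(1)[OF M]] by simp
next
 case False
 then have e1: "e = - 1" using e by simp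
 obtain p n g where g: "frame M p n g" by (rule some_frame[OF M])
 then have gi: "is_frame M p n g" by (simp add: frame_def)
 show ?thesis
 \<comment> \<open>Negation on \<Lambda>^n also negates the stabilising coordinates; a second
   negation, on \<Lambda>^p, undoes this.\<close>
 proof (rule simple_isoI_frames[OF M M g g module_isos_minus[OF basedD(1)[OF M] e] simple_neg simple_neg])
  fix a :: "'a vec" assume a: "a INV n"
  have m: "(- 1) \<cdot>\<^sub>v v = - v" for v :: "'a vec" by (intro eq_vecI) auto
  have "fst (g (- a)) = (- 1) \<odot>\<^bsub>M\<^esub> fst (g a)" "snd (g (- a)) = - snd (g a)"
   using is_frameD(5,6)[OF gi a, of "- 1"] unfolding m by simp_all
  then show "map_prod ((\<odot>\<^bsub>M\<^esub>) e) id (g a) = map_prod id uminus (g (- a))"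
   using e1 is_frameD(2)[OF gi a] by (cases "g a"; cases "g (- a)") auto
 qed
qed

text \<open>The identification takes the sum of the dual frames to the dual of the sum frame without
  any reordering.\<close>

lemma simple_iso_dual_sum:
 fixes M :: "('a, 'm) based_module" and N :: "('a, 'n) based_module"
 assumes M: "based M" and N: "based N"
 shows "siso (bsum (bdual M) (bdual N)) (bdual (bsum M N)) (dual_sum_iso M N)"
proof -
 obtain p n g where g: "frame M p n g" by (rule some_frame[OF M])
 obtain q m h where h: "frame N q m h" by (rule some_frame[OF N])
 have gi: "is_frame M p n g" and hi: "is_frame N q m h" using g h by (simp_all add: frame_def)
 note M' = basedD(1)[OF M] and N' = basedD(1)[OF N]
 note S = based_sum[OF M N g h] and DM = based_dual[OF M g] and DN = based_dual[OF N h]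
 note SD = based_sum[OF DM(1) DN(1) DM(2) DN(2)] and DS = based_dual[OF S]
 have iso: "dual_sum_iso M N \<in> module_isos (bsum (bdual M) (bdual N)) (bdual (bsum M N))"
  using dual_sum_iso_iso[OF M' N'] unfolding module_isos_def linear_maps_def by (auto simp: dual_based_sum Pi_iff)
 have fs: "is_frame (bsum M N) (p + q) (n + m) (sum_frame n m g h)" using S by (simp add: frame_def)
 show ?thesis
 proof (rule simple_isoI_frames[OF SD(1) DS(1) SD(2) DS(2) iso simple_aut_id simple_aut_id])
  fix v :: "'a vec" assume "v INV (n + m)"
  then obtain a b where v: "v = a @\<^sub>v b" "a INV n" "b INV m" by (metis append_vec_cases)
  note da = dual_frame[OF M' gi v(2)] and db = dual_frame[OF N' hi v(3)]
  have SM: "left_module (bsum M N)" using S basedD by blast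
  have vc: "a @\<^sub>v b INV (n + m)" using v by simp
  note ds = dual_frame[OF SM fs vc]
  have "map_prod (dual_sum_iso M N) id (sum_frame n m (dual_frame M p n g) (dual_frame N q m h) v) = dual_frame (bsum M N) (p + q) (n + m) (sum_frame n m g h) v"
   unfolding v
  proof (rule stab_pairing_ext[OF SM _ ds(1)])
   show "map_prod (dual_sum_iso M N) id (sum_frame n m (dual_frame M p n g) (dual_frame N q m h) (a @\<^sub>v b)) \<in> carrier (stabilised (dual (bsum M N)) (p + q))"
    using da(1) db(1) v module_isosD(3)[OF dual_sum_iso_iso[OF M' N']] by (auto simp: mem_Times_iff dual_based_sum)
   fix x and w :: "'a vec" assume "x IN (bsum M N)" and "w INV (p + q)"
   then obtain y z where yz: "x = (y, z)" "y IN M" "z IN N" by auto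
   obtain w1 w2 where w12: "w = w1 @\<^sub>v w2" "w1 INV p" "w2 INV q"
    using append_vec_ex[OF \<open>w INV (p + q)\<close>] by blast
   note xw = yz w12
   have inv: "frame_inv (n + m) (sum_frame n m g h) (x, w) = frame_inv n g (y, w1) @\<^sub>v frame_inv m h (z, w2)"
    by (rule frame_inv_eq[OF fs]) (use frame_inv[OF gi] frame_inv[OF hi] xw in auto)
   have "stab_pairing (p + q) (dual_frame (bsum M N) (p + q) (n + m) (sum_frame n m g h) (a @\<^sub>v b)) (x, w)
     = vpair (n + m) (frame_inv n g (y, w1) @\<^sub>v frame_inv m h (z, w2)) (a @\<^sub>v b)"
    unfolding inv[symmetric] by (rule ds(2)) (use xw in auto)
   also have "\<dots> = vpair n (frame_inv n g (y, w1)) a + vpair m (frame_inv m h (z, w2)) b"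
    using frame_inv[OF gi] frame_inv[OF hi] xw v by (simp add: vpair_append)
   also have "\<dots> = stab_pairing p (dual_frame M p n g a) (y, w1) + stab_pairing q (dual_frame N q m h b) (z, w2)"
    using da(2) db(2) xw by simp
   also have "\<dots> = stab_pairing (p + q) (map_prod (dual_sum_iso M N) id (sum_frame n m (dual_frame M p n g) (dual_frame N q m h) (a @\<^sub>v b))) (x, w)"
    using da(1) db(1) xw v by (simp add: stab_pairing_def vpair_append[of _ p _ q] mem_Times_iff)
   finally show "stab_pairing (p + q) (map_prod (dual_sum_iso M N) id (sum_frame n m (dual_frame M p n g) (dual_frame N q m h) (a @\<^sub>v b))) (x, w)
     = stab_pairing (p + q) (dual_frame (bsum M N) (p + q) (n + m) (sum_frame n m g h) (a @\<^sub>v b)) (x, w)" by simp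
  qed
  then show "map_prod (dual_sum_iso M N) id (sum_frame n m (dual_frame M p n g) (dual_frame N q m h) v) =
    map_prod id id (dual_frame (bsum M N) (p + q) (n + m) (sum_frame n m g h) (id v))" by (simp add: prod.map_id0)
 qed
qed

lemma dual_based_dual: "dual (bdual M) = dual (dual M)"
 by (simp add: dual_def based_dual_def)

text \<open>Both sides pair with a stabilised functional to the conjugate of its value on
  \<open>g a\<close>. Hence biduality carries a frame to its double dual and is simple.\<close>

lemma evaluation_bij:
 fixes M :: "('a, 'm) based_module"
 assumes M: "based M" and g: "frame M p n g" and a: "a INV n"
 shows "map_prod (evaluation M) id (g a) = dual_frame (bdual M) p n (dual_frame M p n g) a"
proof -
 note M' = basedD(1)[OF M] and D = based_dual[OF M g]
 have gi: "is_frame M p n g" using g by (simp add: frame_def)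
 have di: "is_frame (bdual M) p n (dual_frame M p n g)" using D by (simp add: frame_def)
 note D' = basedD(1)[OF D(1)]
 have ga: "fst (g a) IN M" "snd (g a) INV p" using is_frameD[OF gi] a by auto
 show ?thesis
 proof (rule stab_pairing_ext[OF D'])
  show "map_prod (evaluation M) id (g a) \<in> carrier (stabilised (dual (bdual M)) p)"
   using ga linD(1)[OF evaluation_linear[OF M']] by (cases "g a") (auto simp: dual_based_dual)
  show "dual_frame (bdual M) p n (dual_frame M p n g) a \<in> carrier (stabilised (dual (bdual M)) p)"
   by (rule dual_frame[OF D' di a])
  fix F and w :: "'a vec" assume Fw: "F IN (bdual M)" "w INV p"
  let ?b = "frame_inv n (dual_frame M p n g) (F, w)"
  have b: "?b INV n" "dual_frame M p n g ?b = (F, w)" using frame_inv(2,3)[OF di Fw] by auto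
  have "stab_pairing p (dual_frame (bdual M) p n (dual_frame M p n g) a) (F, w) = vpair n ?b a"
   by (rule dual_frame(2)[OF D' di a Fw])
  also have "\<dots> = invol (vpair n a ?b)" by (simp add: vpair_sym)
  also have "\<dots> = invol (stab_pairing p (F, w) (g a))" using dual_frame(3)[OF M' gi b(1) a] b(2) by simp
  also have "\<dots> = stab_pairing p (map_prod (evaluation M) id (g a)) (F, w)"
   using ga Fw by (simp add: stab_pairing_def evaluation_def invol_add vpair_sym)
  finally show "stab_pairing p (map_prod (evaluation M) id (g a)) (F, w) = stab_pairing p (dual_frame (bdual M) p n (dual_frame M p n g) a) (F, w)"
   by simp
 qed
qed

lemma simple_iso_evaluation:
 fixes M :: "('a, 'm) based_module"
 assumes M: "based M"
 shows "siso M (bdual (bdual M)) (evaluation M)"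
proof -
 obtain p n g where g: "frame M p n g" by (rule some_frame[OF M])
 note M' = basedD(1)[OF M] and D = based_dual[OF M g]
 note DD = based_dual[OF D]
 have gi: "is_frame M p n g" and ddi: "is_frame (dual (dual M)) p n (dual_frame (bdual M) p n (dual_frame M p n g))"
  using g DD unfolding frame_def is_frame_def by (simp_all add: dual_based_dual module_sum_def)
 note ev = evaluation_bij[OF M g] and ll = linD[OF evaluation_linear[OF M']]
 have iso: "evaluation M \<in> module_isos M (dual (dual M))"
 proof (rule module_isosI[where g = "\<lambda>F. fst (g (frame_inv n (dual_frame (bdual M) p n (dual_frame M p n g)) (F, 0\<^sub>v p)))"])
  show "evaluation M \<in> linear_maps M (dual (dual M))" by (rule evaluation_linear[OF M'])
  fix F assume F: "F \<in> carrier (dual (dual M))"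
  let ?a = "frame_inv n (dual_frame (bdual M) p n (dual_frame M p n g)) (F, 0\<^sub>v p)"
  have a: "?a INV n" "dual_frame (bdual M) p n (dual_frame M p n g) ?a = (F, 0\<^sub>v p)"
   using frame_inv(2,3)[OF ddi F, of "0\<^sub>v p"] by auto
  show "fst (g ?a) IN M" using is_frameD[OF gi] a by simp
  show "evaluation M (fst (g ?a)) = F" using ev[OF a(1)] a(2) by (cases "g ?a") simp
 next
  fix x assume x: "x IN M"
  let ?b = "frame_inv n g (x, 0\<^sub>v p)"
  have b: "?b INV n" "g ?b = (x, 0\<^sub>v p)" using frame_inv(2,3)[OF gi x, of "0\<^sub>v p"] by auto
  have "frame_inv n (dual_frame (bdual M) p n (dual_frame M p n g)) (evaluation M x, 0\<^sub>v p) = ?b"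
   by (rule frame_inv_eq[OF ddi b(1)]) (use ev[OF b(1)] b(2) in simp)
  then show "fst (g (frame_inv n (dual_frame (bdual M) p n (dual_frame M p n g)) (evaluation M x, 0\<^sub>v p))) = x"
   using b(2) by simp
 qed
 show ?thesis
  by (rule simple_isoI_frames[OF M DD(1) g DD(2) _ simple_aut_id simple_aut_id])
   (use iso ev in \<open>auto simp: dual_based_dual prod.map_id0\<close>)
qed

lemma simple_iso_vec_dual: "siso (bfree k) (bdual (bfree k)) (vec_dual k)"
proof -
 note F = based_free(1)[where k = k] based_free(2)[where k = k and p = 0]
 note D = based_dual[OF F]
 have fi: "is_frame (bfree k) 0 (k + 0) (on_append k 0 Pair)" using F by (simp add: frame_def)
 have di: "is_frame (dual (bfree k)) 0 (k + 0) (dual_frame (bfree k) 0 (k + 0) (on_append k 0 Pair))"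
  using D unfolding frame_def is_frame_def by (simp add: module_sum_def)
 note F' = basedD(1)[OF F(1)]
 have v0: "w = 0\<^sub>v 0" if "w INV 0" for w :: "'a vec" using that by (intro eq_vecI) auto
 have app: "on_append k 0 Pair a = (a, 0\<^sub>v 0)" if "a INV k" for a :: "'a vec"
  using that by (auto simp: on_append_def vec_first_def vec_last_def intro!: eq_vecI)
 have lin: "vec_dual k \<in> linear_maps (bfree k) (dual (bfree k))"
 proof (rule linI)
  show "vec_dual k x \<in> carrier (dual (bfree k))" if "x IN (bfree k)" for x
   by (rule dualI) (use that in \<open>auto simp: vec_dual_def vpair_add[of _ k]\<close>)
 qed (auto simp: vec_dual_def dual_simps(3,4) vpair_add[of _ k])
 have eq: "(vec_dual k a, 0\<^sub>v 0) = dual_frame (bfree k) 0 (k + 0) (on_append k 0 Pair) a" if a: "a INV k" for a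
 proof (rule stab_pairing_ext[OF F'])
  have a': "a INV (k + 0)" using a by simp
  show "(vec_dual k a, 0\<^sub>v 0) \<in> carrier (stabilised (dual (bfree k)) 0)" using linD(1)[OF lin, of a] a by simp
  show "dual_frame (bfree k) 0 (k + 0) (on_append k 0 Pair) a \<in> carrier (stabilised (dual (bfree k)) 0)"
   by (rule dual_frame[OF F' fi a'])
  fix x and w :: "'a vec" assume xw: "x IN (bfree k)" "w INV 0"
  have "frame_inv (k + 0) (on_append k 0 Pair) (x, w) = x"
   by (rule frame_inv_eq[OF fi]) (use xw app v0 in auto)
  then show "stab_pairing 0 (vec_dual k a, 0\<^sub>v 0) (x, w) = stab_pairing 0 (dual_frame (bfree k) 0 (k + 0) (on_append k 0 Pair) a) (x, w)"
   using dual_frame(2)[OF F' fi a' xw] xw by (simp add: stab_pairing_def vec_dual_def vpair_def)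
 qed
 have iso: "vec_dual k \<in> module_isos (bfree k) (dual (bfree k))"
 proof (rule module_isosI[OF lin, where g = "\<lambda>F. frame_inv (k + 0) (dual_frame (bfree k) 0 (k + 0) (on_append k 0 Pair)) (F, 0\<^sub>v 0)"])
  fix F assume F: "F \<in> carrier (dual (bfree k))"
  show "frame_inv (k + 0) (dual_frame (bfree k) 0 (k + 0) (on_append k 0 Pair)) (F, 0\<^sub>v 0) IN (bfree k)"
   using frame_inv(3)[OF di F, of "0\<^sub>v 0"] by simp
  then show "vec_dual k (frame_inv (k + 0) (dual_frame (bfree k) 0 (k + 0) (on_append k 0 Pair)) (F, 0\<^sub>v 0)) = F"
   using eq frame_inv(2)[OF di F, of "0\<^sub>v 0"] by (metis free_based_simps(1) fst_conv zero_carrier_vec)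
 next
  fix x :: "'a vec" assume "x IN (bfree k)"
  then show "frame_inv (k + 0) (dual_frame (bfree k) 0 (k + 0) (on_append k 0 Pair)) (vec_dual k x, 0\<^sub>v 0) = x"
   by (intro frame_inv_eq[OF di]) (simp, rule eq[symmetric], simp)
 qed
 show ?thesis
  by (rule simple_isoI_frames[OF F(1) D(1) F(2) D(2) _ simple_aut_id simple_aut_id])
   (use iso eq app in \<open>auto simp: prod.map_id0\<close>)
qed

text \<open>Used to replace a stably free module by a free one. Here \<Lambda>^p occurs twice, as a
  summand of the target and as the stabilising module; the two frames differ by exchanging these
  copies, and \<open>torsion_frame_stab\<close> shows that the exchange is simple.\<close>

lemma simple_iso_frame:
 fixes M :: "('a, 'm) based_module"
 assumes M: "based M" and g: "frame M p n g"
 shows "siso (bfree n) (bsum M (bfree p)) g"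
proof -
 note Fn = based_free(1)[where k = n] based_free(2)[where k = n and p = p] and Fp = based_free(1)[where k = p] based_free(2)[where k = p and p = 0]
 note S = based_sum[OF M Fp(1) g Fp(2)]
 have gi: "is_frame M p n g" using g by (simp add: frame_def)
 have Fn2: "frame (bfree n) (p + 0) (n + (p + 0)) (on_append n p Pair)" using Fn(2) by simp
 have Si: "is_frame (bsum M (bfree p)) (p + 0) (n + (p + 0)) (sum_frame n (p + 0) g (on_append p 0 Pair))"
  using S(2) by (simp add: frame_def)
 have iso: "g \<in> module_isos (bfree n) (bsum M (bfree p))"
 proof -
  have "carrier (bsum M (bfree p)) = carrier (stabilised M p)" "add (bsum M (bfree p)) = add (stabilised M p)"
   "smult (bsum M (bfree p)) = smult (stabilised M p)"
   by (simp_all add: based_sum_def module_sum_def)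
  then show ?thesis using gi unfolding is_frame_def module_isos_def linear_maps_def by simp
 qed
 note eg = is_frame_extend[OF gi, of p]
 let ?k = "frame_inv (n + p) (extend_frame n p g) \<circ> (map_prod id (swap_blocks p p) \<circ> extend_frame n p g)"
 have k: "simple_aut (n + p) ?k"
  using torsion_frame_stab[OF basedD(1)[OF M] eg swap_blocks_aut] simple_swap_blocks[of p p] by (simp add: simple_aut_def)
 have "simple_aut (n + p) (frame_change (n + p) (map_prod g id \<circ> on_append n p Pair) (sum_frame n (p + 0) g (on_append p 0 Pair)))"
 proof (rule simple_aut_cong[OF k])
  fix v :: "'a vec" assume vc: "v INV (n + p)"
  then obtain a b where v: "v = a @\<^sub>v b" "a INV n" "b INV p" by (metis append_vec_cases)
  have gc: "fst (g a) IN M" "snd (g a) INV p" using is_frameD[OF gi v(2)] by auto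
  let ?c = "frame_inv n g (fst (g a), b)"
  have c: "?c INV n" "g ?c = (fst (g a), b)" using frame_inv(2,3)[OF gi gc(1) v(3)] by auto
  have "?k v = ?c @\<^sub>v snd (g a)"
   unfolding o_def by (rule frame_inv_eq[OF eg]) (use v c gc in auto)
  moreover have "frame_change (n + p) (map_prod g id \<circ> on_append n p Pair) (sum_frame n (p + 0) g (on_append p 0 Pair)) v = ?c @\<^sub>v snd (g a)"
  proof (rule frame_change_eq)
   show "is_frame (bsum M (bfree p)) (p + 0) (n + p) (sum_frame n (p + 0) g (on_append p 0 Pair))" using Si by simp
   have "on_append p 0 Pair x = (x, 0\<^sub>v 0)" if "x INV p" for x :: "'a vec"
    using that by (auto simp: on_append_def vec_first_def vec_last_def intro!: eq_vecI)
   moreover have "b @\<^sub>v 0\<^sub>v 0 = b" by (intro eq_vecI) auto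
   ultimately show "sum_frame n (p + 0) g (on_append p 0 Pair) (?c @\<^sub>v snd (g a)) = (map_prod g id \<circ> on_append n p Pair) v"
    using v c gc by simp
  qed (use c gc in simp)
  ultimately show "?k v = frame_change (n + p) (map_prod g id \<circ> on_append n p Pair) (sum_frame n (p + 0) g (on_append p 0 Pair)) v" by simp
 qed
 then show ?thesis
  using simple_iso_iff[OF Fn(1) S(1) Fn2 S(2)] iso by simp
qed

lemma simple_iso_append: "siso (bsum (bfree k) (bfree l)) (bfree (k + l)) (\<lambda>(a, b). a @\<^sub>v b)"
proof -
 note Fk = based_free(1)[where k = k] based_free(2)[where k = k and p = 0] and Fl = based_free(1)[where k = l] based_free(2)[where k = l and p = 0] and F = based_free(1)[where k = "k + l"] based_free(2)[where k = "k + l" and p = "0 + 0"]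
 note S = based_sum[OF Fk(1) Fl(1) Fk(2) Fl(2)]
 have F2: "frame (bfree (k + l)) (0 + 0) (k + 0 + (l + 0)) (on_append (k + l) 0 Pair)" using F(2) by simp
 have app: "on_append n 0 Pair x = (x, 0\<^sub>v 0)" if "x INV n" for n and x :: "'a vec"
  using that by (auto simp: on_append_def vec_first_def vec_last_def intro!: eq_vecI)
 have iso: "(\<lambda>(a, b). a @\<^sub>v b) \<in> module_isos (bsum (bfree k) (bfree l)) (bfree (k + l))"
  by (rule module_isosI[where g = "on_append k l Pair"]; (rule linI)?)
   (auto simp: append_vec_ops[of _ k _ l] dest!: append_vec_ex)
 show ?thesis
 proof (rule simple_isoI_frames[OF S(1) F(1) S(2) F2 iso simple_aut_id simple_aut_id])
  fix v :: "'a vec" assume "v \<in> carrier_vec (k + 0 + (l + 0))"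
  then obtain a b where v: "v = a @\<^sub>v b" "a INV k" "b INV l" by (metis append_vec_cases add_0_right)
  have e: "0\<^sub>v 0 @\<^sub>v 0\<^sub>v 0 = (0\<^sub>v 0 :: 'a vec)" by (intro eq_vecI) auto
  show "map_prod (\<lambda>(a, b). a @\<^sub>v b) id (sum_frame (k + 0) (l + 0) (on_append k 0 Pair) (on_append l 0 Pair) v) = map_prod id id (on_append (k + l) 0 Pair (id v))"
   using v e by (simp add: app[of _ k] app[of _ l] app[of "a @\<^sub>v b" "k + l"])
 qed
qed

text \<open>Equivalent bases have the same length once they are stabilised to a common size, so n -
  p does not depend on the basis.\<close>

lemma module_rank_frame:
 assumes M: "based M" and g: "frame M p n g"
 shows "module_rank M = int n - int p"
 unfolding module_rank_def
proof (rule the_equality)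
 have b: "frame_basis p n g \<in> bases M" using g by (simp add: frame_def)
 then show "\<exists>(m, bs)\<in>bases M. int n - int p = int (length bs) - int m"
  by (intro bexI[OF _ b]) (simp add: frame_basis_def)
 fix r assume "\<exists>(m, bs)\<in>bases M. r = int (length bs) - int m"
 then obtain c where c: "c \<in> bases M" "r = int (length (snd c)) - int (fst c)" by force
 then obtain p' n' g' where g': "is_frame M p' n' g'" "c = frame_basis p' n' g'"
  using basedD(3)[OF M] s_bases_iff[OF basedD(1)[OF M]] by blast
 have "torsion_in Z M (frame_basis p n g) c" using bases_rel_iff[OF M b, of c] c basedD(3)[OF M] by blast
 then have "n + p' = n' + p"
  using torsion_in_simple_iff[OF basedD(1)[OF M] _ g'(1), of p n g p' p] g g' by (simp add: frame_def)
 then show "r = int n - int p" using c g' by (simp add: frame_basis_def)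
qed

lemma module_rank_simple_iso:
 assumes "based M" "based N" "siso M N f"
 shows "module_rank M = module_rank N"
proof -
 obtain p n g m h where g: "frame M p n g" and h: "frame N p m h" by (rule common_frames[OF assms(1,2)])
 then show ?thesis
  using simple_iso_iff[OF assms(1,2) g h] assms(3) module_rank_frame[OF assms(1) g] module_rank_frame[OF assms(2) h] by simp
qed

lemma module_rank_sum: "based M ==> based N ==> module_rank (bsum M N) = module_rank M + module_rank N"
proof -
 assume M: "based M" and N: "based N"
 obtain p n g where g: "frame M p n g" by (rule some_frame[OF M])
 obtain q m h where h: "frame N q m h" by (rule some_frame[OF N])
 show ?thesis
  using module_rank_frame[OF based_sum[OF M N g h]] module_rank_frame[OF M g] module_rank_frame[OF N h] by simp
qed

lemma module_rank_dual: "based M ==> module_rank (bdual M) = module_rank M"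
proof -
 assume M: "based M"
 obtain p n g where g: "frame M p n g" by (rule some_frame[OF M])
 show ?thesis using module_rank_frame[OF based_dual[OF M g]] module_rank_frame[OF M g] by simp
qed

text \<open>The inverse of a frame embeds M in \<Lambda>^n. The relation \<open>l_equiv\<close> only
  compares quasi-formations on vectors, so constructions with other element types have to be moved
  there.\<close>

lemma vec_model:
 fixes M :: "('a, 'm) based_module"
 assumes M: "based M"
 shows "\<exists>(N :: ('a, 'a vec) based_module) f. based N \<and> siso M N f"
proof -
 obtain p n g where "frame M p n g" by (rule some_frame[OF M])
 then have gi: "is_frame M p n g" by (simp add: frame_def)
 note M' = basedD(1)[OF M]
 note l = linD[OF frame_inv_lin[OF gi M']]
 let ?f = "\<lambda>x. frame_inv n g (x, 0\<^sub>v p)"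
 have z: "c \<cdot>\<^sub>v 0\<^sub>v p = (0\<^sub>v p :: 'a vec)" for c by (intro eq_vecI) auto
 have lin: "?f \<in> linear_maps M (bfree n)"
 proof (rule linI)
  show "?f (x \<oplus>\<^bsub>M\<^esub> y) = ?f x \<oplus>\<^bsub>bfree n\<^esub> ?f y" if "x IN M" "y IN M" for x y
   using l(2)[of "(x, 0\<^sub>v p)" "(y, 0\<^sub>v p)"] that by simp
  show "?f (a \<odot>\<^bsub>M\<^esub> x) = a \<odot>\<^bsub>bfree n\<^esub> ?f x" if "x IN M" for a x
   using l(3)[of "(x, 0\<^sub>v p)" a] that z by simp
  show "?f x IN (bfree n)" if "x IN M" for x
   using l(1)[of "(x, 0\<^sub>v p)"] that by simp
 qed
 have inj: "inj_on ?f (carrier M)"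
 proof (rule inj_onI)
  fix x y assume xy: "x IN M" "y IN M" "?f x = ?f y"
  have "(x, 0\<^sub>v p) = g (?f x)" by (rule frame_inv(2)[OF gi xy(1) zero_carrier_vec, symmetric])
  also have "\<dots> = g (?f y)" by (rule arg_cong[OF xy(3)])
  also have "\<dots> = (y, 0\<^sub>v p)" by (rule frame_inv(2)[OF gi xy(2) zero_carrier_vec])
  finally show "x = y" by simp
 qed
 note b = based_image[OF M basedD(1)[OF based_free(1)] lin inj]
 show ?thesis by (intro exI conjI) (rule b)+
qed

end

section \<open>Sesquilinear and quadratic forms\<close>

definition sesqui :: "('a::involutive_ring, 'm, 'z) module_scheme => ('a, 'm) bilinear => bool" where
 "sesqui M \<phi> \<longleftrightarrow>
   (\<forall>x\<in>carrier M. \<forall>y\<in>carrier M. \<forall>z\<in>carrier M. \<phi> (x \<oplus>\<^bsub>M\<^esub> y) z = \<phi> x z + \<phi> y z \<and> \<phi> z (x \<oplus>\<^bsub>M\<^esub> y) = \<phi> z x + \<phi> z y) \<and>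
   (\<forall>a. \<forall>x\<in>carrier M. \<forall>y\<in>carrier M. \<phi> (a \<odot>\<^bsub>M\<^esub> x) y = \<phi> x y * invol a \<and> \<phi> x (a \<odot>\<^bsub>M\<^esub> y) = a * \<phi> x y)"

definition rform :: "('a::involutive_ring, 'm, 'z) module_scheme => ('a, 'm) bilinear => ('a, 'm) bilinear" where
 "rform M \<phi> = (\<lambda>x\<in>carrier M. \<lambda>y\<in>carrier M. \<phi> x y)"

lemma rform_apply [simp]:
 "x IN M ==> y IN M ==> rform M \<phi> x y = \<phi> x y"
 by (simp add: rform_def)

lemma rform_cong:
 "(\<And>x y. x IN M ==> y IN M ==> \<phi> x y = \<phi>' x y) ==> rform M \<phi> = rform M \<phi>'"
 by (auto simp: rform_def intro!: restrict_ext)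

lemma rform_eq_iff:
 "rform M \<phi> = rform M \<phi>' \<longleftrightarrow> (\<forall>x\<in>carrier M. \<forall>y\<in>carrier M. \<phi> x y = \<phi>' x y)"
 by (metis rform_apply rform_cong)

lemma sesquiI:
 assumes "\<And>x y z. x IN M ==> y IN M ==> z IN M ==> \<phi> (x \<oplus>\<^bsub>M\<^esub> y) z = \<phi> x z + \<phi> y z"
  "\<And>x y z. x IN M ==> y IN M ==> z IN M ==> \<phi> z (x \<oplus>\<^bsub>M\<^esub> y) = \<phi> z x + \<phi> z y"
  "\<And>a x y. x IN M ==> y IN M ==> \<phi> (a \<odot>\<^bsub>M\<^esub> x) y = \<phi> x y * invol a"
  "\<And>a x y. x IN M ==> y IN M ==> \<phi> x (a \<odot>\<^bsub>M\<^esub> y) = a * \<phi> x y"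
 shows "sesqui M \<phi>"
 using assms by (simp add: sesqui_def)

lemma sesquiD:
 assumes "sesqui M \<phi>"
 shows "\<And>x y z. x IN M ==> y IN M ==> z IN M ==> \<phi> (x \<oplus>\<^bsub>M\<^esub> y) z = \<phi> x z + \<phi> y z"
  "\<And>x y z. x IN M ==> y IN M ==> z IN M ==> \<phi> z (x \<oplus>\<^bsub>M\<^esub> y) = \<phi> z x + \<phi> z y"
  "\<And>a x y. x IN M ==> y IN M ==> \<phi> (a \<odot>\<^bsub>M\<^esub> x) y = \<phi> x y * invol a"
  "\<And>a x y. x IN M ==> y IN M ==> \<phi> x (a \<odot>\<^bsub>M\<^esub> y) = a * \<phi> x y"
 using assms by (simp_all add: sesqui_def)

text \<open>Separates sesquilinearity from extensionality. Forms can then be given by formulas, and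
  \<open>rform\<close> makes them extensional only when a class is taken.\<close>

lemma Hom_dual_iff:
 fixes M :: "('a::involutive_ring, 'm, 'z) module_scheme"
 assumes M: "left_module M"
 shows "h IN (Hom_dual M) \<longleftrightarrow> sesqui M h \<and> rform M h = h"
proof (intro iffI conjI)
 note M' = lmodD[OF M]
 assume "h IN (Hom_dual M)"
 then have h: "h \<in> linear_maps M (dual M)" "h \<in> extensional (carrier M)" by (auto simp: Hom_dual_def)
 note l = linD[OF h(1)]
 show "sesqui M h"
  by (rule sesquiI) (auto simp: l dualD(2,3)[OF l(1)])
 show "rform M h = h"
 proof (rule extensionalityI[OF _ h(2)])
  fix x assume x: "x IN M"
  show "rform M h x = h x"
   by (rule extensionalityI[OF _ dualD(1)[OF l(1)[OF x]]]) (use x in \<open>auto simp: rform_def\<close>)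
 qed (simp add: rform_def)
next
 note M' = lmodD[OF M]
 assume h: "sesqui M h \<and> rform M h = h"
 then have s: "sesqui M h" and r: "rform M h = h" by auto
 note s' = sesquiD[OF s]
 have hx: "h x = (\<lambda>y\<in>carrier M. h x y)" if "x IN M" for x
  using fun_cong[OF r, of x] that by (simp add: rform_def)
 have "h \<in> linear_maps M (dual M)"
 proof (rule linI)
  fix x assume x: "x IN M"
  show "h x IN (dual M)"
  proof (rule dualI)
   show "h x \<in> extensional (carrier M)" by (subst hx[OF x]) simp
  qed (use s'(2,4) x in auto)
  show "h (x \<oplus>\<^bsub>M\<^esub> y) = h x \<oplus>\<^bsub>dual M\<^esub> h y" if y: "y IN M" for y
   by (subst hx[OF M'(2)[OF x y]], unfold dual_simps(3), rule restrict_ext, rule s'(1)[OF x y])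
  show "h (a \<odot>\<^bsub>M\<^esub> x) = a \<odot>\<^bsub>dual M\<^esub> h x" for a
   by (subst hx[OF M'(4)[OF x]], unfold dual_simps(4), rule restrict_ext, rule s'(3)[OF x])
 qed
 moreover have "h \<in> extensional (carrier M)" by (subst r[symmetric]) (simp add: rform_def)
 ultimately show "h IN (Hom_dual M)" by (simp add: Hom_dual_def)
qed

lemma sesqui_restrict_form [simp]:
 fixes M :: "('a::involutive_ring, 'm, 'z) module_scheme"
 assumes "left_module M"
 shows "sesqui M (rform M \<phi>) \<longleftrightarrow> sesqui M \<phi>"
 using lmodD[OF assms] by (simp add: sesqui_def)

lemma rform_in_Hom:
 assumes "left_module (M :: ('a::involutive_ring, 'm, 'z) module_scheme)" "sesqui M \<phi>"
 shows "rform M \<phi> IN (Hom_dual M)"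
proof -
 have "rform M (rform M \<phi>) = rform M \<phi>" by (rule rform_cong) simp
 then show ?thesis unfolding Hom_dual_iff[OF assms(1)] using assms by simp
qed

lemma Hom_dual_simps:
 "\<one>\<^bsub>Hom_dual M\<^esub> = rform M (\<lambda>x y. 0)" "\<phi> \<otimes>\<^bsub>Hom_dual M\<^esub> \<phi>' = rform M (\<lambda>x y. \<phi> x y + \<phi>' x y)"
 by (auto simp: Hom_dual_def rform_def dual_simps)

lemma sesqui_ops:
 fixes M :: "('a::involutive_ring, 'm, 'z) module_scheme"
 assumes "sesqui M \<phi>"
 shows "sesqui M \<phi>' ==> sesqui M (\<lambda>x y. \<phi> x y + \<phi>' x y)" "sesqui M (\<lambda>x y. - \<phi> x y)"
  "sesqui M (\<lambda>x y. invol (\<phi> y x))"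
 using assms by (auto simp: sesqui_def algebra_simps invol_add invol_mult)

lemma sesqui_zero [simp]: "sesqui M (\<lambda>x y. 0)"
 by (simp add: sesqui_def)

lemma sesqui_pullback:
 fixes M :: "('a::involutive_ring, 'm, 'y) module_scheme" and N :: "('a, 'n, 'z) module_scheme"
 assumes "sesqui N \<phi>" "f \<in> linear_maps M N"
 shows "sesqui M (\<lambda>x y. \<phi> (f x) (f y))"
 by (rule sesquiI) (auto simp: linD[OF assms(2)] sesquiD[OF assms(1)])

text \<open>Equality in the cokernel of 1 - T, stated for forms that need not be
  extensional.\<close>

definition form_equiv :: "'a => ('a::involutive_ring, 'm, 'z) module_scheme => ('a, 'm) bilinear => ('a, 'm) bilinear => bool" where
 "form_equiv \<epsilon> M \<phi> \<phi>' \<longleftrightarrow> (\<exists>\<kappa>. sesqui M \<kappa> \<and>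
   (\<forall>x\<in>carrier M. \<forall>y\<in>carrier M. \<phi> x y = \<phi>' x y + (\<kappa> x y - \<epsilon> * invol (\<kappa> y x))))"

definition quad_class :: "'a => ('a::involutive_ring, 'm, 'z) module_scheme => ('a, 'm) bilinear => ('a, 'm) bilinear set" where
 "quad_class \<epsilon> M \<phi> = Q_class \<epsilon> M (rform M \<phi>)"

lemma even_forms_iff:
 assumes "left_module (M :: ('a::involutive_ring, 'm, 'z) module_scheme)"
 shows "h \<in> even_forms \<epsilon> M \<longleftrightarrow> (\<exists>\<kappa>. sesqui M \<kappa> \<and> h = rform M (\<lambda>x y. \<kappa> x y - \<epsilon> * invol (\<kappa> y x)))"
proof -
 have e: "(\<lambda>x\<in>carrier M. \<lambda>y\<in>carrier M. \<kappa> x y - T_involution \<epsilon> M \<kappa> x y) = rform M (\<lambda>x y. \<kappa> x y - \<epsilon> * invol (\<kappa> y x))" for \<kappa>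
  by (auto simp: rform_def T_involution_def intro!: restrict_ext)
 show ?thesis
 proof
  assume "h \<in> even_forms \<epsilon> M"
  then show "\<exists>\<kappa>. sesqui M \<kappa> \<and> h = rform M (\<lambda>x y. \<kappa> x y - \<epsilon> * invol (\<kappa> y x))"
   unfolding even_forms_def e using Hom_dual_iff[OF assms] by blast
 next
  assume "\<exists>\<kappa>. sesqui M \<kappa> \<and> h = rform M (\<lambda>x y. \<kappa> x y - \<epsilon> * invol (\<kappa> y x))"
  then obtain \<kappa> where k: "sesqui M \<kappa>" "h = rform M (\<lambda>x y. \<kappa> x y - \<epsilon> * invol (\<kappa> y x))" by blast
  then have "h = rform M (\<lambda>x y. rform M \<kappa> x y - \<epsilon> * invol (rform M \<kappa> y x))"
   by (auto intro: rform_cong)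
  then show "h \<in> even_forms \<epsilon> M" unfolding even_forms_def e using rform_in_Hom[OF assms k(1)] by blast
 qed
qed

lemma quad_class_iff:
 assumes M: "left_module (M :: ('a::involutive_ring, 'm, 'z) module_scheme)"
 shows "h \<in> quad_class \<epsilon> M \<phi> \<longleftrightarrow> (\<exists>\<phi>'. h = rform M \<phi>' \<and> form_equiv \<epsilon> M \<phi>' \<phi>)"
proof -
 have "h \<in> quad_class \<epsilon> M \<phi> \<longleftrightarrow> (\<exists>e\<in>even_forms \<epsilon> M. h = rform M (\<lambda>x y. e x y + rform M \<phi> x y))"
  by (auto simp: quad_class_def Q_class_def r_coset_def Hom_dual_simps)
 also have "\<dots> \<longleftrightarrow> (\<exists>\<kappa>. sesqui M \<kappa> \<and> h = rform M (\<lambda>x y. \<phi> x y + (\<kappa> x y - \<epsilon> * invol (\<kappa> y x))))"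
 proof -
  have "rform M (\<lambda>x y. rform M (\<lambda>x y. \<kappa> x y - \<epsilon> * invol (\<kappa> y x)) x y + rform M \<phi> x y)
    = rform M (\<lambda>x y. \<phi> x y + (\<kappa> x y - \<epsilon> * invol (\<kappa> y x)))" for \<kappa>
   by (rule rform_cong) simp
  note r = this
  show ?thesis
  proof
   assume "\<exists>e\<in>even_forms \<epsilon> M. h = rform M (\<lambda>x y. e x y + rform M \<phi> x y)"
   then obtain e where e: "e \<in> even_forms \<epsilon> M" "h = rform M (\<lambda>x y. e x y + rform M \<phi> x y)" by blast
   obtain \<kappa> where k: "sesqui M \<kappa>" "e = rform M (\<lambda>x y. \<kappa> x y - \<epsilon> * invol (\<kappa> y x))"
    using even_forms_iff[OF M, THEN iffD1, OF e(1)] by blast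
   show "\<exists>\<kappa>. sesqui M \<kappa> \<and> h = rform M (\<lambda>x y. \<phi> x y + (\<kappa> x y - \<epsilon> * invol (\<kappa> y x)))"
    using e(2)[unfolded k(2) r] k(1) by blast
  next
   assume "\<exists>\<kappa>. sesqui M \<kappa> \<and> h = rform M (\<lambda>x y. \<phi> x y + (\<kappa> x y - \<epsilon> * invol (\<kappa> y x)))"
   then obtain \<kappa> where k: "sesqui M \<kappa>" "h = rform M (\<lambda>x y. \<phi> x y + (\<kappa> x y - \<epsilon> * invol (\<kappa> y x)))" by blast
   show "\<exists>e\<in>even_forms \<epsilon> M. h = rform M (\<lambda>x y. e x y + rform M \<phi> x y)"
    using k(2)[folded r] even_forms_iff[OF M, THEN iffD2, OF exI, OF conjI, OF k(1) refl] by blast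
  qed
 qed
 also have "\<dots> \<longleftrightarrow> (\<exists>\<phi>'. h = rform M \<phi>' \<and> form_equiv \<epsilon> M \<phi>' \<phi>)"
 proof
  assume "\<exists>\<kappa>. sesqui M \<kappa> \<and> h = rform M (\<lambda>x y. \<phi> x y + (\<kappa> x y - \<epsilon> * invol (\<kappa> y x)))"
  then show "\<exists>\<phi>'. h = rform M \<phi>' \<and> form_equiv \<epsilon> M \<phi>' \<phi>" unfolding form_equiv_def by blast
 next
  assume "\<exists>\<phi>'. h = rform M \<phi>' \<and> form_equiv \<epsilon> M \<phi>' \<phi>"
  then obtain \<phi>' \<kappa> where "h = rform M \<phi>'" "sesqui M \<kappa>"
   "\<forall>x\<in>carrier M. \<forall>y\<in>carrier M. \<phi>' x y = \<phi> x y + (\<kappa> x y - \<epsilon> * invol (\<kappa> y x))" unfolding form_equiv_def by blast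
  then show "\<exists>\<kappa>. sesqui M \<kappa> \<and> h = rform M (\<lambda>x y. \<phi> x y + (\<kappa> x y - \<epsilon> * invol (\<kappa> y x)))"
   by (intro exI[of _ \<kappa>] conjI) (auto intro: rform_cong)
 qed
 finally show ?thesis .
qed

lemma form_equiv_cong:
 "(\<And>x y. x IN M ==> y IN M ==> \<phi> x y = \<phi>' x y) ==> form_equiv \<epsilon> M \<phi> \<phi>'"
 unfolding form_equiv_def by (intro exI[of _ "\<lambda>x y. 0"]) simp

lemma form_equiv_sym: "form_equiv \<epsilon> M \<phi> \<phi>' ==> form_equiv \<epsilon> M \<phi>' \<phi>"
proof -
 assume "form_equiv \<epsilon> M \<phi> \<phi>'"
 then obtain \<kappa> where "sesqui M \<kappa>" "\<forall>x\<in>carrier M. \<forall>y\<in>carrier M. \<phi> x y = \<phi>' x y + (\<kappa> x y - \<epsilon> * invol (\<kappa> y x))"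
  unfolding form_equiv_def by blast
 then show ?thesis unfolding form_equiv_def
  by (intro exI[of _ "\<lambda>x y. - \<kappa> x y"] conjI) (auto simp: sesqui_ops(2))
qed

lemma form_equiv_trans: "form_equiv \<epsilon> M \<phi> \<phi>' ==> form_equiv \<epsilon> M \<phi>' \<phi>'' ==> form_equiv \<epsilon> M \<phi> \<phi>''"
proof -
 assume "form_equiv \<epsilon> M \<phi> \<phi>'" "form_equiv \<epsilon> M \<phi>' \<phi>''"
 then obtain \<kappa> \<kappa>' where "sesqui M \<kappa>" "\<forall>x\<in>carrier M. \<forall>y\<in>carrier M. \<phi> x y = \<phi>' x y + (\<kappa> x y - \<epsilon> * invol (\<kappa> y x))"
  "sesqui M \<kappa>'" "\<forall>x\<in>carrier M. \<forall>y\<in>carrier M. \<phi>' x y = \<phi>'' x y + (\<kappa>' x y - \<epsilon> * invol (\<kappa>' y x))"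
  unfolding form_equiv_def by blast
 then show ?thesis unfolding form_equiv_def
  by (intro exI[of _ "\<lambda>x y. \<kappa> x y + \<kappa>' x y"] conjI) (auto simp: sesqui_ops(1) algebra_simps invol_add)
qed

lemma form_equiv_refl [simp]: "form_equiv \<epsilon> M \<phi> \<phi>"
 by (rule form_equiv_cong) simp

lemma form_equiv_pullback:
 fixes M :: "('a::involutive_ring, 'm, 'y) module_scheme" and N :: "('a, 'n, 'z) module_scheme"
 assumes "form_equiv \<epsilon> N \<phi> \<phi>'" "f \<in> linear_maps M N"
 shows "form_equiv \<epsilon> M (\<lambda>x y. \<phi> (f x) (f y)) (\<lambda>x y. \<phi>' (f x) (f y))"
proof -
 obtain \<kappa> where "sesqui N \<kappa>" "\<forall>x\<in>carrier N. \<forall>y\<in>carrier N. \<phi> x y = \<phi>' x y + (\<kappa> x y - \<epsilon> * invol (\<kappa> y x))"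
  using assms(1) unfolding form_equiv_def by blast
 then show ?thesis unfolding form_equiv_def using linD(1)[OF assms(2)] sesqui_pullback[OF _ assms(2)]
  by (intro exI[of _ "\<lambda>x y. \<kappa> (f x) (f y)"] conjI) auto
qed

lemma quad_class_eq_iff:
 assumes M: "left_module (M :: ('a::involutive_ring, 'm, 'z) module_scheme)"
 shows "quad_class \<epsilon> M \<phi> = quad_class \<epsilon> M \<phi>' \<longleftrightarrow> form_equiv \<epsilon> M \<phi> \<phi>'"
proof
 assume "quad_class \<epsilon> M \<phi> = quad_class \<epsilon> M \<phi>'"
 then have "rform M \<phi> \<in> quad_class \<epsilon> M \<phi>'" using quad_class_iff[OF M] form_equiv_refl by blast
 then obtain \<phi>'' where "rform M \<phi> = rform M \<phi>''" "form_equiv \<epsilon> M \<phi>'' \<phi>'" using quad_class_iff[OF M] by blast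
 then show "form_equiv \<epsilon> M \<phi> \<phi>'"
  using form_equiv_trans[OF form_equiv_cong, of M \<phi> \<phi>'' \<epsilon> \<phi>'] unfolding rform_eq_iff by blast
next
 assume e: "form_equiv \<epsilon> M \<phi> \<phi>'"
 have "h \<in> quad_class \<epsilon> M \<phi> \<longleftrightarrow> h \<in> quad_class \<epsilon> M \<phi>'" for h
  unfolding quad_class_iff[OF M] using form_equiv_trans[OF _ e] form_equiv_trans[OF _ form_equiv_sym[OF e]] by blast
 then show "quad_class \<epsilon> M \<phi> = quad_class \<epsilon> M \<phi>'" by blast
qed

lemma carrier_Q_group:
 assumes M: "left_module (M :: ('a::involutive_ring, 'm, 'z) module_scheme)"
 shows "\<psi> IN (Q_group \<epsilon> M) \<longleftrightarrow> (\<exists>\<phi>. sesqui M \<phi> \<and> \<psi> = quad_class \<epsilon> M \<phi>)"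
proof -
 have "\<psi> IN (Q_group \<epsilon> M) \<longleftrightarrow> (\<exists>h\<in>carrier (Hom_dual M). \<psi> = Q_class \<epsilon> M h)"
  by (auto simp: Q_group_def FactGroup_def RCOSETS_def Q_class_def)
 also have "\<dots> \<longleftrightarrow> (\<exists>\<phi>. sesqui M \<phi> \<and> \<psi> = quad_class \<epsilon> M \<phi>)"
  unfolding quad_class_def using Hom_dual_iff[OF M] rform_in_Hom[OF M] by metis
 finally show ?thesis .
qed

lemma one_Q_group:
 assumes M: "left_module (M :: ('a::involutive_ring, 'm, 'z) module_scheme)"
 shows "\<one>\<^bsub>Q_group \<epsilon> M\<^esub> = quad_class \<epsilon> M (\<lambda>x y. 0)"
proof -
 have "\<one>\<^bsub>Q_group \<epsilon> M\<^esub> = even_forms \<epsilon> M" by (simp add: Q_group_def FactGroup_def)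
 moreover have "h \<in> even_forms \<epsilon> M \<longleftrightarrow> h \<in> quad_class \<epsilon> M (\<lambda>x y. 0)" for h
 proof
  assume "h \<in> even_forms \<epsilon> M"
  then obtain \<kappa> where "sesqui M \<kappa>" "h = rform M (\<lambda>x y. \<kappa> x y - \<epsilon> * invol (\<kappa> y x))"
   using even_forms_iff[OF M] by blast
  then show "h \<in> quad_class \<epsilon> M (\<lambda>x y. 0)" unfolding quad_class_iff[OF M] form_equiv_def
   by (intro exI[of _ "\<lambda>x y. \<kappa> x y - \<epsilon> * invol (\<kappa> y x)"]) auto
 next
  assume "h \<in> quad_class \<epsilon> M (\<lambda>x y. 0)"
  then obtain \<phi>' where p: "h = rform M \<phi>'" "form_equiv \<epsilon> M \<phi>' (\<lambda>x y. 0)" using quad_class_iff[OF M] by blast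
  then obtain \<kappa> where k: "sesqui M \<kappa>" "\<forall>x\<in>carrier M. \<forall>y\<in>carrier M. \<phi>' x y = 0 + (\<kappa> x y - \<epsilon> * invol (\<kappa> y x))"
   unfolding form_equiv_def by blast
  then have "h = rform M (\<lambda>x y. \<kappa> x y - \<epsilon> * invol (\<kappa> y x))" unfolding p(1) by (intro rform_cong) simp
  then show "h \<in> even_forms \<epsilon> M" using even_forms_iff[OF M] k(1) by blast
 qed
 ultimately show ?thesis by blast
qed

lemma same_module_forms:
 assumes "same_module (M :: ('a::involutive_ring, 'm, 'y) module_scheme) (M' :: ('a, 'm, 'z) module_scheme)"
 shows "Hom_dual M = Hom_dual M'" "quad_class \<epsilon> M = quad_class \<epsilon> M'" "Q_class \<epsilon> M = Q_class \<epsilon> M'" "Q_group \<epsilon> M = Q_group \<epsilon> M'" "sesqui M = sesqui M'"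
  "dual M = dual M'" "rform M = rform M'"
proof -
 have f: "carrier M = carrier M'" "zero M = zero M'" "add M = add M'" "smult M = smult M'" using assms by (auto simp: same_module_def)
 show d: "dual M = dual M'" by (simp add: dual_def f)
 show h: "Hom_dual M = Hom_dual M'" by (simp add: Hom_dual_def linear_maps_def f d)
 have e: "even_forms \<epsilon> M = even_forms \<epsilon> M'" by (simp add: even_forms_def T_involution_def[abs_def] f h)
 show q: "Q_class \<epsilon> M = Q_class \<epsilon> M'" by (intro ext) (simp add: Q_class_def e h)
 show r: "rform M = rform M'" by (intro ext) (simp add: rform_def f)
 show "quad_class \<epsilon> M = quad_class \<epsilon> M'" by (intro ext) (simp add: quad_class_def q r)
 show "Q_group \<epsilon> M = Q_group \<epsilon> M'" by (simp add: Q_group_def e h)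
 show "sesqui M = sesqui M'" by (intro ext) (simp add: sesqui_def f)
qed

lemma same_module_based_sum: "same_module (based_sum Z M N) (module_sum M N)"
 by (simp add: based_sum_def same_module_with_bases)

definition lambda_form :: "'a => ('a::involutive_ring, 'm) bilinear => ('a, 'm) bilinear" where
 "lambda_form \<epsilon> \<phi> x y = \<phi> x y + \<epsilon> * invol (\<phi> y x)"

section \<open>Classes, sums and isometries of forms by representatives\<close>

locale form_parameter = torsion_subgroup Z for Z :: "'a::involutive_ring torsion_set" +
 fixes \<epsilon> :: 'a
 assumes eps: "\<epsilon> = 1 \<or> \<epsilon> = - 1"
begin

abbreviation isom where "isom \<equiv> isometry \<epsilon> Z"

abbreviation qform where "qform \<equiv> quad_form \<epsilon> Z"

abbreviation fsum where "fsum \<equiv> form_sum \<epsilon> Z"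

abbreviation qcls where "qcls \<equiv> quad_class \<epsilon>"

abbreviation fequiv where "fequiv \<equiv> form_equiv \<epsilon>"

abbreviation lam where "lam \<equiv> lambda_form \<epsilon>"

abbreviation qf where "qf \<equiv> quasi_formation \<epsilon> Z"

abbreviation qf_iso where "qf_iso \<equiv> qf_isomorphic \<epsilon> Z"

abbreviation qf_add where "qf_add \<equiv> qf_sum \<epsilon> Z"

abbreviation lcls where "lcls \<equiv> l_class \<epsilon> Z"

abbreviation lequiv where "lequiv \<equiv> l_equiv \<epsilon> Z"

abbreviation triv where "triv \<equiv> trivial_formation \<epsilon> Z"

abbreviation hyper where "hyper \<equiv> hyperbolic \<epsilon> Z"

abbreviation lmon where "lmon \<equiv> l_monoid \<epsilon> Z"

lemma eps_simps: "\<epsilon> * \<epsilon> = 1" "invol \<epsilon> = \<epsilon>" "a * \<epsilon> = \<epsilon> * a" "\<epsilon> * (\<epsilon> * a) = a"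
 using eps by auto

text \<open>Since \<epsilon> is 1 or -1, the symmetrisation of an even form \<kappa> - T \<kappa>
  vanishes.\<close>

lemma lambda_form_equiv:
 assumes "fequiv M \<phi> \<phi>'" "x IN M" "y IN M"
 shows "lam \<phi> x y = lam \<phi>' x y"
proof -
 obtain \<kappa> where "\<forall>x\<in>carrier M. \<forall>y\<in>carrier M. \<phi> x y = \<phi>' x y + (\<kappa> x y - \<epsilon> * invol (\<kappa> y x))"
  using assms(1) unfolding form_equiv_def by blast
 then have "\<phi> x y = \<phi>' x y + (\<kappa> x y - \<epsilon> * invol (\<kappa> y x))" "\<phi> y x = \<phi>' y x + (\<kappa> y x - \<epsilon> * invol (\<kappa> x y))"
  using assms by auto
 then show ?thesis unfolding lambda_form_def using eps by (elim disjE) (simp_all add: invol_add invol_mult)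
qed

lemma sesqui_eps: "sesqui M \<phi> ==> sesqui M (\<lambda>x y. \<epsilon> * \<phi> x y)"
 using eps by (auto simp: sesqui_ops)

lemma sesqui_lambda: "sesqui M \<phi> ==> sesqui M (lam \<phi>)"
 unfolding lambda_form_def[abs_def] by (intro sesqui_ops(1) sesqui_eps sesqui_ops(3))

text \<open>\<phi> and T \<phi> differ by (1 - T) \<phi>. Applied to a hyperbolic form, this lets
  the two summands change roles.\<close>

lemma form_equiv_flip:
 assumes "sesqui M \<phi>"
 shows "fequiv M (\<lambda>x y. \<psi> x y + \<epsilon> * invol (\<phi> y x)) (\<lambda>x y. \<psi> x y + \<phi> x y)"
 unfolding form_equiv_def
 by (rule exI[of _ "\<lambda>x y. - \<phi> x y"]) (auto simp: sesqui_ops(2)[OF assms] algebra_simps)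

text \<open>Equivalent representatives have the same symmetrisation, so \<open>the_elem\<close> is
  applied to a singleton. Pullbacks and sums of classes are evaluated below in the same
  manner.\<close>

lemma symmetrisation_quad_class:
 assumes M: "left_module (M :: ('a, 'm, 'z) module_scheme)"
 shows "symmetrisation \<epsilon> M (qcls M \<phi>) = rform M (lam \<phi>)"
proof -
 let ?F = "\<lambda>\<phi>. \<lambda>x\<in>carrier M. \<lambda>y\<in>carrier M. \<phi> x y + T_involution \<epsilon> M \<phi> x y"
 have e: "?F (rform M \<phi>') = rform M (lam \<phi>')" for \<phi>'
  by (auto simp: rform_def T_involution_def lambda_form_def intro!: restrict_ext)
 have "?F ` qcls M \<phi> = {rform M (lam \<phi>)}"
 proof (intro equalityI subsetI)
  fix h assume "h \<in> ?F ` qcls M \<phi>"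
  then obtain h0 where h0: "h = ?F h0" "h0 \<in> qcls M \<phi>" by blast
  obtain \<phi>' where "h0 = rform M \<phi>'" and p2: "fequiv M \<phi>' \<phi>" using quad_class_iff[OF M, THEN iffD1, OF h0(2)] by blast
  then have "h = ?F (rform M \<phi>')" using h0(1) by simp
  note p = this p2
  then have "h = rform M (lam \<phi>)" unfolding p(1) e by (intro rform_cong lambda_form_equiv)
  then show "h \<in> {rform M (lam \<phi>)}" by simp
 next
  fix h assume "h \<in> {rform M (lam \<phi>)}"
  then have "h = ?F (rform M \<phi>)" by (simp only: e singleton_iff)
  moreover have "rform M \<phi> \<in> qcls M \<phi>" using quad_class_iff[OF M] form_equiv_refl by blast
  ultimately show "h \<in> ?F ` qcls M \<phi>" by blast
 qed
 then show ?thesis by (simp add: symmetrisation_def)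
qed

lemma Q_pullback_quad_class:
 fixes M :: "('a, 'm, 'y) module_scheme" and N :: "('a, 'n, 'z) module_scheme"
 assumes M: "left_module M" and N: "left_module N" and f: "f \<in> linear_maps M N"
 shows "Q_pullback \<epsilon> M f (qcls N \<phi>) = qcls M (\<lambda>x y. \<phi> (f x) (f y))"
proof -
 let ?F = "\<lambda>\<phi>. Q_class \<epsilon> M (\<lambda>x\<in>carrier M. \<lambda>y\<in>carrier M. \<phi> (f x) (f y))"
 have e: "?F (rform N \<phi>') = qcls M (\<lambda>x y. \<phi>' (f x) (f y))" for \<phi>'
  unfolding quad_class_def rform_def using linD(1)[OF f]
  by (intro arg_cong[of _ _ "Q_class \<epsilon> M"]) (auto intro!: restrict_ext)
 have "?F ` qcls N \<phi> = {qcls M (\<lambda>x y. \<phi> (f x) (f y))}"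
 proof (intro equalityI subsetI)
  fix h assume "h \<in> ?F ` qcls N \<phi>"
  then obtain h0 where h0: "h = ?F h0" "h0 \<in> qcls N \<phi>" by blast
  obtain \<phi>' where "h0 = rform N \<phi>'" and p2: "fequiv N \<phi>' \<phi>" using quad_class_iff[OF N, THEN iffD1, OF h0(2)] by blast
  then have "h = ?F (rform N \<phi>')" using h0(1) by simp
  note p = this p2
  then have "h = qcls M (\<lambda>x y. \<phi> (f x) (f y))"
   unfolding p(1) e quad_class_eq_iff[OF M] by (intro form_equiv_pullback[OF _ f])
  then show "h \<in> {qcls M (\<lambda>x y. \<phi> (f x) (f y))}" by simp
 next
  fix h assume "h \<in> {qcls M (\<lambda>x y. \<phi> (f x) (f y))}"
  then have "h = ?F (rform N \<phi>)" by (simp only: e singleton_iff)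
  moreover have "rform N \<phi> \<in> qcls N \<phi>" using quad_class_iff[OF N] form_equiv_refl by blast
  ultimately show "h \<in> ?F ` qcls N \<phi>" by blast
 qed
 then show ?thesis by (simp add: Q_pullback_def)
qed

definition sum_form :: "('a, 'm) bilinear => ('a, 'n) bilinear => ('a, 'm \<times> 'n) bilinear" where
 "sum_form \<phi> \<phi>' = (\<lambda>(x, y) (x', y'). \<phi> x x' + \<phi>' y y')"

lemma sum_form_apply [simp]: "sum_form \<phi> \<phi>' (x, y) (x', y') = \<phi> x x' + \<phi>' y y'"
 by (simp add: sum_form_def)

lemma sesqui_sum_form:
 fixes M :: "('a, 'm, 'y) module_scheme" and N :: "('a, 'n, 'z) module_scheme"
 shows "sesqui M \<phi> ==> sesqui N \<phi>' ==> sesqui (module_sum M N) (sum_form \<phi> \<phi>')"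
 by (rule sesquiI) (auto simp: sesquiD algebra_simps)

lemma form_equiv_sum_form:
 fixes M :: "('a, 'm, 'y) module_scheme" and N :: "('a, 'n, 'z) module_scheme"
 assumes "fequiv M \<phi> \<phi>1" "fequiv N \<phi>' \<phi>1'"
 shows "fequiv (module_sum M N) (sum_form \<phi> \<phi>') (sum_form \<phi>1 \<phi>1')"
proof -
 obtain \<kappa> \<kappa>' where k: "sesqui M \<kappa>" "\<forall>x\<in>carrier M. \<forall>y\<in>carrier M. \<phi> x y = \<phi>1 x y + (\<kappa> x y - \<epsilon> * invol (\<kappa> y x))"
  "sesqui N \<kappa>'" "\<forall>x\<in>carrier N. \<forall>y\<in>carrier N. \<phi>' x y = \<phi>1' x y + (\<kappa>' x y - \<epsilon> * invol (\<kappa>' y x))"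
  using assms unfolding form_equiv_def by blast
 show ?thesis unfolding form_equiv_def
  by (intro exI[of _ "sum_form \<kappa> \<kappa>'"] conjI sesqui_sum_form k(1,3)) (auto simp: k(2,4) invol_add algebra_simps)
qed

lemma form_sum_quad_class:
 fixes M :: "('a, 'm) based_module" and N :: "('a, 'n) based_module"
 assumes M: "left_module M" and N: "left_module N"
 shows "fsum (M, qcls M \<phi>) (N, qcls N \<phi>') = (bsum M N, qcls (bsum M N) (sum_form \<phi> \<phi>'))"
proof -
 let ?S = "module_sum M N"
 note S = left_module_sum[OF M N]
 let ?F = "\<lambda>\<phi> \<phi>'. Q_class \<epsilon> ?S (\<lambda>(x, y)\<in>carrier M \<times> carrier N. \<lambda>(x', y')\<in>carrier M \<times> carrier N. \<phi> x x' + \<phi>' y y')"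
 have e: "?F (rform M \<phi>) (rform N \<phi>') = qcls ?S (sum_form \<phi> \<phi>')" for \<phi> \<phi>'
  unfolding quad_class_def rform_def
  by (intro arg_cong[of _ _ "Q_class \<epsilon> ?S"]) (auto simp: sum_form_def split: prod.split intro!: restrict_ext)
 have "{?F \<chi> \<chi>' | \<chi> \<chi>'. \<chi> \<in> qcls M \<phi> \<and> \<chi>' \<in> qcls N \<phi>'} = {qcls ?S (sum_form \<phi> \<phi>')}"
 proof (intro equalityI subsetI)
  fix h assume "h \<in> {?F \<chi> \<chi>' | \<chi> \<chi>'. \<chi> \<in> qcls M \<phi> \<and> \<chi>' \<in> qcls N \<phi>'}"
  then obtain \<phi>1 \<phi>1' where p: "h = ?F (rform M \<phi>1) (rform N \<phi>1')" "fequiv M \<phi>1 \<phi>" "fequiv N \<phi>1' \<phi>'"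
  proof -
   obtain h1 h2 where h12: "h = ?F h1 h2" "h1 \<in> qcls M \<phi>" "h2 \<in> qcls N \<phi>'"
    using \<open>h \<in> _\<close> by blast
   obtain \<phi>1 where p1: "h1 = rform M \<phi>1" "fequiv M \<phi>1 \<phi>" using quad_class_iff[OF M, THEN iffD1, OF h12(2)] by blast
   obtain \<phi>1' where p2: "h2 = rform N \<phi>1'" "fequiv N \<phi>1' \<phi>'" using quad_class_iff[OF N, THEN iffD1, OF h12(3)] by blast
   show ?thesis by (rule that[OF h12(1)[unfolded p1(1) p2(1)] p1(2) p2(2)])
  qed
  then have "h = qcls ?S (sum_form \<phi> \<phi>')"
   unfolding p(1) e quad_class_eq_iff[OF S] by (intro form_equiv_sum_form)
  then show "h \<in> {qcls ?S (sum_form \<phi> \<phi>')}" by simp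
 next
  fix h assume "h \<in> {qcls ?S (sum_form \<phi> \<phi>')}"
  then have "h = ?F (rform M \<phi>) (rform N \<phi>')" by (simp only: e singleton_iff)
  moreover have "rform M \<phi> \<in> qcls M \<phi>" "rform N \<phi>' \<in> qcls N \<phi>'"
   using quad_class_iff[OF M] quad_class_iff[OF N] form_equiv_refl by blast+
  ultimately show "h \<in> {?F \<chi> \<chi>' | \<chi> \<chi>'. \<chi> \<in> qcls M \<phi> \<and> \<chi>' \<in> qcls N \<phi>'}" by blast
 qed
 then show ?thesis by (simp add: same_module_forms(2)[OF same_module_based_sum])
qed

lemma quad_formE:
 assumes "qform (M, \<psi>)"
 obtains \<phi> where "based M" "sesqui M \<phi>" "\<psi> = qcls M \<phi>"
 using assms carrier_Q_group[OF basedD(1), of M \<psi> \<epsilon>] by auto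

lemma quad_form_iff [simp]:
 "sesqui M \<phi> ==> qform (M, qcls M \<phi>) \<longleftrightarrow> based M"
 using carrier_Q_group[OF basedD(1), of M] by auto

lemma isometry_iff:
 assumes "based M" "based M'"
 shows "isom (M, qcls M \<phi>) (M', qcls M' \<phi>') f \<longleftrightarrow>
  siso M M' f \<and> fequiv M (\<lambda>x y. \<phi>' (f x) (f y)) \<phi>"
proof -
 note M = basedD(1)[OF assms(1)] and M' = basedD(1)[OF assms(2)]
 have "Q_pullback \<epsilon> M f (qcls M' \<phi>') = qcls M \<phi> \<longleftrightarrow> fequiv M (\<lambda>x y. \<phi>' (f x) (f y)) \<phi>"
  if "siso M M' f"
  unfolding Q_pullback_quad_class[OF M M' sisoD(2)[OF that]] quad_class_eq_iff[OF M] ..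
 then show ?thesis unfolding isometry.simps by (rule conj_cong[OF refl])
qed

lemma isometry_comp:
 assumes M: "based M" and M': "based M'" and M'': "based M''"
  and f: "isom (M, qcls M \<phi>) (M', qcls M' \<phi>') f"
  and g: "isom (M', qcls M' \<phi>') (M'', qcls M'' \<phi>'') g"
 shows "isom (M, qcls M \<phi>) (M'', qcls M'' \<phi>'') (g \<circ> f)"
proof -
 have sf: "siso M M' f" "fequiv M (\<lambda>x y. \<phi>' (f x) (f y)) \<phi>" and sg: "siso M' M'' g" "fequiv M' (\<lambda>x y. \<phi>'' (g x) (g y)) \<phi>'"
  using f g isometry_iff[OF M M'] isometry_iff[OF M' M''] by auto
 have "fequiv M (\<lambda>x y. \<phi>'' (g (f x)) (g (f y))) \<phi>"
  using form_equiv_trans[OF form_equiv_pullback[OF sg(2) sisoD(2)[OF sf(1)]] sf(2)] by simp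
 then show ?thesis unfolding isometry_iff[OF M M''] using siso_comp[OF M M' M'' sf(1) sg(1)] by simp
qed

lemma isometry_inv:
 assumes M: "based M" and M': "based M'"
  and f: "isom (M, qcls M \<phi>) (M', qcls M' \<phi>') f"
 shows "isom (M', qcls M' \<phi>') (M, qcls M \<phi>) (inv_map M f)"
proof -
 have sf: "siso M M' f" "fequiv M (\<lambda>x y. \<phi>' (f x) (f y)) \<phi>" using f isometry_iff[OF M M'] by auto
 note i = siso_inv[OF M M' sf(1)]
 have "fequiv M' (\<lambda>x y. \<phi>' x y) (\<lambda>x y. \<phi>' (f (inv_map M f x)) (f (inv_map M f y)))"
  by (rule form_equiv_cong) (simp add: sisoD(7)[OF sf(1)])
 then have "fequiv M' (\<lambda>x y. \<phi> (inv_map M f x) (inv_map M f y)) \<phi>'"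
  using form_equiv_sym[OF form_equiv_trans[OF _ form_equiv_pullback[OF sf(2) sisoD(2)[OF i]]]] by simp
 then show ?thesis unfolding isometry_iff[OF M' M] using i by simp
qed

lemma isometry_map_prod:
 assumes M: "based M" and M': "based M'" and N: "based N" and N': "based N'"
  and f: "isom (M, qcls M \<phi>) (M', qcls M' \<phi>') f"
  and g: "isom (N, qcls N \<chi>) (N', qcls N' \<chi>') g"
 shows "isom (bsum M N, qcls (bsum M N) (sum_form \<phi> \<chi>))
  (bsum M' N', qcls (bsum M' N') (sum_form \<phi>' \<chi>')) (map_prod f g)"
proof -
 have sf: "siso M M' f" "fequiv M (\<lambda>x y. \<phi>' (f x) (f y)) \<phi>" and sg: "siso N N' g" "fequiv N (\<lambda>x y. \<chi>' (g x) (g y)) \<chi>"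
  using f g isometry_iff[OF M M'] isometry_iff[OF N N'] by auto
 have "sum_form \<phi>' \<chi>' (map_prod f g x) (map_prod f g y) = sum_form (\<lambda>x y. \<phi>' (f x) (f y)) (\<lambda>x y. \<chi>' (g x) (g y)) x y" for x y
  by (cases x; cases y) simp
 then have "fequiv (module_sum M N) (\<lambda>x y. sum_form \<phi>' \<chi>' (map_prod f g x) (map_prod f g y)) (sum_form \<phi> \<chi>)"
  using form_equiv_sum_form[OF sf(2) sg(2)] by simp
 then have "fequiv (bsum M N) (\<lambda>x y. sum_form \<phi>' \<chi>' (map_prod f g x) (map_prod f g y)) (sum_form \<phi> \<chi>)"
  by (simp add: form_equiv_def same_module_forms(5)[OF same_module_based_sum])
 then show ?thesis unfolding isometry_iff[OF based_sum_closed[OF M N] based_sum_closed[OF M' N']]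
  using simple_iso_map_prod[OF M N M' N' sf(1) sg(1)] by simp
qed

end

section \<open>Hyperbolic forms and Lagrangians\<close>

abbreviation inl :: "('a, 'n, 'z) module_scheme => 'm => 'm \<times> 'n" where "inl N \<equiv> \<lambda>x. (x, zero N)"

abbreviation inr :: "('a, 'm, 'z) module_scheme => 'n => 'm \<times> 'n" where "inr M \<equiv> \<lambda>y. (zero M, y)"

declare quad_form.simps [simp del] simple_form.simps [simp del] isometry.simps [simp del]

lemma sesqui_pullback2:
 fixes M :: "('a::involutive_ring, 'm, 'y) module_scheme" and N :: "('a, 'n, 'z) module_scheme"
 assumes "sesqui N \<phi>" "f \<in> linear_maps M N" "g \<in> linear_maps M N"
 shows "sesqui M (\<lambda>x y. \<phi> (f x) (g y))"
 by (rule sesquiI) (auto simp: linD[OF assms(2)] linD[OF assms(3)] sesquiD[OF assms(1)])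

lemma sesqui_based_sum [simp]: "sesqui (based_sum Z M N) = sesqui (module_sum M N)"
 by (rule same_module_forms(5)[OF same_module_based_sum])

lemma form_equiv_based_sum [simp]: "form_equiv \<epsilon> (based_sum Z M N) = form_equiv \<epsilon> (module_sum M N)"
 by (intro ext) (simp add: form_equiv_def)

lemma linear_maps_fst: "fst \<in> linear_maps (module_sum M N) M" and linear_maps_snd: "snd \<in> linear_maps (module_sum M N) N"
 by (auto simp: linear_maps_def)

lemma linear_maps_inl:
 assumes "left_module (N :: ('a::ring_1, 'n, 'z) module_scheme)"
 shows "(inl N) \<in> linear_maps M (module_sum M N)"
 using lmodD[OF assms] lmod_minus(4)[OF assms lmodD(3)[OF assms]] by (auto simp: linear_maps_def)

lemma linear_maps_inr:
 assumes "left_module (M :: ('a::ring_1, 'n, 'z) module_scheme)"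
 shows "(inr M) \<in> linear_maps N (module_sum M N)"
 using lmodD[OF assms] lmod_minus(4)[OF assms lmodD(3)[OF assms]] by (auto simp: linear_maps_def)

lemma linear_maps_add:
 assumes N: "left_module (N :: ('a::ring_1, 'n, 'z) module_scheme)" and f: "f \<in> linear_maps M N" and g: "g \<in> linear_maps M N"
 shows "(\<lambda>x. f x \<oplus>\<^bsub>N\<^esub> g x) \<in> linear_maps M N"
proof (rule linI)
 note N' = lmodD[OF N] and f' = linD[OF f] and g' = linD[OF g]
 have ac: "x \<oplus>\<^bsub>N\<^esub> y \<oplus>\<^bsub>N\<^esub> (z \<oplus>\<^bsub>N\<^esub> w) = x \<oplus>\<^bsub>N\<^esub> z \<oplus>\<^bsub>N\<^esub> (y \<oplus>\<^bsub>N\<^esub> w)"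
  if "x IN N" "y IN N" "z IN N" "w IN N" for x y z w
  using that N'(2) left_module_assoc[OF N] left_module_comm[OF N] by (metis (no_types, lifting))
 show "f (x \<oplus>\<^bsub>M\<^esub> y) \<oplus>\<^bsub>N\<^esub> g (x \<oplus>\<^bsub>M\<^esub> y) = f x \<oplus>\<^bsub>N\<^esub> g x \<oplus>\<^bsub>N\<^esub> (f y \<oplus>\<^bsub>N\<^esub> g y)"
  if "x IN M" "y IN M" for x y
  using that ac f' g' by simp
qed (use linD[OF f] linD[OF g] lmodD[OF N] in auto)

lemma linear_maps_sign:
 assumes "left_module (N :: ('a::ring_1, 'n, 'z) module_scheme)" "f \<in> linear_maps M N"
 shows "(\<lambda>x. (- 1) \<odot>\<^bsub>N\<^esub> f x) \<in> linear_maps M N"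
 using lin_comp[OF assms(2) module_isosD(1)[OF module_isos_minus[OF assms(1), of "- 1"]]] by (simp add: o_def)

lemma linear_maps_pair:
 "f \<in> linear_maps M N ==> g \<in> linear_maps M P ==> (\<lambda>x. (f x, g x)) \<in> linear_maps M (module_sum N P)"
 by (auto simp: linear_maps_def)

section \<open>Pairings, hyperbolic forms and direct summands\<close>

definition pair_map :: "('a, 'm, 'z) module_scheme => ('m => 'n => 'a) => 'n => 'm => 'a" where
 "pair_map A pr f = (\<lambda>y\<in>carrier A. pr y f)"

lemma pair_map_apply [simp]: "y IN A ==> pair_map A pr f y = pr y f"
 by (simp add: pair_map_def)

definition hyp_form :: "('m => 'n => 'a) => ('a, 'm \<times> 'n) bilinear" where
 "hyp_form pr = (\<lambda>(x, f) (y, g). pr y f)"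

lemma hyp_form_apply [simp]: "hyp_form pr (x, f) (y, g) = pr y f"
 by (simp add: hyp_form_def)

definition sum_pairing :: "('m => 'n => 'a::plus) => ('p => 'q => 'a) => 'm \<times> 'p => 'n \<times> 'q => 'a" where
 "sum_pairing pr pr' = (\<lambda>(x, y) (f, g). pr x f + pr' y g)"

lemma sum_pairing_apply [simp]: "sum_pairing pr pr' (x, y) (f, g) = pr x f + pr' y g"
 by (simp add: sum_pairing_def)

definition submodule_structure :: "('a, 'm, 'y) module_scheme => ('a, 'm, 'z) module_scheme => bool" where
 "submodule_structure L M \<longleftrightarrow> carrier L \<subseteq> carrier M \<and> (zero L) = (zero M) \<and>
   (\<forall>x\<in>carrier L. \<forall>y\<in>carrier L. x \<oplus>\<^bsub>L\<^esub> y = x \<oplus>\<^bsub>M\<^esub> y) \<and>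
   (\<forall>a. \<forall>x\<in>carrier L. a \<odot>\<^bsub>L\<^esub> x = a \<odot>\<^bsub>M\<^esub> x)"

lemma submodule_structure_id: "submodule_structure L M ==> id \<in> linear_maps L M"
 by (auto simp: submodule_structure_def linear_maps_def)

text \<open>C is the kernel of r, and conversely r is the first component of the decomposition along
  C. A retraction is more convenient than a complement because it is transported along isomorphisms
  by composition.\<close>

lemma complement_iff_retraction:
 assumes M: "left_module (M :: ('a::ring_1, 'm, 'z) module_scheme)" and L: "left_module L" and s: "submodule_structure L M"
 shows "(\<exists>C. submodule_of C M \<and> carrier L \<inter> C = {(zero M)} \<and> (\<forall>x\<in>carrier M. \<exists>l\<in>carrier L. \<exists>c\<in>C. x = l \<oplus>\<^bsub>M\<^esub> c)) \<longleftrightarrow>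
  (\<exists>r\<in>linear_maps M L. \<forall>x\<in>carrier L. r x = x)"
proof
 note M' = lmodD[OF M] and L' = lmodD[OF L] and mm = lmod_minus[OF M]
 have sub: "\<And>x. x IN L ==> x IN M" "(zero L) = zero M" "\<And>x y. x IN L ==> y IN L ==> x \<oplus>\<^bsub>L\<^esub> y = x \<oplus>\<^bsub>M\<^esub> y"
  "\<And>a x. x IN L ==> a \<odot>\<^bsub>L\<^esub> x = a \<odot>\<^bsub>M\<^esub> x" using s by (auto simp: submodule_structure_def)
 have ac: "x \<oplus>\<^bsub>M\<^esub> y \<oplus>\<^bsub>M\<^esub> (z \<oplus>\<^bsub>M\<^esub> w) = x \<oplus>\<^bsub>M\<^esub> z \<oplus>\<^bsub>M\<^esub> (y \<oplus>\<^bsub>M\<^esub> w)"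
  if "x IN M" "y IN M" "z IN M" "w IN M" for x y z w
  using that M'(2) left_module_assoc[OF M] left_module_comm[OF M] by (metis (no_types, lifting))
 {
  assume "\<exists>C. submodule_of C M \<and> carrier L \<inter> C = {(zero M)} \<and> (\<forall>x\<in>carrier M. \<exists>l\<in>carrier L. \<exists>c\<in>C. x = l \<oplus>\<^bsub>M\<^esub> c)"
  then obtain C where C: "submodule_of C M" "carrier L \<inter> C = {(zero M)}" "\<And>x. x IN M ==> \<exists>l\<in>carrier L. \<exists>c\<in>C. x = l \<oplus>\<^bsub>M\<^esub> c" by blast
  have CM: "\<And>c. c \<in> C ==> c IN M" "(zero M) \<in> C" "\<And>c d. c \<in> C ==> d \<in> C ==> c \<oplus>\<^bsub>M\<^esub> d \<in> C" "\<And>a c. c \<in> C ==> a \<odot>\<^bsub>M\<^esub> c \<in> C"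
   using C(1) by (auto simp: submodule_of_def)
  have uniq: "l = l'" if l: "l IN L" "l' IN L" "c \<in> C" "c' \<in> C" "l \<oplus>\<^bsub>M\<^esub> c = l' \<oplus>\<^bsub>M\<^esub> c'" for l l' c c'
  proof -
   let ?n = "\<lambda>x. (- 1) \<odot>\<^bsub>M\<^esub> x"
   note cl = sub(1)[OF l(1)] sub(1)[OF l(2)] CM(1)[OF l(3)] CM(1)[OF l(4)]
   note cn = M'(4)[OF cl(2), of "- 1"] M'(4)[OF cl(3), of "- 1"]
   have "l \<oplus>\<^bsub>M\<^esub> ?n l' = (l \<oplus>\<^bsub>M\<^esub> ?n l') \<oplus>\<^bsub>M\<^esub> (c \<oplus>\<^bsub>M\<^esub> ?n c)" using cl cn M' mm by simp
   also have "\<dots> = (l \<oplus>\<^bsub>M\<^esub> c) \<oplus>\<^bsub>M\<^esub> (?n l' \<oplus>\<^bsub>M\<^esub> ?n c)" by (rule ac) (use cl cn in simp_all)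
   also have "\<dots> = (l' \<oplus>\<^bsub>M\<^esub> c') \<oplus>\<^bsub>M\<^esub> (?n l' \<oplus>\<^bsub>M\<^esub> ?n c)" using l(5) by simp
   also have "\<dots> = (l' \<oplus>\<^bsub>M\<^esub> ?n l') \<oplus>\<^bsub>M\<^esub> (c' \<oplus>\<^bsub>M\<^esub> ?n c)" by (rule ac) (use cl cn in simp_all)
   also have "\<dots> = c' \<oplus>\<^bsub>M\<^esub> ?n c" using cl cn M' mm by simp
   finally have eq: "l \<oplus>\<^bsub>M\<^esub> ?n l' = c' \<oplus>\<^bsub>M\<^esub> ?n c" .
   have "l \<oplus>\<^bsub>M\<^esub> ?n l' IN L"
    using L'(2)[OF l(1) L'(4)[OF l(2), of "- 1"]] sub(3)[OF l(1) L'(4)[OF l(2), of "- 1"]] sub(4)[OF l(2)] by simp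
   moreover have "l \<oplus>\<^bsub>M\<^esub> ?n l' \<in> C" unfolding eq using CM(3)[OF l(4) CM(4)[OF l(3)]] .
   ultimately have z: "l \<oplus>\<^bsub>M\<^esub> ?n l' = zero M" using C(2) by blast
   have "l = l \<oplus>\<^bsub>M\<^esub> (?n l' \<oplus>\<^bsub>M\<^esub> l')" using cl M' mm by simp
   also have "\<dots> = l'" unfolding left_module_assoc[OF M cl(1) cn(1) cl(2), symmetric] z using cl M' by simp
   finally show ?thesis .
  qed
  define r where "r x = (SOME l. l IN L \<and> (\<exists>c\<in>C. x = l \<oplus>\<^bsub>M\<^esub> c))" for x
  have r: "r x IN L" "\<exists>c\<in>C. x = r x \<oplus>\<^bsub>M\<^esub> c" if "x IN M" for x
   using someI_ex[of "\<lambda>l. l IN L \<and> (\<exists>c\<in>C. x = l \<oplus>\<^bsub>M\<^esub> c)"] C(3)[OF that] unfolding r_def by blast+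
  have r_eq: "r x = l" if x: "x IN M" "l IN L" "c \<in> C" "x = l \<oplus>\<^bsub>M\<^esub> c" for x l c
  proof -
   obtain c' where "c' \<in> C" "x = r x \<oplus>\<^bsub>M\<^esub> c'" using r(2)[OF x(1)] by blast
   then show ?thesis using uniq[OF r(1)[OF x(1)] x(2) _ x(3), of c'] x(4) by simp
  qed
  have "r \<in> linear_maps M L"
  proof (rule linI)
   fix x y assume xy: "x IN M" "y IN M"
   obtain c where c: "c \<in> C" "x = r x \<oplus>\<^bsub>M\<^esub> c" using r(2)[OF xy(1)] by blast
   obtain d where d: "d \<in> C" "y = r y \<oplus>\<^bsub>M\<^esub> d" using r(2)[OF xy(2)] by blast
   have "x \<oplus>\<^bsub>M\<^esub> y = (r x \<oplus>\<^bsub>M\<^esub> c) \<oplus>\<^bsub>M\<^esub> (r y \<oplus>\<^bsub>M\<^esub> d)" using c d by simp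
   also have "\<dots> = (r x \<oplus>\<^bsub>L\<^esub> r y) \<oplus>\<^bsub>M\<^esub> (c \<oplus>\<^bsub>M\<^esub> d)"
    unfolding sub(3)[OF r(1)[OF xy(1)] r(1)[OF xy(2)]] by (rule ac) (use r xy sub(1) CM c d in auto)
   finally show "r (x \<oplus>\<^bsub>M\<^esub> y) = r x \<oplus>\<^bsub>L\<^esub> r y"
    using r_eq[OF M'(2)[OF xy] L'(2)[OF r(1)[OF xy(1)] r(1)[OF xy(2)]] CM(3)[OF c(1) d(1)]] by simp
  next
   fix a x assume x: "x IN M"
   obtain c where c: "c \<in> C" "x = r x \<oplus>\<^bsub>M\<^esub> c" using r(2)[OF x] by blast
   have "a \<odot>\<^bsub>M\<^esub> x = a \<odot>\<^bsub>M\<^esub> (r x \<oplus>\<^bsub>M\<^esub> c)" using c by simp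
   also have "\<dots> = a \<odot>\<^bsub>L\<^esub> r x \<oplus>\<^bsub>M\<^esub> a \<odot>\<^bsub>M\<^esub> c"
    unfolding sub(4)[OF r(1)[OF x]] by (rule M'(6)) (use r x sub(1) CM c in auto)
   finally show "r (a \<odot>\<^bsub>M\<^esub> x) = a \<odot>\<^bsub>L\<^esub> r x"
    using r_eq[OF M'(4)[OF x] L'(4)[OF r(1)[OF x]] CM(4)[OF c(1)]] by simp
  qed (rule r)
  moreover have "r x = x" if "x IN L" for x
   using r_eq[OF sub(1)[OF that] that CM(2)] M'(10)[OF sub(1)[OF that]] by simp
  ultimately show "\<exists>r\<in>linear_maps M L. \<forall>x\<in>carrier L. r x = x" by blast
 }
 {
  assume "\<exists>r\<in>linear_maps M L. \<forall>x\<in>carrier L. r x = x"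
  then obtain r where r: "r \<in> linear_maps M L" "\<And>x. x IN L ==> r x = x" by blast
  note r' = linD[OF r(1)]
  let ?C = "{c \<in> carrier M. r c = (zero L)}"
  have "submodule_of ?C M"
   using M' r' L' linear_maps_zero[OF r(1) M L] lmod_minus(4)[OF L L'(3)] by (auto simp: submodule_of_def)
  moreover have "carrier L \<inter> ?C = {(zero M)}" using r(2) sub L' M' by auto
  moreover have "\<exists>l\<in>carrier L. \<exists>c\<in>?C. x = l \<oplus>\<^bsub>M\<^esub> c" if x: "x IN M" for x
  proof -
   let ?c = "x \<oplus>\<^bsub>M\<^esub> (- 1) \<odot>\<^bsub>M\<^esub> r x"
   note rx = r'(1)[OF x] and rM = sub(1)[OF r'(1)[OF x]]
   have "r ?c = r x \<oplus>\<^bsub>L\<^esub> (- 1) \<odot>\<^bsub>L\<^esub> r x" using r'(2)[OF x M'(4)[OF rM]] r'(3)[OF rM] r(2)[OF rx] by simp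
   then have "?c \<in> ?C" using lmod_minus(2)[OF L rx] M'(2)[OF x M'(4)[OF rM]] by simp
   moreover have "x = r x \<oplus>\<^bsub>M\<^esub> ?c"
    using left_module_comm[OF M x M'(4)[OF rM, of "- 1"]] left_module_assoc[OF M rM M'(4)[OF rM, of "- 1"] x] mm(2)[OF rM] M'(9)[OF x] by simp
   ultimately show ?thesis using rx by blast
  qed
  ultimately show "\<exists>C. submodule_of C M \<and> carrier L \<inter> C = {(zero M)} \<and> (\<forall>x\<in>carrier M. \<exists>l\<in>carrier L. \<exists>c\<in>C. x = l \<oplus>\<^bsub>M\<^esub> c)" by blast
 }
qed

context form_parameter
begin

lemma based_summand_iff:
 assumes M: "left_module M"
 shows "based_summand Z L M \<longleftrightarrow> based L \<and> submodule_structure L M \<and> (\<exists>r\<in>linear_maps M L. \<forall>x\<in>carrier L. r x = x)"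
proof (cases "based L \<and> submodule_structure L M")
 case True
 then show ?thesis using complement_iff_retraction[OF M basedD(1), of L]
  by (simp add: based_summand_def submodule_structure_def)
qed (auto simp: based_summand_def submodule_structure_def)

text \<open>\<open>A'\<close> is a module in simple duality with A. Taking it in place of the dual
  itself avoids identifications: sums of duals for sums, \<Lambda>^n paired with itself, and M
  paired with itself by a simple form are all instances.\<close>

definition dual_pair :: "('a, 'm) based_module => ('a, 'n) based_module => ('m => 'n => 'a) => bool" where
 "dual_pair A A' pr \<longleftrightarrow> based A \<and> based A' \<and> siso A' (bdual A) (pair_map A pr)"

lemma dual_pairD:
 assumes "dual_pair A A' pr"
 shows "based A" "based A'" "siso A' (bdual A) (pair_map A pr)"
  "\<And>x y f. x IN A ==> y IN A ==> f IN A' ==> pr (x \<oplus>\<^bsub>A\<^esub> y) f = pr x f + pr y f"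
  "\<And>a x f. x IN A ==> f IN A' ==> pr (a \<odot>\<^bsub>A\<^esub> x) f = a * pr x f"
  "\<And>x f g. x IN A ==> f IN A' ==> g IN A' ==> pr x (f \<oplus>\<^bsub>A'\<^esub> g) = pr x f + pr x g"
  "\<And>a x f. x IN A ==> f IN A' ==> pr x (a \<odot>\<^bsub>A'\<^esub> f) = pr x f * invol a"
  "\<And>f. f IN A' ==> pr (zero A) f = 0" "\<And>x. x IN A ==> pr x (zero A') = 0"
proof -
 show A: "based A" "based A'" and s: "siso A' (bdual A) (pair_map A pr)"
  using assms by (auto simp: dual_pair_def)
 note A' = lmodD[OF basedD(1)[OF A(1)]] and B' = lmodD[OF basedD(1)[OF A(2)]]
 note sd = sisoD[OF s, simplified]
 have d: "pair_map A pr f IN (dual A)" if "f IN A'" for f using sd(3)[OF that] .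
 show "pr (x \<oplus>\<^bsub>A\<^esub> y) f = pr x f + pr y f" if "x IN A" "y IN A" "f IN A'" for x y f
  using dualD(2)[OF d[OF that(3)] that(1,2)] that A' by simp
 show *: "pr (a \<odot>\<^bsub>A\<^esub> x) f = a * pr x f" if "x IN A" "f IN A'" for a x f
  using dualD(3)[OF d[OF that(2)] that(1)] that A' by simp
 show "pr x (f \<oplus>\<^bsub>A'\<^esub> g) = pr x f + pr x g" if "x IN A" "f IN A'" "g IN A'" for x f g
  using fun_cong[OF sd(4)[OF that(2,3)], of x] that by simp
 show **: "pr x (a \<odot>\<^bsub>A'\<^esub> f) = pr x f * invol a" if "x IN A" "f IN A'" for x a f
  using fun_cong[OF sd(5)[OF that(2)], of a x] that by simp
 show "pr (zero A) f = 0" if "f IN A'" for f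
  using *[OF A'(3) that, of 0] lmod_minus(3)[OF basedD(1)[OF A(1)] A'(3)] by simp
 show "pr x (zero A') = 0" if "x IN A" for x
  using **[OF that B'(3), of 0] lmod_minus(3)[OF basedD(1)[OF A(2)] B'(3)] by simp
qed

lemma dual_pair_ext:
 assumes "dual_pair A A' pr" "f IN A'" "g IN A'" "\<And>y. y IN A ==> pr y f = pr y g"
 shows "f = g"
proof -
 have "pair_map A pr f = pair_map A pr g" using assms(4) by (auto simp: pair_map_def intro!: restrict_ext)
 then show ?thesis using sisoD(9)[OF dual_pairD(3)[OF assms(1)]] assms(2,3) by (auto dest: inj_onD)
qed

lemma dual_pair_represent:
 assumes "dual_pair A A' pr" "F IN (dual A)"
 shows "inv_map A' (pair_map A pr) F IN A'" "\<And>y. y IN A ==> pr y (inv_map A' (pair_map A pr) F) = F y"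
proof -
 note s = sisoD[OF dual_pairD(3)[OF assms(1)], simplified]
 show "inv_map A' (pair_map A pr) F IN A'" by (rule s(8)[OF assms(2)])
 show "pr y (inv_map A' (pair_map A pr) F) = F y" if "y IN A" for y
  using fun_cong[OF s(7)[OF assms(2)], of y] that by simp
qed

lemma sesqui_hyp_form:
 assumes "dual_pair A A' pr"
 shows "sesqui (module_sum A A') (hyp_form pr)"
 by (rule sesquiI) (auto simp: dual_pairD(4-)[OF assms])

lemma dual_pair_dual:
 fixes K :: "('a, 'm) based_module"
 assumes K: "based K"
 shows "dual_pair K (bdual K) (\<lambda>y f. f y)"
proof -
 note D = based_dual_closed[OF K]
 have "siso (bdual K) (bdual K) (pair_map K (\<lambda>y f. f y))"
  by (rule simple_iso_cong[OF siso_id[OF D] D D])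
   (auto simp: pair_map_def extensional_restrict dest!: dualD(1))
 then show ?thesis using K D by (simp add: dual_pair_def)
qed

lemma dual_pair_vec: "dual_pair (bfree k) (bfree k) (vpair k)"
proof -
 note F = based_free_closed[of k]
 have "siso (bfree k) (bdual (bfree k)) (pair_map (bfree k) (vpair k))"
  by (rule simple_iso_cong[OF simple_iso_vec_dual F based_dual_closed[OF F]]) (auto simp: pair_map_def vec_dual_def)
 then show ?thesis using F by (simp add: dual_pair_def)
qed

lemma dual_pair_sum:
 assumes A: "dual_pair A A' pr" and B: "dual_pair B B' pr'"
 shows "dual_pair (bsum A B) (bsum A' B') (sum_pairing pr pr')"
proof -
 note a = dual_pairD[OF A] and b = dual_pairD[OF B]
 note d = based_dual_closed[OF a(1)] based_dual_closed[OF b(1)]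
 have "siso (bsum A' B') (bdual (bsum A B)) (dual_sum_iso A B \<circ> map_prod (pair_map A pr) (pair_map B pr'))"
  by (rule siso_comp[OF _ _ _ simple_iso_map_prod[OF a(2) b(2) d a(3) b(3)] simple_iso_dual_sum[OF a(1) b(1)]])
   (simp_all add: a b d)
 then have "siso (bsum A' B') (bdual (bsum A B)) (pair_map (bsum A B) (sum_pairing pr pr'))"
  by (rule simple_iso_cong) (auto simp: a b pair_map_def dual_sum_iso_def intro!: restrict_ext)
 then show ?thesis by (simp add: dual_pair_def a b)
qed

text \<open>With the negated pairing, the negative of a hyperbolic form is again a hyperbolic form
  on the same two modules.\<close>

lemma dual_pair_neg:
 assumes A: "dual_pair A A' pr"
 shows "dual_pair A A' (\<lambda>y f. - pr y f)"
proof -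
 note a = dual_pairD[OF A]
 note d = based_dual_closed[OF a(1)]
 have "siso A' (bdual A) ((\<lambda>F. (- 1) \<odot>\<^bsub>bdual A\<^esub> F) \<circ> pair_map A pr)"
  by (rule siso_comp[OF a(2) d d a(3) simple_iso_sign[OF d]]) simp
 then have "siso A' (bdual A) (pair_map A (\<lambda>y f. - pr y f))"
  by (rule simple_iso_cong[OF _ a(2) d]) (auto simp: pair_map_def dual_simps intro!: restrict_ext)
 then show ?thesis by (simp add: dual_pair_def a)
qed

text \<open>The transposed pairing is perfect as well, because $A \to A^{**}$ is an isomorphism.\<close>

lemma dual_pair_adjoint:
 assumes A: "dual_pair A A' pr"
 shows "siso A (bdual A') (\<lambda>x. \<lambda>f\<in>carrier A'. invol (pr x f))"
proof -
 note a = dual_pairD[OF A]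
 have "siso A (bdual A') (dual_map A' (pair_map A pr) \<circ> evaluation A)"
  by (rule siso_comp[OF _ _ _ simple_iso_evaluation[OF a(1)] simple_iso_dual[OF a(2) based_dual_closed[OF a(1)] a(3)]])
   (simp_all add: a)
 then show ?thesis
  by (rule simple_iso_cong)
   (use sisoD(3)[OF a(3)] in \<open>auto simp: a dual_map_def evaluation_def intro!: restrict_ext\<close>)
qed

text \<open>The symmetrisation exchanges the summands and then applies A' -> A* to one and
  \<epsilon> times the transposed isomorphism A -> A'* to the other. All of these maps are
  simple.\<close>

lemma simple_form_hyp:
 assumes A: "dual_pair A A' pr"
 shows "simple_form \<epsilon> Z (bsum A A', qcls (bsum A A') (hyp_form pr))"
proof -
 note a = dual_pairD[OF A]
 let ?H = "bsum A A'" and ?adj = "\<lambda>x. \<lambda>f\<in>carrier A'. invol (pr x f)"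
 have H: "based ?H" by (simp add: a)
 note d = based_dual_closed[OF a(1)] based_dual_closed[OF a(2)]
 have "siso ?H (bdual ?H) (dual_sum_iso A A' \<circ> (map_prod (pair_map A pr) ((\<lambda>F. \<epsilon> \<odot>\<^bsub>bdual A'\<^esub> F) \<circ> ?adj) \<circ> prod.swap))"
  by (rule siso_comp[OF _ _ _ siso_comp[OF _ _ _ simple_iso_swap[OF a(1,2)]
     simple_iso_map_prod[OF a(2,1) d a(3) siso_comp[OF a(1) d(2) d(2) dual_pair_adjoint[OF A] simple_iso_sign[OF d(2) eps]]]]
     simple_iso_dual_sum[OF a(1,2)]]) (simp_all add: a d)
 then have "siso ?H (bdual ?H) (rform ?H (lam (hyp_form pr)))"
  by (rule simple_iso_cong)
   (auto simp: a H rform_def dual_sum_iso_def lambda_form_def dual_simps(4) eps_simps(2) eps_simps(3)[of "invol _"] intro!: restrict_ext)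
 then show ?thesis
  using H sesqui_hyp_form[OF A] by (simp add: simple_form.simps symmetrisation_quad_class basedD)
qed

text \<open>The new symmetrisation is the old one, preceded by the inverse isometry and followed by
  the dual of that inverse.\<close>

lemma simple_form_isometry:
 assumes M: "based M" and M': "based M'" and s: "sesqui M' \<phi>'"
  and f: "isom (M, qcls M \<phi>) (M', qcls M' \<phi>') f"
  and sf: "simple_form \<epsilon> Z (M, qcls M \<phi>)"
 shows "simple_form \<epsilon> Z (M', qcls M' \<phi>')"
proof -
 have f1: "siso M M' f" "fequiv M (\<lambda>x y. \<phi>' (f x) (f y)) \<phi>" using f isometry_iff[OF M M'] by auto
 note i = siso_inv[OF M M' f1(1)] and fd = sisoD[OF f1(1)]
 have l: "siso M (bdual M) (rform M (lam \<phi>))"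
  using sf symmetrisation_quad_class[OF basedD(1)[OF M]] by (simp add: simple_form.simps)
 have "siso M' (bdual M') (dual_map M' (inv_map M f) \<circ> (rform M (lam \<phi>) \<circ> inv_map M f))"
  by (rule siso_comp[OF M' based_dual_closed[OF M] based_dual_closed[OF M'] siso_comp[OF M' M based_dual_closed[OF M] i l] simple_iso_dual[OF M' M i]])
 then have "siso M' (bdual M') (rform M' (lam \<phi>'))"
 proof (rule simple_iso_cong[OF _ M' based_dual_closed[OF M']])
  fix x assume x: "x IN M'"
  have "lam \<phi> (inv_map M f x) (inv_map M f y) = lam \<phi>' x y" if y: "y IN M'" for y
   using lambda_form_equiv[OF f1(2) fd(8)[OF x] fd(8)[OF y]] x y fd(7) by (simp add: lambda_form_def)
  then show "(dual_map M' (inv_map M f) \<circ> (rform M (lam \<phi>) \<circ> inv_map M f)) x = rform M' (lam \<phi>') x"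
   using x fd(8) by (auto simp: rform_def dual_map_def intro!: restrict_ext)
 qed
 then show ?thesis using M' s by (simp add: simple_form.simps symmetrisation_quad_class basedD)
qed

lemma hyperbolic_eq: "hyper K = (bsum K (bdual K), qcls (bsum K (bdual K)) (hyp_form (\<lambda>y f. f y)))"
proof -
 have "(\<lambda>(x, f)\<in>carrier H. \<lambda>(y, g)\<in>carrier H. f y) = rform H (hyp_form (\<lambda>y f. f y))" for H :: "('a, 'b \<times> ('b => 'a)) based_module"
  by (auto simp: rform_def hyp_form_def split: prod.split intro!: restrict_ext)
 then show ?thesis by (simp add: hyperbolic_def Let_def quad_class_def)
qed

text \<open>\<open>s'\<close> is the contragredient of \<open>s\<close>: the dual of its inverse,
  read through the identifications of \<open>A'\<close> and \<open>B'\<close> with the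
  duals.\<close>

lemma dual_pair_iso:
 assumes A: "dual_pair A A' pr" and B: "dual_pair B B' pr'" and s: "siso A B s"
 obtains s' where "siso A' B' s'" "\<And>y f. y IN A ==> f IN A' ==> pr' (s y) (s' f) = pr y f"
  "isom (bsum A A', qcls (bsum A A') (hyp_form pr))
    (bsum B B', qcls (bsum B B') (hyp_form pr')) (map_prod s s')"
proof -
 note a = dual_pairD[OF A] and b = dual_pairD[OF B] and sd = sisoD[OF s]
 note i = siso_inv[OF a(1) b(1) s]
 note da = based_dual_closed[OF a(1)] and db = based_dual_closed[OF b(1)]
 let ?s = "inv_map B' (pair_map B pr') \<circ> (dual_map B (inv_map A s) \<circ> pair_map A pr)"
 have s': "siso A' B' ?s"
  by (rule siso_comp[OF a(2) db b(2) siso_comp[OF a(2) da db a(3) simple_iso_dual[OF b(1) a(1) i]] siso_inv[OF b(2) db b(3)]])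
 have pr: "pr' (s y) (?s f) = pr y f" if "y IN A" "f IN A'" for y f
 proof -
  have "dual_map B (inv_map A s) (pair_map A pr f) IN (dual B)"
   using sisoD(3)[OF simple_iso_dual[OF b(1) a(1) i]] sisoD(3)[OF a(3) that(2)] by simp
  from dual_pair_represent(2)[OF B this sd(3)[OF that(1)]] show ?thesis
   using that sd by simp
 qed
 have "fequiv (module_sum A A') (\<lambda>x y. hyp_form pr' (map_prod s ?s x) (map_prod s ?s y)) (hyp_form pr)"
  by (rule form_equiv_cong) (use pr in auto)
 then have "isom (bsum A A', qcls (bsum A A') (hyp_form pr))
    (bsum B B', qcls (bsum B B') (hyp_form pr')) (map_prod s ?s)"
  unfolding isometry_iff[OF based_sum_closed[OF a(1,2)] based_sum_closed[OF b(1,2)]]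
  using simple_iso_map_prod[OF a(1,2) b(1,2) s s'] by simp
 then show ?thesis using that s' pr by blast
qed

lemma isometry_interchange:
 assumes A: "dual_pair A A' pr" and B: "dual_pair B B' pr'"
 shows "isom (bsum (bsum A A') (bsum B B'), qcls (bsum (bsum A A') (bsum B B')) (sum_form (hyp_form pr) (hyp_form pr')))
   (bsum (bsum A B) (bsum A' B'), qcls (bsum (bsum A B) (bsum A' B')) (hyp_form (sum_pairing pr pr'))) interchange"
proof -
 note a = dual_pairD[OF A] and b = dual_pairD[OF B]
 have "fequiv (bsum (bsum A A') (bsum B B')) (\<lambda>x y. hyp_form (sum_pairing pr pr') (interchange x) (interchange y)) (sum_form (hyp_form pr) (hyp_form pr'))"
  by (rule form_equiv_cong) auto
 then show ?thesis
  using isometry_iff[of "bsum (bsum A A') (bsum B B')" "bsum (bsum A B) (bsum A' B')" "sum_form (hyp_form pr) (hyp_form pr')"]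
   simple_iso_interchange[OF a(1,2) b(1,2)] a b by simp
qed

text \<open>A simple Lagrangian is the first summand of a hyperbolic form isometric to the given one.\<close>

definition hyperbolic_splitting where
 "hyperbolic_splitting M \<phi> K h \<longleftrightarrow> based K \<and>
   isom (hyper K) (M, qcls M \<phi>) h \<and> (\<forall>x\<in>carrier K. h (x, zero (dual K)) = x)"

lemma hyperbolic_splittingD:
 assumes M: "based M" and h: "hyperbolic_splitting M \<phi> K h"
 shows "based K" "siso (bsum K (bdual K)) M h"
  "fequiv (bsum K (bdual K)) (\<lambda>x y. \<phi> (h x) (h y)) (hyp_form (\<lambda>y f. f y))"
  "\<And>x. x IN K ==> h (x, zero (dual K)) = x" "submodule_structure K M"
proof -
 show K: "based K" and x: "\<And>x. x IN K ==> h (x, zero (dual K)) = x" using h by (auto simp: hyperbolic_splitting_def)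
 let ?H = "bsum K (bdual K)"
 have H: "based ?H" using K by simp
 show i: "siso ?H M h" and "fequiv ?H (\<lambda>x y. \<phi> (h x) (h y)) (hyp_form (\<lambda>y f. f y))"
  using h isometry_iff[OF H M] unfolding hyperbolic_splitting_def hyperbolic_eq by auto
 note K' = lmodD[OF basedD(1)[OF K]] and D' = lmodD[OF left_module_dual[OF basedD(1)[OF K]]]
 note hd = sisoD[OF i, simplified]
 have "x \<oplus>\<^bsub>K\<^esub> y = x \<oplus>\<^bsub>M\<^esub> y" if "x IN K" "y IN K" for x y
  using hd(4)[of "(x, zero (dual K))" "(y, zero (dual K))"] that x K' D' by simp
 moreover have "a \<odot>\<^bsub>K\<^esub> y = a \<odot>\<^bsub>M\<^esub> y" if "y IN K" for a y
  using hd(5)[of "(y, zero (dual K))" a] that x K' D' lmod_minus(4)[OF left_module_dual[OF basedD(1)[OF K]] D'(3)] by simp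
 moreover have "(zero K) = zero M"
  using linear_maps_zero[OF hd(2)] x[OF K'(3)] left_module_sum[OF basedD(1)[OF K] basedD(1)[OF based_dual_closed[OF K]]]
   basedD(1)[OF M] by simp
 moreover have "carrier K \<subseteq> carrier M"
 proof
  fix z assume "z IN K"
  then show "z IN M" using hd(3)[of "(z, zero (dual K))"] x D' by simp
 qed
 ultimately show "submodule_structure K M" by (simp add: submodule_structure_def)
qed

text \<open>In the coordinates of the splitting, \<open>h (z, F)\<close> pairs with y in K to
  \<open>F y\<close>. So orthogonality to K means F = 0, and the map from M to the dual of K is the
  projection to F, split by the second summand.\<close>

lemma simple_lagrangian_if_splitting:
 assumes M: "based M" and s: "sesqui M \<phi>" and h: "hyperbolic_splitting M \<phi> K h"
 shows "simple_lagrangian \<epsilon> Z (M, qcls M \<phi>) K"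
proof -
 note D = hyperbolic_splittingD[OF M h]
 let ?D = "bdual K" and ?H = "bsum K (bdual K)" and ?l = "lam \<phi>"
 note K = basedD(1)[OF D(1)] and M' = basedD(1)[OF M]
 note Kd = lmodD[OF K] and Dd = lmodD[OF left_module_dual[OF K]]
 note hd = sisoD[OF D(2), simplified]
 have H: "based ?H" using D(1) by simp
 have sym: "symmetrisation \<epsilon> M (qcls M \<phi>) = rform M ?l" by (rule symmetrisation_quad_class[OF M'])
 have sf: "simple_form \<epsilon> Z (M, qcls M \<phi>)"
  using h simple_form_isometry[OF H M s _ simple_form_hyp[OF dual_pair_dual[OF D(1)]], of h]
  by (simp add: hyperbolic_splitting_def hyperbolic_eq)
 have KM: "x IN M" if "x IN K" for x using D(5) that by (auto simp: submodule_structure_def)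
 have lam: "?l (h (z, F)) y = F y" if "z IN K" "F IN (dual K)" "y IN K" for z F y
 proof -
  have "?l (h (z, F)) (h (y, zero (dual K))) = lam (hyp_form (\<lambda>y f. f y)) (z, F) (y, zero (dual K))"
   using lambda_form_equiv[OF D(3), of "(z, F)" "(y, zero (dual K))"] that Dd by (simp add: lambda_form_def)
  also have "\<dots> = F y" using that by (simp add: lambda_form_def)
  finally show ?thesis using D(4) that by simp
 qed
 have dec: "\<exists>z F. z IN K \<and> F IN (dual K) \<and> x = h (z, F)" if "x IN M" for x
  using hd(7)[OF that] hd(8)[OF that] by (cases "inv_into (carrier K \<times> carrier (dual K)) h x") auto
 have summ: "based_summand Z K M"
  unfolding based_summand_iff[OF M']
 proof (intro conjI D(1) D(5))
  show "\<exists>r\<in>linear_maps M K. \<forall>x\<in>carrier K. r x = x"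
  proof (intro bexI[of _ "fst \<circ> inv_map ?H h"] ballI)
   show "fst \<circ> inv_map ?H h \<in> linear_maps M K"
    using lin_comp[OF sisoD(2)[OF siso_inv[OF H M D(2)]], of fst K] linear_maps_fst[of K ?D] by simp
   fix x assume x: "x IN K"
   have "inv_map ?H h (h (x, zero (dual K))) = (x, zero (dual K))" using sisoD(6)[OF D(2), of "(x, zero (dual K))"] x Dd by simp
   then show "(fst \<circ> inv_map ?H h) x = x" using D(4)[OF x] by simp
  qed
 qed
 have perp: "carrier K = {x \<in> carrier M. \<forall>y\<in>carrier K. rform M ?l x y = 0}"
 proof (intro equalityI subsetI)
  fix x assume x: "x IN K"
  then have "?l x y = 0" if "y IN K" for y using lam[OF x Dd(3) that] D(4)[OF x] that by simp
  then show "x \<in> {x \<in> carrier M. \<forall>y\<in>carrier K. rform M ?l x y = 0}" using x KM by simp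
 next
  fix x assume "x \<in> {x \<in> carrier M. \<forall>y\<in>carrier K. rform M ?l x y = 0}"
  then have x: "x IN M" "\<And>y. y IN K ==> ?l x y = 0" using KM by auto
  obtain z F where zF: "z IN K" "F IN (dual K)" "x = h (z, F)" using dec[OF x(1)] by blast
  have "F = zero (dual K)" by (rule dual_ext[OF zF(2) Dd(3)]) (use x(2) lam zF in auto)
  then show "x IN K" using zF D(4) by simp
 qed
 have "(inl (dual K)) \<in> linear_maps K ?H"
  using linear_maps_inl[OF basedD(1)[OF based_dual_closed[OF D(1)]], of K] by simp
 from form_equiv_pullback[OF D(3) this]
 have "fequiv K (\<lambda>x y. \<phi> (h (x, zero (dual K))) (h (y, zero (dual K)))) (\<lambda>x y. hyp_form (\<lambda>y f. f y) (x, zero (dual K)) (y, zero (dual K)))" .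
 moreover have "fequiv K \<phi> (\<lambda>x y. \<phi> (h (x, zero (dual K))) (h (y, zero (dual K))))" by (rule form_equiv_cong) (simp add: D(4))
 moreover have "fequiv K (\<lambda>x y. hyp_form (\<lambda>y f. f y) (x, zero (dual K)) (y, zero (dual K))) (\<lambda>x y. 0)" by (rule form_equiv_cong) simp
 ultimately have "fequiv K (\<lambda>x y. \<phi> (id x) (id y)) (\<lambda>x y. 0)" by (metis (no_types, lifting) form_equiv_trans id_apply form_equiv_cong)
 then have pb: "Q_pullback \<epsilon> K id (qcls M \<phi>) = \<one>\<^bsub>Q_group \<epsilon> K\<^esub>"
  unfolding Q_pullback_quad_class[OF K M' submodule_structure_id[OF D(5)]] one_Q_group[OF K] quad_class_eq_iff[OF K] .
 let ?p = "\<lambda>x. restrict (rform M ?l x) (carrier K)"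
 have p_h: "?p (h (z, F)) = F" if "z IN K" "F IN (dual K)" for z F
  using lam[OF that] KM hd(3)[of "(z, F)"] that dualD(1)[OF that(2)] by (auto intro!: extensionalityI[of _ "carrier K"])
 have plin: "?p \<in> linear_maps M ?D"
 proof -
  have "rform M ?l \<in> linear_maps M (dual M)"
   using rform_in_Hom[OF M' sesqui_lambda[OF s]] by (simp add: Hom_dual_def)
  from lin_comp[OF this dual_map_linear[OF submodule_structure_id[OF D(5)] K]]
  show ?thesis by (simp add: dual_map_def[abs_def] o_def)
 qed
 have ex: "based_exact Z K M ?D id ?p"
  unfolding based_exact_def
 proof (intro conjI)
  show "id \<in> linear_maps K M" by (rule submodule_structure_id[OF D(5)])
  show "?p \<in> linear_maps M ?D" by (rule plin)
  have "?p x = (zero ?D) \<longleftrightarrow> (\<forall>y\<in>carrier K. rform M ?l x y = 0)" for x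
   by (auto simp: dual_simps(2) restrict_def fun_eq_iff)
  then show "id ` carrier K = {x \<in> carrier M. ?p x = (zero ?D)}" using perp by simp
  show "?p ` carrier M = carrier ?D"
  proof (intro equalityI subsetI)
   fix F assume F: "F IN ?D"
   then have "?p (h (zero K, F)) = F" by (intro p_h) (use Kd in auto)
   moreover have "h (zero K, F) IN M" using F by (intro hd(3)) (use Kd in auto)
   ultimately show "F \<in> ?p ` carrier M" by (metis image_eqI)
  qed (use linD(1)[OF plin] in auto)
  show "\<exists>s\<in>linear_maps ?D M. (\<forall>z\<in>carrier ?D. ?p (s z) = z) \<and> siso ?H M (\<lambda>(x, z). id x \<oplus>\<^bsub>M\<^esub> s z)"
  proof (intro bexI[of _ "\<lambda>F. h (zero K, F)"] conjI ballI)
   show "(\<lambda>F. h (zero K, F)) \<in> linear_maps ?D M"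
    using lin_comp[OF linear_maps_inr[OF K], of h ?D M] sisoD(2)[OF D(2)] by (simp add: o_def linear_maps_def)
   show "?p (h (zero K, F)) = F" if "F IN ?D" for F by (rule p_h) (use that Kd in auto)
   show "siso ?H M (\<lambda>(x, z). id x \<oplus>\<^bsub>M\<^esub> h (zero K, z))"
   proof (rule simple_iso_cong[OF D(2) H M])
    fix q assume "q IN ?H"
    then obtain x F where q: "q = (x, F)" "x IN K" "F IN (dual K)" by auto
    have "h (x, F) = h (x, zero (dual K)) \<oplus>\<^bsub>M\<^esub> h (zero K, F)"
     using hd(4)[of "(x, zero (dual K))" "(zero K, F)"] q Kd Dd by simp
    then show "h q = (case q of (x, z) => id x \<oplus>\<^bsub>M\<^esub> h (zero K, z))" using D(4) q by simp
   qed
  qed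
 qed simp_all
 show ?thesis using sf summ perp pb ex by (simp add: sym)
qed

text \<open>Conversely, the given splitting $K^* \to M$ is corrected by a map $c \colon K^* \to K$ so that its image
 becomes a Lagrangian; $c$ represents the form induced on $K^*$.\<close>

lemma splitting_if_simple_lagrangian:
 assumes sl: "simple_lagrangian \<epsilon> Z (M, qcls M \<phi>) K" and M: "based M" and s: "sesqui M \<phi>"
 shows "\<exists>h. hyperbolic_splitting M \<phi> K h"
proof -
 let ?D = "bdual K" and ?H = "bsum K (bdual K)" and ?l = "lam \<phi>"
 note M' = basedD(1)[OF M] and Md = lmodD[OF basedD(1)[OF M]]
 have sym: "symmetrisation \<epsilon> M (qcls M \<phi>) = rform M ?l" by (rule symmetrisation_quad_class[OF M'])
 have summ: "based_summand Z K M" and pb: "Q_pullback \<epsilon> K id (qcls M \<phi>) = \<one>\<^bsub>Q_group \<epsilon> K\<^esub>"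
  and perp: "carrier K = {x \<in> carrier M. \<forall>y\<in>carrier K. rform M ?l x y = 0}"
  and ex: "based_exact Z K M ?D id (\<lambda>x. restrict (rform M ?l x) (carrier K))"
  using sl by (auto simp: sym)
 have Kb: "based K" and sub: "submodule_structure K M" using summ based_summand_iff[OF M'] by auto
 note K = basedD(1)[OF Kb]
 note Kd = lmodD[OF K] and Dd = lmodD[OF left_module_dual[OF K]]
 have KM: "x IN M" if "x IN K" for x using sub that by (auto simp: submodule_structure_def)
 have H: "based ?H" using Kb by simp
 obtain t where t: "t \<in> linear_maps ?D M" "\<And>z. z IN ?D ==> restrict (rform M ?l (t z)) (carrier K) = z"
  "siso ?H M (\<lambda>(x, z). id x \<oplus>\<^bsub>M\<^esub> t z)"
  using ex unfolding based_exact_def by blast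
 note tl = linD[OF t(1), simplified]
 have lam: "?l (t F) y = F y" if "F IN (dual K)" "y IN K" for F y
  using fun_cong[OF t(2), of F y] that tl(1) KM by simp
 have "fequiv K (\<lambda>x y. \<phi> (id x) (id y)) (\<lambda>x y. 0)"
  using pb unfolding Q_pullback_quad_class[OF K M' submodule_structure_id[OF sub]] one_Q_group[OF K] quad_class_eq_iff[OF K] .
 then obtain \<kappa>0 where k0: "sesqui K \<kappa>0" "\<And>x y. x IN K ==> y IN K ==> \<phi> x y = \<kappa>0 x y - \<epsilon> * invol (\<kappa>0 y x)"
  unfolding form_equiv_def by auto
 note sd = sesquiD[OF s]
 let ?E = "\<lambda>F. \<lambda>G\<in>carrier (dual K). \<epsilon> * \<phi> (t F) (t G)"
 have E: "?E \<in> linear_maps (dual K) (dual (dual K))"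
 proof -
  have "sesqui (dual K) (\<lambda>F G. \<epsilon> * \<phi> (t F) (t G))"
   by (rule sesqui_eps[OF sesqui_pullback[OF s]]) (use t(1) in simp)
  then have "rform (dual K) (\<lambda>F G. \<epsilon> * \<phi> (t F) (t G)) \<in> linear_maps (dual K) (dual (dual K))"
   using rform_in_Hom[OF left_module_dual[OF K]] by (simp add: Hom_dual_def)
  note e = linD[OF this]
  have eq: "rform (dual K) (\<lambda>F G. \<epsilon> * \<phi> (t F) (t G)) F = ?E F" if "F IN (dual K)" for F
   using that by (simp add: rform_def)
  show ?thesis
  proof (rule linI)
   show "?E F \<in> carrier (dual (dual K))" if "F IN (dual K)" for F
    using e(1)[OF that] unfolding eq[OF that] .
   show "?E (F \<oplus>\<^bsub>dual K\<^esub> G) = ?E F \<oplus>\<^bsub>dual (dual K)\<^esub> ?E G" if "F IN (dual K)" "G IN (dual K)" for F G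
    using e(2)[OF that] unfolding eq[OF that(1)] eq[OF that(2)] eq[OF Dd(2)[OF that]] .
   show "?E (a \<odot>\<^bsub>dual K\<^esub> F) = a \<odot>\<^bsub>dual (dual K)\<^esub> ?E F" if "F IN (dual K)" for a F
    using e(3)[OF that] unfolding eq[OF that] eq[OF Dd(4)[OF that]] .
  qed
 qed
 note ev = simple_iso_evaluation[OF Kb]
 note evd = sisoD[OF ev, simplified]
 \<comment> \<open>Biduality is bijective, so the form induced on the dual of K by t is represented
   by a map into K: the value \<open>invol (G (c F))\<close> is
   \<open>\<epsilon> * \<phi> (t F) (t G)\<close>.\<close>
 define c where "c = inv_map K (evaluation K) \<circ> ?E"
 have dd: "dual (bdual K) = dual (dual K)" by (rule dual_based_dual)
 have clin: "c \<in> linear_maps (dual K) K"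
  unfolding c_def using lin_comp[OF E, of "inv_map K (evaluation K)" K] sisoD(2)[OF siso_inv[OF Kb _ ev]] Kb
  by (simp add: dd)
 have cval: "invol (G (c F)) = \<epsilon> * \<phi> (t F) (t G)" if "F IN (dual K)" "G IN (dual K)" for F G
 proof -
  have "evaluation K (c F) = ?E F"
   unfolding c_def o_def by (rule evd(7)) (use linD(1)[OF E that(1)] dd in simp)
  from fun_cong[OF this, of G] show ?thesis using that by (simp add: evaluation_def)
 qed
 let ?c' = "\<lambda>F. (- 1) \<odot>\<^bsub>K\<^esub> c F"
 have c'lin: "?c' \<in> linear_maps (dual K) K" by (rule linear_maps_sign[OF K clin])
 note c'd = linD[OF c'lin]
 let ?u = "\<lambda>(x, F). x \<oplus>\<^bsub>K\<^esub> ?c' F"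
 let ?h = "(\<lambda>(x, z). id x \<oplus>\<^bsub>M\<^esub> t z) \<circ> (\<lambda>(x, F). (x \<oplus>\<^bsub>K\<^esub> ?c' F, F))"
 have hs: "siso ?H M ?h"
  by (rule siso_comp[OF H H M simple_iso_shear[OF Kb based_dual_closed[OF Kb]] t(3)]) (use c'lin in simp)
 have happ: "?h (x, F) = ?u (x, F) \<oplus>\<^bsub>M\<^esub> t F" for x F by simp
 have ulin: "?u \<in> linear_maps ?H K"
  using linear_maps_add[OF K linear_maps_fst lin_comp[OF linear_maps_snd[of K ?D], of ?c' K]] c'lin by (simp add: o_def case_prod_unfold)
 have ulinM: "?u \<in> linear_maps ?H M"
  using lin_comp[OF ulin submodule_structure_id[OF sub]] by simp
 have tlin: "(\<lambda>(x, F). t F) \<in> linear_maps ?H M"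
  using lin_comp[OF linear_maps_snd[of K ?D] t(1)] by (simp add: o_def case_prod_unfold)
 \<comment> \<open>\<kappa>0 comes from the vanishing of \<phi> on K and the second term is the
   cross term between K and the image of t. The form on that image enters with its own
   \<epsilon>-transpose, and this transpose is what the correction by c contributes.\<close>
 let ?k = "\<lambda>p q. (\<kappa>0 (?u p) (?u q) + \<phi> (?u p) ((\<lambda>(x, F). t F) q)) + \<phi> ((\<lambda>(x, F). t F) p) ((\<lambda>(x, F). t F) q)"
 have fe: "fequiv ?H (\<lambda>p q. \<phi> (?h p) (?h q)) (hyp_form (\<lambda>y f. f y))"
  unfolding form_equiv_def
 proof (intro exI[of _ ?k] conjI ballI)
  show "sesqui ?H ?k"
   by (intro sesqui_ops(1) sesqui_pullback2[OF k0(1) ulin ulin] sesqui_pullback2[OF s ulinM tlin] sesqui_pullback2[OF s tlin tlin])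
  fix p q assume "p IN ?H" "q IN ?H"
  then obtain x F y G where pq: "p = (x, F)" "x IN K" "F IN (dual K)" "q = (y, G)" "y IN K" "G IN (dual K)" by auto
  let ?x = "x \<oplus>\<^bsub>K\<^esub> ?c' F" and ?y = "y \<oplus>\<^bsub>K\<^esub> ?c' G"
  have xy: "?x IN K" "?y IN K" using Kd(2) c'd(1) pq by auto
  note cl = KM[OF xy(1)] KM[OF xy(2)] tl(1)[OF pq(3)] tl(1)[OF pq(6)]
  have exp: "\<phi> (?h p) (?h q) = \<phi> ?x ?y + \<phi> ?x (t G) + \<phi> (t F) ?y + \<phi> (t F) (t G)"
   unfolding pq(1,4) happ using cl by (simp add: sd Md algebra_simps)
  have "F (?c' G) = - F (c G)"
   using dualD(3)[OF pq(3), of "c G" "- 1"] linD(1)[OF clin pq(6)] by simp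
  then have "F ?y = F y - F (c G)" using dualD(2)[OF pq(3) pq(5), of "?c' G"] c'd(1)[OF pq(6)] by simp
  moreover have "F (c G) = \<epsilon> * invol (\<phi> (t G) (t F))"
  proof -
   have "F (c G) = invol (invol (F (c G)))" by simp
   also have "\<dots> = invol (\<epsilon> * \<phi> (t G) (t F))" using cval[OF pq(6,3)] by simp
   also have "\<dots> = \<epsilon> * invol (\<phi> (t G) (t F))" using eps by (auto simp: invol_mult)
   finally show ?thesis .
  qed
  moreover have "\<phi> (t F) ?y + \<epsilon> * invol (\<phi> ?y (t F)) = F ?y" using lam[OF pq(3) xy(2)] by (simp add: lambda_form_def)
  ultimately have e: "\<phi> (t F) ?y = F y - \<epsilon> * invol (\<phi> (t G) (t F)) - \<epsilon> * invol (\<phi> ?y (t F))" by (simp add: algebra_simps)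
  have "\<phi> ?x ?y = \<kappa>0 ?x ?y - \<epsilon> * invol (\<kappa>0 ?y ?x)" by (rule k0(2)[OF xy])
  then have "\<phi> (?h p) (?h q) = (\<kappa>0 ?x ?y - \<epsilon> * invol (\<kappa>0 ?y ?x)) + \<phi> ?x (t G) + (F y - \<epsilon> * invol (\<phi> (t G) (t F)) - \<epsilon> * invol (\<phi> ?y (t F))) + \<phi> (t F) (t G)"
   unfolding exp e by simp
  also have "\<dots> = F y + (((\<kappa>0 ?x ?y + \<phi> ?x (t G)) + \<phi> (t F) (t G)) - \<epsilon> * invol ((\<kappa>0 ?y ?x + \<phi> ?y (t F)) + \<phi> (t G) (t F)))"
   by (simp add: invol_add algebra_simps)
  finally show "\<phi> (?h p) (?h q) = hyp_form (\<lambda>y f. f y) p q + (?k p q - \<epsilon> * invol (?k q p))"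
   by (simp add: pq(1,4))
 qed
 have "?h (x, zero (dual K)) = x" if x: "x IN K" for x
 proof -
  have "?c' (zero (dual K)) = zero K" by (rule linear_maps_zero[OF c'lin left_module_dual[OF K] K])
  moreover have "t (zero (dual K)) = zero M" using linear_maps_zero[of t "dual K" M] t(1) left_module_dual[OF K] M' by simp
  ultimately show ?thesis using x Kd Md KM by simp
 qed
 then have "hyperbolic_splitting M \<phi> K ?h"
  unfolding hyperbolic_splitting_def hyperbolic_eq isometry_iff[OF H M] using Kb hs fe by blast
 then show ?thesis by blast
qed

end

section \<open>Quasi-formations\<close>

lemma linear_maps_cong:
 assumes "f \<in> linear_maps M N" "left_module M" "\<And>x. x IN M ==> f' x = f x"
 shows "f' \<in> linear_maps M N"
 by (rule linI) (simp_all add: assms(3) lmodD[OF assms(2)] linD[OF assms(1)])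

lemma fst_form_sum [simp]: "fst (form_sum \<epsilon> Z F G) = based_sum Z (fst F) (fst G)"
 by (cases F; cases G) simp

context form_parameter
begin

section \<open>Hyperbolic spaces and isometries between forms\<close>

definition hyp_space :: "('a, 'm) based_module => ('a, 'n) based_module => ('m => 'n => 'a) => ('a, 'm \<times> 'n) quad_form" where
 "hyp_space A A' pr = (bsum A A', qcls (bsum A A') (hyp_form pr))"

lemma fst_hyp_space [simp]: "fst (hyp_space A A' pr) = bsum A A'"
 by (simp add: hyp_space_def)

lemma hyperbolic_hyp_space: "hyper K = hyp_space K (bdual K) (\<lambda>y f. f y)"
 by (simp add: hyperbolic_eq hyp_space_def)

lemma fst_hyperbolic [simp]: "fst (hyper K) = bsum K (bdual K)"
 by (simp add: hyperbolic_hyp_space)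

lemma qform_hyp: "dual_pair A A' pr ==> qform (hyp_space A A' pr)"
 using dual_pairD(1,2)[of A A' pr] sesqui_hyp_form[of A A' pr] by (simp add: hyp_space_def)

lemma quad_form_hyperbolic: "based K ==> qform (hyper K)"
 by (simp add: hyperbolic_hyp_space qform_hyp dual_pair_dual)

lemma qform_cases:
 assumes "qform F"
 obtains M \<phi> where "F = (M, qcls M \<phi>)" "based M" "sesqui M \<phi>"
 using assms quad_formE by (metis surj_pair)

lemma quad_form_based: "qform F ==> based (fst F)"
 by (erule qform_cases) simp

lemma isometry_simple_iso: "isom F F' f ==> siso (fst F) (fst F') f"
 by (cases F; cases F') (simp add: isometry.simps)

lemma isometry_refl: "qform F ==> isom F F id"
proof (erule qform_cases)
 fix M \<phi> assume F: "F = (M, qcls M \<phi>)" and M: "based M"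
 show ?thesis unfolding F isometry_iff[OF M M] using siso_id[OF M] by simp
qed

lemma isometry_trans:
 assumes F: "qform F" and G: "qform G" and H: "qform H"
  and f: "isom F G f" and g: "isom G H g"
 shows "isom F H (g \<circ> f)"
proof -
 obtain M \<phi> where M: "F = (M, qcls M \<phi>)" "based M" by (rule qform_cases[OF F])
 obtain M' \<phi>' where M': "G = (M', qcls M' \<phi>')" "based M'" by (rule qform_cases[OF G])
 obtain M'' \<phi>'' where M'': "H = (M'', qcls M'' \<phi>'')" "based M''" by (rule qform_cases[OF H])
 show ?thesis using isometry_comp[OF M(2) M'(2) M''(2)] f g unfolding M(1) M'(1) M''(1) by blast
qed

lemma isometry_sym:
 assumes F: "qform F" and G: "qform G" and f: "isom F G f"
 shows "isom G F (inv_map (fst F) f)"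
proof -
 obtain M \<phi> where M: "F = (M, qcls M \<phi>)" "based M" by (rule qform_cases[OF F])
 obtain M' \<phi>' where M': "G = (M', qcls M' \<phi>')" "based M'" by (rule qform_cases[OF G])
 show ?thesis using isometry_inv[OF M(2) M'(2)] f unfolding M(1) M'(1) by simp
qed

lemma isometry_cong:
 assumes F: "qform F" and G: "qform G" and f: "isom F G f"
  and eq: "\<And>x. x IN (fst F) ==> f x = f' x"
 shows "isom F G f'"
proof -
 obtain M \<phi> where M: "F = (M, qcls M \<phi>)" "based M" by (rule qform_cases[OF F])
 obtain M' \<phi>' where M': "G = (M', qcls M' \<phi>')" "based M'" by (rule qform_cases[OF G])
 have i: "siso M M' f" "fequiv M (\<lambda>x y. \<phi>' (f x) (f y)) \<phi>" using f isometry_iff[OF M(2) M'(2)] unfolding M(1) M'(1) by auto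
 have "fequiv M (\<lambda>x y. \<phi>' (f' x) (f' y)) (\<lambda>x y. \<phi>' (f x) (f y))" by (rule form_equiv_cong) (use eq M in simp)
 from form_equiv_trans[OF this i(2)] show ?thesis
  unfolding M(1) M'(1) isometry_iff[OF M(2) M'(2)] using simple_iso_cong[OF i(1) M(2) M'(2)] eq M by simp
qed

lemma quad_form_sum:
 assumes F: "qform F" and G: "qform G"
 shows "qform (fsum F G)"
proof -
 obtain M \<phi> where M: "F = (M, qcls M \<phi>)" "based M" "sesqui M \<phi>" by (rule qform_cases[OF F])
 obtain N \<chi> where N: "G = (N, qcls N \<chi>)" "based N" "sesqui N \<chi>" by (rule qform_cases[OF G])
 show ?thesis
  using M N sesqui_sum_form[OF M(3) N(3)] unfolding M(1) N(1) form_sum_quad_class[OF basedD(1)[OF M(2)] basedD(1)[OF N(2)]] by simp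
qed

lemma isometry_sum:
 assumes F: "qform F" and G: "qform G" and F': "qform F'" and G': "qform G'"
  and f: "isom F F' f" and g: "isom G G' g"
 shows "isom (fsum F G) (fsum F' G') (map_prod f g)"
proof -
 obtain M \<phi> where M: "F = (M, qcls M \<phi>)" "based M" by (rule qform_cases[OF F])
 obtain N \<chi> where N: "G = (N, qcls N \<chi>)" "based N" by (rule qform_cases[OF G])
 obtain M' \<phi>' where M': "F' = (M', qcls M' \<phi>')" "based M'" by (rule qform_cases[OF F'])
 obtain N' \<chi>' where N': "G' = (N', qcls N' \<chi>')" "based N'" by (rule qform_cases[OF G'])
 show ?thesis
  using isometry_map_prod[OF M(2) M'(2) N(2) N'(2)] f g
  unfolding M(1) N(1) M'(1) N'(1) form_sum_quad_class[OF basedD(1)[OF M(2)] basedD(1)[OF N(2)]]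
   form_sum_quad_class[OF basedD(1)[OF M'(2)] basedD(1)[OF N'(2)]] by blast
qed

lemma isometry_swap:
 assumes F: "qform F" and G: "qform G"
 shows "isom (fsum F G) (fsum G F) prod.swap"
proof -
 obtain M \<phi> where M: "F = (M, qcls M \<phi>)" "based M" by (rule qform_cases[OF F])
 obtain N \<chi> where N: "G = (N, qcls N \<chi>)" "based N" by (rule qform_cases[OF G])
 note M' = basedD(1)[OF M(2)] and N' = basedD(1)[OF N(2)]
 have "fequiv (bsum M N) (\<lambda>x y. sum_form \<chi> \<phi> (prod.swap x) (prod.swap y)) (sum_form \<phi> \<chi>)"
  by (rule form_equiv_cong) (auto simp: add.commute)
 then show ?thesis
  unfolding M(1) N(1) form_sum_quad_class[OF M' N'] form_sum_quad_class[OF N' M']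
   isometry_iff[OF based_sum_closed[OF M(2) N(2)] based_sum_closed[OF N(2) M(2)]]
  using simple_iso_swap[OF M(2) N(2)] by blast
qed

lemma isometry_reassoc:
 assumes F: "qform F" and G: "qform G" and H: "qform H"
 shows "isom (fsum (fsum F G) H) (fsum F (fsum G H)) reassoc"
proof -
 obtain M \<phi> where M: "F = (M, qcls M \<phi>)" "based M" by (rule qform_cases[OF F])
 obtain N \<chi> where N: "G = (N, qcls N \<chi>)" "based N" by (rule qform_cases[OF G])
 obtain P \<omega> where P: "H = (P, qcls P \<omega>)" "based P" by (rule qform_cases[OF H])
 note M' = basedD(1)[OF M(2)] and N' = basedD(1)[OF N(2)] and P' = basedD(1)[OF P(2)]
 note MN = based_sum_closed[OF M(2) N(2)] and NP = based_sum_closed[OF N(2) P(2)]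
 have "fequiv (bsum (bsum M N) P) (\<lambda>x y. sum_form \<phi> (sum_form \<chi> \<omega>) (reassoc x) (reassoc y)) (sum_form (sum_form \<phi> \<chi>) \<omega>)"
  by (rule form_equiv_cong) (auto simp: add.assoc)
 then show ?thesis
  unfolding M(1) N(1) P(1) form_sum_quad_class[OF M' N'] form_sum_quad_class[OF N' P']
   form_sum_quad_class[OF basedD(1)[OF MN] P'] form_sum_quad_class[OF M' basedD(1)[OF NP]]
   isometry_iff[OF based_sum_closed[OF MN P(2)] based_sum_closed[OF M(2) NP]]
  using simple_iso_reassoc[OF M(2) N(2) P(2)] by blast
qed

lemma isometry_hyp_interchange:
 assumes A: "dual_pair A A' pr" and B: "dual_pair B B' pr'"
 shows "isom (fsum (hyp_space A A' pr) (hyp_space B B' pr')) (hyp_space (bsum A B) (bsum A' B') (sum_pairing pr pr')) interchange"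
 using isometry_interchange[OF A B] dual_pairD(1,2)[OF A] dual_pairD(1,2)[OF B]
 by (simp add: hyp_space_def form_sum_quad_class basedD del: form_sum.simps)

lemma hyp_space_iso:
 assumes A: "dual_pair A A' pr" and B: "dual_pair B B' pr'" and s: "siso A B s"
 obtains s' where "siso A' B' s'" "s' (zero A') = zero B'" "\<And>y f. y IN A ==> f IN A' ==> pr' (s y) (s' f) = pr y f"
  "isom (hyp_space A A' pr) (hyp_space B B' pr') (map_prod s s')"
proof -
 note a = dual_pairD(2)[OF A] and b = dual_pairD(2)[OF B]
 obtain s' where s': "siso A' B' s'" "\<And>y f. y IN A ==> f IN A' ==> pr' (s y) (s' f) = pr y f"
  "isom (bsum A A', qcls (bsum A A') (hyp_form pr)) (bsum B B', qcls (bsum B B') (hyp_form pr')) (map_prod s s')"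
  using dual_pair_iso[OF A B s] by metis
 show ?thesis
  by (rule that[OF s'(1) linear_maps_zero[OF sisoD(2)[OF s'(1)] basedD(1)[OF a] basedD(1)[OF b]] s'(2) s'(3)[folded hyp_space_def]])
qed

text \<open>For \<open>u = id\<close> this is the notion of a simple Lagrangian, by
  \<open>simple_lagrangian_iff\<close>. In the present form it is transported by composing
  isometries.\<close>

definition lag :: "('a, 'm) quad_form => ('k => 'm) => ('a, 'k) based_module => bool" where
 "lag F u K \<longleftrightarrow> based K \<and>
   (\<exists>h. isom (hyper K) F h \<and> (\<forall>x\<in>carrier K. h (x, zero (dual K)) = u x))"

definition half_summand :: "('a, 'm) based_module => ('n => 'm) => ('a, 'n) based_module => bool" where
 "half_summand M v N \<longleftrightarrow> based N \<and> v \<in> linear_maps N M \<and>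
   (\<exists>r\<in>linear_maps M N. \<forall>x\<in>carrier N. r (v x) = x) \<and> 2 * module_rank N = module_rank M"

text \<open>Quasi-formations are described by parametrisations $u \colon K \to M$ and $v \colon N \to M$ of the
 Lagrangian and of the half-rank summand; this allows to compare them along maps.\<close>

definition qfm :: "('a, 'm) quad_form => ('k => 'm) => ('a, 'k) based_module => ('n => 'm) => ('a, 'n) based_module => ('a, 'm) quasi_formation" where
 "qfm F u K v N = (F, based_image u K (fst F), based_image v N (fst F))"

lemma half_summand_transport:
 assumes v: "half_summand M v N" and M: "based M" and M': "based M'" and f: "siso M M' f"
  and N': "based N'" and t: "siso N' N t" and v': "\<And>x. x IN N' ==> v' x = f (v (t x))"
 shows "half_summand M' v' N'"
proof -
 obtain r where N: "based N" and vl: "v \<in> linear_maps N M" and r: "r \<in> linear_maps M N" "\<And>x. x IN N ==> r (v x) = x"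
  and rk: "2 * module_rank N = module_rank M" using v unfolding half_summand_def by blast
 note fd = sisoD[OF f] and td = sisoD[OF t]
 have "v' \<in> linear_maps N' M'"
  by (rule linear_maps_cong[OF lin_comp[OF lin_comp[OF td(2) vl] fd(2)] basedD(1)[OF N']]) (simp add: v')
 moreover have "inv_map N' t \<circ> (r \<circ> inv_map M f) \<in> linear_maps M' N'"
  by (rule lin_comp[OF lin_comp[OF sisoD(2)[OF siso_inv[OF M M' f]] r(1)] sisoD(2)[OF siso_inv[OF N' N t]]])
 moreover have "(inv_map N' t \<circ> (r \<circ> inv_map M f)) (v' x) = x" if "x IN N'" for x
  using that v' fd td r(2) linD(1)[OF vl] by simp
 moreover have "2 * module_rank N' = module_rank M'"
  using rk module_rank_simple_iso[OF N' N t] module_rank_simple_iso[OF M M' f] by simp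
 ultimately show ?thesis using N' unfolding half_summand_def by blast
qed

lemma half_summand_sum:
 assumes v: "half_summand M v N" and w: "half_summand M' w N'" and M: "based M" and M': "based M'"
 shows "half_summand (bsum M M') (map_prod v w) (bsum N N')"
proof -
 obtain r where N: "based N" and vl: "v \<in> linear_maps N M" and r: "r \<in> linear_maps M N" "\<And>x. x IN N ==> r (v x) = x"
  and rk: "2 * module_rank N = module_rank M" using v unfolding half_summand_def by blast
 obtain r' where N': "based N'" and wl: "w \<in> linear_maps N' M'" and r': "r' \<in> linear_maps M' N'" "\<And>x. x IN N' ==> r' (w x) = x"
  and rk': "2 * module_rank N' = module_rank M'" using w unfolding half_summand_def by blast
 have rr: "\<forall>x\<in>carrier (bsum N N'). map_prod r r' (map_prod v w x) = x" using r(2) r'(2) by auto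
 have l: "map_prod v w \<in> linear_maps (bsum N N') (bsum M M')" "map_prod r r' \<in> linear_maps (bsum M M') (bsum N N')"
  using linear_maps_map_prod[OF vl wl] linear_maps_map_prod[OF r(1) r'(1)] by simp_all
 have "2 * module_rank (bsum N N') = module_rank (bsum M M')" using N N' M M' rk rk' by (simp add: module_rank_sum)
 with rr l show ?thesis unfolding half_summand_def using based_sum_closed[OF N N'] by blast
qed

lemma half_summand_image:
 assumes v: "half_summand M v N" and M: "based M"
 shows "based N" "based (based_image v N M)" "siso N (based_image v N M) v"
proof -
 obtain r where N: "based N" and vl: "v \<in> linear_maps N M" and r: "\<And>x. x IN N ==> r (v x) = x"
  using v unfolding half_summand_def by blast
 have "inj_on v (carrier N)" using r by (metis inj_onI)
 with N vl show "based N" "based (based_image v N M)" "siso N (based_image v N M) v"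
  using based_image[OF N basedD(1)[OF M]] by auto
qed

text \<open>The contragredient of the identity of K identifies the dual of K with \<open>K'\<close>
  and does not move K.\<close>

lemma lag_pairI:
 assumes F: "qform F" and K: "dual_pair K K' pr" and h: "isom (hyp_space K K' pr) F h"
  and u: "\<And>x. x IN K ==> h (x, zero K') = u x"
 shows "lag F u K"
proof -
 note k = dual_pairD[OF K]
 obtain s' where s': "s' (zero (bdual K)) = zero K'" "isom (hyp_space K (bdual K) (\<lambda>y f. f y)) (hyp_space K K' pr) (map_prod id s')"
  using hyp_space_iso[OF dual_pair_dual[OF k(1)] K siso_id[OF k(1)]] by metis
 have "isom (hyp_space K (bdual K) (\<lambda>y f. f y)) F (h \<circ> map_prod id s')"
  by (rule isometry_trans[OF _ qform_hyp[OF K] F s'(2) h]) (simp add: k qform_hyp dual_pair_dual)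
 moreover have "\<forall>x\<in>carrier K. (h \<circ> map_prod id s') (x, zero (dual K)) = u x" using s'(1) u by simp
 ultimately show ?thesis unfolding lag_def hyperbolic_hyp_space using k(1) by blast
qed

lemma lag_based: "lag F u K ==> based K"
 by (simp add: lag_def)

lemma lag_transport:
 assumes u: "lag F u K" and F: "qform F" and F': "qform F'" and f: "isom F F' f"
  and K': "based K'" and s: "siso K' K s" and u': "\<And>x. x IN K' ==> u' x = f (u (s x))"
 shows "lag F' u' K'"
proof -
 obtain h where K: "based K" and h: "isom (hyper K) F h" "\<And>x. x IN K ==> h (x, zero (dual K)) = u x"
  using u unfolding lag_def by blast
 obtain s' where s': "s' (zero (bdual K')) = zero (bdual K)" "isom (hyper K') (hyper K) (map_prod s s')"
  unfolding hyperbolic_hyp_space using hyp_space_iso[OF dual_pair_dual[OF K'] dual_pair_dual[OF K] s] by metis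
 have "isom (hyper K') F' (f \<circ> (h \<circ> map_prod s s'))"
  by (rule isometry_trans[OF _ F F' isometry_trans[OF _ _ F s'(2) h(1)] f]) (simp_all add: K K' quad_form_hyperbolic)
 moreover have "\<forall>x\<in>carrier K'. (f \<circ> (h \<circ> map_prod s s')) (x, zero (dual K')) = u' x"
  using s'(1) h(2) u' sisoD(3)[OF s] by simp
 ultimately show ?thesis unfolding lag_def using K' by blast
qed

text \<open>A based module and its dual have the same rank, and the projection of H(K) to K provides
  the retraction.\<close>

lemma lag_half_summand:
 assumes F: "qform F" and u: "lag F u K"
 shows "half_summand (fst F) u K"
proof -
 obtain h where K: "based K" and h: "isom (hyper K) F h" "\<And>x. x IN K ==> h (x, zero (dual K)) = u x"
  using u unfolding lag_def by blast
 let ?H = "bsum K (bdual K)"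
 note D = based_dual_closed[OF K] and M = quad_form_based[OF F]
 have H: "based ?H" using K by simp
 have i: "siso ?H (fst F) h" using isometry_simple_iso[OF h(1)] by simp
 have in0: "(inl (dual K)) \<in> linear_maps K ?H" using linear_maps_inl[OF basedD(1)[OF D], of K] by simp
 have "u \<in> linear_maps K (fst F)"
  by (rule linear_maps_cong[OF lin_comp[OF in0 sisoD(2)[OF i]] basedD(1)[OF K]]) (simp add: h(2))
 moreover have "fst \<circ> inv_map ?H h \<in> linear_maps (fst F) K"
  using lin_comp[OF sisoD(2)[OF siso_inv[OF H M i]], of fst K] linear_maps_fst[of K "bdual K"] by simp
 moreover have "(fst \<circ> inv_map ?H h) (u x) = x" if "x IN K" for x
  using sisoD(6)[OF i linD(1)[OF in0 that]] h(2)[OF that] by simp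
 moreover have "2 * module_rank K = module_rank (fst F)"
  using module_rank_simple_iso[OF H M i] K D by (simp add: module_rank_sum module_rank_dual)
 ultimately show ?thesis unfolding half_summand_def using K by blast
qed

lemma lag_hyp_space:
 assumes A: "dual_pair A A' pr"
 shows "lag (hyp_space A A' pr) (inl A') A"
 by (rule lag_pairI[OF _ A isometry_refl]) (simp_all add: qform_hyp A)

text \<open>Exchanging the middle summands turns H(K) \<oplus> H(L) into the hyperbolic form of K
  \<oplus> L, with the sum of the duals in place of the dual of the sum.\<close>

lemma lag_sum:
 assumes F: "qform F" and G: "qform G" and u: "lag F u K" and w: "lag G w L"
 shows "lag (fsum F G) (map_prod u w) (bsum K L)"
proof -
 obtain h where K: "based K" and h: "isom (hyper K) F h" "\<And>x. x IN K ==> h (x, zero (dual K)) = u x"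
  using u unfolding lag_def by blast
 obtain k where L: "based L" and k: "isom (hyper L) G k" "\<And>x. x IN L ==> k (x, zero (dual L)) = w x"
  using w unfolding lag_def by blast
 note DK = dual_pair_dual[OF K] and DL = dual_pair_dual[OF L]
 note D = dual_pair_sum[OF DK DL]
 let ?S = "fsum (hyper K) (hyper L)"
 note HK = quad_form_hyperbolic[OF K] and HL = quad_form_hyperbolic[OF L]
 note S = quad_form_sum[OF HK HL] and FG = quad_form_sum[OF F G]
 have i: "isom ?S (hyp_space (bsum K L) (bsum (bdual K) (bdual L)) (sum_pairing (\<lambda>y f. f y) (\<lambda>y f. f y))) interchange"
  unfolding hyperbolic_hyp_space by (rule isometry_hyp_interchange[OF DK DL])
 note j = isometry_sym[OF S qform_hyp[OF D] i]
 note c = isometry_trans[OF qform_hyp[OF D] S FG j isometry_sum[OF HK HL F G h(1) k(1)]]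
 show ?thesis
 proof (rule lag_pairI[OF FG D c])
  fix z assume "z IN (bsum K L)"
  then obtain x y where z: "z = (x, y)" "x IN K" "y IN L" by auto
  have "inv_map (fst ?S) interchange (interchange ((x, zero (dual K)), (y, zero (dual L)))) = ((x, zero (dual K)), (y, zero (dual L)))"
   by (rule sisoD(6)[OF isometry_simple_iso[OF i]])
    (use z lmodD(3)[OF left_module_dual[OF basedD(1)[OF K]]] lmodD(3)[OF left_module_dual[OF basedD(1)[OF L]]] in simp)
  then show "(map_prod h k \<circ> inv_map (fst ?S) interchange) (z, zero (bsum (bdual K) (bdual L))) = map_prod u w z"
   using z h(2) k(2) by simp
 qed
qed

lemma lag_id_iff: "lag (M, qcls M \<phi>) id K \<longleftrightarrow> (\<exists>h. hyperbolic_splitting M \<phi> K h)"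
 by (auto simp: lag_def hyperbolic_splitting_def)

lemma simple_lagrangian_iff:
 assumes F: "qform F"
 shows "simple_lagrangian \<epsilon> Z F K \<longleftrightarrow> lag F id K"
proof -
 obtain M \<phi> where M: "F = (M, qcls M \<phi>)" "based M" "sesqui M \<phi>" by (rule qform_cases[OF F])
 show ?thesis
  unfolding M(1) lag_id_iff using simple_lagrangian_if_splitting[OF M(2,3)] splitting_if_simple_lagrangian[OF _ M(2,3)] by blast
qed

lemma lag_submodule:
 assumes F: "qform F" and K: "lag F id K"
 shows "submodule_structure K (fst F)"
proof -
 obtain M \<phi> where M: "F = (M, qcls M \<phi>)" "based M" by (rule qform_cases[OF F])
 show ?thesis using K hyperbolic_splittingD(5)[OF M(2)] unfolding M(1) lag_id_iff by auto
qed

lemma lag_image: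
 assumes F: "qform F" and u: "lag F u K"
 shows "lag F id (based_image u K (fst F))"
proof -
 note i = half_summand_image[OF lag_half_summand[OF F u] quad_form_based[OF F]]
 show ?thesis
  by (rule lag_transport[OF u F F isometry_refl[OF F] i(2) siso_inv[OF i]]) (simp add: sisoD(7)[OF i(3)])
qed

lemma quasi_formation_iff:
 assumes F: "qform F"
 shows "qf (F, L, V) \<longleftrightarrow> lag F id L \<and> based_summand Z V (fst F) \<and> 2 * module_rank V = module_rank (fst F)"
proof -
 obtain M \<phi> where M: "F = (M, qcls M \<phi>)" by (rule qform_cases[OF F])
 show ?thesis using simple_lagrangian_iff[OF F, of L] unfolding M by auto
qed

lemma based_summand_half_summand:
 assumes M: "based M"
 shows "based_summand Z V M \<and> 2 * module_rank V = module_rank M \<longleftrightarrow> submodule_structure V M \<and> half_summand M id V"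
 unfolding based_summand_iff[OF basedD(1)[OF M]] half_summand_def using submodule_structure_id by auto

lemma quasi_formation_qfm:
 assumes F: "qform F" and u: "lag F u K" and v: "half_summand (fst F) v N"
 shows "qf (qfm F u K v N)"
proof -
 note M = quad_form_based[OF F]
 note i = half_summand_image[OF v M]
 have "half_summand (fst F) id (based_image v N (fst F))"
  by (rule half_summand_transport[OF v M M siso_id[OF M] i(2) siso_inv[OF i]]) (simp add: sisoD(7)[OF i(3)])
 moreover have "submodule_structure (based_image v N (fst F)) (fst F)"
  using v linD(1)[of v N "fst F"] by (auto simp: submodule_structure_def half_summand_def)
 ultimately show ?thesis
  using based_summand_half_summand[OF M] lag_image[OF F u] unfolding qfm_def quasi_formation_iff[OF F] by blast
qed

text \<open>On A the map \<open>f\<close> equals v' t v^-1, a composite of simple maps. Nothing is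
  asked of \<open>f\<close> outside A.\<close>

lemma simple_iso_square:
 assumes "based N" "based A" "based N'" "based B"
  and v: "siso N A v" and v': "siso N' B v'" and t: "siso N N' t"
  and eq: "\<And>x. x IN N ==> f (v x) = v' (t x)"
 shows "siso A B f"
proof (rule simple_iso_cong[OF siso_comp[OF assms(2,3,4) siso_comp[OF assms(2,1,3) siso_inv[OF assms(1,2) v] t] v'] assms(2,4)])
 fix x assume "x IN A"
 then show "(v' \<circ> (t \<circ> inv_map N v)) x = f x"
  using eq[of "inv_map N v x"] sisoD(7,8)[OF v] by simp
qed

lemma qfm_iso:
 assumes F: "qform F" and F': "qform F'" and f: "isom F F' f"
  and u: "half_summand (fst F) u K" and v: "half_summand (fst F) v N"
  and u': "half_summand (fst F') u' K'" and v': "half_summand (fst F') v' N'"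
  and s: "siso K K' s" "\<And>x. x IN K ==> f (u x) = u' (s x)"
  and t: "siso N N' t" "\<And>x. x IN N ==> f (v x) = v' (t x)"
 shows "qf_iso (qfm F u K v N) (qfm F' u' K' v' N')"
proof -
 note M = quad_form_based[OF F] quad_form_based[OF F']
 note iu = half_summand_image[OF u M(1)] and iv = half_summand_image[OF v M(1)]
  and iu' = half_summand_image[OF u' M(2)] and iv' = half_summand_image[OF v' M(2)]
 show ?thesis
  using f simple_iso_square[OF iu(1,2) iu'(1,2) iu(3) iu'(3) s] simple_iso_square[OF iv(1,2) iv'(1,2) iv(3) iv'(3) t]
  unfolding qfm_def qf_isomorphic.simps by blast
qed

lemma quasi_formationE:
 assumes y: "qf (F, L, V)"
 shows "qform F" "lag F id L" "half_summand (fst F) id V" "qf_iso (F, L, V) (qfm F id L id V)"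
  "submodule_structure L (fst F)" "submodule_structure V (fst F)"
proof -
 show F: "qform F" using y by (cases F) (simp add: simple_form.simps)
 note M = quad_form_based[OF F]
 show L: "lag F id L" and V: "half_summand (fst F) id V" and "submodule_structure V (fst F)"
  using y based_summand_half_summand[OF M, of V] unfolding quasi_formation_iff[OF F] by auto
 show "submodule_structure L (fst F)" by (rule lag_submodule[OF F L])
 note i = half_summand_image[OF lag_half_summand[OF F L] M] and j = half_summand_image[OF V M]
 show "qf_iso (F, L, V) (qfm F id L id V)"
  unfolding qfm_def qf_isomorphic.simps using isometry_refl[OF F] i(3) j(3) by blast
qed

lemma qfm_sum:
 assumes F: "qform F" and G: "qform G"
  and u: "half_summand (fst F) u K" and v: "half_summand (fst F) v N"
  and w: "half_summand (fst G) w L" and z: "half_summand (fst G) z P"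
 shows "qf_iso (qf_add (qfm F u K v N) (qfm G w L z P))
   (qfm (fsum F G) (map_prod u w) (bsum K L) (map_prod v z) (bsum N P))"
proof -
 note M = quad_form_based[OF F] quad_form_based[OF G]
 have *: "siso (bsum (based_image u K (fst F)) (based_image w L (fst G))) (based_image (map_prod u w) (bsum K L) (bsum (fst F) (fst G))) id"
  if u: "half_summand (fst F) u K" and w: "half_summand (fst G) w L" for u :: "'i => 'b" and K and w :: "'j => 'c" and L
 proof -
  note iu = half_summand_image[OF u M(1)] and iw = half_summand_image[OF w M(2)]
  note i = half_summand_image[OF half_summand_sum[OF u w M] based_sum_closed[OF M]]
  show ?thesis
   by (rule simple_iso_square[OF i(1) based_sum_closed[OF iu(2) iw(2)] i(1,2) simple_iso_map_prod[OF iu(1) iw(1) iu(2) iw(2) iu(3) iw(3)] i(3) siso_id[OF i(1)]]) simp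
 qed
 have "isom (fsum F G) (fsum F G) id" by (rule isometry_refl[OF quad_form_sum[OF F G]])
 then show ?thesis unfolding qfm_def qf_sum.simps qf_isomorphic.simps fst_form_sum using *[OF u w] *[OF v z] by blast
qed

section \<open>Isomorphisms and sums of quasi-formations\<close>

lemma qf_isomorphic_trans:
 assumes "qf x" "qf y" "qf z" "qf_iso x y" "qf_iso y z"
 shows "qf_iso x z"
proof -
 obtain F L V F' L' V' F'' L'' V'' where e: "x = (F, L, V)" "y = (F', L', V')" "z = (F'', L'', V'')" by (metis surj_pair)
 note X = quasi_formationE[OF assms(1)[unfolded e]] and Y = quasi_formationE[OF assms(2)[unfolded e]] and Z = quasi_formationE[OF assms(3)[unfolded e]]
 obtain f where f: "isom F F' f" "siso L L' f" "siso V V' f" using assms(4) unfolding e by auto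
 obtain g where g: "isom F' F'' g" "siso L' L'' g" "siso V' V'' g" using assms(5) unfolding e by auto
 note b = lag_based[OF X(2)] lag_based[OF Y(2)] lag_based[OF Z(2)]
 have c: "based V" "based V'" "based V''" using X(3) Y(3) Z(3) by (simp_all add: half_summand_def)
 show ?thesis unfolding e qf_isomorphic.simps
  using isometry_trans[OF X(1) Y(1) Z(1) f(1) g(1)] siso_comp[OF b f(2) g(2)] siso_comp[OF c f(3) g(3)] by blast
qed

lemma siso_inv_sub:
 assumes L: "based L" and L': "based L'" and f: "siso M M' f" "siso L L' f" and s: "submodule_structure L M"
 shows "siso L' L (inv_map M f)"
proof (rule simple_iso_cong[OF siso_inv[OF L L' f(2)] L' L])
 fix y assume y: "y IN L'"
 have "inv_map L f y IN M" using sisoD(8)[OF f(2) y] s by (auto simp: submodule_structure_def)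
 then show "inv_map L f y = inv_map M f y" using sisoD(6)[OF f(1)] sisoD(7)[OF f(2) y] by metis
qed

lemma qf_isomorphic_sym:
 assumes "qf x" "qf y" "qf_iso x y"
 shows "qf_iso y x"
proof -
 obtain F L V F' L' V' where e: "x = (F, L, V)" "y = (F', L', V')" by (metis surj_pair)
 note X = quasi_formationE[OF assms(1)[unfolded e]] and Y = quasi_formationE[OF assms(2)[unfolded e]]
 obtain f where f: "isom F F' f" "siso L L' f" "siso V V' f" using assms(3) unfolding e by auto
 note b = lag_based[OF X(2)] lag_based[OF Y(2)]
 have c: "based V" "based V'" using X(3) Y(3) by (simp_all add: half_summand_def)
 show ?thesis unfolding e qf_isomorphic.simps
  using isometry_sym[OF X(1) Y(1) f(1)] siso_inv_sub[OF b isometry_simple_iso[OF f(1)] f(2) X(5)]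
   siso_inv_sub[OF c isometry_simple_iso[OF f(1)] f(3) X(6)] by blast
qed

lemma quasi_formation_based:
 assumes "qf (F, L, V)"
 shows "based L" "based V"
 using quasi_formationE(2,3)[OF assms] by (simp_all add: lag_def half_summand_def)

lemma qf_isomorphic_sum:
 assumes "qf x" "qf x'" "qf y" "qf y'" "qf_iso x x'" "qf_iso y y'"
 shows "qf_iso (qf_add x y) (qf_add x' y')"
proof -
 obtain F L V F' L' V' where e: "x = (F, L, V)" "x' = (F', L', V')" by (metis surj_pair)
 obtain G K W G' K' W' where d: "y = (G, K, W)" "y' = (G', K', W')" by (metis surj_pair)
 note X = assms(1)[unfolded e] and X' = assms(2)[unfolded e] and Y = assms(3)[unfolded d] and Y' = assms(4)[unfolded d]
 note qx = quasi_formationE(1)[OF X] quasi_formationE(1)[OF Y] quasi_formationE(1)[OF X'] quasi_formationE(1)[OF Y']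
 note bx = quasi_formation_based[OF X] and bx' = quasi_formation_based[OF X'] and "by" = quasi_formation_based[OF Y] and by' = quasi_formation_based[OF Y']
 obtain f where f: "isom F F' f" "siso L L' f" "siso V V' f" using assms(5) unfolding e by auto
 obtain g where g: "isom G G' g" "siso K K' g" "siso W W' g" using assms(6) unfolding d by auto
 show ?thesis unfolding e d qf_sum.simps qf_isomorphic.simps
  using isometry_sum[OF qx f(1) g(1)] simple_iso_map_prod[OF bx(1) "by"(1) bx'(1) by'(1) f(2) g(2)]
   simple_iso_map_prod[OF bx(2) "by"(2) bx'(2) by'(2) f(3) g(3)] by blast
qed

lemma quasi_formation_sum:
 assumes "qf x" "qf y"
 shows "qf (qf_add x y)"
proof -
 obtain F L V G K W where e: "x = (F, L, V)" "y = (G, K, W)" by (metis surj_pair)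
 note X = quasi_formationE[OF assms(1)[unfolded e]] and Y = quasi_formationE[OF assms(2)[unfolded e]]
 note M = quad_form_based[OF X(1)] quad_form_based[OF Y(1)]
 note S = quad_form_sum[OF X(1) Y(1)]
 have "lag (fsum F G) id (bsum L K)"
  using lag_sum[OF X(1) Y(1) X(2) Y(2)] by (simp add: prod.map_id0)
 moreover have "half_summand (bsum (fst F) (fst G)) id (bsum V W)"
  using half_summand_sum[OF X(3) Y(3) M] by (simp add: prod.map_id0)
 moreover have "submodule_structure (bsum V W) (bsum (fst F) (fst G))"
  using X(6) Y(6) by (auto simp: submodule_structure_def)
 ultimately show ?thesis
  using based_summand_half_summand[OF based_sum_closed[OF M], of "bsum V W"] unfolding e qf_sum.simps quasi_formation_iff[OF S] fst_form_sum by blast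
qed

lemma qf_isomorphic_swap:
 assumes "qf x" "qf y"
 shows "qf_iso (qf_add x y) (qf_add y x)"
proof -
 obtain F L V G K W where e: "x = (F, L, V)" "y = (G, K, W)" by (metis surj_pair)
 note X = assms(1)[unfolded e] and Y = assms(2)[unfolded e]
 show ?thesis unfolding e qf_sum.simps qf_isomorphic.simps
  using isometry_swap[OF quasi_formationE(1)[OF X] quasi_formationE(1)[OF Y]]
   simple_iso_swap[OF quasi_formation_based(1)[OF X] quasi_formation_based(1)[OF Y]]
   simple_iso_swap[OF quasi_formation_based(2)[OF X] quasi_formation_based(2)[OF Y]] by blast
qed

lemma qf_isomorphic_reassoc:
 assumes "qf x" "qf y" "qf z"
 shows "qf_iso (qf_add (qf_add x y) z) (qf_add x (qf_add y z))"
proof -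
 obtain F L V G K W H J U where e: "x = (F, L, V)" "y = (G, K, W)" "z = (H, J, U)" by (metis surj_pair)
 note X = assms(1)[unfolded e] and Y = assms(2)[unfolded e] and Z = assms(3)[unfolded e]
 show ?thesis unfolding e qf_sum.simps qf_isomorphic.simps
  using isometry_reassoc[OF quasi_formationE(1)[OF X] quasi_formationE(1)[OF Y] quasi_formationE(1)[OF Z]]
   simple_iso_reassoc[OF quasi_formation_based(1)[OF X] quasi_formation_based(1)[OF Y] quasi_formation_based(1)[OF Z]]
   simple_iso_reassoc[OF quasi_formation_based(2)[OF X] quasi_formation_based(2)[OF Y] quasi_formation_based(2)[OF Z]] by blast
qed

lemma qf_isomorphic_refl:
 assumes "qf x"
 shows "qf_iso x x"
proof -
 obtain F L V where e: "x = (F, L, V)" by (metis surj_pair)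
 note X = assms[unfolded e]
 show ?thesis unfolding e qf_isomorphic.simps
  using isometry_refl[OF quasi_formationE(1)[OF X]] siso_id quasi_formation_based[OF X] by blast
qed

lemma quad_form_vec_model:
 fixes F :: "('a, 'm) quad_form"
 assumes F: "qform F"
 obtains F' :: "('a, 'a vec) quad_form" and f where "qform F'" "isom F F' f"
proof -
 obtain M \<phi> where M: "F = (M, qcls M \<phi>)" "based M" "sesqui M \<phi>" by (rule qform_cases[OF F])
 obtain N :: "('a, 'a vec) based_module" and f where N: "based N" and f: "siso M N f" using vec_model[OF M(2)] by blast
 note i = siso_inv[OF M(2) N f]
 let ?F = "(N, qcls N (\<lambda>x y. \<phi> (inv_map M f x) (inv_map M f y)))"
 have "qform ?F" using N sesqui_pullback[OF M(3) sisoD(2)[OF i]] by simp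
 moreover have "fequiv M (\<lambda>x y. \<phi> (inv_map M f (f x)) (inv_map M f (f y))) \<phi>" by (rule form_equiv_cong) (simp add: sisoD(6)[OF f])
 then have "isom F ?F f" unfolding M(1) isometry_iff[OF M(2) N] using f by simp
 ultimately show ?thesis using that by blast
qed

end

section \<open>Classes in $l_{2q+1}(\Lambda)$\<close>

declare quasi_formation.simps [simp del]

context form_parameter
begin

lemma half_summand_inr:
 assumes A: "dual_pair A A' pr"
 shows "half_summand (bsum A A') (inr A) A'"
proof -
 note a = dual_pairD[OF A]
 have "module_rank A' = module_rank A"
  using module_rank_simple_iso[OF a(2) based_dual_closed[OF a(1)] a(3)] module_rank_dual[OF a(1)] by simp
 moreover have "snd \<in> linear_maps (bsum A A') A'" using linear_maps_snd[of A A'] by simp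
 moreover have "(inr A) \<in> linear_maps A' (bsum A A')"
  using linear_maps_inr[OF basedD(1)[OF a(1)], of A'] by simp
 ultimately show ?thesis
  unfolding half_summand_def using a(1,2) by (auto simp: module_rank_sum intro!: bexI[of _ snd])
qed

definition valid :: "('a, 'm) quad_form => ('k => 'm) => ('a, 'k) based_module => ('n => 'm) => ('a, 'n) based_module => bool" where
 "valid F u K v N \<longleftrightarrow> qform F \<and> lag F u K \<and> half_summand (fst F) v N"

definition qfm_class :: "('a, 'm) quad_form => ('k => 'm) => ('a, 'k) based_module => ('n => 'm) => ('a, 'n) based_module => ('a, 'a vec) quasi_formation set" where
 "qfm_class F u K v N = lcls (qfm F u K v N)"

lemma validD:
 assumes "valid F u K v N"
 shows "qform F" "lag F u K" "half_summand (fst F) v N" "half_summand (fst F) u K" "based (fst F)"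
  "based K" "based N" "qf (qfm F u K v N)"
proof -
 show F: "qform F" and u: "lag F u K" and v: "half_summand (fst F) v N" using assms by (auto simp: valid_def)
 show "half_summand (fst F) u K" by (rule lag_half_summand[OF F u])
 show "based (fst F)" by (rule quad_form_based[OF F])
 show "based K" by (rule lag_based[OF u])
 show "based N" using v by (simp add: half_summand_def)
 show "qf (qfm F u K v N)" by (rule quasi_formation_qfm[OF F u v])
qed

lemma valid_iso:
 assumes v: "valid F u K v N" and F': "qform F'" and f: "isom F F' f"
  and K': "based K'" and N': "based N'"
  and s: "siso K K' s" "\<And>x. x IN K ==> f (u x) = u' (s x)"
  and t: "siso N N' t" "\<And>x. x IN N ==> f (v x) = v' (t x)"
 shows "valid F' u' K' v' N'" "qf_iso (qfm F u K v N) (qfm F' u' K' v' N')"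
proof -
 note V = validD[OF v]
 note si = siso_inv[OF V(6) K' s(1)] and ti = siso_inv[OF V(7) N' t(1)]
 have "lag F' u' K'"
  by (rule lag_transport[OF V(2,1) F' f K' si]) (simp add: s(2) sisoD(7,8)[OF s(1)])
 moreover have "half_summand (fst F') v' N'"
  by (rule half_summand_transport[OF V(3,5) quad_form_based[OF F'] isometry_simple_iso[OF f] N' ti]) (simp add: t(2) sisoD(7,8)[OF t(1)])
 ultimately show V': "valid F' u' K' v' N'" using F' by (simp add: valid_def)
 show "qf_iso (qfm F u K v N) (qfm F' u' K' v' N')"
  by (rule qfm_iso[OF V(1) F' f V(4,3) validD(4,3)[OF V'] s t])
qed

lemma valid_sum:
 assumes v: "valid F u K v N" and w: "valid G w L z P"
 shows "valid (fsum F G) (map_prod u w) (bsum K L) (map_prod v z) (bsum N P)"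
 unfolding valid_def fst_form_sum
 using quad_form_sum[OF validD(1)[OF v] validD(1)[OF w]] lag_sum[OF validD(1)[OF v] validD(1)[OF w] validD(2)[OF v] validD(2)[OF w]]
  half_summand_sum[OF validD(3)[OF v] validD(3)[OF w] validD(5)[OF v] validD(5)[OF w]] by blast

lemma valid_trivial: "dual_pair A A' pr ==> valid (hyp_space A A' pr) (inl A') A (inr A) A'"
 by (simp add: valid_def qform_hyp lag_hyp_space half_summand_inr)

lemma valid_lag: "qform F ==> lag F u K ==> lag F w L ==> valid F u K w L"
 by (simp add: valid_def lag_half_summand)

lemma trivial_formation_qfm:
 "triv P = qfm (hyp_space P (bdual P) (\<lambda>y f. f y)) (inl (bdual P)) P (inr P) (bdual P)"
 by (simp add: trivial_formation_def qfm_def hyperbolic_hyp_space)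

lemma quasi_formation_trivial: "based P ==> qf (triv P)"
 unfolding trivial_formation_qfm by (rule validD(8)[OF valid_trivial[OF dual_pair_dual]])

section \<open>Trivial formations and stable isomorphism\<close>

lemma trivial_iso:
 assumes A: "dual_pair A A' pr" and B: "dual_pair B B' pr'" and s: "siso A B s"
 shows "qf_iso (qfm (hyp_space A A' pr) (inl A') A (inr A) A')
   (qfm (hyp_space B B' pr') (inl B') B (inr B) B')"
proof -
 obtain s' where s': "siso A' B' s'" "s' (zero A') = zero B'" "isom (hyp_space A A' pr) (hyp_space B B' pr') (map_prod s s')"
  using hyp_space_iso[OF A B s] by metis
 have "s (zero A) = zero B"
  by (rule linear_maps_zero[OF sisoD(2)[OF s] basedD(1)[OF dual_pairD(1)[OF A]] basedD(1)[OF dual_pairD(1)[OF B]]])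
 then show ?thesis
  by (intro valid_iso(2)[OF valid_trivial[OF A] qform_hyp[OF B] s'(3) dual_pairD(1,2)[OF B] s _ s'(1)]) (simp_all add: s'(2))
qed

text \<open>R only has to be simply isomorphic to P \<oplus> Q, so it can be chosen on vectors, as
  \<open>stably_isomorphic\<close> demands; the element type of P \<oplus> Q is a product.\<close>

lemma trivial_sum:
 assumes P: "based P" and Q: "based Q" and R: "based R" and s: "siso (bsum P Q) R s"
 shows "qf_iso (qf_add (triv P) (triv Q)) (triv R)"
proof -
 note p = dual_pair_dual[OF P] and q = dual_pair_dual[OF Q] and r = dual_pair_dual[OF R]
 note pq = dual_pair_sum[OF p q]
 note vp = valid_trivial[OF p] and vq = valid_trivial[OF q]
 note v = valid_sum[OF vp vq]
 note bp = validD[OF vp] and bq = validD[OF vq]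
 note i = isometry_hyp_interchange[OF p q]
 note 1 = qfm_sum[OF bp(1) bq(1) bp(4,3) bq(4,3)]
 have 2: "qf_iso (qfm (fsum (hyp_space P (bdual P) (\<lambda>y f. f y)) (hyp_space Q (bdual Q) (\<lambda>y f. f y)))
   (map_prod (inl (bdual P)) (inl (bdual Q))) (bsum P Q)
   (map_prod (inr P) (inr Q)) (bsum (bdual P) (bdual Q)))
   (qfm (hyp_space (bsum P Q) (bsum (bdual P) (bdual Q)) (sum_pairing (\<lambda>y f. f y) (\<lambda>y f. f y)))
   (inl (bsum (bdual P) (bdual Q))) (bsum P Q)
   (inr (bsum P Q)) (bsum (bdual P) (bdual Q)))"
  by (rule valid_iso(2)[OF v qform_hyp[OF pq] i dual_pairD(1,2)[OF pq] siso_id[OF dual_pairD(1)[OF pq]] _ siso_id[OF dual_pairD(2)[OF pq]]]) auto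
 note qs = quasi_formation_sum[OF quasi_formation_trivial[OF P] quasi_formation_trivial[OF Q]]
 note qv = validD(8)[OF v] and qpq = validD(8)[OF valid_trivial[OF pq]] and qr = quasi_formation_trivial[OF R]
 show ?thesis
  unfolding trivial_formation_qfm
  by (rule qf_isomorphic_trans[OF qs[unfolded trivial_formation_qfm] qv qr[unfolded trivial_formation_qfm] 1
     qf_isomorphic_trans[OF qv qpq qr[unfolded trivial_formation_qfm] 2 trivial_iso[OF pq r s]]])
qed

lemma stably_isomorphicI:
 assumes "qf x" "qf y" "qf_iso x y"
 shows "stably_isomorphic \<epsilon> Z x y"
proof -
 note t = quasi_formation_trivial[OF based_free_closed[of 0]]
 show ?thesis unfolding stably_isomorphic_def
  using qf_isomorphic_sum[OF assms(1,2) t t assms(3) qf_isomorphic_refl[OF t]] based_free_closed[of 0] by blast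
qed

text \<open>The definition adds a trivial formation on both sides. The one of the zero module is
  added to each, and on the right it is merged with that of P into a trivial formation on
  vectors.\<close>

lemma stably_isomorphic_trivial:
 assumes x: "qf x" and y: "qf y" and P: "based P"
  and i: "qf_iso x (qf_add y (triv P))"
 shows "stably_isomorphic \<epsilon> Z x y"
proof -
 note O = based_free_closed[of 0]
 note t = quasi_formation_trivial
 obtain R :: "('a, 'a vec) based_module" and s where R: "based R" "siso (bsum P (bfree 0)) R s"
  using vec_model[OF based_sum_closed[OF P O]] by blast
 note q = quasi_formation_sum[OF y t[OF P]]
 note q1 = quasi_formation_sum[OF x t[OF O]] quasi_formation_sum[OF q t[OF O]] quasi_formation_sum[OF y quasi_formation_sum[OF t[OF P] t[OF O]]] quasi_formation_sum[OF y t[OF R(1)]]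
 note 1 = qf_isomorphic_sum[OF x q t[OF O] t[OF O] i qf_isomorphic_refl[OF t[OF O]]]
 note 2 = qf_isomorphic_reassoc[OF y t[OF P] t[OF O]]
 note 3 = qf_isomorphic_sum[OF y y quasi_formation_sum[OF t[OF P] t[OF O]] t[OF R(1)] qf_isomorphic_refl[OF y] trivial_sum[OF P O R]]
 have "qf_iso (qf_add x (triv (bfree 0))) (qf_add y (triv R))"
  by (rule qf_isomorphic_trans[OF q1(1,2,4) 1 qf_isomorphic_trans[OF q1(2,3,4) 2 3]])
 then show ?thesis unfolding stably_isomorphic_def using O R(1) by blast
qed

lemma qf_vec_model:
 fixes y :: "('a, 'm) quasi_formation"
 assumes y: "qf y"
 obtains x :: "('a, 'a vec) quasi_formation" where "qf x" "qf_iso y x"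
proof -
 obtain F L V where e: "y = (F, L, V)" by (metis surj_pair)
 note Y = quasi_formationE[OF y[unfolded e]]
 have v: "valid F id L id V" using Y by (simp add: valid_def)
 obtain F' :: "('a, 'a vec) quad_form" and f where F': "qform F'" and f: "isom F F' f" by (rule quad_form_vec_model[OF Y(1)])
 note i = valid_iso[OF v F' f validD(6,7)[OF v] siso_id[OF validD(6)[OF v]] _ siso_id[OF validD(7)[OF v]], of f f]
 have "valid F' f L f V" "qf_iso (qfm F id L id V) (qfm F' f L f V)" by (rule i; simp)+
 then show ?thesis
  using that qf_isomorphic_trans[OF y[unfolded e] validD(8)[OF v] validD(8) Y(4)] validD(8) unfolding e by blast
qed

section \<open>The commutative monoid of classes\<close>

lemma l_equiv_quasi_formation: "lequiv x y ==> qf x \<and> qf y"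
 by (induction rule: l_equiv.induct) auto

lemma l_equiv_isomorphic: "qf x ==> qf y ==> qf_iso x y ==> lequiv x y"
 by (rule l_equiv.stable) (auto intro: stably_isomorphicI)

text \<open>Two models on vectors of the same quasi-formation are isomorphic, hence equivalent, so
  the class can be computed from any one of them.\<close>

lemma l_class_model:
 assumes y: "qf y" and x: "qf x" and i: "qf_iso y x"
 shows "lcls y = {z. lequiv x z}"
proof -
 have "lequiv x z" if x': "qf x'" "qf_iso y x'" "lequiv x' z" for x' z
  using l_equiv.trans[OF l_equiv_isomorphic[OF x x'(1) qf_isomorphic_trans[OF x y x'(1) qf_isomorphic_sym[OF y x i] x'(2)]] x'(3)] .
 then show ?thesis unfolding l_class_def using x i by blast
qed

lemma l_class_vec: "qf x ==> lcls x = {z. lequiv x z}"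
 by (rule l_class_model) (auto intro: qf_isomorphic_refl)

lemma l_class_iso:
 assumes y: "qf y" and y': "qf y'" and i: "qf_iso y y'"
 shows "lcls y = lcls y'"
proof -
 obtain x :: "('a, 'a vec) quasi_formation" where x: "qf x" "qf_iso y' x" by (rule qf_vec_model[OF y'])
 show ?thesis unfolding l_class_model[OF y' x] by (rule l_class_model[OF y x(1) qf_isomorphic_trans[OF y y' x(1) i x(2)]])
qed

lemma l_class_eqI:
 assumes "lequiv x x'"
 shows "lcls x = lcls x'"
 using assms l_class_vec l_equiv_quasi_formation l_equiv.trans l_equiv.sym
 by (metis (no_types, lifting) Collect_cong)

lemma l_class_stable:
 assumes y: "qf y" and P: "based P"
 shows "lcls (qf_add y (triv P)) = lcls y"
proof -
 note t = quasi_formation_trivial[OF P]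
 note q = quasi_formation_sum[OF y t]
 obtain x :: "('a, 'a vec) quasi_formation" where x: "qf x" "qf_iso y x" by (rule qf_vec_model[OF y])
 obtain x' :: "('a, 'a vec) quasi_formation" where x': "qf x'" "qf_iso (qf_add y (triv P)) x'"
  by (rule qf_vec_model[OF q])
 note q' = quasi_formation_sum[OF x(1) t]
 have "qf_iso x' (qf_add x (triv P))"
  by (rule qf_isomorphic_trans[OF x'(1) q q' qf_isomorphic_sym[OF q x'] qf_isomorphic_sum[OF y x(1) t t x(2) qf_isomorphic_refl[OF t]]])
 then have "lequiv x' x" using stably_isomorphic_trivial[OF x'(1) x(1) P] x x' l_equiv.stable by blast
 then show ?thesis using l_class_eqI l_class_iso[OF y x] l_class_iso[OF q x'] by metis
qed

lemma l_class_sum_cong: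
 assumes e: "lequiv x z" and w: "qf (w :: ('a, 'a vec) quasi_formation)"
 shows "lcls (qf_add x w) = lcls (qf_add z w)" "lcls (qf_add w x) = lcls (qf_add w z)"
proof -
 have x: "qf x" and z: "qf z" using l_equiv_quasi_formation[OF e] by auto
 note q = quasi_formation_sum[OF x w] quasi_formation_sum[OF z w]
 obtain m :: "('a, 'a vec) quasi_formation" where m: "qf m" "qf_iso (qf_add x w) m" by (rule qf_vec_model[OF q(1)])
 obtain m' :: "('a, 'a vec) quasi_formation" where m': "qf m'" "qf_iso (qf_add z w) m'" by (rule qf_vec_model[OF q(2)])
 have "lequiv m m'"
  by (rule l_equiv.sum[OF e w m(1) m'(1) stably_isomorphicI[OF m(1) q(1) qf_isomorphic_sym[OF q(1) m]] stably_isomorphicI[OF m'(1) q(2) qf_isomorphic_sym[OF q(2) m']]])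
 then show 1: "lcls (qf_add x w) = lcls (qf_add z w)"
  using l_class_eqI l_class_iso[OF q(1) m] l_class_iso[OF q(2) m'] by metis
 show "lcls (qf_add w x) = lcls (qf_add w z)"
  using 1 l_class_iso[OF quasi_formation_sum[OF w x] q(1) qf_isomorphic_swap[OF w x]]
   l_class_iso[OF quasi_formation_sum[OF w z] q(2) qf_isomorphic_swap[OF w z]] by metis
qed

abbreviation l_mult (infixl "\<cdot>" 70) where "x \<cdot> y \<equiv> x \<otimes>\<^bsub>lmon\<^esub> y"

abbreviation l_one ("\<one>\<^bsub>l\<^esub>") where "\<one>\<^bsub>l\<^esub> \<equiv> \<one>\<^bsub>lmon\<^esub>"

text \<open>The product of classes is a union over all representatives; since \<open>l_equiv\<close>
  respects sums, all terms of the union coincide.\<close>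

lemma l_class_sum:
 assumes y: "qf y" and y': "qf y'"
 shows "lcls y \<cdot> lcls y' = lcls (qf_add y y')"
proof -
 obtain x :: "('a, 'a vec) quasi_formation" where x: "qf x" "qf_iso y x" by (rule qf_vec_model[OF y])
 obtain x' :: "('a, 'a vec) quasi_formation" where x': "qf x'" "qf_iso y' x'" by (rule qf_vec_model[OF y'])
 have "lcls (qf_add z z') = lcls (qf_add x x')" if "lequiv x z" "lequiv x' z'" for z z'
  using l_class_sum_cong(1)[OF that(1), of z'] l_class_sum_cong(2)[OF that(2), of x] l_equiv_quasi_formation that by metis
 moreover have "lequiv x x" "lequiv x' x'" using x x' qf_isomorphic_refl l_equiv_isomorphic by blast+
 ultimately have "(\<Union>z\<in>{z. lequiv x z}. \<Union>z'\<in>{z. lequiv x' z}. lcls (qf_add z z')) = lcls (qf_add x x')"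
  by blast
 then show ?thesis
  using l_class_iso[OF quasi_formation_sum[OF y y'] quasi_formation_sum[OF x(1) x'(1)] qf_isomorphic_sum[OF y x(1) y' x'(1) x(2) x'(2)]]
  by (simp add: l_class_model[OF y x] l_class_model[OF y' x'] l_monoid_def)
qed

lemma l_class_trivial:
 assumes P: "based P"
 shows "lcls (triv P) = \<one>\<^bsub>l\<^esub>"
proof -
 note O = based_free_closed[of 0] and t = quasi_formation_trivial
 have "lcls (triv P) = lcls (qf_add (triv P) (triv (bfree 0)))"
  using l_class_stable[OF t[OF P] O] by simp
 also have "\<dots> = lcls (qf_add (triv (bfree 0)) (triv P))"
  by (rule l_class_iso[OF quasi_formation_sum quasi_formation_sum qf_isomorphic_swap]) (simp_all add: t P O)
 also have "\<dots> = lcls (triv (bfree 0))" by (rule l_class_stable[OF t[OF O] P])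
 finally show ?thesis by (simp add: l_monoid_def)
qed

lemma l_carrier_iff: "X IN (lmon) \<longleftrightarrow> (\<exists>x :: ('a, 'a vec) quasi_formation. qf x \<and> X = lcls x)"
proof -
 have "X IN (lmon) \<longleftrightarrow> (\<exists>x. qf x \<and> X = {z. lequiv x z})"
  by (simp add: l_monoid_def quotient_def Image_def Bex_def)
 then show ?thesis using l_class_vec by metis
qed

lemma l_class_closed: "qf y ==> lcls y IN (lmon)"
 using l_carrier_iff l_class_iso by (metis qf_vec_model)

lemma comm_monoid_l_monoid: "comm_monoid (lmon)"
proof (rule comm_monoidI)
 note t = quasi_formation_trivial[OF based_free_closed[of 0]]
 have one: "\<one>\<^bsub>l\<^esub> = lcls (triv (bfree 0))" by (simp add: l_monoid_def)
 show "\<one>\<^bsub>l\<^esub> IN (lmon)" unfolding one by (rule l_class_closed[OF t])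
 fix X Y assume "X IN (lmon)" "Y IN (lmon)"
 then obtain x y :: "('a, 'a vec) quasi_formation" where x: "qf x" "X = lcls x" and y: "qf y" "Y = lcls y"
  unfolding l_carrier_iff by blast
 show "X \<cdot> Y IN (lmon)"
  unfolding x(2) y(2) l_class_sum[OF x(1) y(1)] by (rule l_class_closed[OF quasi_formation_sum[OF x(1) y(1)]])
 show "X \<cdot> Y = Y \<cdot> X"
  unfolding x(2) y(2) l_class_sum[OF x(1) y(1)] l_class_sum[OF y(1) x(1)]
  by (rule l_class_iso[OF quasi_formation_sum[OF x(1) y(1)] quasi_formation_sum[OF y(1) x(1)] qf_isomorphic_swap[OF x(1) y(1)]])
 show "\<one>\<^bsub>l\<^esub> \<cdot> X = X"
  unfolding one x(2) l_class_sum[OF t x(1)]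
   l_class_iso[OF quasi_formation_sum[OF t x(1)] quasi_formation_sum[OF x(1) t] qf_isomorphic_swap[OF t x(1)]]
  by (rule l_class_stable[OF x(1) based_free_closed])
 fix W assume "W IN (lmon)"
 then obtain w :: "('a, 'a vec) quasi_formation" where w: "qf w" "W = lcls w" unfolding l_carrier_iff by blast
 note xy = quasi_formation_sum[OF x(1) y(1)] and yw = quasi_formation_sum[OF y(1) w(1)]
 show "X \<cdot> Y \<cdot> W = X \<cdot> (Y \<cdot> W)"
  unfolding x(2) y(2) w(2) l_class_sum[OF x(1) y(1)] l_class_sum[OF y(1) w(1)] l_class_sum[OF xy w(1)] l_class_sum[OF x(1) yw]
  by (rule l_class_iso[OF quasi_formation_sum[OF xy w(1)] quasi_formation_sum[OF x(1) yw] qf_isomorphic_reassoc[OF x(1) y(1) w(1)]])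
qed

section \<open>Computing with parametrised quasi-formations\<close>

lemma qfm_class_closed: "valid F u K v N ==> qfm_class F u K v N IN (lmon)"
 unfolding qfm_class_def by (rule l_class_closed[OF validD(8)])

lemma qfm_class_iso:
 assumes v: "valid F u K v N" and F': "qform F'" and f: "isom F F' f"
  and K': "based K'" and N': "based N'"
  and s: "siso K K' s" "\<And>x. x IN K ==> f (u x) = u' (s x)"
  and t: "siso N N' t" "\<And>x. x IN N ==> f (v x) = v' (t x)"
 shows "qfm_class F u K v N = qfm_class F' u' K' v' N'"
 unfolding qfm_class_def
 by (rule l_class_iso[OF validD(8)[OF v] validD(8)[OF valid_iso(1)[OF v F' f K' N' s t]] valid_iso(2)[OF v F' f K' N' s t]])

lemma qfm_class_isometry:
 assumes v: "valid F u K v N" and F': "qform F'" and f: "isom F F' f"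
  and u': "\<And>x. x IN K ==> u' x = f (u x)" and v': "\<And>x. x IN N ==> v' x = f (v x)"
 shows "qfm_class F u K v N = qfm_class F' u' K v' N" "valid F' u' K v' N"
proof -
 note V = validD(6,7)[OF v]
 show "qfm_class F u K v N = qfm_class F' u' K v' N"
  by (rule qfm_class_iso[OF v F' f V siso_id[OF V(1)] _ siso_id[OF V(2)]]) (simp_all add: u' v')
 show "valid F' u' K v' N"
  by (rule valid_iso(1)[OF v F' f V siso_id[OF V(1)] _ siso_id[OF V(2)]]) (simp_all add: u' v')
qed

lemma qfm_class_sum:
 assumes v: "valid F u K v N" and w: "valid G w L z P"
 shows "qfm_class F u K v N \<cdot> qfm_class G w L z P = qfm_class (fsum F G) (map_prod u w) (bsum K L) (map_prod v z) (bsum N P)"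
proof -
 note V = validD[OF v] and W = validD[OF w]
 show ?thesis
  unfolding qfm_class_def l_class_sum[OF V(8) W(8)]
  by (rule l_class_iso[OF quasi_formation_sum[OF V(8) W(8)] validD(8)[OF valid_sum[OF v w]] qfm_sum[OF V(1) W(1) V(4,3) W(4,3)]])
qed

text \<open>The defining relation, freed from inclusions and from the element type. It reads
  \<open>[u, w] [w, v] = [u, v]\<close>: a Lagrangian w may be inserted anywhere, although no factor
  can be cancelled.\<close>

lemma qfm_class_lagrangian:
 assumes w: "lag F w L" and v: "valid F u K v N"
 shows "qfm_class F u K w L \<cdot> qfm_class F w L v N = qfm_class F u K v N"
proof -
 note V = validD[OF v]
 have uw: "valid F u K w L" and wv: "valid F w L v N" using v w V(1) valid_lag[OF V(1,2) w] by (simp_all add: valid_def)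
 obtain F' :: "('a, 'a vec) quad_form" and f where F': "qform F'" and f: "isom F F' f" by (rule quad_form_vec_model[OF V(1)])
 note i = qfm_class_isometry[OF v F' f refl refl] qfm_class_isometry[OF uw F' f refl refl] qfm_class_isometry[OF wv F' f refl refl]
 let ?im = "\<lambda>u K. based_image (\<lambda>x. f (u x)) K (fst F')"
 let ?x = "(F', ?im u K, ?im w L)" and ?y = "(F', ?im w L, ?im v N)" and ?z = "(F', ?im u K, ?im v N)"
 have q: "qf ?x" "qf ?y" "qf ?z"
  using validD(8)[OF i(4)] validD(8)[OF i(6)] validD(8)[OF i(2)] unfolding qfm_def .
 note qs = quasi_formation_sum[OF q(1,2)]
 obtain m :: "('a, 'a vec) quasi_formation" where m: "qf m" "qf_iso (qf_add ?x ?y) m" by (rule qf_vec_model[OF qs])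
 have sl: "simple_lagrangian \<epsilon> Z F' (?im u K)" "simple_lagrangian \<epsilon> Z F' (?im w L)"
  using lag_image[OF F' validD(2)[OF i(4)]] lag_image[OF F' validD(2)[OF i(6)]] simple_lagrangian_iff[OF F'] by auto
 have "lequiv m ?z"
  by (rule l_equiv.lagrangian_rel[OF sl q(3) m(1) stably_isomorphicI[OF m(1) qs qf_isomorphic_sym[OF qs m]]])
 then have "lcls ?x \<cdot> lcls ?y = lcls ?z"
  using l_class_eqI l_class_iso[OF qs m] l_class_sum[OF q(1,2)] by simp
 then show ?thesis unfolding i(1,3,5) by (simp add: qfm_class_def qfm_def)
qed

lemma qfm_class_trivial:
 assumes A: "dual_pair A A' pr"
 shows "qfm_class (hyp_space A A' pr) (inl A') A (inr A) A' = \<one>\<^bsub>l\<^esub>"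
proof -
 note a = dual_pairD(1)[OF A]
 have "lcls (triv A) = qfm_class (hyp_space A A' pr) (inl A') A (inr A) A'"
  unfolding trivial_formation_qfm qfm_class_def
  by (rule l_class_iso[OF validD(8)[OF valid_trivial] validD(8)[OF valid_trivial] trivial_iso[OF _ A siso_id]]) (simp_all add: a A dual_pair_dual)
 then show ?thesis using l_class_trivial[OF a] by simp
qed

text \<open>Cancellation is avoided by choosing a partner whose class is trivial: in H(K) the
  relation gives \<open>[K, K] [K, K*] = [K, K*]\<close>, and \<open>[K, K*]\<close> is the class of
  a trivial formation.\<close>

lemma qfm_class_self:
 assumes F: "qform F" and u: "lag F u K"
 shows "qfm_class F u K u K = \<one>\<^bsub>l\<^esub>"
proof -
 interpret comm_monoid "lmon" by (rule comm_monoid_l_monoid)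
 obtain h where K: "based K" and h: "isom (hyper K) F h" "\<And>x. x IN K ==> h (x, zero (dual K)) = u x"
  using u unfolding lag_def by blast
 let ?H = "hyp_space K (bdual K) (\<lambda>y f. f y)" and ?i = "inl (bdual K)"
 note D = dual_pair_dual[OF K]
 note l = lag_hyp_space[OF D]
 have v: "valid ?H ?i K ?i K" by (rule valid_lag[OF qform_hyp[OF D] l l])
 have "qfm_class ?H ?i K ?i K \<cdot> \<one>\<^bsub>l\<^esub> = \<one>\<^bsub>l\<^esub>"
  using qfm_class_lagrangian[OF l valid_trivial[OF D]] unfolding qfm_class_trivial[OF D] .
 then have "qfm_class ?H ?i K ?i K = \<one>\<^bsub>l\<^esub>" using qfm_class_closed[OF v] by simp
 moreover have "qfm_class ?H ?i K ?i K = qfm_class F u K u K"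
  by (rule qfm_class_isometry(1)[OF v F]) (use h in \<open>simp_all add: hyperbolic_hyp_space flip: h(2)\<close>)
 ultimately show ?thesis by simp
qed

text \<open>An isometry does not change classes, so the class of (u, v) is also that of (f u, f v);
  it is then composed with the class of (u, f u) through the Lagrangian f u.\<close>

lemma qfm_class_automorphism:
 assumes v: "valid F u K v N" and f: "isom F F f"
 shows "qfm_class F u K (\<lambda>x. f (u x)) K \<cdot> qfm_class F u K v N = qfm_class F u K (\<lambda>x. f (v x)) N"
  "valid F u K (\<lambda>x. f (u x)) K" "valid F u K (\<lambda>x. f (v x)) N"
proof -
 note V = validD[OF v]
 note i = qfm_class_isometry[OF v V(1) f refl refl]
 show fu: "valid F u K (\<lambda>x. f (u x)) K" by (rule valid_lag[OF V(1,2) validD(2)[OF i(2)]])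
 show fv: "valid F u K (\<lambda>x. f (v x)) N" using v i(2) by (simp add: valid_def)
 show "qfm_class F u K (\<lambda>x. f (u x)) K \<cdot> qfm_class F u K v N = qfm_class F u K (\<lambda>x. f (v x)) N"
  unfolding i(1) by (rule qfm_class_lagrangian[OF validD(2)[OF i(2)] fv])
qed

end

section \<open>Boundaries\<close>

lemma hyp_form_neg: "hyp_form (\<lambda>y f. - pr y f) = (\<lambda>x y. - hyp_form pr x y)"
 by (auto simp: hyp_form_def)

context form_parameter
begin

lemma boundary_qfm:
 "boundary \<epsilon> Z K \<rho> = qfm (hyp_space K (bdual K) (\<lambda>y f. f y)) (inl (bdual K)) K (\<lambda>x. (x, \<rho> x)) K"
 by (simp add: boundary_def qfm_def hyperbolic_hyp_space)

definition bd_class :: "('a, 'm) based_module => ('a, 'm) bilinear => ('a, 'a vec) quasi_formation set" where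
 "bd_class A \<phi> = lcls (boundary \<epsilon> Z A (rform A \<phi>))"

lemma represent_form:
 assumes A: "dual_pair A A' pr" and d: "sesqui A \<delta>"
 obtains R where "R \<in> linear_maps A A'" "\<And>x y. x IN A ==> y IN A ==> pr y (R x) = \<delta> x y"
proof -
 note a = dual_pairD[OF A]
 have l: "rform A \<delta> \<in> linear_maps A (dual A)"
  using rform_in_Hom[OF basedD(1)[OF a(1)] d] by (simp add: Hom_dual_def)
 have i: "inv_map A' (pair_map A pr) \<in> linear_maps (dual A) A'"
  using sisoD(2)[OF siso_inv[OF a(2) based_dual_closed[OF a(1)] a(3)]] by simp
 show ?thesis
 proof (rule that[OF lin_comp[OF l i]])
  fix x y assume "x IN A" "y IN A"
  then show "pr y ((inv_map A' (pair_map A pr) \<circ> rform A \<delta>) x) = \<delta> x y"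
   using dual_pair_represent(2)[OF A linD(1)[OF l]] by (simp add: rform_def)
 qed
qed

lemma half_summand_inl:
 assumes M: "based M" and N: "based N" and r: "module_rank M = module_rank N" and f: "f \<in> linear_maps M N"
 shows "half_summand (bsum M N) (\<lambda>x. (x, f x)) M"
proof -
 have "fst \<in> linear_maps (bsum M N) M" using linear_maps_fst[of M N] by simp
 moreover have "(\<lambda>x. (x, f x)) \<in> linear_maps M (bsum M N)"
  using linear_maps_pair[OF _ f, of "\<lambda>x. x" M] by (simp add: linear_maps_def)
 ultimately show ?thesis
  unfolding half_summand_def using M N r by (auto simp: module_rank_sum intro!: bexI[of _ fst])
qed

lemma dual_pair_rank: "dual_pair A A' pr ==> module_rank A = module_rank A'"
 using module_rank_simple_iso[OF dual_pairD(2) based_dual_closed dual_pairD(3)] dual_pairD(1) module_rank_dual by metis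

lemma valid_graph:
 assumes A: "dual_pair A A' pr" and R: "R \<in> linear_maps A A'"
 shows "valid (hyp_space A A' pr) (inl A') A (\<lambda>x. (x, R x)) A"
 using qform_hyp[OF A] lag_hyp_space[OF A] half_summand_inl[OF dual_pairD(1,2)[OF A] dual_pair_rank[OF A] R]
 by (simp add: valid_def)

text \<open>A boundary may thus be computed with any module in simple duality with A, for example
  with M itself if M carries a simple form. The contragredient of the identity relates the model to
  the dual.\<close>

lemma bd_class_model:
 assumes A: "dual_pair A A' pr" and R: "R \<in> linear_maps A A'"
  and e: "\<And>x y. x IN A ==> y IN A ==> pr y (R x) = \<delta> x y"
 shows "bd_class A \<delta> = qfm_class (hyp_space A A' pr) (inl A') A (\<lambda>x. (x, R x)) A"
proof -
 note a = dual_pairD[OF A]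
 note E = dual_pair_dual[OF a(1)]
 obtain s' where s': "siso A' (bdual A) s'" "s' (zero A') = zero (bdual A)"
   "\<And>y f. y IN A ==> f IN A' ==> (s' f) (id y) = pr y f"
   "isom (hyp_space A A' pr) (hyp_space A (bdual A) (\<lambda>y f. f y)) (map_prod id s')"
  using hyp_space_iso[OF A E siso_id[OF a(1)]] by metis
 have "s' (R x) = rform A \<delta> x" if x: "x IN A" for x
 proof -
  note Rx = linD(1)[OF R x]
  have "s' (R x) \<in> extensional (carrier A)" using dualD(1)[of "s' (R x)" A] sisoD(3)[OF s'(1) Rx] by simp
  moreover have "rform A \<delta> x \<in> extensional (carrier A)" using x by (simp add: rform_def)
  moreover have "s' (R x) y = rform A \<delta> x y" if "y IN A" for y
   using s'(3)[OF that Rx] e[OF x that] x that by (simp add: rform_def)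
  ultimately show ?thesis by (rule extensionalityI)
 qed
 then have "qfm_class (hyp_space A A' pr) (inl A') A (\<lambda>x. (x, R x)) A =
   qfm_class (hyp_space A (bdual A) (\<lambda>y f. f y)) (inl (bdual A)) A (\<lambda>x. (x, rform A \<delta> x)) A"
  by (intro qfm_class_isometry(1)[OF valid_graph[OF A R] qform_hyp[OF E] s'(4)]) (simp_all add: s'(2))
 then show ?thesis unfolding bd_class_def boundary_qfm qfm_class_def by simp
qed

lemma bd_class_dual:
 assumes "based A" "R \<in> linear_maps A (bdual A)"
  and "\<forall>x\<in>carrier A. \<forall>y\<in>carrier A. R x y = \<delta> x y"
 shows "bd_class A \<delta> = qfm_class (hyp_space A (bdual A) (\<lambda>y f. f y)) (inl (bdual A)) A (\<lambda>x. (x, R x)) A"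
 by (rule bd_class_model[OF dual_pair_dual[OF assms(1)] assms(2)]) (use assms(3) in blast)

lemma bd_class_closed:
 assumes A: "based A" and d: "sesqui A \<delta>"
 shows "bd_class A \<delta> IN (lmon)"
proof -
 note D = dual_pair_dual[OF A]
 obtain R where R: "R \<in> linear_maps A (bdual A)" "\<forall>x\<in>carrier A. \<forall>y\<in>carrier A. R x y = \<delta> x y"
  using represent_form[OF D d] by metis
 show ?thesis unfolding bd_class_dual[OF A R] by (rule qfm_class_closed[OF valid_graph[OF D R(1)]])
qed

section \<open>Exchanging the summands, shears by even forms, sums of boundaries\<close>

lemma dual_pair_transpose:
 assumes A: "dual_pair A A' pr"
 shows "dual_pair A' A (\<lambda>f x. \<epsilon> * invol (pr x f))"
proof -
 note a = dual_pairD[OF A]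
 note d = based_dual_closed[OF a(2)]
 have "siso A (bdual A') ((\<lambda>F. \<epsilon> \<odot>\<^bsub>bdual A'\<^esub> F) \<circ> (\<lambda>x. \<lambda>f\<in>carrier A'. invol (pr x f)))"
  by (rule siso_comp[OF a(1) d d dual_pair_adjoint[OF A] simple_iso_sign[OF d eps]])
 then have "siso A (bdual A') (pair_map A' (\<lambda>f x. \<epsilon> * invol (pr x f)))"
  by (rule simple_iso_cong[OF _ a(1) d])
   (auto simp: pair_map_def dual_simps(4) eps_simps(2) eps_simps(3)[of "invol _"] intro!: restrict_ext)
 then show ?thesis using a(1,2) by (simp add: dual_pair_def)
qed

text \<open>Exchanging the summands replaces the hyperbolic form by its \<epsilon>-transpose, which
  has the same class by \<open>form_equiv_flip\<close>.\<close>

lemma isometry_hyp_swap: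
 assumes A: "dual_pair A A' pr"
 shows "isom (hyp_space A' A (\<lambda>f x. \<epsilon> * invol (pr x f))) (hyp_space A A' pr) prod.swap"
proof -
 note a = dual_pairD(1,2)[OF A]
 note sw = simple_iso_swap[OF a(2,1)]
 let ?\<phi> = "\<lambda>p q. hyp_form pr (prod.swap p) (prod.swap q)"
 have s: "sesqui (module_sum A' A) ?\<phi>"
  by (rule sesqui_pullback[OF sesqui_hyp_form[OF A]]) (use sisoD(2)[OF sw] in simp)
 have "fequiv (module_sum A' A) (hyp_form (\<lambda>f x. \<epsilon> * invol (pr x f))) (\<lambda>p q. 0 + \<epsilon> * invol (?\<phi> q p))"
  by (rule form_equiv_cong) auto
 from form_equiv_sym[OF form_equiv_trans[OF this form_equiv_flip[OF s, of "\<lambda>p q. 0"]]]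
 have "fequiv (module_sum A' A) ?\<phi> (hyp_form (\<lambda>f x. \<epsilon> * invol (pr x f)))" by simp
 then show ?thesis
  unfolding hyp_space_def isometry_iff[OF based_sum_closed[OF a(2,1)] based_sum_closed[OF a(1,2)]] using sw by simp
qed

text \<open>For the transposed pairing A' is the first summand, so A' is a Lagrangian and (A', A) is
  a trivial formation.\<close>

lemma qfm_class_flip:
 assumes A: "dual_pair A A' pr"
 shows "lag (hyp_space A A' pr) (inr A) A'"
  "qfm_class (hyp_space A A' pr) (inr A) A' (inl A') A = \<one>\<^bsub>l\<^esub>"
proof -
 note T = dual_pair_transpose[OF A] and i = isometry_hyp_swap[OF A] and q = qform_hyp[OF A]
 show "lag (hyp_space A A' pr) (inr A) A'" by (rule lag_pairI[OF q T i]) simp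
 show "qfm_class (hyp_space A A' pr) (inr A) A' (inl A') A = \<one>\<^bsub>l\<^esub>"
  using qfm_class_isometry(1)[OF valid_trivial[OF T] q i, of "inr A" "inl A'"] qfm_class_trivial[OF T] by simp
qed

text \<open>The shear adds to the form the form of D on first components, which is even by
  assumption.\<close>

lemma isometry_hyp_shear:
 assumes A: "dual_pair A A' pr" and D: "D \<in> linear_maps A A'" and k: "sesqui A \<kappa>"
  and e: "\<And>x y. x IN A ==> y IN A ==> pr y (D x) = \<kappa> x y - \<epsilon> * invol (\<kappa> y x)"
 shows "isom (hyp_space A A' pr) (hyp_space A A' pr) (\<lambda>(x, f). (x, f \<oplus>\<^bsub>A'\<^esub> D x))"
proof -
 note a = dual_pairD[OF A]
 let ?f = "\<lambda>(x, f). (x, f \<oplus>\<^bsub>A'\<^esub> D x)" and ?H = "bsum A A'"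
 have "fequiv ?H (\<lambda>p q. hyp_form pr (?f p) (?f q)) (hyp_form pr)"
  unfolding form_equiv_def
 proof (intro exI[of _ "\<lambda>p q. \<kappa> (fst p) (fst q)"] conjI ballI)
  show "sesqui ?H (\<lambda>p q. \<kappa> (fst p) (fst q))"
   using sesqui_pullback[OF k linear_maps_fst[of A A']] by simp
  fix p q assume "p IN ?H" "q IN ?H"
  then show "hyp_form pr (?f p) (?f q) = hyp_form pr p q + (\<kappa> (fst p) (fst q) - \<epsilon> * invol (\<kappa> (fst q) (fst p)))"
   using a(6) e linD(1)[OF D] by auto
 qed
 then show ?thesis
  unfolding hyp_space_def isometry_iff[OF based_sum_closed[OF a(1,2)] based_sum_closed[OF a(1,2)]]
  using simple_iso_shear'[OF a(1,2) D] by simp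
qed

lemma sesqui_even:
 assumes "sesqui M \<kappa>"
 shows "sesqui M (\<lambda>x y. \<kappa> x y - \<epsilon> * invol (\<kappa> y x))"
 using sesqui_ops(1)[OF sesqui_ops(1)[OF assms assms] sesqui_ops(2)[OF sesqui_lambda[OF assms]]]
 by (simp add: lambda_form_def)

text \<open>The shear by an even form maps the Lagrangian $A$ to a Lagrangian with the same complement $A'$.\<close>

lemma bd_class_equiv:
 assumes A: "based A" and d: "sesqui A \<delta>" and e: "fequiv A \<delta>' \<delta>"
 shows "bd_class A \<delta>' = bd_class A \<delta>"
proof -
 interpret comm_monoid "lmon" by (rule comm_monoid_l_monoid)
 let ?A = "bdual A" and ?pr = "\<lambda>y f. f y"
 let ?H = "hyp_space A ?A ?pr" and ?i = "inl ?A" and ?j = "inr A"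
 note P = dual_pair_dual[OF A]
 note p = dual_pairD[OF P]
 obtain \<kappa> where k: "sesqui A \<kappa>" "\<And>x y. x IN A ==> y IN A ==> \<delta>' x y = \<delta> x y + (\<kappa> x y - \<epsilon> * invol (\<kappa> y x))"
  using e unfolding form_equiv_def by blast
 obtain R where R: "R \<in> linear_maps A ?A" "\<forall>x\<in>carrier A. \<forall>y\<in>carrier A. R x y = \<delta> x y"
  using represent_form[OF P d] by metis
 obtain D where D: "D \<in> linear_maps A ?A" "\<forall>x\<in>carrier A. \<forall>y\<in>carrier A. D x y = \<kappa> x y - \<epsilon> * invol (\<kappa> y x)"
  using represent_form[OF P sesqui_even[OF k(1)]] by metis
 let ?f = "\<lambda>(x, f). (x, f \<oplus>\<^bsub>?A\<^esub> D x)"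
 have f: "isom ?H ?H ?f" by (rule isometry_hyp_shear[OF P D(1) k(1)]) (use D(2) in blast)
 note RD = linear_maps_add[OF basedD(1)[OF p(2)] R(1) D(1)]
 note v = valid_graph[OF P R(1)] and q = qform_hyp[OF P]
 note au = qfm_class_automorphism[OF v f]
 have D0: "D (zero A) = zero ?A" by (rule linear_maps_zero[OF D(1) basedD(1)[OF p(1)] basedD(1)[OF p(2)]])
 have vji: "valid ?H ?j ?A ?i A" by (rule valid_lag[OF q qfm_class_flip(1)[OF P] lag_hyp_space[OF P]])
 \<comment> \<open>The shear fixes A' pointwise, so it takes the formation (A', A) to (A', f
   A).\<close>
 have "qfm_class ?H ?j ?A ?i A = qfm_class ?H ?j ?A (\<lambda>x. ?f (?i x)) A"
  by (rule qfm_class_isometry(1)[OF vji q f]) (use lmodD(10)[OF basedD(1)[OF p(2)]] D0 in \<open>simp_all add: lmodD[OF basedD(1)[OF p(2)]]\<close>)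
 then have 1: "qfm_class ?H ?j ?A (\<lambda>x. ?f (?i x)) A = \<one>\<^bsub>l\<^esub>" unfolding qfm_class_flip(2)[OF P] by simp
 \<comment> \<open>Compose through the common complement:
   \<open>[A, A'] [A', f A] = [A, f A]\<close>, and both factors are trivial.\<close>
 have 2: "qfm_class ?H ?i A (\<lambda>x. ?f (?i x)) A = \<one>\<^bsub>l\<^esub>"
  using qfm_class_lagrangian[OF qfm_class_flip(1)[OF P] au(2)] unfolding 1 qfm_class_trivial[OF P] by simp
 have "bd_class A \<delta>' = qfm_class ?H ?i A (\<lambda>x. (x, R x \<oplus>\<^bsub>?A\<^esub> D x)) A"
  by (rule bd_class_dual[OF A RD]) (use p(6) linD(1)[OF R(1)] linD(1)[OF D(1)] R(2) D(2) k(2) in simp)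
 also have "\<dots> = \<one>\<^bsub>l\<^esub> \<cdot> qfm_class ?H ?i A (\<lambda>x. (x, R x)) A" using au(1) unfolding 2 by simp
 also have "\<dots> = bd_class A \<delta>" using qfm_class_closed[OF v] unfolding bd_class_dual[OF A R] by simp
 finally show ?thesis .
qed

lemma bd_class_sum:
 assumes A: "based A" and B: "based B" and d: "sesqui A \<delta>" and d': "sesqui B \<delta>'"
 shows "bd_class A \<delta> \<cdot> bd_class B \<delta>' = bd_class (bsum A B) (sum_form \<delta> \<delta>')"
proof -
 note P = dual_pair_dual[OF A] and Q = dual_pair_dual[OF B]
 note PQ = dual_pair_sum[OF P Q]
 obtain R where R: "R \<in> linear_maps A (bdual A)" "\<forall>x\<in>carrier A. \<forall>y\<in>carrier A. R x y = \<delta> x y"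
  using represent_form[OF P d] by metis
 obtain S where S: "S \<in> linear_maps B (bdual B)" "\<forall>x\<in>carrier B. \<forall>y\<in>carrier B. S x y = \<delta>' x y"
  using represent_form[OF Q d'] by metis
 note v = valid_graph[OF P R(1)] and w = valid_graph[OF Q S(1)]
 have RS: "map_prod R S \<in> linear_maps (bsum A B) (bsum (bdual A) (bdual B))"
  using linear_maps_map_prod[OF R(1) S(1)] by simp
 have "bd_class (bsum A B) (sum_form \<delta> \<delta>') =
   qfm_class (hyp_space (bsum A B) (bsum (bdual A) (bdual B)) (sum_pairing (\<lambda>y f. f y) (\<lambda>y f. f y)))
    (inl (bsum (bdual A) (bdual B))) (bsum A B) (\<lambda>x. (x, map_prod R S x)) (bsum A B)"
  by (rule bd_class_model[OF PQ RS]) (auto simp: R(2) S(2))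
 moreover have "\<dots> = qfm_class (fsum (hyp_space A (bdual A) (\<lambda>y f. f y)) (hyp_space B (bdual B) (\<lambda>y f. f y)))
   (map_prod (inl (bdual A)) (inl (bdual B))) (bsum A B)
   (map_prod (\<lambda>x. (x, R x)) (\<lambda>x. (x, S x))) (bsum A B)"
  by (rule qfm_class_isometry(1)[OF valid_sum[OF v w] qform_hyp[OF PQ] isometry_hyp_interchange[OF P Q], symmetric]) auto
 ultimately show ?thesis unfolding bd_class_dual[OF A R] bd_class_dual[OF B S] qfm_class_sum[OF v w] by simp
qed

text \<open>The isomorphism s together with its contragredient takes the graph of the pulled back
  form to the graph of \<delta>'. The pulled back form differs from \<delta> by an even form
  only.\<close>

lemma bd_class_isometry:
 assumes A: "based A" and B: "based B" and d: "sesqui A \<delta>" and d': "sesqui B \<delta>'"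
  and i: "isom (A, qcls A \<delta>) (B, qcls B \<delta>') s"
 shows "bd_class A \<delta> = bd_class B \<delta>'"
proof -
 have s: "siso A B s" and e: "fequiv A (\<lambda>x y. \<delta>' (s x) (s y)) \<delta>" using i isometry_iff[OF A B] by auto
 note P = dual_pair_dual[OF A] and Q = dual_pair_dual[OF B] and sd = sisoD[OF s]
 note ds = sesqui_pullback[OF d' sd(2)]
 obtain R where R: "R \<in> linear_maps A (bdual A)" "\<forall>x\<in>carrier A. \<forall>y\<in>carrier A. R x y = \<delta>' (s x) (s y)"
  using represent_form[OF P ds] by metis
 obtain S where S: "S \<in> linear_maps B (bdual B)" "\<forall>x\<in>carrier B. \<forall>y\<in>carrier B. S x y = \<delta>' x y"
  using represent_form[OF Q d'] by metis
 obtain s' where s': "siso (bdual A) (bdual B) s'" "s' (zero (bdual A)) = zero (bdual B)"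
  "\<And>y f. y IN A ==> f IN (bdual A) ==> (s' f) (s y) = f y"
  "isom (hyp_space A (bdual A) (\<lambda>y f. f y)) (hyp_space B (bdual B) (\<lambda>y f. f y)) (map_prod s s')"
  using hyp_space_iso[OF P Q s] by metis
 have "s' (R x) = S (s x)" if x: "x IN A" for x
 proof (rule dual_pair_ext[OF Q])
  note Rx = linD(1)[OF R(1) x]
  show "s' (R x) IN (bdual B)" by (rule sisoD(3)[OF s'(1) Rx])
  show "S (s x) IN (bdual B)" by (rule linD(1)[OF S(1) sd(3)[OF x]])
  fix y assume y: "y IN B"
  note z = sd(8)[OF y]
  show "s' (R x) y = S (s x) y"
   using s'(3)[OF z Rx] R(2) S(2) x z y sd(3)[OF x] sd(7)[OF y] by simp
 qed
 then have "bd_class A (\<lambda>x y. \<delta>' (s x) (s y)) = bd_class B \<delta>'"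
  unfolding bd_class_dual[OF A R] bd_class_dual[OF B S]
  by (intro qfm_class_iso[OF valid_graph[OF P R(1)] qform_hyp[OF Q] s'(4) B B s _ s]) (simp_all add: s'(2) del: based_dual_simps)
 then show ?thesis using bd_class_equiv[OF A d e] by simp
qed

lemma bd_class_zero:
 assumes P: "based P"
 shows "bd_class P (\<lambda>x y. 0) = \<one>\<^bsub>l\<^esub>"
proof -
 note D = dual_pair_dual[OF P]
 note b = basedD(1)[OF dual_pairD(2)[OF D]]
 have "(\<lambda>x. (zero (bdual P))) \<in> linear_maps P (bdual P)"
  using lmodD(2,3)[OF b] lmodD(9)[OF b lmodD(3)[OF b]] lmod_minus(4)[OF b lmodD(3)[OF b]]
  by (intro linI) (simp_all add: lmodD[OF b])
 from bd_class_model[OF D this, of "\<lambda>x y. 0"] show ?thesis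
  using qfm_class_self[OF qform_hyp[OF D] lag_hyp_space[OF D]] dual_pairD(9)[OF D] by simp
qed

section \<open>Evaluation of the map e\<close>

lemma form_sum_zero:
 assumes "based M" "based P"
 shows "fsum (M, qcls M \<phi>) (zero_form \<epsilon> P) = (bsum M P, qcls (bsum M P) (sum_form \<phi> (\<lambda>x y. 0)))"
 using assms by (simp add: zero_form_def one_Q_group basedD form_sum_quad_class del: form_sum.simps)

lemma sesqui_zero: "sesqui M (\<lambda>x y. 0 :: 'a)"
 by (rule sesquiI) simp_all

lemma bd_class_sum_zero:
 assumes A: "based A" and P: "based P" and d: "sesqui A \<delta>"
 shows "bd_class (bsum A P) (sum_form \<delta> (\<lambda>x y. 0)) = bd_class A \<delta>"
proof -
 interpret comm_monoid "lmon" by (rule comm_monoid_l_monoid)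
 show ?thesis
  using bd_class_sum[OF A P d sesqui_zero] bd_class_zero[OF P] bd_class_closed[OF A d] by simp
qed

text \<open>Boundary classes do not change under even forms, isometries and the addition of zero
  forms, so all members of the class yield the same value. A model on vectors shows that there is a
  member, so \<open>the_elem\<close> evaluates.\<close>

lemma e_map_form_class:
 fixes A :: "('a, 'm) based_module"
 assumes A: "based A" and d: "sesqui A \<delta>"
 shows "e_map \<epsilon> Z (form_class \<epsilon> Z (A, qcls A \<delta>)) = bd_class A \<delta>"
proof -
 let ?F = "(A, qcls A \<delta>)"
 have F: "qform ?F" using A d by simp
 have only: "lcls (boundary \<epsilon> Z V \<rho>) = bd_class A \<delta>"
  if V: "(V, \<theta>) \<in> form_class \<epsilon> Z ?F" "\<rho> \<in> \<theta>" for V \<theta> \<rho>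
 proof -
  have q: "qform (V, \<theta>)" using V(1) by (simp add: form_class_def)
  obtain \<phi> where \<phi>: "based V" "sesqui V \<phi>" "\<theta> = qcls V \<phi>" by (rule quad_formE[OF q])
  obtain P Q :: "('a, 'a vec) based_module" and f where P: "based P" and Q: "based Q"
   and f: "isom (fsum ?F (zero_form \<epsilon> P)) (fsum (V, \<theta>) (zero_form \<epsilon> Q)) f"
   using V(1) unfolding form_class_def by blast
  obtain \<phi>' where \<phi>': "\<rho> = rform V \<phi>'" "fequiv V \<phi>' \<phi>"
   using V(2) quad_class_iff[OF basedD(1)[OF \<phi>(1)]] unfolding \<phi>(3) by blast
  have "lcls (boundary \<epsilon> Z V \<rho>) = bd_class V \<phi>'" by (simp add: bd_class_def \<phi>'(1))
  also have "\<dots> = bd_class V \<phi>" by (rule bd_class_equiv[OF \<phi>(1,2) \<phi>'(2)])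
  also have "\<dots> = bd_class (bsum V Q) (sum_form \<phi> (\<lambda>x y. 0))" by (rule bd_class_sum_zero[OF \<phi>(1) Q \<phi>(2), symmetric])
  also have "\<dots> = bd_class (bsum A P) (sum_form \<delta> (\<lambda>x y. 0))"
   by (rule bd_class_isometry[OF _ _ _ _ f[unfolded \<phi>(3) form_sum_zero[OF A P] form_sum_zero[OF \<phi>(1) Q]], symmetric])
    (simp_all add: A P \<phi> Q d sesqui_sum_form sesqui_zero)
  also have "\<dots> = bd_class A \<delta>" by (rule bd_class_sum_zero[OF A P d])
  finally show ?thesis .
 qed
 obtain F' :: "('a, 'a vec) quad_form" and f where F': "qform F'" and f: "isom ?F F' f" by (rule quad_form_vec_model[OF F])
 obtain V \<phi> where V: "F' = (V, qcls V \<phi>)" "based V" "sesqui V \<phi>" by (rule qform_cases[OF F'])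
 have z: "qform (zero_form \<epsilon> (bfree 0 :: ('a, 'a vec) based_module))"
  using one_Q_group[OF basedD(1)[OF based_free_closed]] sesqui_zero by (simp add: zero_form_def)
 have "F' \<in> form_class \<epsilon> Z ?F"
  unfolding form_class_def using F' isometry_sum[OF F z F' z f isometry_refl[OF z]] based_free_closed by blast
 moreover have "rform V \<phi> \<in> qcls V \<phi>" using quad_class_iff[OF basedD(1)[OF V(2)]] form_equiv_refl by blast
 ultimately have "{lcls (boundary \<epsilon> Z V \<rho>) | V \<theta> \<rho>. (V, \<theta>) \<in> form_class \<epsilon> Z ?F \<and> \<rho> \<in> \<theta>} = {bd_class A \<delta>}"
  using only unfolding V(1) by blast
 then show ?thesis unfolding e_map_def by simp
qed

lemma elementary_boundary_class:
 fixes A :: "('a, 'm) based_module"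
 assumes A: "based A" and d: "sesqui A \<delta>"
 shows "elementary \<epsilon> Z (bd_class A \<delta>)"
proof -
 have F: "qform (A, qcls A \<delta>)" using A d by simp
 obtain F' :: "('a, 'a vec) quad_form" and f where F': "qform F'" and f: "isom (A, qcls A \<delta>) F' f" by (rule quad_form_vec_model[OF F])
 obtain V \<phi> where V: "F' = (V, qcls V \<phi>)" "based V" "sesqui V \<phi>" by (rule qform_cases[OF F'])
 have "bd_class A \<delta> = lcls (boundary \<epsilon> Z V (rform V \<phi>))"
  using bd_class_isometry[OF A V(2) d V(3) f[unfolded V(1)]] by (simp add: bd_class_def)
 then show ?thesis
  unfolding elementary_def using V(2) rform_in_Hom[OF basedD(1)[OF V(2)] V(3)] by blast
qed

end

section \<open>Doubling\<close>

lemma linear_maps_const_zero: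
 assumes "left_module (N :: ('a::ring_1, 'n, 'z) module_scheme)"
 shows "(\<lambda>x. (zero N)) \<in> linear_maps M N"
 using lmodD(3)[OF assms] lmodD(9)[OF assms lmodD(3)[OF assms]] lmod_minus(4)[OF assms lmodD(3)[OF assms]]
 by (intro linI) simp_all

context form_parameter
begin

text \<open>A simple form makes M its own partner. The resulting hyperbolic form on M \<oplus> M is
  the target of the doubling isometry.\<close>

lemma dual_pair_lambda:
 assumes M: "based M" and sf: "simple_form \<epsilon> Z (M, qcls M \<phi>)"
 shows "dual_pair M M (\<lambda>y x. lam \<phi> x y)"
proof -
 have "siso M (bdual M) (rform M (lam \<phi>))"
  using sf by (simp add: simple_form.simps symmetrisation_quad_class basedD M)
 then have "siso M (bdual M) (pair_map M (\<lambda>y x. lam \<phi> x y))"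
  by (rule simple_iso_cong) (simp_all add: M rform_def pair_map_def)
 then show ?thesis using M by (simp add: dual_pair_def)
qed

text \<open>The isometry maps the diagonal to the second summand $M$ and $M \oplus 0$ to the graph of \<open>\<pi>\<close>.\<close>

lemma isometry_doubling:
 assumes M: "based M" and s: "sesqui M \<phi>" and sf: "simple_form \<epsilon> Z (M, qcls M \<phi>)"
  and p: "\<pi> \<in> linear_maps M M" and e: "\<And>x y. x IN M ==> y IN M ==> lam \<phi> (\<pi> x) y = \<phi> x y"
 shows "isom (fsum (M, qcls M \<phi>) (M, qcls M (\<lambda>x y. - \<phi> x y)))
  (hyp_space M M (\<lambda>y x. lam \<phi> x y))
  (\<lambda>(a, b). (a \<oplus>\<^bsub>M\<^esub> (- 1) \<odot>\<^bsub>M\<^esub> b, b \<oplus>\<^bsub>M\<^esub> \<pi> (a \<oplus>\<^bsub>M\<^esub> (- 1) \<odot>\<^bsub>M\<^esub> b)))" (is "isometry _ _ _ _ ?f")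
proof -
 let ?n = "\<lambda>b. (- 1) \<odot>\<^bsub>M\<^esub> b" and ?S = "bsum M M" and ?l = "lam \<phi>"
 note M' = basedD(1)[OF M]
 note Md = lmodD[OF M'] and sd = sesquiD[OF s] and ld = sesquiD[OF sesqui_lambda[OF s]] and pd = linD[OF p]
 have S: "based ?S" using M by simp
 have nl: "?n \<in> linear_maps M M" by (rule sisoD(2)[OF simple_iso_sign[OF M]]) simp
 have "siso ?S ?S ((\<lambda>(x, y). (x, y \<oplus>\<^bsub>M\<^esub> \<pi> x)) \<circ> (\<lambda>(x, y). (x \<oplus>\<^bsub>M\<^esub> ?n y, y)))"
  by (rule siso_comp[OF S S S simple_iso_shear[OF M M nl] simple_iso_shear'[OF M M p]])
 then have si: "siso ?S ?S ?f" by (rule simple_iso_cong[OF _ S S]) auto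
 let ?d = "\<lambda>p. fst p \<oplus>\<^bsub>M\<^esub> ?n (snd p)"
 have dl: "?d \<in> linear_maps ?S M"
  using linear_maps_add[OF M' linear_maps_fst lin_comp[OF linear_maps_snd nl]] by (simp add: o_def)
 have sn: "snd \<in> linear_maps ?S M" using linear_maps_snd[of M M] by simp
 have sub: "\<phi> (x \<oplus>\<^bsub>M\<^esub> ?n y) z = \<phi> x z - \<phi> y z" "\<phi> z (x \<oplus>\<^bsub>M\<^esub> ?n y) = \<phi> z x - \<phi> z y" "x \<oplus>\<^bsub>M\<^esub> ?n y IN M"
  if "x IN M" "y IN M" "z IN M" for x y z
  using that by (simp_all add: sd Md)
 have "fequiv ?S (\<lambda>p q. hyp_form (\<lambda>y x. ?l x y) (?f p) (?f q)) (sum_form \<phi> (\<lambda>x y. - \<phi> x y))"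
  unfolding form_equiv_def
 \<comment> \<open>For p = (a, b) and q = (c, d) the two forms differ by - \<phi>(a - b, d) +
   \<epsilon> invol (\<phi>(c - d, b)), which determines the witness.\<close>
 proof (intro exI[of _ "\<lambda>p q. - \<phi> (?d p) (snd q)"] conjI ballI)
  show "sesqui ?S (\<lambda>p q. - \<phi> (?d p) (snd q))"
   by (rule sesqui_ops(2)[OF sesqui_pullback2[OF s dl sn]])
  fix p q assume "p IN ?S" "q IN ?S"
  then obtain a b c d where pq: "p = (a, b)" "q = (c, d)" and m: "a IN M" "b IN M" "c IN M" "d IN M" by auto
  let ?x = "a \<oplus>\<^bsub>M\<^esub> ?n b" and ?y = "c \<oplus>\<^bsub>M\<^esub> ?n d"
  note xy = sub(3)[OF m(1,2,2)] sub(3)[OF m(3,4,4)]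
  have "hyp_form (\<lambda>y x. ?l x y) (?f p) (?f q) = ?l b ?y + \<phi> ?x ?y"
   using xy m pd(1) by (simp add: pq ld(1) e)
  also have "\<dots> = sum_form \<phi> (\<lambda>x y. - \<phi> x y) p q + (- \<phi> (?d p) (snd q) - \<epsilon> * invol (- \<phi> (?d q) (snd p)))"
   using m xy by (simp add: pq lambda_form_def sub(1,2) algebra_simps)
  finally show "hyp_form (\<lambda>y x. ?l x y) (?f p) (?f q) = sum_form \<phi> (\<lambda>x y. - \<phi> x y) p q + (- \<phi> (?d p) (snd q) - \<epsilon> * invol (- \<phi> (?d q) (snd p)))" .
 qed
 then show ?thesis
  unfolding form_sum_quad_class[OF M' M'] hyp_space_def isometry_iff[OF S S] using si by blast
qed

section \<open>The double of a hyperbolic form and absorption\<close>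

definition double :: "('a, 'm) based_module => ('a, 'n) based_module => ('m => 'n => 'a) => ('a, ('m \<times> 'n) \<times> ('m \<times> 'n)) quad_form" where
 "double A A' pr = fsum (hyp_space A A' pr) (hyp_space A A' (\<lambda>y f. - pr y f))"

abbreviation double_lag :: "('a, 'n) based_module => 'm \<times> 'm => ('m \<times> 'n) \<times> ('m \<times> 'n)" where
 "double_lag A' \<equiv> map_prod (inl A') (inl A')"

definition double_class :: "('a, 'm) based_module => ('a, 'n) based_module => ('m => 'n => 'a) => ('a, 'a vec) quasi_formation set" where
 "double_class A A' pr = qfm_class (double A A' pr) (double_lag A') (bsum A A) (\<lambda>m. (m, (zero A, zero A'))) (bsum A A')"

lemma quad_form_double: "dual_pair A A' pr ==> qform (double A A' pr)"
 unfolding double_def by (intro quad_form_sum qform_hyp dual_pair_neg)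

lemma lag_double: "dual_pair A A' pr ==> lag (double A A' pr) (double_lag A') (bsum A A)"
 unfolding double_def by (intro lag_sum qform_hyp lag_hyp_space dual_pair_neg)

lemma valid_double:
 assumes A: "dual_pair A A' pr"
 shows "valid (double A A' pr) (double_lag A') (bsum A A) (\<lambda>m. (m, (zero A, zero A'))) (bsum A A')"
proof -
 note M = based_sum_closed[OF dual_pairD(1,2)[OF A]]
 show ?thesis
  using quad_form_double[OF A] lag_double[OF A] half_summand_inl[OF M M refl linear_maps_const_zero[OF basedD(1)[OF M]]]
  by (simp add: valid_def double_def)
qed

text \<open>The factor c compares two Lagrangians of the hyperbolic form on M: the first summand M
  and the image of A \<oplus> A under the doubling isometry. The projection qualifies as \<pi>
  because pairing (0, f) with y by the symmetrisation recovers the hyperbolic form itself.\<close>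

lemma bd_class_double:
 assumes A: "dual_pair A A' pr"
 shows "\<exists>c\<in>carrier (lmon). bd_class (bsum A A') (hyp_form pr) = c \<cdot> double_class A A' pr"
  "\<exists>f. isom (double A A' pr) (hyp_space (bsum A A') (bsum A A') (\<lambda>y x. lam (hyp_form pr) x y)) f \<and>
   (\<forall>m\<in>carrier (bsum A A'). f (m, (zero A, zero A')) = (m, (zero A, snd m)))"
  "dual_pair (bsum A A') (bsum A A') (\<lambda>y x. lam (hyp_form pr) x y)"
  "\<And>x y. x \<in> carrier A \<times> carrier A' ==> y \<in> carrier A \<times> carrier A' ==> lam (hyp_form pr) (zero A, snd x) y = hyp_form pr x y"
proof -
 note a = dual_pairD[OF A]
 let ?M = "bsum A A'" and ?\<phi> = "hyp_form pr" and ?\<pi> = "\<lambda>m. (zero A, snd m)" and ?l = "\<lambda>y x. lam (hyp_form pr) x y"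
 have M: "based ?M" using a by simp
 note Md = lmodD[OF basedD(1)[OF M]]
 have z: "(zero A, zero A') = zero ?M" by simp
 have s: "sesqui ?M ?\<phi>" using sesqui_hyp_form[OF A] by simp
 show L: "dual_pair ?M ?M ?l" by (rule dual_pair_lambda[OF M simple_form_hyp[OF A]])
 have pl: "?\<pi> \<in> linear_maps ?M ?M"
  using linear_maps_pair[OF linear_maps_const_zero[OF basedD(1)[OF a(1)]] linear_maps_snd[of A A']] by simp
 show pe: "lam ?\<phi> (zero A, snd x) y = ?\<phi> x y" if "x \<in> carrier A \<times> carrier A'" "y \<in> carrier A \<times> carrier A'" for x y
  using that a(8) by (auto simp: lambda_form_def)
 let ?f = "\<lambda>(a, b). (a \<oplus>\<^bsub>?M\<^esub> (- 1) \<odot>\<^bsub>?M\<^esub> b, b \<oplus>\<^bsub>?M\<^esub> ?\<pi> (a \<oplus>\<^bsub>?M\<^esub> (- 1) \<odot>\<^bsub>?M\<^esub> b))"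
 have "isom (fsum (?M, qcls ?M ?\<phi>) (?M, qcls ?M (\<lambda>x y. - ?\<phi> x y))) (hyp_space ?M ?M ?l) ?f"
  by (rule isometry_doubling[OF M s simple_form_hyp[OF A] pl]) (simp add: pe)
 then have f: "isom (double A A' pr) (hyp_space ?M ?M ?l) ?f" unfolding double_def hyp_space_def hyp_form_neg .
 have mz: "m \<oplus>\<^bsub>?M\<^esub> (- 1) \<odot>\<^bsub>?M\<^esub> (zero ?M) = m" if "m IN ?M" for m
  using Md(10)[OF that] lmod_minus(4)[OF basedD(1)[OF M] Md(3), of "- 1"] by (simp del: based_sum_simps)
 have fm: "?f (m, (zero A, zero A')) = (m, ?\<pi> m)" if "m IN ?M" for m
  unfolding z using Md(9)[OF linD(1)[OF pl that]] mz[OF that] by (simp del: based_sum_simps)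
 then show "\<exists>f. isom (double A A' pr) (hyp_space ?M ?M ?l) f \<and> (\<forall>m\<in>carrier ?M. f (m, (zero A, zero A')) = (m, (zero A, snd m)))"
  using f by blast
 note i = qfm_class_isometry[OF valid_double[OF A] qform_hyp[OF L] f refl refl]
 have bd: "bd_class ?M ?\<phi> = qfm_class (hyp_space ?M ?M ?l) (inl ?M) ?M (\<lambda>x. (x, ?\<pi> x)) ?M"
  by (rule bd_class_model[OF L pl]) (simp add: pe)
 note g = valid_graph[OF L pl]
 let ?c = "qfm_class (hyp_space ?M ?M ?l) (inl ?M) ?M (\<lambda>x. ?f (double_lag A' x)) (bsum A A)"
 have 1: "?c \<cdot> qfm_class (hyp_space ?M ?M ?l) (\<lambda>x. ?f (double_lag A' x)) (bsum A A) (\<lambda>x. (x, ?\<pi> x)) ?M = bd_class ?M ?\<phi>"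
  unfolding bd by (rule qfm_class_lagrangian[OF validD(2)[OF i(2)] g])
 have 2: "double_class A A' pr = qfm_class (hyp_space ?M ?M ?l) (\<lambda>x. ?f (double_lag A' x)) (bsum A A) (\<lambda>x. (x, ?\<pi> x)) ?M"
  unfolding double_class_def
  by (rule qfm_class_isometry(1)[OF valid_double[OF A] qform_hyp[OF L] f refl]) (rule fm[symmetric])
 have 3: "?c IN (lmon)"
  by (rule qfm_class_closed[OF valid_lag[OF qform_hyp[OF L] lag_hyp_space[OF L] validD(2)[OF i(2)]]])
 show "\<exists>c\<in>carrier (lmon). bd_class ?M ?\<phi> = c \<cdot> double_class A A' pr"
  unfolding 2 by (rule bexI[of _ ?c]) (rule 1[symmetric], rule 3)
qed

lemma double_class_closed: "dual_pair A A' pr ==> double_class A A' pr IN (lmon)"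
 unfolding double_class_def by (rule qfm_class_closed[OF valid_double])

lemma double_class_absorbs:
 assumes A: "dual_pair A A' pr" and g: "isom (hyp_space A A' pr) (hyp_space A A' pr) \<gamma>"
 shows "qfm_class (hyp_space A A' pr) (inl A') A (\<lambda>x. \<gamma> (x, zero A')) A \<cdot> double_class A A' pr = double_class A A' pr"
proof -
 interpret comm_monoid "lmon" by (rule comm_monoid_l_monoid)
 let ?F = "hyp_space A A' pr" and ?G = "hyp_space A A' (\<lambda>y f. - pr y f)" and ?i = "inl A'" and ?M = "bsum A A'"
 let ?in = "\<lambda>m. (m, (zero A, zero A'))"
 note a = dual_pairD(1,2)[OF A] and N = dual_pair_neg[OF A]
 note F = qform_hyp[OF A] and G = qform_hyp[OF N] and D = quad_form_double[OF A]
 have M: "based ?M" using a by simp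
 have g': "isom (double A A' pr) (double A A' pr) (map_prod \<gamma> id)"
  unfolding double_def by (rule isometry_sum[OF F G F G g isometry_refl[OF G]])
 note v = valid_double[OF A]
 note au = qfm_class_automorphism[OF v g']
 have gs: "siso ?M ?M \<gamma>" using isometry_simple_iso[OF g] by simp
 \<comment> \<open>\<gamma> \<oplus> 1 maps M \<oplus> 0 onto itself and changes its parametrisation
   by \<gamma>, which is simple.\<close>
 have 1: "qfm_class (double A A' pr) (double_lag A') (bsum A A) (\<lambda>x. map_prod \<gamma> id (?in x)) ?M = double_class A A' pr"
  unfolding double_class_def
  by (rule qfm_class_iso[OF au(3) D isometry_refl[OF D] based_sum_closed[OF a(1,1)] M siso_id[OF based_sum_closed[OF a(1,1)]] _ gs]) simp_all
 note vl = valid_lag[OF F lag_hyp_space[OF A]] and vn = valid_lag[OF G lag_hyp_space[OF N] lag_hyp_space[OF N]]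
 have gl: "lag ?F (\<lambda>x. \<gamma> (x, zero A')) A"
  by (rule lag_transport[OF lag_hyp_space[OF A] F F g a(1) siso_id[OF a(1)]]) simp
 \<comment> \<open>The second factor is the class of -M with twice the same Lagrangian, hence
   trivial; it is there to turn the first one into a class on M \<oplus> -M.\<close>
 have "qfm_class ?F ?i A (\<lambda>x. \<gamma> (x, zero A')) A \<cdot> qfm_class ?G ?i A ?i A =
   qfm_class (double A A' pr) (double_lag A') (bsum A A) (map_prod (\<lambda>x. \<gamma> (x, zero A')) ?i) (bsum A A)"
  unfolding double_def by (rule qfm_class_sum[OF vl[OF gl] vn])
 also have "map_prod (\<lambda>x. \<gamma> (x, zero A')) ?i = (\<lambda>x. map_prod \<gamma> id (double_lag A' x))" by auto
 finally have 2: "qfm_class ?F ?i A (\<lambda>x. \<gamma> (x, zero A')) A =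
   qfm_class (double A A' pr) (double_lag A') (bsum A A) (\<lambda>x. map_prod \<gamma> id (double_lag A' x)) (bsum A A)"
  unfolding qfm_class_self[OF G lag_hyp_space[OF N]] using qfm_class_closed[OF vl[OF gl]] by simp
 show ?thesis using au(1) unfolding 1 2 double_class_def[symmetric] .
qed

text \<open>By \<open>bd_class_double\<close> the boundary has the double class as a factor, and
  that factor absorbs.\<close>

lemma bd_class_absorbs:
 assumes A: "dual_pair A A' pr" and g: "isom (hyp_space A A' pr) (hyp_space A A' pr) \<gamma>"
 shows "qfm_class (hyp_space A A' pr) (inl A') A (\<lambda>x. \<gamma> (x, zero A')) A \<cdot> bd_class (bsum A A') (hyp_form pr)
  = bd_class (bsum A A') (hyp_form pr)"
proof -
 interpret comm_monoid "lmon" by (rule comm_monoid_l_monoid)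
 note F = qform_hyp[OF A] and a = dual_pairD(1)[OF A]
 have gl: "lag (hyp_space A A' pr) (\<lambda>x. \<gamma> (x, zero A')) A"
  by (rule lag_transport[OF lag_hyp_space[OF A] F F g a siso_id[OF a]]) simp
 note cl = qfm_class_closed[OF valid_lag[OF F lag_hyp_space[OF A] gl]] double_class_closed[OF A]
 obtain c where c: "c IN (lmon)" "bd_class (bsum A A') (hyp_form pr) = c \<cdot> double_class A A' pr"
  using bd_class_double(1)[OF A] by blast
 show ?thesis unfolding c(2) using m_lcomm[OF cl(1) c(1) cl(2)] double_class_absorbs[OF A g] by simp
qed

section \<open>Comparison of a quasi-formation with a boundary\<close>

lemma isometry_unassoc:
 assumes F: "qform F" and G: "qform G" and H: "qform H"
 shows "isom (fsum F (fsum G H)) (fsum (fsum F G) H) (\<lambda>(x, (y, z)). ((x, y), z))"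
proof (rule isometry_cong[OF _ _ isometry_sym[OF _ _ isometry_reassoc[OF F G H]]])
 fix p assume p: "p \<in> carrier (fst (fsum F (fsum G H)))"
 then obtain x y z where "p = reassoc ((x, y), z)" "((x, y), z) \<in> carrier (fst (fsum (fsum F G) H))" by auto
 then show "inv_map (fst (fsum (fsum F G) H)) reassoc p = (case p of (x, (y, z)) => ((x, y), z))"
  using sisoD(6)[OF isometry_simple_iso[OF isometry_reassoc[OF F G H]], of "((x, y), z)"] by simp
qed (simp_all add: quad_form_sum F G H)

lemma simple_iso_unassoc:
 assumes M: "based M" and N: "based N" and P: "based P"
 shows "siso (bsum M (bsum N P)) (bsum (bsum M N) P) (\<lambda>(x, (y, z)). ((x, y), z))"
proof (rule simple_iso_cong[OF siso_inv[OF _ _ simple_iso_reassoc[OF M N P]]])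
 fix p assume "p \<in> carrier (bsum M (bsum N P))"
 then obtain x y z where "p = reassoc ((x, y), z)" "((x, y), z) \<in> carrier (bsum (bsum M N) P)" by auto
 then show "inv_map (bsum (bsum M N) P) reassoc p = (case p of (x, (y, z)) => ((x, y), z))"
  using sisoD(6)[OF simple_iso_reassoc[OF M N P], of "((x, y), z)"] by simp
qed (simp_all add: M N P)

lemma isometry_hyp_interchange_inv:
 assumes A: "dual_pair A A' pr" and B: "dual_pair B B' pr'"
 shows "isom (hyp_space (bsum A B) (bsum A' B') (sum_pairing pr pr')) (fsum (hyp_space A A' pr) (hyp_space B B' pr')) interchange"
proof (rule isometry_cong[OF _ _ isometry_sym[OF _ _ isometry_hyp_interchange[OF A B]]])
 fix p assume p: "p \<in> carrier (fst (hyp_space (bsum A B) (bsum A' B') (sum_pairing pr pr')))"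
 then have "p = interchange (interchange p)" "interchange p \<in> carrier (fst (fsum (hyp_space A A' pr) (hyp_space B B' pr')))" by auto
 then show "inv_map (fst (fsum (hyp_space A A' pr) (hyp_space B B' pr'))) interchange p = interchange p"
  using sisoD(6)[OF isometry_simple_iso[OF isometry_hyp_interchange[OF A B]]] by metis
qed (simp_all add: quad_form_sum qform_hyp A B dual_pair_sum)

text \<open>The double contributes M \<oplus> -M with half-rank summand M \<oplus> 0. Its -M is
  regrouped with the copy of M that contains v N. The half-rank summand is then v N \<oplus> 0 in
  this new double, together with all of the remaining M, and isometries of M \<oplus> -M can act on
  v N \<oplus> 0.\<close>

lemma qfm_class_mult_double:
 assumes A: "dual_pair A A' pr" and v: "valid (hyp_space A A' pr) (inl A') A v N"
 shows "qfm_class (hyp_space A A' pr) (inl A') A v N \<cdot> double_class A A' pr =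
   qfm_class (fsum (double A A' pr) (hyp_space A A' pr)) (map_prod (double_lag A') (inl A')) (bsum (bsum A A) A)
    (\<lambda>(n, m). ((v n, (zero A, zero A')), m)) (bsum N (bsum A A'))" (is "?x \<cdot> _ = ?r")
  "valid (fsum (double A A' pr) (hyp_space A A' pr)) (map_prod (double_lag A') (inl A')) (bsum (bsum A A) A)
    (\<lambda>(n, m). ((v n, (zero A, zero A')), m)) (bsum N (bsum A A'))"
proof -
 let ?F = "hyp_space A A' pr" and ?G = "hyp_space A A' (\<lambda>y f. - pr y f)" and ?i = "inl A'" and ?M = "bsum A A'"
 let ?ri = "\<lambda>m. ((zero A, zero A'), m)"
 note a = dual_pairD(1,2)[OF A] and P = dual_pair_neg[OF A]
 note F = qform_hyp[OF A] and G = qform_hyp[OF P] and D = quad_form_double[OF A]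
 note N = validD(7)[OF v]
 have M: "based ?M" and AA: "based (bsum A A)" using a by simp_all
 note GF = quad_form_sum[OF G F]
 note swi = isometry_swap[OF F G, folded double_def]
 have 1: "double_class A A' pr = qfm_class (fsum ?G ?F) (double_lag A') (bsum A A) ?ri ?M"
  unfolding double_class_def
  by (rule qfm_class_iso[OF valid_double[OF A] GF swi AA M simple_iso_swap[OF a(1,1)] _ siso_id[OF M]]) auto
 have v1: "valid (fsum ?G ?F) (double_lag A') (bsum A A) ?ri ?M"
  by (rule valid_iso(1)[OF valid_double[OF A] GF swi AA M simple_iso_swap[OF a(1,1)] _ siso_id[OF M]]) auto
 have DF: "qform (fsum (double A A' pr) ?F)" by (rule quad_form_sum[OF D F])
 note un = isometry_unassoc[OF F G F, folded double_def]
 have b: "based (bsum (bsum A A) A)" "based (bsum N ?M)" using a N by simp_all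
 show "?x \<cdot> double_class A A' pr = ?r"
  unfolding 1 qfm_class_sum[OF v v1]
  by (rule qfm_class_iso[OF valid_sum[OF v v1] DF un b simple_iso_unassoc[OF a(1,1,1)] _ siso_id[OF b(2)]]) auto
 show "valid (fsum (double A A' pr) (hyp_space A A' pr)) (map_prod (double_lag A') (inl A')) (bsum (bsum A A) A)
    (\<lambda>(n, m). ((v n, (zero A, zero A')), m)) (bsum N (bsum A A'))"
  by (rule valid_iso(1)[OF valid_sum[OF v v1] DF un b simple_iso_unassoc[OF a(1,1,1)] _ siso_id[OF b(2)]]) auto
qed

text \<open>The contragredient of $T = (v, w)^{-1}$, applied after the doubling isometry, maps $v n \oplus 0$ to
 $((n, 0), (R n, S n))$, and a shear removes $S n$.\<close>

lemma double_isometry_graph: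
 assumes A: "dual_pair A A' pr"
  and v: "v \<in> linear_maps A (bsum A A')" and w: "w \<in> linear_maps A (bsum A A')"
  and vw: "siso (bsum A A) (bsum A A') (\<lambda>(a, b). v a \<oplus>\<^bsub>bsum A A'\<^esub> w b)"
  and R: "R \<in> linear_maps A A'" "\<And>x y. x IN A ==> y IN A ==> pr y (R x) = hyp_form pr (v x) (v y)"
 shows "\<exists>\<theta>. isom (double A A' pr) (hyp_space (bsum A A) (bsum A' A') (sum_pairing pr (\<lambda>y f. - pr y f))) \<theta> \<and>
  (\<forall>n\<in>carrier A. \<theta> (v n, (zero A, zero A')) = ((n, zero A), (R n, zero A')))"
proof -
 note a = dual_pairD[OF A]
 let ?M = "bsum A A'" and ?AA = "bsum A A" and ?BB = "bsum A' A'" and ?\<phi> = "hyp_form pr" and ?q = "sum_pairing pr (\<lambda>y f. - pr y f)"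
 let ?\<tau> = "\<lambda>(a, b). v a \<oplus>\<^bsub>?M\<^esub> w b" and ?l = "\<lambda>y x. lam (hyp_form pr) x y"
 note P = dual_pair_sum[OF A dual_pair_neg[OF A]]
 have M: "based ?M" and AA: "based ?AA" and BB: "based ?BB" using a by simp_all
 note Md = lmodD[OF basedD(1)[OF M]]
 note L = bd_class_double(3)[OF A]
 have s: "sesqui ?M ?\<phi>" using sesqui_hyp_form[OF A] by simp
 note sd = sesquiD[OF s]
 obtain f where f: "isom (double A A' pr) (hyp_space ?M ?M ?l) f" "\<forall>m\<in>carrier ?M. f (m, (zero A, zero A')) = (m, (zero A, snd m))"
  using bd_class_double(2)[OF A] by blast
 define T where "T = inv_map ?AA ?\<tau>"
 have Ti: "siso ?M ?AA T" unfolding T_def by (rule siso_inv[OF AA M vw])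
 have T\<tau>: "T (?\<tau> y) = y" if "y IN ?AA" for y unfolding T_def by (rule sisoD(6)[OF vw that])
 obtain T' where T': "siso ?M ?BB T'" "\<And>y g. y IN ?M ==> g IN ?M ==> ?q (T y) (T' g) = ?l y g"
  "isom (hyp_space ?M ?M ?l) (hyp_space ?AA ?BB ?q) (map_prod T T')"
  using hyp_space_iso[OF L P Ti] by metis
 have vf: "v \<circ> fst \<in> linear_maps ?AA ?M" and ws: "w \<circ> snd \<in> linear_maps ?AA ?M"
  using lin_comp[OF linear_maps_fst[of A A] v] lin_comp[OF linear_maps_snd[of A A] w] by simp_all
 \<comment> \<open>At x = (n, 0) and y = (b, c) the even form of \<open>?k\<close> is - \<phi>(v n,
   w c), as w 0 = 0. This cancels the component S n, which pairs with the second copy of A.\<close>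
 let ?k = "\<lambda>x y. - ?\<phi> ((v \<circ> fst) x) ((w \<circ> snd) y)"
 have ks: "sesqui ?AA ?k" by (rule sesqui_ops(2)[OF sesqui_pullback2[OF s vf ws]])
 obtain D where D: "D \<in> linear_maps ?AA ?BB" "\<And>x y. x IN ?AA ==> y IN ?AA ==> ?q y (D x) = ?k x y - \<epsilon> * invol (?k y x)"
  using represent_form[OF P sesqui_even[OF ks]] by metis
 note sh = isometry_hyp_shear[OF P D(1) ks D(2)]
 note q = quad_form_double[OF A] qform_hyp[OF L] qform_hyp[OF P]
 let ?\<theta> = "(\<lambda>(x, f). (x, f \<oplus>\<^bsub>?BB\<^esub> D x)) \<circ> (map_prod T T' \<circ> f)"
 have th: "isom (double A A' pr) (hyp_space ?AA ?BB ?q) ?\<theta>"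
  by (rule isometry_trans[OF q(1,3,3) isometry_trans[OF q f(1) T'(3)] sh])
 have "?\<theta> (v n, (zero A, zero A')) = ((n, zero A), (R n, zero A'))" if n: "n IN A" for n
 proof -
  note Ad = lmodD[OF basedD(1)[OF a(1)]] and Bd = lmodD[OF basedD(1)[OF a(2)]]
  note vn = linD(1)[OF v n]
  let ?g = "(zero A, snd (v n))"
  have n0: "(n, zero A) IN ?AA" using n Ad by simp
  have g: "?g IN ?M" using vn Ad by (cases "v n") simp
  have w0: "w (zero A) = zero ?M" by (rule linear_maps_zero[OF w basedD(1)[OF a(1)] basedD(1)[OF M]])
  have "?\<tau> (n, zero A) = v n" using Md(10)[OF vn] w0 by simp
  then have T: "T (v n) = (n, zero A)" using T\<tau>[OF n0] by simp
  have p0: "?\<phi> (v x) (w (zero A)) = 0" if "x IN A" for x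
   unfolding w0 using sd(4)[OF linD(1)[OF v that] Md(3), of 0] lmod_minus(3)[OF basedD(1)[OF M] Md(3)] by simp
  have "T' ?g \<oplus>\<^bsub>?BB\<^esub> D (n, zero A) = (R n, zero A')"
  proof (rule dual_pair_ext[OF P])
   note TG = sisoD(3)[OF T'(1) g] and Dn = linD(1)[OF D(1) n0]
   show "T' ?g \<oplus>\<^bsub>?BB\<^esub> D (n, zero A) IN ?BB" using lmodD(2)[OF basedD(1)[OF BB] TG Dn] .
   show "(R n, zero A') IN ?BB" using linD(1)[OF R(1) n] Bd by simp
   fix y assume y: "y IN ?AA"
   then obtain b c where bc: "y = (b, c)" "b IN A" "c IN A" by auto
   note vb = linD(1)[OF v bc(2)] and wc = linD(1)[OF w bc(3)]
   have ty: "?\<tau> y IN ?M" by (rule sisoD(3)[OF vw y])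
   have "?q y (T' ?g) = ?l (?\<tau> y) ?g" using T'(2)[OF ty g] T\<tau>[OF y] by simp
   also have "\<dots> = ?\<phi> (v n) (?\<tau> y)"
    using bd_class_double(4)[OF A, of "v n" "?\<tau> y"] vn ty by (simp del: hyp_form_apply)
   also have "\<dots> = ?\<phi> (v n) (v b) + ?\<phi> (v n) (w c)" using sd(2)[OF vb wc vn] bc(1) by simp
   finally have 1: "?q y (T' ?g) = ?\<phi> (v n) (v b) + ?\<phi> (v n) (w c)" .
   have 2: "?q y (D (n, zero A)) = - ?\<phi> (v n) (w c)"
    using D(2)[OF n0 y] p0[OF bc(2)] bc(1) by simp
   have "?q y (T' ?g \<oplus>\<^bsub>?BB\<^esub> D (n, zero A)) = ?\<phi> (v n) (v b)"
    using dual_pairD(6)[OF P y TG Dn] 1 2 by simp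
   also have "\<dots> = ?q y (R n, zero A')" using R(2)[OF n bc(2)] a(9)[OF bc(3)] bc(1) by simp
   finally show "?q y (T' ?g \<oplus>\<^bsub>?BB\<^esub> D (n, zero A)) = ?q y (R n, zero A')" .
  qed
  then show ?thesis using f(2)[rule_format, OF vn] T by (simp del: based_sum_simps)
 qed
 then show ?thesis using th by blast
qed

text \<open>Multiplied by the double class d, the given class x and the boundary b are related by
  \<open>c x d = b d\<close>, where c comes from an isometry of M \<oplus> -M. The first factor of E
  contains d, and the second one absorbs c.\<close>

lemma qfm_class_elementary_stably:
 assumes A: "dual_pair A A' pr"
  and v: "v \<in> linear_maps A (bsum A A')" and w: "w \<in> linear_maps A (bsum A A')"
  and vw: "siso (bsum A A) (bsum A A') (\<lambda>(a, b). v a \<oplus>\<^bsub>bsum A A'\<^esub> w b)"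
  and vx: "valid (hyp_space A A' pr) (inl A') A v A"
 defines "E \<equiv> bd_class (bsum A A') (hyp_form pr) \<cdot>
  bd_class (bsum (bsum A A) (bsum A' A')) (hyp_form (sum_pairing pr (\<lambda>y f. - pr y f)))"
 shows "qfm_class (hyp_space A A' pr) (inl A') A v A \<cdot> E = bd_class A (\<lambda>x y. hyp_form pr (v x) (v y)) \<cdot> E"
proof -
 interpret comm_monoid "lmon" by (rule comm_monoid_l_monoid)
 note a = dual_pairD[OF A]
 let ?M = "bsum A A'" and ?AA = "bsum A A" and ?BB = "bsum A' A'" and ?\<phi> = "hyp_form pr" and ?q = "sum_pairing pr (\<lambda>y f. - pr y f)"
 let ?F = "hyp_space A A' pr" and ?D = "double A A' pr" and ?G = "hyp_space ?AA ?BB ?q" and ?i = "inl A'" and ?U = "double_lag A'"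
 note N = dual_pair_neg[OF A]
 note P = dual_pair_sum[OF A N]
 have s: "sesqui ?M ?\<phi>" using sesqui_hyp_form[OF A] by simp
 have sG: "sesqui (bsum ?AA ?BB) (hyp_form ?q)" using sesqui_hyp_form[OF P] by simp
 note sv = sesqui_pullback[OF s v]
 obtain R where R: "R \<in> linear_maps A A'" "\<And>x y. x IN A ==> y IN A ==> pr y (R x) = ?\<phi> (v x) (v y)"
  using represent_form[OF A sv] by metis
 obtain \<theta> where th: "isom ?D ?G \<theta>" "\<forall>n\<in>carrier A. \<theta> (v n, (zero A, zero A')) = ((n, zero A), (R n, zero A'))"
  using double_isometry_graph[OF A v w vw R] by blast
 note F = qform_hyp[OF A] and D = quad_form_double[OF A] and G = qform_hyp[OF P]
 note ic = isometry_hyp_interchange[OF A N, folded double_def] and ic' = isometry_hyp_interchange_inv[OF A N, folded double_def]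
 \<comment> \<open>An isometry of M \<oplus> -M that takes (v n, 0) to ((n, R n), 0), a point of the
   graph of R in the first summand.\<close>
 let ?\<beta> = "interchange \<circ> \<theta>"
 have be: "isom ?D ?D ?\<beta>" by (rule isometry_trans[OF D G D th(1) ic'])
 have ga: "isom ?G ?G (\<theta> \<circ> interchange)" by (rule isometry_trans[OF G D G ic' th(1)])
 note lD = lag_double[OF A]
 note AA = lag_based[OF lD]
 have bl: "lag ?D (\<lambda>x. ?\<beta> (?U x)) ?AA" by (rule lag_transport[OF lD D D be AA siso_id[OF AA]]) simp
 note vb = valid_lag[OF D lD bl]
 define c where "c = qfm_class ?D ?U ?AA (\<lambda>x. ?\<beta> (?U x)) ?AA"
 have iU: "interchange (?U x) = (x, zero ?BB)" "interchange (x, zero ?BB) = ?U x" for x by (cases x; simp)+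
 have ii: "interchange (interchange z) = z" for z :: "('x \<times> 'y) \<times> ('z \<times> 'w)" by (cases z) auto
 \<comment> \<open>Read in the hyperbolic form of A \<oplus> A, to which M \<oplus> -M is isometric,
   c is the class of the isometry \<theta> after \<open>interchange\<close>, so the absorption
   applies.\<close>
 have "c = qfm_class ?G (inl ?BB) ?AA (\<lambda>x. (\<theta> \<circ> interchange) (x, zero ?BB)) ?AA"
  unfolding c_def by (rule qfm_class_isometry(1)[OF vb G ic]) (simp_all only: iU ii o_def)
 then have c_abs: "c \<cdot> bd_class (bsum ?AA ?BB) (hyp_form ?q) = bd_class (bsum ?AA ?BB) (hyp_form ?q)"
  using bd_class_absorbs[OF P ga] by simp
 have cc: "c IN (lmon)" unfolding c_def by (rule qfm_class_closed[OF vb])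
 let ?x = "qfm_class ?F ?i A v A" and ?b = "bd_class A (\<lambda>x y. ?\<phi> (v x) (v y))" and ?d = "double_class A A' pr"
 let ?DF = "fsum ?D ?F" and ?V = "map_prod ?U ?i" and ?K = "bsum ?AA A"
 have bm: "?b = qfm_class ?F ?i A (\<lambda>x. (x, R x)) A" by (rule bd_class_model[OF A R(1)]) (rule R(2))
 note g = valid_graph[OF A R(1)]
 note xd = qfm_class_mult_double[OF A vx] and bd = qfm_class_mult_double[OF A g]
 have al: "isom ?DF ?DF (map_prod ?\<beta> id)" by (rule isometry_sum[OF D F D F be isometry_refl[OF F]])
 note au = qfm_class_automorphism[OF xd(2) al]
 have "qfm_class ?D ?U ?AA (\<lambda>x. ?\<beta> (?U x)) ?AA \<cdot> qfm_class ?F ?i A ?i A = qfm_class ?DF ?V ?K (map_prod (\<lambda>x. ?\<beta> (?U x)) ?i) ?K"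
  by (rule qfm_class_sum[OF vb valid_lag[OF F lag_hyp_space[OF A] lag_hyp_space[OF A]]])
 also have "map_prod (\<lambda>x. ?\<beta> (?U x)) ?i = (\<lambda>x. map_prod ?\<beta> id (?V x))" by auto
 finally have c1: "qfm_class ?DF ?V ?K (\<lambda>x. map_prod ?\<beta> id (?V x)) ?K = c"
  unfolding qfm_class_self[OF F lag_hyp_space[OF A]] c_def[symmetric] using cc by simp
 let ?N = "bsum A ?M"
 have DF: "qform ?DF" by (rule quad_form_sum[OF D F])
 have "qfm_class ?DF ?V ?K (\<lambda>z. map_prod ?\<beta> id ((\<lambda>(n, m). ((v n, (zero A, zero A')), m)) z)) ?N =
   qfm_class ?DF ?V ?K (\<lambda>(n, m). (((n, R n), (zero A, zero A')), m)) ?N"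
  by (rule qfm_class_isometry(1)[OF au(3) DF isometry_refl[OF DF]]) (auto simp: th(2))
 then have key: "c \<cdot> (?x \<cdot> ?d) = ?b \<cdot> ?d" using au(1) unfolding c1 xd(1) bm bd(1) by simp
 obtain e where e: "e IN (lmon)" "bd_class ?M ?\<phi> = e \<cdot> ?d"
  using bd_class_double(1)[OF A] by blast
 have cl: "?x IN (lmon)" "?b IN (lmon)" "?d IN (lmon)"
  "bd_class (bsum ?AA ?BB) (hyp_form ?q) IN (lmon)"
  using qfm_class_closed[OF vx] bd_class_closed[OF a(1) sv] double_class_closed[OF A]
   bd_class_closed[OF based_sum_closed[OF dual_pairD(1,2)[OF P]] sG] by auto
 let ?g = "bd_class (bsum ?AA ?BB) (hyp_form ?q)"
 \<comment> \<open>c is inserted next to the factor that absorbs it, moved to x d by commutativity,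
   and traded for b by \<open>key\<close>.\<close>
 have "?x \<cdot> E = ?x \<cdot> (e \<cdot> ?d \<cdot> (c \<cdot> ?g))" unfolding E_def e(2) c_abs ..
 also have "\<dots> = e \<cdot> (c \<cdot> (?x \<cdot> ?d)) \<cdot> ?g" using cl cc e(1) by (simp add: m_ac)
 also have "\<dots> = ?b \<cdot> E" unfolding key E_def e(2) using cl e(1) by (simp add: m_ac)
 finally show ?thesis .
qed

section \<open>Free models with free complements\<close>

lemma valid_hyperbolic_model:
 assumes x: "valid F u K v N" and B: "dual_pair B B' pr" and s: "siso B K s" and N': "based N'" and t: "siso N' N t"
 shows "\<exists>v'. valid (hyp_space B B' pr) (inl B') B v' N' \<and>
  qfm_class F u K v N = qfm_class (hyp_space B B' pr) (inl B') B v' N'"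
proof -
 note X = validD[OF x] and b = dual_pairD(1,2)[OF B]
 let ?B = "hyp_space B B' pr"
 obtain h where h: "isom (hyper K) F h" "\<forall>x\<in>carrier K. h (x, zero (dual K)) = u x"
  using X(2) unfolding lag_def by blast
 obtain s' where s': "s' (zero B') = zero (bdual K)" "isom ?B (hyper K) (map_prod s s')"
  unfolding hyperbolic_hyp_space using hyp_space_iso[OF B dual_pair_dual[OF X(6)] s] by metis
 note q = qform_hyp[OF B] and sd = sisoD[OF s] and td = sisoD[OF t]
 \<comment> \<open>The splitting of F along its Lagrangian, read in the given dual pair; its inverse
   moves all data to the standard hyperbolic form.\<close>
 define f where "f = h \<circ> map_prod s s'"
 have f: "isom ?B F f"
  unfolding f_def by (rule isometry_trans[OF q quad_form_hyperbolic[OF X(6)] X(1) s'(2) h(1)])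
 define g where "g = inv_map (fst ?B) f"
 have g: "isom F ?B g" unfolding g_def by (rule isometry_sym[OF q X(1) f])
 have gu: "g (u x) = (inv_map B s x, zero B')" if y: "x IN K" for x
 proof -
  have "f (inv_map B s x, zero B') = u x" using sd(7)[OF y] s'(1) h(2) y by (simp add: f_def)
  moreover have "(inv_map B s x, zero B') IN (fst ?B)" using sd(8)[OF y] lmodD(3)[OF basedD(1)[OF b(2)]] by simp
  ultimately show ?thesis unfolding g_def using sisoD(6)[OF isometry_simple_iso[OF f]] by metis
 qed
 note si = siso_inv[OF b(1) X(6) s] and ti = siso_inv[OF N' X(7) t]
 have "valid ?B (inl B') B (\<lambda>x. g (v (t x))) N'"
  by (rule valid_iso(1)[OF x q g b(1) N' si _ ti]) (simp_all add: gu td)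
 moreover have "qfm_class F u K v N = qfm_class ?B (inl B') B (\<lambda>x. g (v (t x))) N'"
  by (rule qfm_class_iso[OF x q g b(1) N' si _ ti]) (simp_all add: gu td)
 ultimately show ?thesis by blast
qed

text \<open>Adding the trivial formation of \<Lambda>^p replaces L and V by L \<oplus> \<Lambda>^p
  and V \<oplus> \<Lambda>^p, which frames identify with free modules. Their ranks agree because L
  and V both have half the rank of the form.\<close>

lemma stabilised_model:
 assumes X: "X IN (lmon)"
 shows "\<exists>n v. n > 0 \<and> valid (hyp_space (bfree n) (bfree n) (vpair n)) (inl (bfree n)) (bfree n) v (bfree n) \<and>
  X = qfm_class (hyp_space (bfree n) (bfree n) (vpair n)) (inl (bfree n)) (bfree n) v (bfree n)"
proof -
 interpret comm_monoid "lmon" by (rule comm_monoid_l_monoid)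
 obtain x :: "('a, 'a vec) quasi_formation" where x: "qf x" "X = lcls x" using X unfolding l_carrier_iff by blast
 obtain F L V where e: "x = (F, L, V)" by (metis surj_pair)
 note Y = quasi_formationE[OF x(1)[unfolded e]]
 have v: "valid F id L id V" using Y by (simp add: valid_def)
 note W = validD[OF v]
 have 1: "X = qfm_class F id L id V"
  unfolding x(2) e qfm_class_def by (rule l_class_iso[OF x(1)[unfolded e] W(8) Y(4)])
 obtain p0 where p0: "\<forall>p\<ge>p0. \<exists>n g. frame L p n g \<and> n \<ge> p - p0" using frame_exists[OF W(6)] by blast
 obtain q0 where q0: "\<forall>p\<ge>q0. \<exists>n g. frame V p n g \<and> n \<ge> p - q0" using frame_exists[OF W(7)] by blast
 \<comment> \<open>The successor makes p - p0, and with it n, positive; this is what gives k > 0 in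
   the end.\<close>
 define p where "p = Suc (p0 + q0)"
 obtain n g where g: "frame L p n g" "n \<ge> p - p0" using p0[rule_format, of p] unfolding p_def by auto
 obtain n' g' where g': "frame V p n' g'" using q0[rule_format, of p] unfolding p_def by auto
 have "2 * module_rank L = 2 * module_rank V" using W(3,4) by (simp add: half_summand_def)
 then have n: "n' = n" using module_rank_frame[OF W(6) g(1)] module_rank_frame[OF W(7) g'] by simp
 note P = dual_pair_vec[of p]
 note t = valid_trivial[OF P]
 have "X = qfm_class F id L id V \<cdot> \<one>\<^bsub>l\<^esub>" unfolding 1 using qfm_class_closed[OF v] by simp
 note 2 = this[folded qfm_class_trivial[OF P], unfolded qfm_class_sum[OF v t]]
 show ?thesis
  using valid_hyperbolic_model[OF valid_sum[OF v t] dual_pair_vec[of n] simple_iso_frame[OF W(6) g(1)] based_free_closed[of n] simple_iso_frame[OF W(7) g'[unfolded n]]]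
   g(2) unfolding 2 p_def by (intro exI[of _ n]) auto
qed

text \<open>M is the sum of v B and the kernel of r. The map exchanges the component of m in v B,
  read off by r, with a. It is a product of shears and one sign, like the exchange of two
  coordinates, so it is simple even though the kernel of r has no basis.\<close>

lemma complement_shear:
 assumes M: "based M" and B: "based B" and v: "v \<in> linear_maps B M" and r: "r \<in> linear_maps M B"
  and rv: "\<And>x. x IN B ==> r (v x) = x"
 shows "siso (bsum M B) (bsum M B) (\<lambda>(m, a). (v a \<oplus>\<^bsub>M\<^esub> (m \<oplus>\<^bsub>M\<^esub> (- 1) \<odot>\<^bsub>M\<^esub> v (r m)), r m))"
proof -
 let ?S = "bsum M B" and ?n = "\<lambda>x. (- 1) \<odot>\<^bsub>B\<^esub> x"
 note M' = basedD(1)[OF M] and B' = basedD(1)[OF B]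
 note Md = lmodD[OF M'] and Bd = lmodD[OF B'] and vd = linD[OF v] and rd = linD[OF r]
 have S: "based ?S" using M B by simp
 have nr: "(\<lambda>m. ?n (r m)) \<in> linear_maps M B" by (rule linear_maps_sign[OF B' r])
 have sg: "siso ?S ?S (map_prod id ?n)"
  by (rule simple_iso_map_prod[OF M B M B siso_id[OF M] simple_iso_sign[OF B]]) simp
 have c: "siso ?S ?S ((\<lambda>(x, y). (x, y \<oplus>\<^bsub>B\<^esub> r x)) \<circ> (map_prod id ?n \<circ> ((\<lambda>(x, y). (x \<oplus>\<^bsub>M\<^esub> v y, y)) \<circ> (\<lambda>(x, y). (x, y \<oplus>\<^bsub>B\<^esub> ?n (r x))))))"
  by (rule siso_comp[OF S S S siso_comp[OF S S S siso_comp[OF S S S simple_iso_shear'[OF M B nr] simple_iso_shear[OF M B v]] sg] simple_iso_shear'[OF M B r]])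
 show ?thesis
 proof (rule simple_iso_cong[OF c S S])
  fix z assume "z IN ?S"
  then obtain m a where z: "z = (m, a)" "m IN M" "a IN B" by auto
  let ?a = "a \<oplus>\<^bsub>B\<^esub> ?n (r m)"
  note rm = rd(1)[OF z(2)] and nrm = Bd(4)[OF rd(1)[OF z(2)], of "- 1"]
  have a: "?a IN B" using Bd(2)[OF z(3) nrm] .
  note va = vd(1)[OF z(3)] and vrm = vd(1)[OF rm] and nvr = Md(4)[OF vd(1)[OF rm], of "- 1"]
  have "v ?a = v a \<oplus>\<^bsub>M\<^esub> (- 1) \<odot>\<^bsub>M\<^esub> v (r m)" using vd(2)[OF z(3) nrm] vd(3)[OF rm] by simp
  then have "m \<oplus>\<^bsub>M\<^esub> v ?a = v a \<oplus>\<^bsub>M\<^esub> (m \<oplus>\<^bsub>M\<^esub> (- 1) \<odot>\<^bsub>M\<^esub> v (r m))"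
   using left_module_assoc[OF M' z(2) va nvr] left_module_assoc[OF M' va z(2) nvr] left_module_comm[OF M' z(2) va] by simp
  moreover have "?n ?a \<oplus>\<^bsub>B\<^esub> r (m \<oplus>\<^bsub>M\<^esub> v ?a) = r m"
  proof -
   note na = Bd(4)[OF a, of "- 1"]
   have "r (m \<oplus>\<^bsub>M\<^esub> v ?a) = r m \<oplus>\<^bsub>B\<^esub> ?a" using rd(2)[OF z(2) vd(1)[OF a]] rv[OF a] by simp
   then have "?n ?a \<oplus>\<^bsub>B\<^esub> r (m \<oplus>\<^bsub>M\<^esub> v ?a) = r m \<oplus>\<^bsub>B\<^esub> (?a \<oplus>\<^bsub>B\<^esub> ?n ?a)"
    using left_module_assoc[OF B' rm a na] left_module_comm[OF B' na Bd(2)[OF rm a]] by simp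
   then show ?thesis using lmod_minus(2)[OF B' a] Bd(10)[OF rm] by simp
  qed
  ultimately show "((\<lambda>(x, y). (x, y \<oplus>\<^bsub>B\<^esub> r x)) \<circ> (map_prod id ?n \<circ> ((\<lambda>(x, y). (x \<oplus>\<^bsub>M\<^esub> v y, y)) \<circ> (\<lambda>(x, y). (x, y \<oplus>\<^bsub>B\<^esub> ?n (r x)))))) z =
    (case z of (m, a) => (v a \<oplus>\<^bsub>M\<^esub> (m \<oplus>\<^bsub>M\<^esub> (- 1) \<odot>\<^bsub>M\<^esub> v (r m)), r m))"
   by (simp add: z(1))
 qed
qed

text \<open>After one more trivial summand the summand $V$ is free with a free complement of the same rank.\<close>

lemma complemented_model:
 assumes P: "dual_pair B B pr" and x: "valid (hyp_space B B pr) (inl B) B v0 B"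
 defines "A \<equiv> bsum B B" and "PR \<equiv> sum_pairing pr pr"
 shows "\<exists>v w. valid (hyp_space A A PR) (inl A) A v A \<and>
  qfm_class (hyp_space B B pr) (inl B) B v0 B = qfm_class (hyp_space A A PR) (inl A) A v A \<and>
  v \<in> linear_maps A (bsum A A) \<and> w \<in> linear_maps A (bsum A A) \<and>
  siso (bsum A A) (bsum A A) (\<lambda>(a, b). v a \<oplus>\<^bsub>bsum A A\<^esub> w b)"
proof -
 interpret comm_monoid "lmon" by (rule comm_monoid_l_monoid)
 note X = validD[OF x] and b = dual_pairD(1)[OF P]
 note PP = dual_pair_sum[OF P P, folded A_def PR_def]
 note t = valid_trivial[OF P] and q = qform_hyp[OF PP]
 note ic = isometry_hyp_interchange[OF P P, folded A_def PR_def]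
 have A: "based A" using b by (simp add: A_def)
 have AA: "based (bsum A A)" using A by simp
 let ?v = "\<lambda>z. interchange (map_prod v0 (inr B) z)"
 have "qfm_class (hyp_space B B pr) (inl B) B v0 B = qfm_class (hyp_space B B pr) (inl B) B v0 B \<cdot> \<one>\<^bsub>l\<^esub>"
  using qfm_class_closed[OF x] by simp
 note 1 = this[folded qfm_class_trivial[OF P], unfolded qfm_class_sum[OF x t], folded A_def]
 note vs = valid_sum[OF x t, folded A_def]
 have 2: "qfm_class (hyp_space B B pr) (inl B) B v0 B = qfm_class (hyp_space A A PR) (inl A) A ?v A"
  unfolding 1 by (rule qfm_class_isometry(1)[OF vs q ic _ refl]) (auto simp: A_def)
 have 3: "valid (hyp_space A A PR) (inl A) A ?v A"
  by (rule qfm_class_isometry(2)[OF vs q ic _ refl]) (auto simp: A_def)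
 obtain r where v0: "v0 \<in> linear_maps B A" and r: "r \<in> linear_maps A B" "\<forall>x\<in>carrier B. r (v0 x) = x"
  using X(3) unfolding half_summand_def A_def by auto
 let ?k = "\<lambda>m. m \<oplus>\<^bsub>A\<^esub> (- 1) \<odot>\<^bsub>A\<^esub> v0 (r m)"
 let ?w = "\<lambda>m. interchange (?k m, (r m, zero B))"
 note A' = basedD(1)[OF A] and B' = basedD(1)[OF b]
 have il: "interchange \<in> linear_maps (bsum A A) (bsum A A)"
  unfolding A_def by (rule sisoD(2)[OF simple_iso_interchange[OF b b b b]])
 have vl: "?v \<in> linear_maps A (bsum A A)"
  using validD(3)[OF 3] by (simp add: half_summand_def)
 have "(\<lambda>m. m) \<in> linear_maps A A" by (rule linI) simp_all
 from linear_maps_add[OF A' this linear_maps_sign[OF A' lin_comp[OF r(1) v0]]]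
 have kl: "?k \<in> linear_maps A A" by simp
 have "(\<lambda>m. (r m, zero B)) \<in> linear_maps A (bsum B B)"
  using linear_maps_pair[OF r(1) linear_maps_const_zero[OF B', of A]] by simp
 from linear_maps_pair[OF kl this[folded A_def]]
 have "(\<lambda>m. (?k m, (r m, zero B))) \<in> linear_maps A (bsum A A)" by simp
 then have wl: "?w \<in> linear_maps A (bsum A A)" using lin_comp[OF _ il] by (simp add: o_def)
 let ?\<Theta> = "\<lambda>(m, a). (v0 a \<oplus>\<^bsub>A\<^esub> (m \<oplus>\<^bsub>A\<^esub> (- 1) \<odot>\<^bsub>A\<^esub> v0 (r m)), r m)"
 have th: "siso (bsum A B) (bsum A B) ?\<Theta>"
  by (rule complement_shear[OF A b v0 r(1)]) (use r(2) in blast)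
 have AB: "based (bsum A B)" "based (bsum (bsum A B) B)" "based (bsum A (bsum B B))"
  using A b by simp_all
 have ic2: "siso (bsum A (bsum B B)) (bsum A A) interchange"
  using simple_iso_interchange[OF b b b b] by (simp add: A_def)
 have sw: "siso (bsum A A) (bsum A (bsum B B)) prod.swap"
  using simple_iso_swap[OF A A] by (simp add: A_def)
 have ch: "siso (bsum A A) (bsum A A) (interchange \<circ> (reassoc \<circ> (map_prod ?\<Theta> id \<circ> ((\<lambda>(x, (y, z)). ((x, y), z)) \<circ> prod.swap))))"
  by (rule siso_comp[OF AA AB(3) AA siso_comp[OF AA AB(2,3) siso_comp[OF AA AB(2,2)
     siso_comp[OF AA AB(3,2) sw simple_iso_unassoc[OF A b b]]
     simple_iso_map_prod[OF AB(1) b AB(1) b th siso_id[OF b]]] simple_iso_reassoc[OF A b b]] ic2])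
 have "siso (bsum A A) (bsum A A) (\<lambda>(a, m). ?v a \<oplus>\<^bsub>bsum A A\<^esub> ?w m)"
 proof (rule simple_iso_cong[OF ch AA AA])
  fix z assume "z IN (bsum A A)"
  then obtain a f m where z: "z = ((a, f), m)" "a IN B" "f IN B" "m IN A" unfolding A_def by auto
  note va = linD(1)[OF v0 z(2)] and km = linD(1)[OF kl z(4)] and rm = linD(1)[OF r(1) z(4)]
  note Bd = lmodD[OF B']
  have 1: "(v0 a, (zero B, f)) IN (bsum A A)" "(?k m, (r m, zero B)) IN (bsum A A)"
   using va km rm z Bd(3) by (simp_all add: A_def)
  have "?v (a, f) \<oplus>\<^bsub>bsum A A\<^esub> ?w m = interchange ((v0 a, (zero B, f)) \<oplus>\<^bsub>bsum A A\<^esub> (?k m, (r m, zero B)))"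
   using linD(2)[OF il 1] by simp
  also have "(v0 a, (zero B, f)) \<oplus>\<^bsub>bsum A A\<^esub> (?k m, (r m, zero B)) = (v0 a \<oplus>\<^bsub>A\<^esub> ?k m, (r m, f))"
  proof -
   have "(zero B, f) \<oplus>\<^bsub>A\<^esub> (r m, zero B) = (r m, f)" using Bd(9)[OF rm] Bd(10)[OF z(3)] by (simp add: A_def)
   then show ?thesis by simp
  qed
  finally show "(interchange \<circ> (reassoc \<circ> (map_prod ?\<Theta> id \<circ> ((\<lambda>(x, (y, z)). ((x, y), z)) \<circ> prod.swap)))) z =
    (case z of (a, m) => ?v a \<oplus>\<^bsub>bsum A A\<^esub> ?w m)"
   by (simp add: z(1))
 qed
 then show ?thesis using 2 3 vl wl by blast
qed

section \<open>Conclusion\<close>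

lemma simple_iso_free_sum:
 assumes "based M" "based N" "siso M (bfree k) f" "siso N (bfree l) g"
 shows "siso (bsum M N) (bfree (k + l)) ((\<lambda>(a, b). a @\<^sub>v b) \<circ> map_prod f g)"
 by (rule siso_comp[OF _ _ _ simple_iso_map_prod[OF assms(1,2) _ _ assms(3,4)] simple_iso_append]) (simp_all add: assms)

text \<open>Boundaries are additive, and the sum of the two hyperbolic forms is the hyperbolic form
  of A \<oplus> B, hence that of \<Lambda>^k.\<close>

lemma bd_class_hyp_sum:
 assumes P: "dual_pair A A' pr" and Q: "dual_pair B B' pr'" and s: "siso (bsum A B) (bfree k) s"
 shows "bd_class (bsum A A') (hyp_form pr) \<cdot> bd_class (bsum B B') (hyp_form pr') =
  e_map \<epsilon> Z (form_class \<epsilon> Z (hyper (bfree k)))"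
proof -
 note PQ = dual_pair_sum[OF P Q] and F = based_free_closed[of k]
 note D = dual_pair_dual[OF F]
 note m = based_sum_closed[OF dual_pairD(1,2)[OF P]] based_sum_closed[OF dual_pairD(1,2)[OF Q]]
 note h = based_sum_closed[OF F based_dual_closed[OF F]]
 have sP: "sesqui (bsum A A') (hyp_form pr)" and sQ: "sesqui (bsum B B') (hyp_form pr')"
  and sD: "sesqui (bsum (bfree k) (bdual (bfree k))) (hyp_form (\<lambda>y f. f y))"
  using sesqui_hyp_form[OF P] sesqui_hyp_form[OF Q] sesqui_hyp_form[OF D] by (simp_all only: sesqui_based_sum)
 obtain s' where s': "isom (hyp_space (bsum A B) (bsum A' B') (sum_pairing pr pr'))
   (hyp_space (bfree k) (bdual (bfree k)) (\<lambda>y f. f y)) (map_prod s s')"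
  using hyp_space_iso[OF PQ D s] by metis
 have i: "isom (fsum (hyp_space A A' pr) (hyp_space B B' pr'))
   (hyp_space (bfree k) (bdual (bfree k)) (\<lambda>y f. f y)) (map_prod s s' \<circ> interchange)"
  by (rule isometry_trans[OF quad_form_sum[OF qform_hyp[OF P] qform_hyp[OF Q]] qform_hyp[OF PQ] qform_hyp[OF D]
     isometry_hyp_interchange[OF P Q] s'])
 have sS: "sesqui (bsum (bsum A A') (bsum B B')) (sum_form (hyp_form pr) (hyp_form pr'))"
  using sesqui_sum_form[OF sP sQ] by simp
 have "bd_class (bsum (bsum A A') (bsum B B')) (sum_form (hyp_form pr) (hyp_form pr')) =
   bd_class (bsum (bfree k) (bdual (bfree k))) (hyp_form (\<lambda>y f. f y))"
  by (rule bd_class_isometry[OF based_sum_closed[OF m] h sS sD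
     i[unfolded hyp_space_def form_sum_quad_class[OF basedD(1)[OF m(1)] basedD(1)[OF m(2)]]]])
 then show ?thesis
  unfolding hyperbolic_eq e_map_form_class[OF h sD] bd_class_sum[OF m sP sQ] .
qed

theorem elementary_after_hyperbolic:
 assumes X: "X IN (lmon)"
 shows "\<exists>k>0. elementary \<epsilon> Z (X \<cdot> e_map \<epsilon> Z (form_class \<epsilon> Z (hyper (bfree k))))"
proof -
 obtain n v0 where n: "n > 0" and x: "valid (hyp_space (bfree n) (bfree n) (vpair n)) (inl (bfree n)) (bfree n) v0 (bfree n)"
  "X = qfm_class (hyp_space (bfree n) (bfree n) (vpair n)) (inl (bfree n)) (bfree n) v0 (bfree n)"
  using stabilised_model[OF X] by blast
 define B :: "('a, 'a vec) based_module" where "B = bfree n"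
 define A where "A = bsum B B"
 define pr :: "'a vec => 'a vec => 'a" where "pr = vpair n"
 define PR where "PR = sum_pairing pr pr"
 note x' = x[folded B_def pr_def]
 have P: "dual_pair B B pr" unfolding B_def pr_def by (rule dual_pair_vec)
 obtain v w where v: "valid (hyp_space A A PR) (inl A) A v A" "X = qfm_class (hyp_space A A PR) (inl A) A v A"
  "v \<in> linear_maps A (bsum A A)" "w \<in> linear_maps A (bsum A A)"
  "siso (bsum A A) (bsum A A) (\<lambda>(a, b). v a \<oplus>\<^bsub>bsum A A\<^esub> w b)"
  using complemented_model[OF P x'(1), folded A_def PR_def] unfolding x'(2) by blast
 have PA: "dual_pair A A PR" unfolding A_def PR_def by (rule dual_pair_sum[OF P P])
 note PG = dual_pair_sum[OF PA dual_pair_neg[OF PA]]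
 note a = dual_pairD(1)[OF PA]
 have fB: "siso B (bfree n) id" and b: "based B" unfolding B_def by (rule siso_id, simp, simp)
 obtain f where fA: "siso A (bfree (n + n)) f" using simple_iso_free_sum[OF b b fB fB] unfolding A_def by blast
 note fAA = simple_iso_free_sum[OF a a fA fA]
 note fS = simple_iso_free_sum[OF a based_sum_closed[OF a a] fA fAA]
 \<comment> \<open>The rank of A \<oplus> (A \<oplus> A), where A has rank n + n: one A for the form
   on M, and A \<oplus> A for that on M \<oplus> -M.\<close>
 let ?k = "n + n + (n + n + (n + n))"
 note E = bd_class_hyp_sum[OF PA PG fS]
 let ?AA = "bsum A A"
 have sA: "sesqui ?AA (hyp_form PR)" using sesqui_hyp_form[OF PA] by simp
 have sG: "sesqui (bsum ?AA ?AA) (hyp_form (sum_pairing PR (\<lambda>y f. - PR y f)))" using sesqui_hyp_form[OF PG] by simp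
 have bA: "based ?AA" "based (bsum ?AA ?AA)" using a by simp_all
 have sS: "sesqui (bsum ?AA (bsum ?AA ?AA)) (sum_form (hyp_form PR) (hyp_form (sum_pairing PR (\<lambda>y f. - PR y f))))"
  using sesqui_sum_form[OF sA sG] by simp
 note sd = sesqui_pullback[OF sA v(3)]
 note bS = based_sum_closed[OF bA]
 have "X \<cdot> e_map \<epsilon> Z (form_class \<epsilon> Z (hyper (bfree ?k))) =
   bd_class A (\<lambda>x y. hyp_form PR (v x) (v y)) \<cdot> e_map \<epsilon> Z (form_class \<epsilon> Z (hyper (bfree ?k)))"
  using qfm_class_elementary_stably[OF PA v(3-5,1)] unfolding E v(2)[symmetric] .
 \<comment> \<open>The three factors are boundaries, so their product is the boundary of the sum of
   the three forms.\<close>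
 also have "\<dots> = bd_class (bsum A (bsum ?AA (bsum ?AA ?AA)))
   (sum_form (\<lambda>x y. hyp_form PR (v x) (v y)) (sum_form (hyp_form PR) (hyp_form (sum_pairing PR (\<lambda>y f. - PR y f)))))"
  unfolding E[symmetric] bd_class_sum[OF bA sA sG] by (rule bd_class_sum[OF a bS sd sS])
 finally have "elementary \<epsilon> Z (X \<cdot> e_map \<epsilon> Z (form_class \<epsilon> Z (hyper (bfree ?k))))"
  using elementary_boundary_class[OF based_sum_closed[OF a bS]] sesqui_sum_form[OF sd sS] by simp
 then show ?thesis using n by (intro exI[of _ ?k]) simp
qed

end

theorem proposition16:
  fixes q :: nat and Z :: "'a::involutive_ring torsion_set"
    and X :: "('a, 'a vec) quasi_formation set"
  assumes "q \<ge> 1"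
    and "weakly_finite TYPE('a)"
    and "subgroup Z reduced_K1" and "invol_invariant Z"
    and "X \<in> carrier (l_monoid ((-1) ^ q) Z)"
  shows "\<exists>k::nat. k > 0 \<and> elementary ((-1) ^ q) Z
           (X \<otimes>\<^bsub>l_monoid ((-1) ^ q) Z\<^esub>
              e_map ((-1) ^ q) Z (form_class ((-1) ^ q) Z (hyperbolic ((-1) ^ q) Z (free_based Z k))))"
proof -
 interpret form_parameter Z "(-1) ^ q"
  by (intro form_parameter.intro torsion_subgroup.intro form_parameter_axioms.intro) (use assms(3,4) in \<open>simp_all add: minus_one_power_iff\<close>)
 show ?thesis by (rule elementary_after_hyperbolic[OF assms(5)])
qed

end
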